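(* Let $D\subset\mathbb{R}^2$ be a bounded open set of class $\mathcal{C}^2$, $h>0$, $\Omega=D\times(-h,0)$. Then \[ (L^2(\Omega))^2=H_1\oplus G_1\oplus G_2, \] where $H_1,G_1,G_2$ are mutually orthogonal subspaces of $(L^2(\Omega))^2$ and \[ G_1:=\{u\in(L^2(\Omega))^2: u_z=0,\ u=\nabla q,\ q\in H^1(D),\ \Delta q=0\},\quad G_2:=\{u\in(L^2(\Omega))^2: u_z=0,\ u=\nabla q,\ q\in H^1_0(D)\}. \] Moreover, for every $u\in(L^2(\Omega))^2$, \[ u=\mathbb{P}u+\nabla(q_1+q_2), \] where $q_2\in H^1_0(D)$ solves $\Delta q_2=\nabla\cdot\overline{u}\in H^{-1}(D)$, and $q_1\in H^1(D)$ solves $\Delta q_1=0$ in $D$ with $\partial_n q_1|_{\partial D}=n\cdot(\overline{u}-\nabla q_2)$.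
   Context: $H_1:=\{v\in (L^2(\Omega))^2 : \nabla\cdot\overline{v}=0,\ \overline{v}\cdot n|_{\partial D}=0\}$ (in the weak sense), where $\overline{\varphi}(x,y)=\frac1h\int_{-h}^0\varphi(x,y,z)\,dz$ is the vertical average, $\nabla=(\partial_x,\partial_y)$, $\Delta=\partial_x^2+\partial_y^2$, and $n$ is the outward unit normal to $\partial D$. The hydrostatic Leray projector $\mathbb{P}$ is the orthogonal projection of $(L^2(\Omega))^2$ onto $H_1$ with respect to the $(L^2(\Omega))^2$ inner product. $u_z=0$ means the distributional $z$-derivative vanishes. *)

theory Defs
  imports "HOL-Analysis.Analysis"
begin

(* Points of D \<subseteq> R^2 are pairs (x,y) :: real \<times> real;
   points of \<Omega> = D \<times> (-h,0) are ((x,y),z) :: (real \<times> real) \<times> real.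
   Elements of L^2 are represented by functions; equality in L^2 is equality a.e. *)

primrec Ck :: "nat \<Rightarrow> ('a::euclidean_space \<Rightarrow> real) \<Rightarrow> bool" where
  "Ck 0 f = continuous_on UNIV f"
| "Ck (Suc k) f = (f differentiable_on UNIV \<and>
                    (\<forall>v. Ck k (\<lambda>x. frechet_derivative f (at x) v)))"

definition smooth_fun :: "('a::euclidean_space \<Rightarrow> real) \<Rightarrow> bool" where
  "smooth_fun f \<longleftrightarrow> (\<forall>k. Ck k f)"

definition test_fun :: "'a::euclidean_space set \<Rightarrow> ('a \<Rightarrow> real) \<Rightarrow> bool" where
  "test_fun U f \<longleftrightarrow> smooth_fun f \<and> compact (closure {x. f x \<noteq> 0})
                      \<and> closure {x. f x \<noteq> 0} \<subseteq> U"

definition grad2 :: "(real \<times> real \<Rightarrow> real) \<Rightarrow> real \<times> real \<Rightarrow> real \<times> real" where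
  "grad2 f p = (frechet_derivative f (at p) (1, 0), frechet_derivative f (at p) (0, 1))"

definition dz :: "((real \<times> real) \<times> real \<Rightarrow> real) \<Rightarrow> (real \<times> real) \<times> real \<Rightarrow> real" where
  "dz f x = frechet_derivative f (at x) ((0, 0), 1)"

definition L2 :: "'a::euclidean_space set \<Rightarrow> ('a \<Rightarrow> 'b::euclidean_space) \<Rightarrow> bool" where
  "L2 S u \<longleftrightarrow> u \<in> borel_measurable (lebesgue_on S)
              \<and> integrable (lebesgue_on S) (\<lambda>x. (norm (u x))\<^sup>2)"

definition L2_inner :: "'a::euclidean_space set \<Rightarrow> ('a \<Rightarrow> 'b::euclidean_space) \<Rightarrow> ('a \<Rightarrow> 'b) \<Rightarrow> real" where
  "L2_inner S u v = (LINT x|lebesgue_on S. inner (u x) (v x))"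

definition Omega :: "(real \<times> real) set \<Rightarrow> real \<Rightarrow> ((real \<times> real) \<times> real) set" where
  "Omega D h = D \<times> {-h<..<0}"

definition vavg :: "real \<Rightarrow> ((real \<times> real) \<times> real \<Rightarrow> real \<times> real) \<Rightarrow> real \<times> real \<Rightarrow> real \<times> real" where
  "vavg h u p = (1 / h) *\<^sub>R (LINT z|lebesgue_on {-h<..<0}. u (p, z))"

definition is_weak_grad :: "(real \<times> real) set \<Rightarrow> (real \<times> real \<Rightarrow> real) \<Rightarrow> (real \<times> real \<Rightarrow> real \<times> real) \<Rightarrow> bool" where
  "is_weak_grad D q g \<longleftrightarrow> (\<forall>\<phi>. test_fun D \<phi> \<longrightarrow>
      (LINT p|lebesgue_on D. q p *\<^sub>R grad2 \<phi> p) = - (LINT p|lebesgue_on D. \<phi> p *\<^sub>R g p))"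

definition H1 :: "(real \<times> real) set \<Rightarrow> (real \<times> real \<Rightarrow> real) \<Rightarrow> bool" where
  "H1 D q \<longleftrightarrow> L2 D q \<and> (\<exists>g. L2 D g \<and> is_weak_grad D q g)"

(* the weak gradient (unique a.e.) *)
definition wgrad :: "(real \<times> real) set \<Rightarrow> (real \<times> real \<Rightarrow> real) \<Rightarrow> real \<times> real \<Rightarrow> real \<times> real" where
  "wgrad D q = (SOME g. L2 D g \<and> is_weak_grad D q g)"

definition H10 :: "(real \<times> real) set \<Rightarrow> (real \<times> real \<Rightarrow> real) \<Rightarrow> bool" where
  "H10 D q \<longleftrightarrow> H1 D q \<and> (\<exists>\<phi>s. (\<forall>k. test_fun D (\<phi>s k)) \<and>
      (\<lambda>k. LINT p|lebesgue_on D. (\<phi>s k p - q p)\<^sup>2 + (norm (grad2 (\<phi>s k) p - wgrad D q p))\<^sup>2)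
        \<longlonglongrightarrow> 0)"

definition weakly_harmonic :: "(real \<times> real) set \<Rightarrow> (real \<times> real \<Rightarrow> real) \<Rightarrow> bool" where
  "weakly_harmonic D q \<longleftrightarrow> (\<forall>\<phi>. test_fun D \<phi> \<longrightarrow>
      (LINT p|lebesgue_on D. inner (wgrad D q p) (grad2 \<phi> p)) = 0)"

definition dz_zero :: "((real \<times> real) \<times> real) set \<Rightarrow> ((real \<times> real) \<times> real \<Rightarrow> real \<times> real) \<Rightarrow> bool" where
  "dz_zero W u \<longleftrightarrow> (\<forall>\<phi>. test_fun W \<phi> \<longrightarrow> (LINT x|lebesgue_on W. dz \<phi> x *\<^sub>R u x) = 0)"

definition C2_fun :: "(real \<Rightarrow> real) \<Rightarrow> bool" where
  "C2_fun g \<longleftrightarrow> (\<exists>g' g''. (\<forall>t. (g has_real_derivative g' t) (at t)) \<and>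
                          (\<forall>t. (g' has_real_derivative g'' t) (at t)) \<and> continuous_on UNIV g'')"

definition C2_domain :: "(real \<times> real) set \<Rightarrow> bool" where
  "C2_domain D \<longleftrightarrow> bounded D \<and> open D \<and>
     (\<forall>p\<in>frontier D. \<exists>r>0. \<exists>Q g. orthogonal_transformation Q \<and> C2_fun g \<and>
        (\<forall>x\<in>ball p r. x \<in> D \<longleftrightarrow> snd (Q (x - p)) < g (fst (Q (x - p)))))"

(* H_1: vector fields in (L^2(\<Omega>))^2 with \<nabla>\<cdot>\<overline>v = 0 and \<overline>v\<cdot>n = 0 on \<partial>D, weakly:
   \<integral>_D \<overline>v \<cdot> \<nabla>\<phi> = 0 for all \<phi> \<in> C^\<infinity>(closure D) (restrictions of smooth functions) *)
definition Hspace1 :: "(real \<times> real) set \<Rightarrow> real \<Rightarrow> ((real \<times> real) \<times> real \<Rightarrow> real \<times> real) set" where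
  "Hspace1 D h = {v. L2 (Omega D h) v \<and>
      (\<forall>\<phi>. smooth_fun \<phi> \<longrightarrow> (LINT p|lebesgue_on D. inner (vavg h v p) (grad2 \<phi> p)) = 0)}"

definition Gspace1 :: "(real \<times> real) set \<Rightarrow> real \<Rightarrow> ((real \<times> real) \<times> real \<Rightarrow> real \<times> real) set" where
  "Gspace1 D h = {u. L2 (Omega D h) u \<and> dz_zero (Omega D h) u \<and>
      (\<exists>q. H1 D q \<and> weakly_harmonic D q \<and>
           (AE x in lebesgue_on (Omega D h). u x = wgrad D q (fst x)))}"

definition Gspace2 :: "(real \<times> real) set \<Rightarrow> real \<Rightarrow> ((real \<times> real) \<times> real \<Rightarrow> real \<times> real) set" where
  "Gspace2 D h = {u. L2 (Omega D h) u \<and> dz_zero (Omega D h) u \<and>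
      (\<exists>q. H10 D q \<and> (AE x in lebesgue_on (Omega D h). u x = wgrad D q (fst x)))}"

definition fun_subspace :: "('a \<Rightarrow> 'b::real_vector) set \<Rightarrow> bool" where
  "fun_subspace S \<longleftrightarrow> (\<lambda>x. 0) \<in> S \<and> (\<forall>u\<in>S. \<forall>v\<in>S. (\<lambda>x. u x + v x) \<in> S)
                      \<and> (\<forall>c. \<forall>u\<in>S. (\<lambda>x. c *\<^sub>R u x) \<in> S)"

definition leray :: "(real \<times> real) set \<Rightarrow> real \<Rightarrow> ((real \<times> real) \<times> real \<Rightarrow> real \<times> real)
                      \<Rightarrow> ((real \<times> real) \<times> real \<Rightarrow> real \<times> real)" where
  "leray D h u = (SOME v. v \<in> Hspace1 D h \<and>
      (\<forall>w\<in>Hspace1 D h. L2_inner (Omega D h) (\<lambda>x. u x - v x) w = 0))"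

definition solves_q2 :: "(real \<times> real) set \<Rightarrow> real \<Rightarrow> ((real \<times> real) \<times> real \<Rightarrow> real \<times> real)
                          \<Rightarrow> (real \<times> real \<Rightarrow> real) \<Rightarrow> bool" where
  "solves_q2 D h u q2 \<longleftrightarrow> H10 D q2 \<and> (\<forall>\<phi>. test_fun D \<phi> \<longrightarrow>
      (LINT p|lebesgue_on D. inner (wgrad D q2 p) (grad2 \<phi> p)) =
      (LINT p|lebesgue_on D. inner (vavg h u p) (grad2 \<phi> p)))"

(* q1 \<in> H^1(D), \<Delta> q1 = 0 in D, \<partial>_n q1 = n\<cdot>(\<overline>u - \<nabla> q2) on \<partial>D (weak Neumann problem) *)
definition solves_q1 :: "(real \<times> real) set \<Rightarrow> real \<Rightarrow> ((real \<times> real) \<times> real \<Rightarrow> real \<times> real)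
                          \<Rightarrow> (real \<times> real \<Rightarrow> real) \<Rightarrow> (real \<times> real \<Rightarrow> real) \<Rightarrow> bool" where
  "solves_q1 D h u q2 q1 \<longleftrightarrow> H1 D q1 \<and> weakly_harmonic D q1 \<and> (\<forall>\<phi>. smooth_fun \<phi> \<longrightarrow>
      (LINT p|lebesgue_on D. inner (wgrad D q1 p) (grad2 \<phi> p)) =
      (LINT p|lebesgue_on D. inner (vavg h u p - wgrad D q2 p) (grad2 \<phi> p)))"

end

(* Averaging over the vertical variable is, up to the factor h, adjoint to lifting a planar field to
   the cylinder, so everything reduces to the square integrable planar fields on D. There the two
   gradient parts are obtained by orthogonal projection: first onto the closure of the gradients of
   test functions, then, for the remainder, onto the closure of the gradients of functions smooth on
   the whole plane. What has to be shown is that limits of such gradients are again gradients of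
   square integrable functions, and that gradients of H^1 functions are limits of gradients of smooth
   functions, at least in the weak sense that they annihilate the same fields. Both follow from the
   observation that a bounded C^2 domain is a finite union of pieces that are star-shaped about a
   small ball. On such a piece there is a Poincare inequality, obtained by averaging over segments
   ending in the ball, and the averages of f over dilations towards points of the ball are smooth
   functions that converge to f without any extension across the boundary. *)
theory Submission
  imports Defs
begin

text \<open>The delicate point is that \<open>Hspace1\<close> tests a field only with functions
  smooth on the whole plane, while the potentials in \<open>Gspace1\<close> and
  \<open>Gspace2\<close> are merely in H^1 and nothing is known about them near the boundary.
  Dilation towards interior points settles this: the gradient of an averaged potential is (1 -
  \<delta>) times the average of its weak gradient, so the test passes to the limit.

  The projections also replace every boundary value problem. Orthogonality of a residual to all
  gradients of test functions is the weak equation for q2; orthogonality of the next residual to all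
  smooth gradients is the weak Neumann problem for q1, with the flux condition built in, so no trace
  or boundary integral appears. The second projection acts on a field already orthogonal to
  gradients of test functions, which is why q1 comes out harmonic.

  Potentials are determined only up to one constant per connected part of D, and D may be
  disconnected. Overlapping star-shaped pieces are therefore merged until the remaining ones are
  disjoint, and a constant is subtracted on each.\<close>

section \<open>Smooth functions and bumps\<close>

declare Ck.simps(2)[simp del]

text \<open>Uniqueness of derivatives lets any explicit family \<open>f'\<close> stand in for the
  choice operator \<open>frechet_derivative\<close>. Every later smoothness proof exhibits a
  derivative and recurses on its directional values.\<close>

lemma Ck_Suc_iff:
  "Ck (Suc k) f \<longleftrightarrow> (\<exists>f'. (\<forall>x. (f has_derivative f' x) (at x)) \<and> (\<forall>v. Ck k (\<lambda>x. f' x v)))"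
  (is "?L \<longleftrightarrow> ?R")
proof
  assume L: ?L
  then have "\<forall>x. f differentiable (at x)"
    by (simp add: Ck.simps(2) differentiable_on_def)
  then have "\<forall>x. (f has_derivative frechet_derivative f (at x)) (at x)"
    by (simp add: frechet_derivative_works)
  with L show ?R by (auto simp: Ck.simps(2))
next
  assume ?R
  then obtain f' where f': "\<And>x. (f has_derivative f' x) (at x)" "\<And>v. Ck k (\<lambda>x. f' x v)" by blast
  then have "frechet_derivative f (at x) = f' x" for x
    by (metis frechet_derivative_at)
  with f' show ?L
    by (auto simp: Ck.simps(2) differentiable_on_def differentiable_def)
qed

lemma Ck_SucI:
  assumes "\<And>x. (f has_derivative f' x) (at x)" and "\<And>v. Ck k (\<lambda>x. f' x v)"
  shows "Ck (Suc k) f"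
  using assms unfolding Ck_Suc_iff by blast

lemma Ck_imp_continuous: "Ck k f \<Longrightarrow> continuous_on A f"
proof (cases k)
  case 0
  assume "Ck k f" with 0 show ?thesis by (auto intro: continuous_on_subset)
next
  case (Suc l)
  assume "Ck k f" with Suc show ?thesis
    by (auto simp: Ck.simps(2) intro: continuous_on_subset dest: differentiable_imp_continuous_on)
qed

lemma Ck_SucD: "Ck (Suc k) f \<Longrightarrow> Ck k f"
proof (induction k arbitrary: f)
  case 0
  then show ?case using Ck_imp_continuous[of "Suc 0" f UNIV] by simp
next
  case (Suc k)
  then obtain f' where f': "\<And>x. (f has_derivative f' x) (at x)" "\<And>v. Ck (Suc k) (\<lambda>x. f' x v)"
    unfolding Ck_Suc_iff[of "Suc k"] by blast
  show ?case by (rule Ck_SucI[OF f'(1) Suc.IH[OF f'(2)]])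
qed

lemma Ck_const: "Ck k (\<lambda>x. c)"
proof (induction k arbitrary: c)
  case (Suc k)
  show ?case by (rule Ck_SucI[where f'="\<lambda>_ _. 0"]) (auto intro: Suc)
qed simp

lemma Ck_bounded_linear: "bounded_linear f \<Longrightarrow> Ck k f"
proof (cases k)
  case 0
  assume "bounded_linear f" with 0 show ?thesis by (simp add: linear_continuous_on)
next
  case (Suc l)
  assume "bounded_linear f" with Suc show ?thesis
    by (auto intro!: Ck_SucI Ck_const bounded_linear_imp_has_derivative)
qed

lemma Ck_add: "Ck k f \<Longrightarrow> Ck k g \<Longrightarrow> Ck k (\<lambda>x. f x + g x)"
proof (induction k arbitrary: f g)
  case 0 then show ?case by (auto intro: continuous_on_add)
next
  case (Suc k)
  from Suc.prems obtain f' g' where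
    f': "\<And>x. (f has_derivative f' x) (at x)" "\<And>v. Ck k (\<lambda>x. f' x v)" and
    g': "\<And>x. (g has_derivative g' x) (at x)" "\<And>v. Ck k (\<lambda>x. g' x v)"
    unfolding Ck_Suc_iff by blast
  show ?case
    by (rule Ck_SucI[OF has_derivative_add[OF f'(1) g'(1)] Suc.IH[OF f'(2) g'(2)]])
qed

lemma Ck_mult: "Ck k f \<Longrightarrow> Ck k g \<Longrightarrow> Ck k (\<lambda>x. f x * g x)"
proof (induction k arbitrary: f g)
  case 0 then show ?case by (auto intro: continuous_on_mult)
next
  case (Suc k)
  from Suc.prems obtain f' g' where
    f': "\<And>x. (f has_derivative f' x) (at x)" "\<And>v. Ck k (\<lambda>x. f' x v)" and
    g': "\<And>x. (g has_derivative g' x) (at x)" "\<And>v. Ck k (\<lambda>x. g' x v)"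
    unfolding Ck_Suc_iff by blast
  show ?case
    by (rule Ck_SucI[OF has_derivative_mult[OF f'(1) g'(1)]])
       (intro Ck_add Suc.IH f'(2) g'(2) Ck_SucD[OF Suc.prems(1)] Ck_SucD[OF Suc.prems(2)])
qed

text \<open>With a real outer function the chain rule is a product of \<open>f' x v\<close> and the
  scalar \<open>g' (f x) 1\<close>, so the induction stays inside products of real
  functions.\<close>

lemma Ck_compose_real:
  fixes g :: "real \<Rightarrow> real"
  shows "Ck k g \<Longrightarrow> Ck k f \<Longrightarrow> Ck k (\<lambda>x. g (f x))"
proof (induction k arbitrary: f g)
  case 0 then show ?case using continuous_on_compose2[of UNIV g UNIV f] by simp
next
  case (Suc k)
  from Suc.prems obtain f' g' where
    f': "\<And>x. (f has_derivative f' x) (at x)" "\<And>v. Ck k (\<lambda>x. f' x v)" and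
    g': "\<And>x. (g has_derivative g' x) (at x)" "\<And>v. Ck k (\<lambda>x. g' x v)"
    unfolding Ck_Suc_iff by blast
  have lin: "g' y v = v * g' y 1" for y v
  proof -
    have "bounded_linear (g' y)" using g'(1) by (rule has_derivative_bounded_linear)
    then have "g' y (v *\<^sub>R 1) = v *\<^sub>R g' y 1" by (intro linear_simps)
    then show ?thesis by simp
  qed
  have "((\<lambda>x. g (f x)) has_derivative (\<lambda>v. f' x v * g' (f x) 1)) (at x)" for x
  proof -
    have "((\<lambda>x. g (f x)) has_derivative (\<lambda>v. g' (f x) (f' x v))) (at x)"
      by (rule has_derivative_compose[OF f'(1) g'(1)])
    also have "(\<lambda>v. g' (f x) (f' x v)) = (\<lambda>v. f' x v * g' (f x) 1)" by (subst lin) simp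
    finally show ?thesis .
  qed
  then show ?case
    by (rule Ck_SucI)
       (intro Ck_mult f'(2) Suc.IH[OF g'(2) Ck_SucD[OF Suc.prems(2)]])
qed

lemma Ck_cmult: "Ck k f \<Longrightarrow> Ck k (\<lambda>x. c * f x)"
  by (intro Ck_mult Ck_const)

lemma Ck_minus: "Ck k f \<Longrightarrow> Ck k (\<lambda>x. - f x)"
  using Ck_cmult[of k f "-1"] by simp

lemma Ck_diff: "Ck k f \<Longrightarrow> Ck k g \<Longrightarrow> Ck k (\<lambda>x. f x - g x)"
  using Ck_add[OF _ Ck_minus, of k f g] by simp

lemma Ck_sum: "(\<And>i. i \<in> I \<Longrightarrow> Ck k (f i)) \<Longrightarrow> Ck k (\<lambda>x. \<Sum>i\<in>I. f i x)"
  by (induction I rule: infinite_finite_induct) (auto intro: Ck_add Ck_const)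

lemma Ck_inverse:
  assumes "\<And>x. f x \<noteq> 0"
  shows "Ck k f \<Longrightarrow> Ck k (\<lambda>x. inverse (f x))"
proof (induction k)
  case 0 then show ?case by (auto intro: continuous_on_inverse simp: assms)
next
  case (Suc k)
  then obtain f' where f': "\<And>x. (f has_derivative f' x) (at x)" "\<And>v. Ck k (\<lambda>x. f' x v)"
    unfolding Ck_Suc_iff by blast
  show ?case
    by (rule Ck_SucI[OF Deriv.has_derivative_inverse[OF assms f'(1)]])
       (intro Ck_minus Ck_mult f'(2) Suc.IH[OF Ck_SucD[OF Suc.prems]])
qed

lemma Ck_affine: "Ck k f \<Longrightarrow> Ck k (\<lambda>x. f (c *\<^sub>R x + b))"
proof (induction k arbitrary: f)
  case 0
  have "continuous_on UNIV (\<lambda>x::'a. c *\<^sub>R x + b)" by (intro continuous_intros)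
  with 0 show ?case using continuous_on_compose2[of UNIV f UNIV] by simp
next
  case (Suc k)
  then obtain f' where f': "\<And>x. (f has_derivative f' x) (at x)" "\<And>v. Ck k (\<lambda>x. f' x v)"
    unfolding Ck_Suc_iff by blast
  have "((\<lambda>x. f (c *\<^sub>R x + b)) has_derivative (\<lambda>v. f' (c *\<^sub>R x + b) (c *\<^sub>R v))) (at x)" for x
    by (rule has_derivative_compose[OF _ f'(1)]) (auto intro!: derivative_eq_intros)
  then show ?case by (rule Ck_SucI) (rule Suc.IH[OF f'(2)])
qed

lemmas smooth_fun_intros =
  Ck_const Ck_add Ck_mult Ck_diff

lemma smooth_fun_Ck: "smooth_fun f \<Longrightarrow> Ck k f"
  by (simp add: smooth_fun_def)

lemma smooth_fun_continuous: "smooth_fun f \<Longrightarrow> continuous_on A f"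
  using smooth_fun_Ck[of f 0] Ck_imp_continuous by blast

lemma smooth_fun_has_derivative:
  assumes "smooth_fun f"
  shows "(f has_derivative frechet_derivative f (at x)) (at x)"
  using smooth_fun_Ck[OF assms, of "Suc 0"]
  by (simp add: Ck.simps(2) differentiable_on_def flip: frechet_derivative_works)

lemma smooth_fun_frechet:
  assumes "smooth_fun f"
  shows "smooth_fun (\<lambda>x. frechet_derivative f (at x) v)"
  using smooth_fun_Ck[OF assms, of "Suc _"] by (auto simp: Ck.simps(2) smooth_fun_def)

text \<open>This family is closed under differentiation up to linear combinations, which makes
  \<^term>\<open>\<lambda>t::real. exp (- 1 / t)\<close> (extended by zero) smooth.\<close>

definition flat_exp :: "nat \<Rightarrow> real \<Rightarrow> real" where
  "flat_exp n t = (if t > 0 then exp (- 1 / t) / t ^ n else 0)"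

text \<open>A single term of the series of exp(1/t), the one of degree n + 2, already beats the pole
  of order n with t^2 to spare; this is where the factorial comes from.\<close>

lemma flat_exp_bound: "\<exists>C\<ge>0. \<forall>t>0. flat_exp n t \<le> C * t\<^sup>2"
proof (intro exI conjI allI impI)
  fix t :: real assume t: "t > 0"
  define C :: real where "C = fact (n + 2)"
  have C: "C > 0" by (simp add: C_def)
  have "(1 / t) ^ (n + 2) / C \<le> exp (1 / t)"
  proof -
    have "(\<Sum>k\<in>{n+2}. (1/t) ^ k /\<^sub>R fact k) \<le> (\<Sum>k. (1/t) ^ k /\<^sub>R fact k)"
      by (rule sum_le_suminf) (use t summable_exp_generic[of "1 / t"] in auto)
    then show ?thesis by (simp add: exp_def C_def divide_inverse mult_ac del: fact_Suc)
  qed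
  then have "1 \<le> exp (1/t) * C * t ^ (n+2)"
    using t C by (simp add: field_simps)
  then have "exp (- 1 / t) / t ^ n * 1 \<le> exp (- 1 / t) / t ^ n * (exp (1/t) * C * t ^ (n+2))"
    using t by (intro mult_left_mono) auto
  also have "\<dots> = (exp (-1/t) * exp (1/t)) * (C * t\<^sup>2)"
    using t by (simp add: power_add power2_eq_square)
  also have "exp (-1/t) * exp (1/t) = 1" by (simp flip: exp_add)
  finally show "flat_exp n t \<le> fact (n + 2) * t\<^sup>2" using t by (simp add: flat_exp_def C_def)
qed simp

lemma flat_exp_nonneg: "0 \<le> flat_exp n t"
  by (simp add: flat_exp_def)

text \<open>Away from the origin this is the quotient rule. At the origin the quadratic bound forces
  the difference quotient below \<open>C * \<bar>h\<bar>\<close>.\<close>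

lemma flat_exp_DERIV:
  "(flat_exp n has_real_derivative flat_exp (n + 2) t - real n * flat_exp (n + 1) t) (at t)"
proof -
  consider "t > 0" | "t < 0" | "t = 0" by linarith
  then show ?thesis
  proof cases
    case 1
    have "((\<lambda>t. exp (- 1 / t) / t ^ n) has_real_derivative
        flat_exp (n + 2) t - real n * flat_exp (n + 1) t) (at t)"
    proof -
      have "((\<lambda>t. exp (- 1 / t)) has_real_derivative exp (- 1 / t) / t\<^sup>2) (at t)"
        using 1 by (auto intro!: derivative_eq_intros simp: power2_eq_square)
      from DERIV_divide[OF this DERIV_pow[of n t UNIV]] 1
      have "((\<lambda>t. exp (- 1 / t) / t ^ n) has_real_derivative
          (exp (- 1 / t) / t\<^sup>2 * t ^ n - exp (- 1 / t) * (real n * t ^ (n - Suc 0))) / (t ^ n * t ^ n)) (at t)"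
        by simp
      also have "(exp (- 1 / t) / t\<^sup>2 * t ^ n - exp (- 1 / t) * (real n * t ^ (n - Suc 0))) / (t ^ n * t ^ n)
          = flat_exp (n + 2) t - real n * flat_exp (n + 1) t"
        using 1 by (cases n) (simp_all add: flat_exp_def field_simps power2_eq_square)
      finally show ?thesis .
    qed
    then show ?thesis
      by (rule has_field_derivative_transform_within_open[of _ _ _ "{0<..}"])
         (use 1 in \<open>auto simp: flat_exp_def\<close>)
  next
    case 2
    have "((\<lambda>t. 0) has_real_derivative flat_exp (n + 2) t - real n * flat_exp (n + 1) t) (at t)"
      using 2 by (simp add: flat_exp_def)
    then show ?thesis
      by (rule has_field_derivative_transform_within_open[of _ _ _ "{..<0}"])
         (use 2 in \<open>auto simp: flat_exp_def\<close>)
  next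
    case 3
    obtain C where C: "C \<ge> 0" "\<And>t. t > 0 \<Longrightarrow> flat_exp n t \<le> C * t\<^sup>2"
      using flat_exp_bound by blast
    have "((\<lambda>h. flat_exp n h / h) \<longlongrightarrow> 0) (at 0)"
    proof (rule Lim_null_comparison)
      have "norm (flat_exp n h / h) \<le> C * \<bar>h\<bar>" for h
        using C(1) C(2)[of h] flat_exp_nonneg[of n h]
        by (cases "h > 0") (simp_all add: divide_simps power2_eq_square mult_ac, simp add: flat_exp_def)
      then show "\<forall>\<^sub>F h in at 0. norm (flat_exp n h / h) \<le> C * \<bar>h\<bar>"
        by simp
      show "((\<lambda>h::real. C * \<bar>h\<bar>) \<longlongrightarrow> 0) (at 0)"
        by (auto intro!: tendsto_eq_intros)
    qed
    moreover have "flat_exp n 0 = 0" by (simp add: flat_exp_def)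
    ultimately have "(flat_exp n has_real_derivative 0) (at 0)"
      by (simp add: DERIV_def)
    with 3 show ?thesis by (simp add: flat_exp_def)
  qed
qed

lemma smooth_flat_exp: "Ck k (flat_exp n)"
proof (induction k arbitrary: n)
  case 0
  then show ?case
    using flat_exp_DERIV[THEN DERIV_isCont] by (simp add: continuous_at_imp_continuous_on)
next
  case (Suc k)
  show ?case
  proof (rule Ck_SucI[OF flat_exp_DERIV[unfolded has_field_derivative_def]])
    show "Ck k (\<lambda>x. (flat_exp (n + 2) x - real n * flat_exp (n + 1) x) * v)" for v
      by (intro Ck_mult Ck_diff Ck_const Suc)
  qed
qed

section \<open>Smooth cut-offs and test functions\<close>

definition sstep :: "real \<Rightarrow> real" where
  "sstep = flat_exp 0"

lemma sstep_eq: "sstep t = (if t > 0 then exp (- 1 / t) else 0)"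
  by (simp add: sstep_def flat_exp_def)

lemma Ck_sstep: "Ck k sstep"
  by (simp add: sstep_def smooth_flat_exp)

lemma sstep_bounds: "0 \<le> sstep t" "sstep t \<le> 1" "sstep t > 0 \<longleftrightarrow> t > 0" "sstep t \<noteq> 0 \<longleftrightarrow> t > 0"
  by (auto simp: sstep_eq)

text \<open>A step without a plateau suffices: the value one is reached only in the limit, which is
  all that dominated convergence asks of a smooth approximation to an indicator.\<close>

lemma sstep_tendsto: "(\<lambda>n. sstep (real n * t)) \<longlonglongrightarrow> (if t > 0 then 1 else 0)"
proof (cases "t > 0")
  case True
  have "(\<lambda>n. exp (- (1 / t) * inverse (real n))) \<longlonglongrightarrow> exp (- (1 / t) * 0)"
    by (intro tendsto_intros lim_inverse_n)
  then have "(\<lambda>n. exp (- (1 / t) * inverse (real n))) \<longlonglongrightarrow> 1" by simp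
  moreover have "\<forall>\<^sub>F n in sequentially. exp (- (1 / t) * inverse (real n)) = sstep (real n * t)"
    using eventually_gt_at_top[of 0] 
    by eventually_elim (use True in \<open>auto simp: sstep_eq field_simps\<close>)
  ultimately show ?thesis using True by (simp add: tendsto_cong)
next
  case False
  then have "sstep (real n * t) = 0" for n by (auto simp: sstep_eq zero_less_mult_iff)
  with False show ?thesis by simp
qed

text \<open>The exponential bump exp(-1/(r^2 - |x - p|^2)). The squared norm is a polynomial in the
  coordinates, so no smoothness of the norm itself is involved.\<close>

definition ball_bump :: "'a::euclidean_space \<Rightarrow> real \<Rightarrow> 'a \<Rightarrow> real" where
  "ball_bump p r x = sstep (r\<^sup>2 - (norm (x - p))\<^sup>2)"

lemma Ck_norm_sq: "Ck k (\<lambda>x::'a::euclidean_space. (norm (x - p))\<^sup>2)"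
proof -
  have "Ck k (\<lambda>x::'a. \<Sum>b\<in>Basis. ((x \<bullet> b) + (- (p \<bullet> b))) * ((x \<bullet> b) + (- (p \<bullet> b))))"
    by (intro Ck_sum Ck_mult Ck_add Ck_const Ck_bounded_linear[OF bounded_linear_inner_left])
  also have "(\<lambda>x::'a. \<Sum>b\<in>Basis. ((x \<bullet> b) + (- (p \<bullet> b))) * ((x \<bullet> b) + (- (p \<bullet> b)))) = (\<lambda>x. (norm (x - p))\<^sup>2)"
    by (rule ext) (subst power2_norm_eq_inner, subst euclidean_inner, simp add: inner_diff_left)
  finally show ?thesis .
qed

lemma smooth_ball_bump: "smooth_fun (ball_bump p r)"
  unfolding smooth_fun_def ball_bump_def
  by (intro allI Ck_compose_real[OF Ck_sstep] Ck_diff Ck_const Ck_norm_sq)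

lemma ball_bump_pos: 
  assumes "r > 0"
  shows "ball_bump p r x > 0 \<longleftrightarrow> x \<in> ball p r" "ball_bump p r x \<noteq> 0 \<longleftrightarrow> x \<in> ball p r"
proof -
  have "(norm (x - p))\<^sup>2 < r\<^sup>2 \<longleftrightarrow> norm (x - p) < r"
    using assms abs_square_less_1[of "norm (x - p) / r"] by (simp add: power_divide)
  then show "ball_bump p r x > 0 \<longleftrightarrow> x \<in> ball p r" "ball_bump p r x \<noteq> 0 \<longleftrightarrow> x \<in> ball p r"
    by (simp_all add: ball_bump_def sstep_bounds dist_norm norm_minus_commute)
qed

lemma ball_bump_nonneg: "0 \<le> ball_bump p r x"
  by (simp add: ball_bump_def sstep_bounds)

text \<open>Any compact carrier \<open>K\<close> inside \<open>U\<close> replaces the closure of the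
  support, which later proofs then never have to compute.\<close>

lemma test_funI:
  assumes "smooth_fun f" "compact K" "K \<subseteq> U" "\<And>x. x \<notin> K \<Longrightarrow> f x = 0"
  shows "test_fun U f"
proof -
  have "closure {x. f x \<noteq> 0} \<subseteq> K"
    using assms by (intro closure_minimal) (auto intro: compact_imp_closed)
  moreover from this have "compact (closure {x. f x \<noteq> 0})"
    using assms(2) by (metis closed_closure compact_Int_closed inf.absorb_iff2)
  ultimately show ?thesis using assms by (auto simp: test_fun_def)
qed

lemma test_funE:
  assumes "test_fun U f"
  obtains K where "compact K" "K \<subseteq> U" "\<And>x. x \<notin> K \<Longrightarrow> f x = 0"
proof
  show "compact (closure {x. f x \<noteq> 0})" "closure {x. f x \<noteq> 0} \<subseteq> U"
    using assms by (simp_all add: test_fun_def)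
  show "f x = 0" if "x \<notin> closure {x. f x \<noteq> 0}" for x
    using that closure_subset[of "{x. f x \<noteq> 0}"] by blast
qed

lemma test_fun_smooth: "test_fun U f \<Longrightarrow> smooth_fun f"
  by (simp add: test_fun_def)

lemma test_fun_mono: "test_fun U f \<Longrightarrow> U \<subseteq> V \<Longrightarrow> test_fun V f"
  by (auto simp: test_fun_def)

lemma test_ball_bump:
  fixes p :: "'a::euclidean_space"
  assumes "r > 0" "cball p r \<subseteq> U"
  shows "test_fun U (ball_bump p r)"
  by (rule test_funI[OF smooth_ball_bump compact_cball assms(2)])
     (use ball_bump_pos(2)[OF assms(1), of p] in \<open>force simp: not_less\<close>)

lemma smooth_add: "smooth_fun f \<Longrightarrow> smooth_fun g \<Longrightarrow> smooth_fun (\<lambda>x. f x + g x)"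
  and smooth_mult: "smooth_fun f \<Longrightarrow> smooth_fun g \<Longrightarrow> smooth_fun (\<lambda>x. f x * g x)"
  and smooth_cmult: "smooth_fun f \<Longrightarrow> smooth_fun (\<lambda>x. c * f x)"
  and smooth_diff: "smooth_fun f \<Longrightarrow> smooth_fun g \<Longrightarrow> smooth_fun (\<lambda>x. f x - g x)"
  and smooth_const: "smooth_fun (\<lambda>x. c)"
  by (simp_all add: smooth_fun_def smooth_fun_intros)

lemma test_add: "test_fun U f \<Longrightarrow> test_fun U g \<Longrightarrow> test_fun U (\<lambda>x. f x + g x)"
proof -
  assume f: "test_fun U f" and g: "test_fun U g"
  obtain K where K: "compact K" "K \<subseteq> U" "\<And>x. x \<notin> K \<Longrightarrow> f x = 0" using test_funE[OF f] by metis
  obtain L where L: "compact L" "L \<subseteq> U" "\<And>x. x \<notin> L \<Longrightarrow> g x = 0" using test_funE[OF g] by metis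
  show ?thesis
    by (rule test_funI[where K="K \<union> L"])
       (use K L f g in \<open>auto intro: smooth_add simp: test_fun_smooth\<close>)
qed

lemma test_mult: "smooth_fun f \<Longrightarrow> test_fun U g \<Longrightarrow> test_fun U (\<lambda>x. f x * g x)"
proof -
  assume f: "smooth_fun f" and g: "test_fun U g"
  obtain L where L: "compact L" "L \<subseteq> U" "\<And>x. x \<notin> L \<Longrightarrow> g x = 0" using test_funE[OF g] by metis
  show ?thesis
    by (rule test_funI[where K="L"])
       (use L f g in \<open>auto intro: smooth_mult simp: test_fun_smooth\<close>)
qed

lemma test_cmult: "test_fun U g \<Longrightarrow> test_fun U (\<lambda>x. c * g x)"
  using test_mult[OF smooth_const] by blast

lemma test_zero: "test_fun U (\<lambda>x. 0)"
  by (rule test_funI[OF smooth_const, of "{}"]) auto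

text \<open>The complement of the carrier is open and the function is zero on it, so the derivative
  vanishes there as well and the same carrier serves.\<close>

lemma test_frechet:
  assumes "test_fun U f" shows "test_fun U (\<lambda>x. frechet_derivative f (at x) v)"
proof -
  obtain K where K: "compact K" "K \<subseteq> U" "\<And>x. x \<notin> K \<Longrightarrow> f x = 0" using test_funE[OF assms] by metis
  show ?thesis
  proof (rule test_funI[where K=K])
    fix x assume "x \<notin> K"
    have "(f has_derivative (\<lambda>_. 0)) (at x)"
      by (rule has_derivative_transform_within_open[of "\<lambda>_. 0" _ _ _ "- K"])
         (use K \<open>x \<notin> K\<close> in \<open>auto simp: compact_imp_closed open_Compl\<close>)
    then show "frechet_derivative f (at x) v = 0"
      using frechet_derivative_at by metis
  qed (use K smooth_fun_frechet[OF test_fun_smooth[OF assms]] in auto)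
qed

lemma test_fun_bounded:
  assumes "test_fun U f"
  obtains B where "\<And>x. \<bar>f x\<bar> \<le> B" "B \<ge> 0"
proof -
  obtain K where K: "compact K" "K \<subseteq> U" "\<And>x. x \<notin> K \<Longrightarrow> f x = 0" using test_funE[OF assms] by metis
  have "compact (f ` K)"
    by (rule compact_continuous_image[OF smooth_fun_continuous[OF test_fun_smooth[OF assms]] K(1)])
  then have "bounded (f ` K)" by (rule compact_imp_bounded)
  then obtain B where B: "B > 0" "\<forall>y\<in>f ` K. norm y \<le> B" unfolding bounded_pos by blast
  have bd: "\<bar>f x\<bar> \<le> B" for x using B K(3)[of x] by (cases "x \<in> K") auto
  show thesis by (rule that[OF bd]) (use B in simp)
qed

text \<open>Dilated and shifted copies of one fixed kernel become admissible test functions in this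
  way.\<close>

lemma test_fun_affine:
  assumes "test_fun U f" "c \<noteq> 0" "\<And>x. c *\<^sub>R x + b \<in> U \<Longrightarrow> x \<in> V"
  shows "test_fun V (\<lambda>x. f (c *\<^sub>R x + b))"
proof -
  obtain K where K: "compact K" "K \<subseteq> U" "\<And>x. x \<notin> K \<Longrightarrow> f x = 0" using test_funE[OF assms(1)] by metis
  define L where "L = (\<lambda>y. (1/c) *\<^sub>R (y - b)) ` K"
  show ?thesis
  proof (rule test_funI[where K=L])
    show "smooth_fun (\<lambda>x. f (c *\<^sub>R x + b))"
      using test_fun_smooth[OF assms(1)] by (simp add: smooth_fun_def Ck_affine)
    show "compact L" unfolding L_def
      using K by (intro compact_continuous_image continuous_intros)
    show "L \<subseteq> V" using K assms by (auto simp: L_def)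
    fix x assume "x \<notin> L"
    then have "c *\<^sub>R x + b \<notin> K"
      using assms(2) unfolding L_def image_iff by (force dest: bspec[where x="c *\<^sub>R x + b"])
    then show "f (c *\<^sub>R x + b) = 0" by (rule K)
  qed
qed

section \<open>Square integrable functions\<close>

text \<open>Unlike \<open>L2\<close> this is stated for an arbitrary measure, so that the Hilbert
  space arguments serve the planar domain, its pieces, the cylinder and \<open>lborel\<close>
  alike.\<close>

definition sq_integrable :: "'a measure \<Rightarrow> ('a \<Rightarrow> 'b::euclidean_space) \<Rightarrow> bool" where
  "sq_integrable M u \<longleftrightarrow> u \<in> borel_measurable M \<and> integrable M (\<lambda>x. (norm (u x))\<^sup>2)"

definition sqnorm :: "'a measure \<Rightarrow> ('a \<Rightarrow> 'b::euclidean_space) \<Rightarrow> real" where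
  "sqnorm M u = (LINT x|M. (norm (u x))\<^sup>2)"

lemma L2_iff: "L2 S u \<longleftrightarrow> sq_integrable (lebesgue_on S) u"
  by (simp add: L2_def sq_integrable_def)

lemma sqi_meas[dest]: "sq_integrable M u \<Longrightarrow> u \<in> borel_measurable M"
  and sqi_int: "sq_integrable M u \<Longrightarrow> integrable M (\<lambda>x. (norm (u x))\<^sup>2)"
  by (simp_all add: sq_integrable_def)

lemma sqnorm_nonneg: "0 \<le> sqnorm M u"
  by (simp add: sqnorm_def)

lemma sqi_inner:
  assumes "sq_integrable M u" "sq_integrable M v"
  shows "integrable M (\<lambda>x. u x \<bullet> v x)"
proof (rule Bochner_Integration.integrable_bound)
  show "integrable M (\<lambda>x. (norm (u x))\<^sup>2 + (norm (v x))\<^sup>2)"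
    using assms by (intro Bochner_Integration.integrable_add sqi_int)
  show "(\<lambda>x. u x \<bullet> v x) \<in> borel_measurable M"
    using assms by (intro borel_measurable_inner sqi_meas)
  have "norm (u x \<bullet> v x) \<le> norm ((norm (u x))\<^sup>2 + (norm (v x))\<^sup>2)" for x
  proof -
    have "norm (u x \<bullet> v x) \<le> norm (u x) * norm (v x)" by (simp add: Cauchy_Schwarz_ineq2)
    moreover have "0 \<le> (norm (u x) - norm (v x))\<^sup>2" "0 \<le> norm (u x) * norm (v x)" by auto
    ultimately show ?thesis by (simp add: power2_diff)
  qed
  then show "AE x in M. norm (u x \<bullet> v x) \<le> norm ((norm (u x))\<^sup>2 + (norm (v x))\<^sup>2)" by simp
qed

lemma norm_add_sq_le: "(norm (a + b))\<^sup>2 \<le> 2 * (norm a)\<^sup>2 + 2 * (norm (b :: 'b::real_inner))\<^sup>2"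
proof -
  have "0 \<le> (norm (a - b))\<^sup>2" by simp
  then show ?thesis by (simp add: power2_norm_eq_inner inner_add inner_diff inner_commute)
qed

lemma sqi_add:
  assumes "sq_integrable M u" "sq_integrable M v"
  shows "sq_integrable M (\<lambda>x. u x + v x)"
  unfolding sq_integrable_def
proof
  show m: "(\<lambda>x. u x + v x) \<in> borel_measurable M" using assms by (intro borel_measurable_add sqi_meas)
  show "integrable M (\<lambda>x. (norm (u x + v x))\<^sup>2)"
  proof (rule Bochner_Integration.integrable_bound)
    show "integrable M (\<lambda>x. 2 * (norm (u x))\<^sup>2 + 2 * (norm (v x))\<^sup>2)"
      using assms by (intro Bochner_Integration.integrable_add integrable_mult_right sqi_int)
    show "(\<lambda>x. (norm (u x + v x))\<^sup>2) \<in> borel_measurable M" using m by measurable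
  qed (use norm_add_sq_le in auto)
qed

lemma sqi_scaleR:
  assumes "sq_integrable M u" shows "sq_integrable M (\<lambda>x. c *\<^sub>R u x)"
  using assms by (auto simp: sq_integrable_def power_mult_distrib)

lemma sqi_minus: "sq_integrable M u \<Longrightarrow> sq_integrable M (\<lambda>x. - u x)"
  using sqi_scaleR[of M u "-1"] by simp

lemma sqi_diff:
  "sq_integrable M u \<Longrightarrow> sq_integrable M v \<Longrightarrow> sq_integrable M (\<lambda>x. u x - v x)"
  using sqi_add[OF _ sqi_minus, of M u v] by simp

lemma sqi_zero: "sq_integrable M (\<lambda>x. 0)"
  by (simp add: sq_integrable_def)

lemma sqi_AE_cong:
  assumes "sq_integrable M u" "v \<in> borel_measurable M" "AE x in M. u x = v x"
  shows "sq_integrable M v"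
proof -
  have "(\<lambda>x. (norm (v x))\<^sup>2) \<in> borel_measurable M" using assms(2) by measurable
  moreover have "(\<lambda>x. (norm (u x))\<^sup>2) \<in> borel_measurable M" using sqi_int[OF assms(1)] by measurable
  moreover have "AE x in M. (norm (u x))\<^sup>2 = (norm (v x))\<^sup>2" using assms(3) by auto
  ultimately show ?thesis using assms integrable_cong_AE[of "\<lambda>x. (norm (u x))\<^sup>2" M "\<lambda>x. (norm (v x))\<^sup>2"]
    by (simp add: sq_integrable_def)
qed

lemma sqnorm_diff_scaleR:
  assumes "sq_integrable M u" "sq_integrable M v"
  shows "sqnorm M (\<lambda>x. u x - t *\<^sub>R v x) = sqnorm M u - 2 * t * (LINT x|M. u x \<bullet> v x) + t\<^sup>2 * sqnorm M v"
proof -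
  have "(norm (u x - t *\<^sub>R v x))\<^sup>2 = (norm (u x))\<^sup>2 - 2 * t * (u x \<bullet> v x) + t\<^sup>2 * (norm (v x))\<^sup>2" for x
    unfolding power2_norm_eq_inner
    by (simp add: inner_diff inner_commute[of "v x" "u x"] power2_eq_square algebra_simps)
  then show ?thesis
    using sqi_int[OF assms(1)] sqi_int[OF assms(2)] sqi_inner[OF assms]
    by (simp add: sqnorm_def)
qed

lemma sqnorm_add_le:
  assumes "sq_integrable M u" "sq_integrable M v"
  shows "sqnorm M (\<lambda>x. u x + v x) \<le> 2 * sqnorm M u + 2 * sqnorm M v"
proof -
  have "sqnorm M (\<lambda>x. u x + v x) \<le> (LINT x|M. 2 * (norm (u x))\<^sup>2 + 2 * (norm (v x))\<^sup>2)"
    unfolding sqnorm_def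
    by (rule integral_mono)
       (use sqi_int[OF sqi_add[OF assms]] sqi_int[OF assms(1)] sqi_int[OF assms(2)] norm_add_sq_le in auto)
  also have "\<dots> = 2 * sqnorm M u + 2 * sqnorm M v"
    using sqi_int[OF assms(1)] sqi_int[OF assms(2)] by (simp add: sqnorm_def)
  finally show ?thesis .
qed

lemma sqnorm_minus_commute: "sqnorm M (\<lambda>x. u x - v x) = sqnorm M (\<lambda>x. v x - u x)"
  by (simp add: sqnorm_def norm_minus_commute)

lemma sqnorm_triangle:
  assumes "sq_integrable M u" "sq_integrable M v" "sq_integrable M w"
  shows "sqnorm M (\<lambda>x. u x - w x) \<le> 2 * sqnorm M (\<lambda>x. u x - v x) + 2 * sqnorm M (\<lambda>x. v x - w x)"
  using sqnorm_add_le[OF sqi_diff[OF assms(1,2)] sqi_diff[OF assms(2,3)]] by simp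

lemma sqnorm_cong_AE:
  assumes "sq_integrable M u" "sq_integrable M v" "AE x in M. u x = v x"
  shows "sqnorm M u = sqnorm M v"
  unfolding sqnorm_def
proof (rule integral_cong_AE)
  show "AE x in M. (norm (u x))\<^sup>2 = (norm (v x))\<^sup>2" using assms(3) by eventually_elim simp
qed (rule borel_measurable_integrable[OF sqi_int[OF assms(1)]] borel_measurable_integrable[OF sqi_int[OF assms(2)]])+

lemma integral_inner_cong_AE:
  assumes "sq_integrable M u" "sq_integrable M v" "sq_integrable M w" "AE x in M. u x = v x"
  shows "(LINT x|M. u x \<bullet> w x) = (LINT x|M. v x \<bullet> w x)"
proof (rule integral_cong_AE)
  show "AE x in M. u x \<bullet> w x = v x \<bullet> w x" using assms(4) by eventually_elim simp
qed (rule borel_measurable_integrable[OF sqi_inner[OF assms(1,3)]] borel_measurable_integrable[OF sqi_inner[OF assms(2,3)]])+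

lemma sqnorm_eq_0_AE:
  assumes "sq_integrable M u" "sqnorm M u = 0" shows "AE x in M. u x = 0"
proof -
  have "AE x in M. (norm (u x))\<^sup>2 = 0"
    using integral_nonneg_eq_0_iff_AE[OF sqi_int[OF assms(1)]] assms(2) by (simp add: sqnorm_def)
  then show ?thesis by eventually_elim simp
qed

text \<open>Used twice: for the Cauchy-Schwarz inequality, and with a = 0 to read off orthogonality
  from a minimality condition.\<close>

lemma quadratic_nonneg_discriminant:
  fixes a b c :: real
  assumes "\<And>t. 0 \<le> a - 2 * t * b + t\<^sup>2 * c" "0 \<le> c"
  shows "b\<^sup>2 \<le> a * c"
proof (cases "c = 0")
  case True
  have "b = 0"
  proof (rule ccontr)
    assume "b \<noteq> 0"
    \<comment> \<open>At this value of t the expression equals -1.\<close>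
    with True assms(1)[of "(a + 1) / (2 * b)"] show False by simp
  qed
  with True show ?thesis by simp
next
  case False
  with assms(1)[of "b / c"] assms(2) show ?thesis
    by (simp add: field_simps power2_eq_square)
qed

lemma L2_Cauchy_Schwarz:
  assumes "sq_integrable M u" "sq_integrable M v"
  shows "(LINT x|M. u x \<bullet> v x)\<^sup>2 \<le> sqnorm M u * sqnorm M v"
  using sqnorm_nonneg[of M "\<lambda>x. u x - _ *\<^sub>R v x"] sqnorm_nonneg[of M v]
  unfolding sqnorm_diff_scaleR[OF assms] by (rule quadratic_nonneg_discriminant)

section \<open>Convergence in the mean, completeness and orthogonal projection\<close>

lemma tendsto_inner_L2:
  assumes "\<And>n. sq_integrable M (f n)" "sq_integrable M g" "sq_integrable M w"
    and "(\<lambda>n. sqnorm M (\<lambda>x. f n x - g x)) \<longlonglongrightarrow> 0"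
  shows "(\<lambda>n. LINT x|M. f n x \<bullet> w x) \<longlonglongrightarrow> (LINT x|M. g x \<bullet> w x)"
proof -
  have "(\<lambda>n. sqrt (sqnorm M (\<lambda>x. f n x - g x) * sqnorm M w)) \<longlonglongrightarrow> sqrt (0 * sqnorm M w)"
    by (intro tendsto_intros assms)
  then have "(\<lambda>n. sqrt (sqnorm M (\<lambda>x. f n x - g x) * sqnorm M w)) \<longlonglongrightarrow> 0" by simp
  moreover have "norm ((LINT x|M. f n x \<bullet> w x) - (LINT x|M. g x \<bullet> w x))
      \<le> sqrt (sqnorm M (\<lambda>x. f n x - g x) * sqnorm M w)" for n
  proof -
    have "(LINT x|M. f n x \<bullet> w x) - (LINT x|M. g x \<bullet> w x) = (LINT x|M. (f n x - g x) \<bullet> w x)"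
      using sqi_inner[OF assms(1,3)] sqi_inner[OF assms(2,3)] by (simp add: inner_diff_left)
    then show ?thesis
      using L2_Cauchy_Schwarz[OF sqi_diff[OF assms(1)[of n] assms(2)] assms(3)]
      by (simp add: real_le_rsqrt)
  qed
  ultimately have "(\<lambda>n. (LINT x|M. f n x \<bullet> w x) - (LINT x|M. g x \<bullet> w x)) \<longlonglongrightarrow> 0"
    by (rule Lim_null_comparison[OF always_eventually[OF allI], rotated])
  then show ?thesis by (simp add: LIM_zero_iff)
qed

text \<open>Phrased with squared norms, like all estimates here: no square roots have to be handled,
  and the triangle inequality costs a factor 2.\<close>

definition L2_Cauchy :: "'a measure \<Rightarrow> (nat \<Rightarrow> 'a \<Rightarrow> 'b::euclidean_space) \<Rightarrow> bool" where
  "L2_Cauchy M f \<longleftrightarrow> (\<forall>e>0. \<exists>N. \<forall>m\<ge>N. \<forall>n\<ge>N. sqnorm M (\<lambda>x. f m x - f n x) < e)"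

text \<open>The form in which a Poincare inequality turns convergence of gradients into convergence
  of potentials.\<close>

lemma L2_Cauchy_dominated:
  assumes f: "L2_Cauchy M f" and C: "C \<ge> 0"
    and le: "\<And>k n. sqnorm N (\<lambda>x. g k x - g n x) \<le> C * sqnorm M (\<lambda>x. f k x - f n x)"
  shows "L2_Cauchy N g"
  unfolding L2_Cauchy_def
proof (intro allI impI)
  fix e :: real assume e: "e > 0"
  then have "e / (C + 1) > 0" using C by simp
  then obtain K where K: "\<And>k n. k \<ge> K \<Longrightarrow> n \<ge> K \<Longrightarrow> sqnorm M (\<lambda>x. f k x - f n x) < e / (C + 1)"
    using f unfolding L2_Cauchy_def by metis
  have "sqnorm N (\<lambda>x. g k x - g n x) < e" if "k \<ge> K" "n \<ge> K" for k n
  proof -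
    have "C * sqnorm M (\<lambda>x. f k x - f n x) \<le> C * (e / (C + 1))"
      using K[OF that] C by (intro mult_left_mono) auto
    also have "\<dots> < e" using C e by (simp add: field_simps)
    finally show ?thesis using le[of k n] by linarith
  qed
  then show "\<exists>K. \<forall>k\<ge>K. \<forall>n\<ge>K. sqnorm N (\<lambda>x. g k x - g n x) < e" by blast
qed

lemma L2_convergent_imp_Cauchy:
  assumes "\<And>n. sq_integrable M (f n)" "sq_integrable M g"
    and "(\<lambda>n. sqnorm M (\<lambda>x. f n x - g x)) \<longlonglongrightarrow> 0"
  shows "L2_Cauchy M f"
  unfolding L2_Cauchy_def
proof (intro allI impI)
  fix e :: real assume "e > 0"
  then have "\<forall>\<^sub>F n in sequentially. sqnorm M (\<lambda>x. f n x - g x) < e / 4"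
    using order_tendstoD(2)[OF assms(3), of "e / 4"] by simp
  then obtain N where N: "\<And>n. n \<ge> N \<Longrightarrow> sqnorm M (\<lambda>x. f n x - g x) < e / 4"
    unfolding eventually_sequentially by blast
  have "sqnorm M (\<lambda>x. f m x - f n x) < e" if "m \<ge> N" "n \<ge> N" for m n
  proof -
    have "sqnorm M (\<lambda>x. f m x - f n x) \<le> 2 * sqnorm M (\<lambda>x. f m x - g x) + 2 * sqnorm M (\<lambda>x. g x - f n x)"
      by (rule sqnorm_triangle assms)+
    also have "sqnorm M (\<lambda>x. g x - f n x) = sqnorm M (\<lambda>x. f n x - g x)" by (rule sqnorm_minus_commute)
    also have "2 * sqnorm M (\<lambda>x. f m x - g x) + 2 * sqnorm M (\<lambda>x. f n x - g x) < e"
      using N[OF that(1)] N[OF that(2)] by linarith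
    finally show ?thesis .
  qed
  then show "\<exists>N. \<forall>m\<ge>N. \<forall>n\<ge>N. sqnorm M (\<lambda>x. f m x - f n x) < e" by blast
qed

text \<open>Riesz-Fischer: a fast subsequence converges almost everywhere, and Fatou's lemma shows
  that the whole sequence converges in the mean to this pointwise limit.\<close>

lemma L2_complete:
  fixes f :: "nat \<Rightarrow> 'a \<Rightarrow> 'b::euclidean_space"
  assumes f: "\<And>n. sq_integrable M (f n)" and C: "L2_Cauchy M f"
  obtains g where "sq_integrable M g" "(\<lambda>n. sqnorm M (\<lambda>x. f n x - g x)) \<longlonglongrightarrow> 0"
proof -
  have [measurable]: "f n \<in> borel_measurable M" for n using f by auto
  have "\<forall>k. \<exists>N. \<forall>m\<ge>N. \<forall>n\<ge>N. sqnorm M (\<lambda>x. f m x - f n x) < (1/4) ^ k"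
    using C unfolding L2_Cauchy_def by simp
  then obtain N where N: "\<And>k m n. m \<ge> N k \<Longrightarrow> n \<ge> N k \<Longrightarrow> sqnorm M (\<lambda>x. f m x - f n x) < (1/4) ^ k"
    by metis
  \<comment> \<open>Summing the thresholds and adding the index makes \<open>r\<close> monotone,
    unbounded and at least \<open>N k\<close> at the same time.\<close>
  define r where "r k = (\<Sum>j\<le>k. N j) + k" for k
  have r: "N k \<le> r k" "k \<le> r k" "r k \<le> r (Suc k)" for k
    using member_le_sum[of k "{..k}" N] by (auto simp: r_def)
  define h where "h k x = f (r (Suc k)) x - f (r k) x" for k x
  have [measurable]: "h k \<in> borel_measurable M" for k unfolding h_def by measurable
  have hi: "integrable M (\<lambda>x. (norm (h k x))\<^sup>2)" for k
    unfolding h_def by (intro sqi_int sqi_diff f)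
  have hb: "(LINT x|M. (norm (h k x))\<^sup>2) \<le> (1/4) ^ k" for k
    using N[of k "r (Suc k)" "r k"] r[of k] unfolding sqnorm_def h_def by fastforce
  \<comment> \<open>The squared increments are below 4^-k, so a weight 2^k still leaves a convergent
    series. The weight pays for the passage from squares to norms.\<close>
  have "(\<integral>\<^sup>+x. (\<Sum>k. ennreal (2 ^ k * (norm (h k x))\<^sup>2)) \<partial>M)
      = (\<Sum>k. \<integral>\<^sup>+x. ennreal (2 ^ k * (norm (h k x))\<^sup>2) \<partial>M)"
    by (rule nn_integral_suminf) measurable
  also have "\<dots> = (\<Sum>k. ennreal (2 ^ k * (LINT x|M. (norm (h k x))\<^sup>2)))"
    using hi by (subst nn_integral_eq_integral) auto
  also have "\<dots> \<le> (\<Sum>k. ennreal ((1/2) ^ k))"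
  proof (intro suminf_le summableI ennreal_leI)
    show "2 ^ k * (LINT x|M. (norm (h k x))\<^sup>2) \<le> (1/2) ^ k" for k
    proof -
      have "2 ^ k * (LINT x|M. (norm (h k x))\<^sup>2) \<le> 2 ^ k * (1/4) ^ k"
        by (rule mult_left_mono[OF hb]) simp
      also have "\<dots> = (2 * (1/4)) ^ k" by (rule power_mult_distrib[symmetric])
      finally show ?thesis by simp
    qed
  qed
  also have "\<dots> = ennreal (\<Sum>k. (1/2) ^ k)"
    by (rule suminf_ennreal2) (auto intro: summable_geometric)
  also have "\<dots> < \<infinity>" by simp
  finally have "AE x in M. (\<Sum>k. ennreal (2 ^ k * (norm (h k x))\<^sup>2)) \<noteq> \<infinity>"
    by (intro nn_integral_PInf_AE) auto
  then have conv: "AE x in M. convergent (\<lambda>k. f (r k) x)"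
  proof (rule AE_mp, intro AE_I2 impI)
    fix x assume "(\<Sum>k. ennreal (2 ^ k * (norm (h k x))\<^sup>2)) \<noteq> \<infinity>"
    then have "summable (\<lambda>k. 2 ^ k * (norm (h k x))\<^sup>2)"
      by (intro summable_suminf_not_top) auto
    then have s: "summable (\<lambda>k. 2 ^ k * (norm (h k x))\<^sup>2 + (1/2) ^ k)"
      by (intro summable_add summable_geometric) auto
    \<comment> \<open>With a = 2^k |h k x| this is a <= a^2 + 1. It takes the place of a
      Cauchy-Schwarz inequality for series.\<close>
    have "norm (h k x) \<le> 2 ^ k * (norm (h k x))\<^sup>2 + (1/2) ^ k" for k
    proof -
      have "0 \<le> (2 ^ k * norm (h k x) - 1)\<^sup>2 + 2 ^ k * norm (h k x)" by simp
      then have "(2 ^ k * norm (h k x)) * 1 \<le> (2 ^ k * norm (h k x))\<^sup>2 + 1"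
        by (simp add: power2_diff mult.commute)
      then show ?thesis by (simp add: field_simps power2_eq_square power_one_over)
    qed
    then have "summable (\<lambda>k. h k x)"
      by (intro summable_comparison_test'[OF s, of 0]) simp
    then have "convergent (\<lambda>n. \<Sum>k<n. h k x)" by (simp add: summable_iff_convergent)
    moreover have "(\<Sum>k<n. h k x) = f (r n) x - f (r 0) x" for n
      unfolding h_def by (rule sum_lessThan_telescope)
    ultimately show "convergent (\<lambda>k. f (r k) x)"
      using convergent_diff_const_right_iff[of "\<lambda>k. f (r k) x" "f (r 0) x"]  by simp
  qed
  define g where "g x = lim (\<lambda>k. f (r k) x)" for x
  have [measurable]: "g \<in> borel_measurable M" unfolding g_def by measurable
  have lim: "AE x in M. (\<lambda>k. f (r k) x) \<longlonglongrightarrow> g x"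
    using conv by eventually_elim (simp add: g_def convergent_LIMSEQ_iff)
  \<comment> \<open>Fatou along the subsequence: a bound on the distance from \<open>f n\<close> to
    all late members survives the pointwise limit.\<close>
  have key: "(\<integral>\<^sup>+x. ennreal ((norm (f n x - g x))\<^sup>2) \<partial>M) \<le> ennreal e"
    if "e > 0" "\<And>m. m \<ge> K \<Longrightarrow> sqnorm M (\<lambda>x. f n x - f m x) < e" for n e K
  proof -
    have "(\<integral>\<^sup>+x. ennreal ((norm (f n x - g x))\<^sup>2) \<partial>M)
        = (\<integral>\<^sup>+x. liminf (\<lambda>k. ennreal ((norm (f n x - f (r k) x))\<^sup>2)) \<partial>M)"
    proof (rule nn_integral_cong_AE, use lim in eventually_elim)
      fix x assume "(\<lambda>k. f (r k) x) \<longlonglongrightarrow> g x"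
      then have "(\<lambda>k. ennreal ((norm (f n x - f (r k) x))\<^sup>2)) \<longlonglongrightarrow> ennreal ((norm (f n x - g x))\<^sup>2)"
        by (intro tendsto_intros)
      then show "ennreal ((norm (f n x - g x))\<^sup>2) = liminf (\<lambda>k. ennreal ((norm (f n x - f (r k) x))\<^sup>2))"
        by (rule lim_imp_Liminf[symmetric, rotated]) simp
    qed
    also have "\<dots> \<le> liminf (\<lambda>k. \<integral>\<^sup>+x. ennreal ((norm (f n x - f (r k) x))\<^sup>2) \<partial>M)"
      by (rule nn_integral_liminf) measurable
    also have "\<dots> \<le> ennreal e"
    proof (rule Liminf_le)
      show "\<forall>\<^sub>F k in sequentially. (\<integral>\<^sup>+x. ennreal ((norm (f n x - f (r k) x))\<^sup>2) \<partial>M) \<le> ennreal e"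
        using eventually_ge_at_top[of K]
      proof eventually_elim
        fix k assume "K \<le> k"
        then have "sqnorm M (\<lambda>x. f n x - f (r k) x) < e" using that(2) r(2)[of k] by simp
        then show "(\<integral>\<^sup>+x. ennreal ((norm (f n x - f (r k) x))\<^sup>2) \<partial>M) \<le> ennreal e"
          using sqi_int[OF sqi_diff[OF f[of n] f[of "r k"]]]
          by (subst nn_integral_eq_integral) (auto simp: sqnorm_def intro: ennreal_leI)
      qed
    qed simp
    finally show ?thesis .
  qed
  have fg: "sq_integrable M (\<lambda>x. f n x - g x)" if "n \<ge> N 0" for n
  proof -
    have "(\<integral>\<^sup>+x. ennreal ((norm (f n x - g x))\<^sup>2) \<partial>M) \<le> ennreal 1"
      by (rule key[of _ "N 0"]) (use N[of 0 n] that in auto)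
    then have "(\<integral>\<^sup>+x. ennreal ((norm (f n x - g x))\<^sup>2) \<partial>M) < \<infinity>"
      using ennreal_less_top le_less_trans by (metis infinity_ennreal_def)
    then show ?thesis by (auto simp: sq_integrable_def integrable_iff_bounded)
  qed
  have g: "sq_integrable M g" using sqi_diff[OF f[of "N 0"] fg[OF order_refl]] by simp
  moreover have "(\<lambda>n. sqnorm M (\<lambda>x. f n x - g x)) \<longlonglongrightarrow> 0"
  proof (rule LIMSEQ_I)
    fix e :: real assume e: "e > 0"
    then obtain K where K: "\<And>m n. m \<ge> K \<Longrightarrow> n \<ge> K \<Longrightarrow> sqnorm M (\<lambda>x. f n x - f m x) < e / 2"
      using C unfolding L2_Cauchy_def by (meson half_gt_zero)
    have "norm (sqnorm M (\<lambda>x. f n x - g x) - 0) < e" if "n \<ge> K" for n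
    proof -
      have "ennreal (sqnorm M (\<lambda>x. f n x - g x)) = (\<integral>\<^sup>+x. ennreal ((norm (f n x - g x))\<^sup>2) \<partial>M)"
        using sqi_int[OF sqi_diff[OF f[of n] g]] by (simp add: nn_integral_eq_integral sqnorm_def)
      also have "\<dots> \<le> ennreal (e / 2)" by (rule key[of _ K]) (use e K that in auto)
      finally have "sqnorm M (\<lambda>x. f n x - g x) \<le> e / 2" using e by (subst (asm) ennreal_le_iff) auto
      then show ?thesis using e sqnorm_nonneg[of M "\<lambda>x. f n x - g x"] by simp
    qed
    then show "\<exists>K. \<forall>n\<ge>K. norm (sqnorm M (\<lambda>x. f n x - g x) - 0) < e" by blast
  qed
  ultimately show thesis by (rule that)
qed

text \<open>\<open>V\<close> is only a linear set of functions and need not be closed. The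
  projection \<open>g\<close> lies in its closure and is delivered together with a sequence from
  \<open>V\<close>; the potentials are later built from that sequence, not from \<open>g\<close>
  alone.\<close>

lemma L2_projection:
  fixes u :: "'a \<Rightarrow> 'b::euclidean_space"
  assumes V: "\<And>v. v \<in> V \<Longrightarrow> sq_integrable M v"
    and V0: "(\<lambda>x. 0) \<in> V" and Vadd: "\<And>v w. v \<in> V \<Longrightarrow> w \<in> V \<Longrightarrow> (\<lambda>x. v x + w x) \<in> V"
    and Vsc: "\<And>v c. v \<in> V \<Longrightarrow> (\<lambda>x. c *\<^sub>R v x) \<in> V"
    and u: "sq_integrable M u"
  obtains v g where "\<And>n. v n \<in> V" "sq_integrable M g" "(\<lambda>n. sqnorm M (\<lambda>x. v n x - g x)) \<longlonglongrightarrow> 0"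
    "\<And>w. w \<in> V \<Longrightarrow> (LINT x|M. (u x - g x) \<bullet> w x) = 0"
proof -
  define d where "d = (INF v\<in>V. sqnorm M (\<lambda>x. u x - v x))"
  have bdd: "bdd_below ((\<lambda>v. sqnorm M (\<lambda>x. u x - v x)) ` V)"
    by (rule bdd_belowI2[of _ 0]) (rule sqnorm_nonneg)
  have dle: "d \<le> sqnorm M (\<lambda>x. u x - v x)" if "v \<in> V" for v
    unfolding d_def by (rule cINF_lower[OF bdd that])
  have "\<exists>v\<in>V. sqnorm M (\<lambda>x. u x - v x) < d + 1 / real (Suc n)" for n
  proof -
    have "(INF v\<in>V. sqnorm M (\<lambda>x. u x - v x)) < d + 1 / real (Suc n)" unfolding d_def[symmetric] by simp
    then show ?thesis using V0 bdd by (subst (asm) cINF_less_iff) auto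
  qed
  then obtain v where v: "\<And>n. v n \<in> V" "\<And>n. sqnorm M (\<lambda>x. u x - v n x) < d + 1 / real (Suc n)"
    by metis
  \<comment> \<open>Parallelogram identity: the midpoint \<open>w\<close> belongs to
    \<open>V\<close> and so cannot be closer to \<open>u\<close> than \<open>d\<close>, which forces
    two nearly optimal elements to be near each other.\<close>
  have para: "sqnorm M (\<lambda>x. v m x - v n x) \<le> 2 / real (Suc m) + 2 / real (Suc n)" for m n
  proof -
    define a b where "a = (\<lambda>x. u x - v m x)" and "b = (\<lambda>x. u x - v n x)"
    have ab: "sq_integrable M a" "sq_integrable M b"
      unfolding a_def b_def by (intro sqi_diff u V v)+
    define w where "w x = (1/2) *\<^sub>R (v m x + v n x)" for x
    have wV: "w \<in> V" unfolding w_def by (intro Vadd Vsc v)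
    have "sqnorm M (\<lambda>x. v m x - v n x) = sqnorm M (\<lambda>x. b x - 1 *\<^sub>R a x)"
      by (simp add: a_def b_def)
    also have "\<dots> = 2 * sqnorm M a + 2 * sqnorm M b - sqnorm M (\<lambda>x. b x - (-1) *\<^sub>R a x)"
      unfolding sqnorm_diff_scaleR[OF ab(2,1)] by simp
    also have "(\<lambda>x. b x - (-1) *\<^sub>R a x) = (\<lambda>x. 2 *\<^sub>R (u x - w x))"
      by (auto simp: a_def b_def w_def algebra_simps scaleR_2)
    also have "sqnorm M (\<lambda>x. 2 *\<^sub>R (u x - w x)) = 4 * sqnorm M (\<lambda>x. u x - w x)"
      by (simp add: sqnorm_def power_mult_distrib)
    also have "2 * sqnorm M a + 2 * sqnorm M b - 4 * sqnorm M (\<lambda>x. u x - w x)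
        \<le> 2 * (d + 1 / real (Suc m)) + 2 * (d + 1 / real (Suc n)) - 4 * d"
      using v(2)[of m] v(2)[of n] dle[OF wV] unfolding a_def[symmetric] b_def[symmetric]
      by (intro diff_mono add_mono mult_left_mono) auto
    also have "\<dots> = 2 / real (Suc m) + 2 / real (Suc n)" by simp
    finally show ?thesis .
  qed
  have "L2_Cauchy M v"
    unfolding L2_Cauchy_def
  proof (intro allI impI)
    fix e :: real assume "e > 0"
    then obtain K where K: "1 / real (Suc K) < e / 4" using nat_approx_posE[of "e / 4"] by auto
    have "sqnorm M (\<lambda>x. v m x - v n x) < e" if "m \<ge> K" "n \<ge> K" for m n
    proof -
      have "1 / real (Suc m) \<le> 1 / real (Suc K)" "1 / real (Suc n) \<le> 1 / real (Suc K)"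
        using that by (simp_all add: frac_le)
      then show ?thesis using para[of m n] K by linarith
    qed
    then show "\<exists>N. \<forall>m\<ge>N. \<forall>n\<ge>N. sqnorm M (\<lambda>x. v m x - v n x) < e" by blast
  qed
  then obtain g where g: "sq_integrable M g" "(\<lambda>n. sqnorm M (\<lambda>x. v n x - g x)) \<longlonglongrightarrow> 0"
    using L2_complete[of M v] V[OF v(1)] by blast
  have "(LINT x|M. (u x - g x) \<bullet> w x) = 0" if w: "w \<in> V" for w
  proof -
    define I where "I = (LINT x|M. (u x - g x) \<bullet> w x)"
    have "0 \<le> 0 - 2 * t * I + t\<^sup>2 * sqnorm M w" for t
    proof -
      have lim: "(\<lambda>n. LINT x|M. (u x - v n x) \<bullet> w x) \<longlonglongrightarrow> I"
        unfolding I_def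
      proof (rule tendsto_inner_L2)
        have "sqnorm M (\<lambda>x. (u x - v n x) - (u x - g x)) = sqnorm M (\<lambda>x. v n x - g x)" for n
          using sqnorm_minus_commute[of M g] by simp
        then show "(\<lambda>n. sqnorm M (\<lambda>x. (u x - v n x) - (u x - g x))) \<longlonglongrightarrow> 0" using g(2) by simp
      qed (intro sqi_diff u V v g w)+
      \<comment> \<open>The competitor is v_n + t w. Since v_n is optimal only up to 1/(n+1), this
        error remains and disappears in the limit.\<close>
      have "- (1 / real (Suc n)) \<le> - 2 * t * (LINT x|M. (u x - v n x) \<bullet> w x) + t\<^sup>2 * sqnorm M w" for n
      proof -
        have "(\<lambda>x. v n x + t *\<^sub>R w x) \<in> V" by (intro Vadd Vsc v w)
        from dle[OF this] have "d \<le> sqnorm M (\<lambda>x. (u x - v n x) - t *\<^sub>R w x)" by (simp add: diff_diff_add)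
        also have "\<dots> = sqnorm M (\<lambda>x. u x - v n x) - 2 * t * (LINT x|M. (u x - v n x) \<bullet> w x) + t\<^sup>2 * sqnorm M w"
          by (intro sqnorm_diff_scaleR sqi_diff u V v w)
        finally show ?thesis using v(2)[of n] by linarith
      qed
      moreover have "(\<lambda>n. - 2 * t * (LINT x|M. (u x - v n x) \<bullet> w x) + t\<^sup>2 * sqnorm M w)
          \<longlonglongrightarrow> - 2 * t * I + t\<^sup>2 * sqnorm M w"
        by (intro tendsto_intros lim)
      moreover have "(\<lambda>n. - (1 / real (Suc n))) \<longlonglongrightarrow> - 0"
        by (intro tendsto_minus LIMSEQ_Suc[OF lim_1_over_n])
      ultimately have "- 0 \<le> - 2 * t * I + t\<^sup>2 * sqnorm M w"
        by (intro LIMSEQ_le[of "\<lambda>n. - (1 / real (Suc n))"]) auto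
      then show ?thesis by simp
    qed
    then have "I\<^sup>2 \<le> 0 * sqnorm M w"
      by (intro quadratic_nonneg_discriminant sqnorm_nonneg)
    then show ?thesis by (simp add: I_def)
  qed
  with v g show thesis by (intro that)
qed

section \<open>The fundamental lemma of the calculus of variations\<close>

text \<open>Affine substitution and Fubini are applied over \<open>lborel\<close>, so Lebesgue
  measurable representatives are exchanged for Borel ones off a null set. The exchange is made
  coordinate by coordinate.\<close>

lemma lebesgue_on_borel_version:
  fixes f :: "'a::euclidean_space \<Rightarrow> 'b::euclidean_space"
  assumes f: "f \<in> borel_measurable (lebesgue_on S)" and S: "S \<in> sets lebesgue"
  obtains g where "g \<in> borel_measurable borel" "AE x in lebesgue_on S. f x = g x"
proof -
  have m: "(\<lambda>x. if x \<in> S then f x else 0) \<in> borel_measurable lebesgue"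
    using f S by (simp add: borel_measurable_if)
  have "\<exists>g. g \<in> borel_measurable borel \<and> (AE x in lborel. (if x \<in> S then f x else 0) \<bullet> b = g x)" for b
    using completion_ex_borel_measurable_real[of "\<lambda>x. (if x \<in> S then f x else 0) \<bullet> b" lborel]
      borel_measurable_inner[OF m, of "\<lambda>_. b"] by auto
  then obtain g where g: "\<And>b. g b \<in> borel_measurable borel"
    "\<And>b. AE x in lborel. (if x \<in> S then f x else 0) \<bullet> b = g b x" by metis
  show thesis
  proof
    show "(\<lambda>x. \<Sum>b\<in>Basis. g b x *\<^sub>R b) \<in> borel_measurable borel" using g(1) by measurable
    have "AE x in lborel. \<forall>b\<in>Basis. (if x \<in> S then f x else 0) \<bullet> b = g b x"
      using g(2) by (simp add: AE_finite_all)
    then have "AE x in lborel. x \<in> S \<longrightarrow> f x = (\<Sum>b\<in>Basis. g b x *\<^sub>R b)"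
    proof eventually_elim
      case (elim x)
      show ?case
      proof
        assume "x \<in> S"
        then have "\<And>b. b \<in> Basis \<Longrightarrow> g b x = f x \<bullet> b" using elim by auto
        then show "f x = (\<Sum>b\<in>Basis. g b x *\<^sub>R b)" by (simp add: euclidean_representation)
      qed
    qed
    then have "AE x in lebesgue. x \<in> S \<longrightarrow> f x = (\<Sum>b\<in>Basis. g b x *\<^sub>R b)" by (rule AE_completion)
    then show "AE x in lebesgue_on S. f x = (\<Sum>b\<in>Basis. g b x *\<^sub>R b)"
      using S by (simp add: AE_restrict_space_iff)
  qed
qed

lemma borel_imp_lebesgue_on: "f \<in> borel_measurable borel \<Longrightarrow> f \<in> borel_measurable (lebesgue_on S)"
  by (intro measurable_restrict_space1 measurable_completion) simp

lemma continuous_imp_lebesgue_on: "continuous_on UNIV f \<Longrightarrow> f \<in> borel_measurable (lebesgue_on S)"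
  by (intro borel_imp_lebesgue_on borel_measurable_continuous_onI)

lemma finite_measure_lebesgue_on_bounded:
  fixes S :: "'a::euclidean_space set"
  assumes "bounded S" "open S" shows "finite_measure (lebesgue_on S)"
  by (rule finite_measure_lebesgue_on) (use assms in \<open>auto intro: lmeasurable_open\<close>)

lemma sqi_bounded:
  fixes f :: "'a::euclidean_space \<Rightarrow> 'b::euclidean_space"
  assumes "bounded S" "open S" "f \<in> borel_measurable (lebesgue_on S)" "\<And>x. x \<in> S \<Longrightarrow> norm (f x) \<le> B"
  shows "sq_integrable (lebesgue_on S) f"
  unfolding sq_integrable_def
proof
  interpret finite_measure "lebesgue_on S" using assms by (intro finite_measure_lebesgue_on_bounded)
  show "integrable (lebesgue_on S) (\<lambda>x. (norm (f x))\<^sup>2)"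
  proof (rule integrable_const_bound[of _ "B\<^sup>2"])
    show "AE x in lebesgue_on S. norm ((norm (f x))\<^sup>2) \<le> B\<^sup>2"
      by (rule AE_I2) (use assms(4) in \<open>auto simp: intro: power_mono\<close>)
    show "(\<lambda>x. (norm (f x))\<^sup>2) \<in> borel_measurable (lebesgue_on S)" using assms(3) by measurable
  qed
qed (rule assms)

lemma sqi_continuous:
  fixes f :: "'a::euclidean_space \<Rightarrow> 'b::euclidean_space"
  assumes "bounded S" "open S" "continuous_on UNIV f"
  shows "sq_integrable (lebesgue_on S) f"
proof -
  have "compact (f ` closure S)"
    using assms by (intro compact_continuous_image) (simp_all add: continuous_on_subset[OF assms(3)])
  then have "bounded (f ` closure S)" by (rule compact_imp_bounded)
  then obtain B where B: "\<forall>y\<in>f ` closure S. norm y \<le> B"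
    unfolding bounded_iff by blast
  show ?thesis
  proof (rule sqi_bounded[OF assms(1,2) continuous_imp_lebesgue_on[OF assms(3)]])
    show "norm (f x) \<le> B" if "x \<in> S" for x
      using B that closure_subset[of S] by (simp add: subset_iff)
  qed
qed

lemma sqi_imp_integrable:
  assumes "finite_measure M" "sq_integrable M f" shows "integrable M f"
proof (rule Bochner_Integration.integrable_bound)
  interpret finite_measure M by fact
  show "integrable M (\<lambda>x. 1 + (norm (f x))\<^sup>2)"
    by (intro Bochner_Integration.integrable_add sqi_int assms) auto
  have "norm (f x) \<le> norm (1 + (norm (f x))\<^sup>2)" for x
  proof -
    have "0 \<le> (norm (f x) - 1)\<^sup>2 + norm (f x)" by simp
    then show ?thesis by (simp add: power2_diff)
  qed
  then show "AE x in M. norm (f x) \<le> norm (1 + (norm (f x))\<^sup>2)" by simp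
qed (use assms in auto)

lemma integral_lebesgue_on_superset:
  fixes f :: "'a::euclidean_space \<Rightarrow> 'b::{banach, second_countable_topology}"
  assumes "open U" "open V" "U \<subseteq> V" "\<And>x. x \<in> V \<Longrightarrow> x \<notin> U \<Longrightarrow> f x = 0"
  shows "(LINT x|lebesgue_on U. f x) = (LINT x|lebesgue_on V. f x)"
proof -
  have "(LINT x|lebesgue_on U. f x) = (LINT x|lebesgue. indicator U x *\<^sub>R f x)"
    using assms by (intro integral_restrict_space) auto
  also have "\<dots> = (LINT x|lebesgue. indicator V x *\<^sub>R f x)"
    using assms by (intro Bochner_Integration.integral_cong) (auto simp: indicator_def)
  also have "\<dots> = (LINT x|lebesgue_on V. f x)"
    using assms by (intro integral_restrict_space[symmetric]) auto
  finally show ?thesis .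
qed

section \<open>Integrals against test functions determine an integrable function\<close>

lemma smooth_sstep_compose: "smooth_fun f \<Longrightarrow> smooth_fun (\<lambda>x. sstep (c * f x))"
  by (simp add: smooth_fun_def Ck_cmult Ck_compose_real[OF Ck_sstep])

text \<open>An open set is a countable union of balls. For finitely many balls the sum
  \<open>b\<close> of their bumps is positive exactly on the union, so \<open>sstep (k * b)\<close>
  consists of test functions increasing to its indicator; dominated convergence then passes to
  infinitely many balls.\<close>

lemma integral_open_set_zero:
  fixes f :: "'a::euclidean_space \<Rightarrow> real"
  assumes U: "open U" and f: "integrable (lebesgue_on U) f"
    and z: "\<And>\<phi>. test_fun U \<phi> \<Longrightarrow> (LINT x|lebesgue_on U. \<phi> x * f x) = 0"
    and W: "open W" "W \<subseteq> U"
  shows "(LINT x|lebesgue_on U. indicator W x * f x) = 0"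
proof (cases "W = {}")
  case False
  let ?M = "lebesgue_on U"
  define F where "F = {ball x r |x r. r > 0 \<and> cball x r \<subseteq> W}"
  have WF: "W = \<Union>F"
  proof
    show "W \<subseteq> \<Union>F"
    proof
      fix x assume "x \<in> W"
      then obtain r where "r > 0" "cball x r \<subseteq> W" using W open_contains_cball by blast
      then have "ball x r \<in> F" "x \<in> ball x r" by (auto simp: F_def)
      then show "x \<in> \<Union>F" by blast
    qed
  qed (use ball_subset_cball in \<open>fastforce simp: F_def\<close>)
  obtain F' where F': "F' \<subseteq> F" "countable F'" "\<Union>F' = \<Union>F"
    using Lindelof[of F] by (auto simp: F_def)
  with False WF have "F' \<noteq> {}" by auto
  then obtain B :: "nat \<Rightarrow> 'a set" where B: "range B = F'"
    using F'(2) by (metis uncountable_def)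
  then have "\<forall>n. \<exists>x r. B n = ball x r \<and> r > 0 \<and> cball x r \<subseteq> W"
    using F'(1) unfolding F_def by blast
  then obtain c r where cr: "\<And>n. B n = ball (c n) (r n)" "\<And>n. r n > 0" "\<And>n. cball (c n) (r n) \<subseteq> W"
    by metis
  have WB: "W = (\<Union>n. B n)" using WF F'(3) B by auto
  have fm[measurable]: "f \<in> borel_measurable ?M" by (rule borel_measurable_integrable[OF f])
  have fin: "(LINT x|?M. indicator (\<Union>n<N. B n) x * f x) = 0" for N
  proof -
    \<comment> \<open>Finitely many balls first: only then is the union of the closed balls a
      compact carrier inside W.\<close>
    define b where "b x = (\<Sum>n<N. ball_bump (c n) (r n) x)" for x
    have bpos: "b x > 0 \<longleftrightarrow> x \<in> (\<Union>n<N. B n)" for x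
    proof
      assume "b x > 0"
      then obtain n where "n < N" "ball_bump (c n) (r n) x \<noteq> 0"
        unfolding b_def using sum.neutral[of "{..<N}" "\<lambda>n. ball_bump (c n) (r n) x"] by fastforce
      then show "x \<in> (\<Union>n<N. B n)" using ball_bump_pos(2)[OF cr(2)[of n], of "c n" x] cr(1)[of n] by auto
    next
      assume "x \<in> (\<Union>n<N. B n)"
      then obtain n where n: "n < N" "x \<in> B n" by blast
      then have "ball_bump (c n) (r n) x > 0" using ball_bump_pos(1)[OF cr(2)[of n], of "c n" x] cr(1)[of n] by simp
      moreover have "ball_bump (c n) (r n) x \<le> b x"
        unfolding b_def using n by (intro member_le_sum) (auto simp: ball_bump_nonneg)
      ultimately show "b x > 0" by simp
    qed
    have bs: "smooth_fun b"
      unfolding b_def smooth_fun_def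
      by (intro allI Ck_sum smooth_fun_Ck[OF smooth_ball_bump])
    have b0: "b x = 0" if "x \<notin> (\<Union>n<N. B n)" for x
    proof -
      have "0 \<le> b x" unfolding b_def by (intro sum_nonneg) (simp add: ball_bump_nonneg)
      with that bpos[of x] show ?thesis by linarith
    qed
    have test: "test_fun U (\<lambda>x. sstep (real k * b x))" for k
    proof (rule test_funI[where K="\<Union>n<N. cball (c n) (r n)"])
      show "smooth_fun (\<lambda>x. sstep (real k * b x))" by (rule smooth_sstep_compose[OF bs])
      show "(\<Union>n<N. cball (c n) (r n)) \<subseteq> U" using cr(3) W by blast
      fix x assume "x \<notin> (\<Union>n<N. cball (c n) (r n))"
      then have "x \<notin> (\<Union>n<N. ball (c n) (r n))"
        using ball_subset_cball by blast
      then have "x \<notin> (\<Union>n<N. B n)" by (simp only: cr(1) not_False_eq_True)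
      then show "sstep (real k * b x) = 0" by (simp add: b0 sstep_eq)
    qed auto
    have "(\<lambda>k. LINT x|?M. sstep (real k * b x) * f x) \<longlonglongrightarrow> (LINT x|?M. indicator (\<Union>n<N. B n) x * f x)"
    proof (rule integral_dominated_convergence[where w="\<lambda>x. norm (f x)"])
      have "open (\<Union>n<N. B n)" unfolding cr(1) by (rule open_UN) simp
      then have "(indicator (\<Union>n<N. B n) :: 'a \<Rightarrow> real) \<in> borel_measurable ?M"
        by (intro borel_imp_lebesgue_on borel_measurable_indicator borel_open)
      then show "(\<lambda>x. indicator (\<Union>n<N. B n) x * f x) \<in> borel_measurable ?M" by measurable
      have [measurable]: "(\<lambda>x. sstep (real k * b x)) \<in> borel_measurable ?M" for k
        by (intro continuous_imp_lebesgue_on smooth_fun_continuous smooth_sstep_compose bs)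
      show "(\<lambda>x. sstep (real k * b x) * f x) \<in> borel_measurable ?M" for k by measurable
      show "integrable ?M (\<lambda>x. norm (f x))" using f by simp
      show "AE x in ?M. (\<lambda>k. sstep (real k * b x) * f x) \<longlonglongrightarrow> indicator (\<Union>n<N. B n) x * f x"
      proof (intro AE_I2 tendsto_mult tendsto_const)
        fix x
        show "(\<lambda>k. sstep (real k * b x)) \<longlonglongrightarrow> indicator (\<Union>n<N. B n) x"
          using sstep_tendsto[of "b x"] unfolding bpos indicator_def of_bool_def .
      qed
      show "AE x in ?M. norm (sstep (real k * b x) * f x) \<le> norm (f x)" for k
        using sstep_bounds(1,2) by (auto simp: abs_mult intro!: mult_left_le_one_le)
    qed
    then have "(\<lambda>k. 0) \<longlonglongrightarrow> (LINT x|?M. indicator (\<Union>n<N. B n) x * f x)"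
      unfolding z[OF test] .
    then show ?thesis by (rule LIMSEQ_unique[OF _ tendsto_const])
  qed
  have "(\<lambda>N. LINT x|?M. indicator (\<Union>n<N. B n) x * f x) \<longlonglongrightarrow> (LINT x|?M. indicator W x * f x)"
  proof (rule integral_dominated_convergence[where w="\<lambda>x. norm (f x)"])
    have ob: "open (\<Union>n<N. B n)" for N unfolding cr(1) by (rule open_UN) simp
    have im: "(indicator A :: 'a \<Rightarrow> real) \<in> borel_measurable ?M" if "open A" for A
      using that by (intro borel_imp_lebesgue_on borel_measurable_indicator borel_open)
    show "(\<lambda>x. indicator W x * f x) \<in> borel_measurable ?M"
      using im[OF W(1)] by measurable
    show "(\<lambda>x. indicator (\<Union>n<N. B n) x * f x) \<in> borel_measurable ?M" for N
      using im[OF ob] by measurable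
    show "integrable ?M (\<lambda>x. norm (f x))" using f by simp
    show "AE x in ?M. (\<lambda>N. indicator (\<Union>n<N. B n) x * f x) \<longlonglongrightarrow> indicator W x * f x"
      unfolding WB by (intro AE_I2 tendsto_mult tendsto_const LIMSEQ_indicator_UN)
    show "AE x in ?M. norm (indicator (\<Union>n<N. B n) x * f x) \<le> norm (f x)" for N
      by (auto simp: indicator_def)
  qed
  then show ?thesis unfolding fin by (rule LIMSEQ_unique[OF _ tendsto_const])
qed simp

text \<open>Dynkin's argument: open sets form an intersection-stable generator, and the sets with
  vanishing integral are closed under complements and disjoint countable unions.\<close>

lemma integral_borel_set_zero:
  fixes f :: "'a::euclidean_space \<Rightarrow> real"
  assumes U: "open U" and f: "integrable (lebesgue_on U) f"
    and z: "\<And>\<phi>. test_fun U \<phi> \<Longrightarrow> (LINT x|lebesgue_on U. \<phi> x * f x) = 0"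
    and A: "A \<in> sets borel"
  shows "(LINT x|lebesgue_on U. indicator A x * f x) = 0"
proof -
  let ?M = "lebesgue_on U"
  have op: "(LINT x|?M. indicator W x * f x) = 0" if "open W" for W
  proof -
    have "(LINT x|?M. indicator W x * f x) = (LINT x|?M. indicator (W \<inter> U) x * f x)"
      by (intro Bochner_Integration.integral_cong) (auto simp: indicator_def)
    with integral_open_set_zero[OF U f z, of "W \<inter> U"] that U show ?thesis by auto
  qed
  have fm[measurable]: "f \<in> borel_measurable ?M" by (rule borel_measurable_integrable[OF f])
  have im: "(indicator A :: 'a \<Rightarrow> real) \<in> borel_measurable ?M" if "A \<in> sets borel" for A
    using that by (intro borel_imp_lebesgue_on borel_measurable_indicator) auto
  have int: "integrable ?M (\<lambda>x. indicator A x * f x)" if "A \<in> sets borel" for A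
    by (rule Bochner_Integration.integrable_bound[OF f borel_measurable_times[OF im[OF that] fm]])
       (simp add: indicator_def)
  have "Int_stable {S :: 'a set. open S}" by (auto simp: Int_stable_def)
  moreover have "{S :: 'a set. open S} \<subseteq> Pow UNIV" by simp
  moreover have "A \<in> sigma_sets UNIV {S. open S}" using A by (simp add: borel_def)
  ultimately show ?thesis
  proof (induct rule: sigma_sets_induct_disjoint)
    case (compl A)
    then have "A \<in> sets borel" by (simp add: borel_def)
    have "(LINT x|?M. indicator (UNIV - A) x * f x)
        = (LINT x|?M. indicator UNIV x * f x - indicator A x * f x)"
      by (intro Bochner_Integration.integral_cong) (auto simp: indicator_def)
    also have "\<dots> = (LINT x|?M. indicator UNIV x * f x) - (LINT x|?M. indicator A x * f x)"
      by (intro Bochner_Integration.integral_diff int \<open>A \<in> sets borel\<close>) auto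
    finally show ?case using compl op[of UNIV] by simp
  next
    case (union A)
    then have Ab: "A i \<in> sets borel" for i by (auto simp: borel_def)
    have "(\<lambda>N. LINT x|?M. indicator (\<Union>i<N. A i) x * f x) \<longlonglongrightarrow> (LINT x|?M. indicator (\<Union>i. A i) x * f x)"
    proof (rule integral_dominated_convergence[where w="\<lambda>x. norm (f x)"])
      have "(\<Union>i. A i) \<in> sets borel" by (rule sets.countable_UN) (use Ab in auto)
      then show "(\<lambda>x. indicator (\<Union>i. A i) x * f x) \<in> borel_measurable ?M"
        by (intro borel_measurable_times[OF im fm])
      have "(\<Union>i<N. A i) \<in> sets borel" for N by (rule sets.finite_UN) (use Ab in auto)
      then show "(\<lambda>x. indicator (\<Union>i<N. A i) x * f x) \<in> borel_measurable ?M" for N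
        by (intro borel_measurable_times[OF im fm])
      show "integrable ?M (\<lambda>x. norm (f x))" using f by simp
      show "AE x in ?M. (\<lambda>N. indicator (\<Union>i<N. A i) x * f x) \<longlonglongrightarrow> indicator (\<Union>i. A i) x * f x"
        by (intro AE_I2 tendsto_mult tendsto_const LIMSEQ_indicator_UN)
      show "AE x in ?M. norm (indicator (\<Union>i<N. A i) x * f x) \<le> norm (f x)" for N
        by (auto simp: indicator_def)
    qed
    moreover have "(LINT x|?M. indicator (\<Union>i<N. A i) x * f x) = 0" for N
    proof (induction N)
      case (Suc N)
      have "(LINT x|?M. indicator (\<Union>i<Suc N. A i) x * f x)
          = (LINT x|?M. indicator (\<Union>i<N. A i) x * f x + indicator (A N) x * f x)"
      proof (intro Bochner_Integration.integral_cong refl)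
        fix x
        have "x \<notin> A i" if "x \<in> A N" "i < N" for i
          using disjoint_family_onD[OF union(1), of N i] that by auto
        then show "indicator (\<Union>i<Suc N. A i) x * f x = indicator (\<Union>i<N. A i) x * f x + indicator (A N) x * f x"
          by (cases "x \<in> A N") (auto simp: indicator_def lessThan_Suc)
      qed
      also have "\<dots> = (LINT x|?M. indicator (\<Union>i<N. A i) x * f x) + (LINT x|?M. indicator (A N) x * f x)"
        by (intro Bochner_Integration.integral_add int Ab sets.finite_UN) auto
      finally show ?case using Suc union(3) by simp
    qed simp
    ultimately have "(\<lambda>N. 0) \<longlonglongrightarrow> (LINT x|?M. indicator (\<Union>i. A i) x * f x)"
      by simp
    then show ?case by (rule LIMSEQ_unique[OF _ tendsto_const])
  qed (use op in auto)
qed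

text \<open>The integral is tested on the Borel set where a Borel version of \<open>f\<close> has a
  strict sign; the factor \<open>s\<close> handles both signs at once.\<close>

theorem fundamental_lemma_variations:
  fixes f :: "'a::euclidean_space \<Rightarrow> real"
  assumes U: "open U" and f: "integrable (lebesgue_on U) f"
    and z: "\<And>\<phi>. test_fun U \<phi> \<Longrightarrow> (LINT x|lebesgue_on U. \<phi> x * f x) = 0"
  shows "AE x in lebesgue_on U. f x = 0"
proof -
  let ?M = "lebesgue_on U"
  have fm[measurable]: "f \<in> borel_measurable ?M" by (rule borel_measurable_integrable[OF f])
  obtain g where g: "g \<in> borel_measurable borel" "AE x in ?M. f x = g x"
    using lebesgue_on_borel_version[OF fm] U by auto
  have neg: "AE x in ?M. \<not> 0 < s * f x" for s :: real
  proof -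
    define A where "A = {x. 0 < s * g x}"
    have "{x \<in> space borel. 0 < s * g x} \<in> sets borel" using g(1) by measurable
    then have A: "A \<in> sets borel" by (simp add: A_def)
    have im: "(indicator A :: 'a \<Rightarrow> real) \<in> borel_measurable ?M"
      using A by (intro borel_imp_lebesgue_on borel_measurable_indicator) auto
    have int: "integrable ?M (\<lambda>x. indicator A x * f x)"
      by (rule Bochner_Integration.integrable_bound[OF f borel_measurable_times[OF im fm]])
         (simp add: indicator_def)
    have "(LINT x|?M. s * (indicator A x * f x)) = 0"
      using integral_borel_set_zero[OF U f z A] by simp
    moreover have "AE x in ?M. 0 \<le> s * (indicator A x * f x)"
      using g(2) by eventually_elim (auto simp: A_def indicator_def)
    ultimately have "AE x in ?M. s * (indicator A x * f x) = 0"
      using integral_nonneg_eq_0_iff_AE[of ?M "\<lambda>x. s * (indicator A x * f x)"] int by auto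
    with g(2) show ?thesis by eventually_elim (auto simp: A_def indicator_def split: if_splits)
  qed
  from neg[of 1] neg[of "-1"] show ?thesis by eventually_elim auto
qed

lemma test_sqi:
  assumes "bounded U" "open U" "test_fun V f"
  shows "sq_integrable (lebesgue_on U) f"
  by (rule sqi_continuous[OF assms(1,2) smooth_fun_continuous[OF test_fun_smooth[OF assms(3)]]])

text \<open>No smoothing is involved: the residual of the projection onto test functions is
  orthogonal to all of them, hence zero by the fundamental lemma. Mollification will rest on this
  density.\<close>

lemma test_functions_dense:
  fixes f :: "'a::euclidean_space \<Rightarrow> real"
  assumes U: "bounded U" "open U" and f: "sq_integrable (lebesgue_on U) f"
  obtains \<psi> where "\<And>n. test_fun U (\<psi> n)" "(\<lambda>n. sqnorm (lebesgue_on U) (\<lambda>x. \<psi> n x - f x)) \<longlonglongrightarrow> 0"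
proof -
  let ?M = "lebesgue_on U"
  obtain \<psi> g where v: "\<And>n. \<psi> n \<in> {\<phi>. test_fun U \<phi>}" "sq_integrable ?M g"
      "(\<lambda>n. sqnorm ?M (\<lambda>x. \<psi> n x - g x)) \<longlonglongrightarrow> 0"
      "\<And>w. w \<in> {\<phi>. test_fun U \<phi>} \<Longrightarrow> (LINT x|?M. (f x - g x) \<bullet> w x) = 0"
    by (rule L2_projection[of "{\<phi>. test_fun U \<phi>}" ?M f])
      (use test_sqi[OF U] f in \<open>auto intro: test_zero test_add test_cmult\<close>)
  have "AE x in ?M. f x - g x = 0"
  proof (rule fundamental_lemma_variations[OF U(2)])
    show "integrable ?M (\<lambda>x. f x - g x)"
      by (intro sqi_imp_integrable sqi_diff finite_measure_lebesgue_on_bounded U f v)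
    show "(LINT x|?M. \<phi> x * (f x - g x)) = 0" if "test_fun U \<phi>" for \<phi>
      using v(4)[of \<phi>] that by (simp add: mult.commute)
  qed
  moreover have \<psi>: "sq_integrable ?M (\<psi> n)" for n using v(1)[of n] test_sqi[OF U] by blast
  moreover have "integrable ?M (\<lambda>x. (norm (\<psi> n x - g x))\<^sup>2)" "integrable ?M (\<lambda>x. (norm (\<psi> n x - f x))\<^sup>2)" for n
    by (rule sqi_int[OF sqi_diff[OF \<psi> v(2)]] sqi_int[OF sqi_diff[OF \<psi> f]])+
  ultimately have "sqnorm ?M (\<lambda>x. \<psi> n x - g x) = sqnorm ?M (\<lambda>x. \<psi> n x - f x)" for n
    unfolding sqnorm_def
    by (intro integral_cong_AE borel_measurable_integrable) auto
  with v that show thesis by auto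
qed

section \<open>Weak gradients\<close>

lemma frechet_derivative_eqI: "(f has_derivative f') (at x) \<Longrightarrow> frechet_derivative f (at x) = f'"
  by (rule frechet_derivative_at[symmetric])

lemma smooth_frechet_expand:
  assumes "smooth_fun f"
  shows "frechet_derivative f (at x) h = (\<Sum>b\<in>Basis. (h \<bullet> b) * frechet_derivative f (at x) b)"
proof -
  have lin: "linear (frechet_derivative f (at x))"
    by (rule has_derivative_linear[OF smooth_fun_has_derivative[OF assms]])
  have "frechet_derivative f (at x) h = frechet_derivative f (at x) (\<Sum>b\<in>Basis. (h \<bullet> b) *\<^sub>R b)"
    by (simp add: euclidean_representation)
  also have "\<dots> = (\<Sum>b\<in>Basis. (h \<bullet> b) * frechet_derivative f (at x) b)"
    by (simp add: linear_sum[OF lin] linear_scale[OF lin])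
  finally show ?thesis .
qed

lemma frechet_eq_grad2:
  assumes "smooth_fun f"
  shows "frechet_derivative f (at x) v = grad2 f x \<bullet> v"
proof -
  have lin: "linear (frechet_derivative f (at x))"
    by (rule has_derivative_linear[OF smooth_fun_has_derivative[OF assms]])
  obtain a b where v: "v = (a, b)" by (cases v)
  have "v = a *\<^sub>R (1, 0) + b *\<^sub>R (0, 1)" by (simp add: v)
  then have "frechet_derivative f (at x) v
      = a * frechet_derivative f (at x) (1, 0) + b * frechet_derivative f (at x) (0, 1)"
    by (simp only: linear_add[OF lin] linear_scale[OF lin] real_scaleR_def)
  then show ?thesis by (simp add: grad2_def v mult.commute)
qed

lemma grad2_eqI: "(f has_derivative (\<lambda>v. w \<bullet> v)) (at p) \<Longrightarrow> grad2 f p = w"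
  by (cases w) (simp add: grad2_def frechet_derivative_eqI)

lemma smooth_has_derivative_grad2:
  assumes "smooth_fun f" shows "(f has_derivative (\<lambda>v. grad2 f p \<bullet> v)) (at p)"
  using smooth_fun_has_derivative[OF assms, of p]
  by (simp add: frechet_eq_grad2[OF assms, abs_def])

lemma grad2_add:
  assumes "smooth_fun f" "smooth_fun g"
  shows "grad2 (\<lambda>x. f x + g x) p = grad2 f p + grad2 g p"
proof (rule grad2_eqI)
  show "((\<lambda>x. f x + g x) has_derivative (\<lambda>v. (grad2 f p + grad2 g p) \<bullet> v)) (at p)"
    unfolding inner_add_left
    by (intro has_derivative_add smooth_has_derivative_grad2 assms)
qed

lemma grad2_mult:
  assumes "smooth_fun f" "smooth_fun g"
  shows "grad2 (\<lambda>x. f x * g x) p = f p *\<^sub>R grad2 g p + g p *\<^sub>R grad2 f p"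
proof (rule grad2_eqI)
  have "((\<lambda>x. f x * g x) has_derivative (\<lambda>v. f p * (grad2 g p \<bullet> v) + (grad2 f p \<bullet> v) * g p)) (at p)"
    by (intro has_derivative_mult smooth_has_derivative_grad2 assms)
  then show "((\<lambda>x. f x * g x) has_derivative (\<lambda>v. (f p *\<^sub>R grad2 g p + g p *\<^sub>R grad2 f p) \<bullet> v)) (at p)"
    by (simp add: inner_add_left mult.commute)
qed

lemma grad2_const: "grad2 (\<lambda>x. c) p = 0"
  by (rule grad2_eqI) simp

lemma grad2_cmult:
  assumes "smooth_fun f" shows "grad2 (\<lambda>x. c * f x) p = c *\<^sub>R grad2 f p"
  using grad2_mult[OF smooth_const assms, of c p] by (simp add: grad2_const)

lemma grad2_diff:
  assumes "smooth_fun f" "smooth_fun g"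
  shows "grad2 (\<lambda>x. f x - g x) p = grad2 f p - grad2 g p"
  using grad2_add[OF assms(1) smooth_cmult[OF assms(2), of "-1"], of p] grad2_cmult[OF assms(2), of "-1" p]
  by simp

lemma grad2_sum:
  assumes "\<And>i. i \<in> I \<Longrightarrow> smooth_fun (f i)"
  shows "grad2 (\<lambda>x. \<Sum>i\<in>I. f i x) p = (\<Sum>i\<in>I. grad2 (f i) p)"
proof (rule grad2_eqI)
  show "((\<lambda>x. \<Sum>i\<in>I. f i x) has_derivative (\<lambda>v. (\<Sum>i\<in>I. grad2 (f i) p) \<bullet> v)) (at p)"
    unfolding inner_sum_left
    by (intro has_derivative_sum smooth_has_derivative_grad2 assms)
qed

lemma grad2_local_zero:
  assumes "open V" "p \<in> V" "\<And>x. x \<in> V \<Longrightarrow> f x = 0" shows "grad2 f p = 0"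
proof (rule grad2_eqI)
  show "(f has_derivative (\<lambda>v. 0 \<bullet> v)) (at p)"
    by (rule has_derivative_transform_within_open[of "\<lambda>_. 0" _ _ _ V]) (use assms in auto)
qed

lemma continuous_grad2: "smooth_fun f \<Longrightarrow> continuous_on A (grad2 f)"
  unfolding grad2_def
  by (intro continuous_on_Pair smooth_fun_continuous smooth_fun_frechet)

lemma test_fun_lipschitz:
  assumes "test_fun U f"
  obtains L where "L \<ge> 0" "\<And>x y. \<bar>f x - f y\<bar> \<le> L * norm (x - y)"
proof -
  have s: "smooth_fun f" by (rule test_fun_smooth[OF assms])
  have "\<exists>B. (\<forall>x. \<bar>frechet_derivative f (at x) b\<bar> \<le> B) \<and> B \<ge> 0" for b
    using test_fun_bounded[OF test_frechet[OF assms, of b]] by metis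
  then obtain B where B: "\<And>b x. \<bar>frechet_derivative f (at x) b\<bar> \<le> B b" "\<And>b. B b \<ge> 0" by metis
  define L where "L = (\<Sum>b\<in>Basis. B b)"
  have "\<bar>frechet_derivative f (at x) h\<bar> \<le> L * norm h" for x h
  proof -
    have "\<bar>frechet_derivative f (at x) h\<bar> \<le> (\<Sum>b\<in>Basis. \<bar>(h \<bullet> b) * frechet_derivative f (at x) b\<bar>)"
      unfolding smooth_frechet_expand[OF s, of x h] by (rule sum_abs)
    also have "\<dots> \<le> (\<Sum>b\<in>Basis. norm h * B b)"
      unfolding abs_mult by (intro sum_mono mult_mono B Basis_le_norm) auto
    also have "\<dots> = L * norm h" by (simp add: L_def sum_distrib_left mult.commute)
    finally show ?thesis .
  qed
  then have "onorm (frechet_derivative f (at x)) \<le> L" for x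
    by (intro onorm_le) simp
  then have "norm (f x - f y) \<le> L * norm (x - y)" for x y
    by (intro differentiable_bound[of UNIV f "\<lambda>x. frechet_derivative f (at x)"])
       (auto intro: smooth_fun_has_derivative[OF s])
  moreover have "L \<ge> 0" unfolding L_def by (intro sum_nonneg B)
  ultimately show thesis using that by simp
qed

section \<open>Integration by parts for test functions\<close>

lemma integral_lebesgue_on_eq_lborel:
  fixes f :: "'a::euclidean_space \<Rightarrow> 'b::euclidean_space"
  assumes "open U" "f \<in> borel_measurable borel" "\<And>x. x \<notin> U \<Longrightarrow> f x = 0"
  shows "(LINT x|lebesgue_on U. f x) = (LINT x|lborel. f x)"
proof -
  have "(LINT x|lebesgue_on U. f x) = (LINT x|lebesgue_on UNIV. f x)"
    by (rule integral_lebesgue_on_superset) (use assms in auto)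
  also have "\<dots> = (LINT x|lborel. f x)"
    using assms(2) by (simp add: lebesgue_on_UNIV_eq integral_completion)
  finally show ?thesis .
qed

lemma test_fun_outside: "test_fun U f \<Longrightarrow> x \<notin> U \<Longrightarrow> f x = 0"
  using test_funE by blast

lemma test_fun_borel: "test_fun U f \<Longrightarrow> f \<in> borel_measurable borel"
  by (intro borel_measurable_continuous_onI smooth_fun_continuous test_fun_smooth)

text \<open>Instead of a divergence theorem, translation invariance: every difference quotient has
  integral zero, and the quotients converge boundedly to the derivative.\<close>

lemma test_integral_derivative:
  fixes f :: "'a::euclidean_space \<Rightarrow> real"
  assumes U: "open U" and f: "test_fun U f"
  shows "(LINT x|lebesgue_on U. frechet_derivative f (at x) v) = 0"
proof -
  obtain K where K: "compact K" "\<And>x. x \<notin> K \<Longrightarrow> f x = 0" using test_funE[OF f] by metis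
  obtain R where R: "\<And>x. x \<in> K \<Longrightarrow> norm x \<le> R" using compact_imp_bounded[OF K(1)] by (auto simp: bounded_iff)
  obtain L where L: "L \<ge> 0" "\<And>x y. \<bar>f x - f y\<bar> \<le> L * norm (x - y)" using test_fun_lipschitz[OF f] by metis
  have fb[measurable]: "f \<in> borel_measurable borel" by (rule test_fun_borel[OF f])
  have df: "(\<lambda>x. frechet_derivative f (at x) v) \<in> borel_measurable borel"
    by (rule test_fun_borel[OF test_frechet[OF f]])
  define t where "t n = inverse (real (Suc n))" for n
  have t: "t n > 0" "t n \<le> 1" for n by (auto simp: t_def inverse_le_1_iff)
  obtain B where B: "\<And>x. \<bar>f x\<bar> \<le> B" "B \<ge> 0" using test_fun_bounded[OF f] by metis
  have cb: "integrable lborel (indicator (cball (0::'a) r) :: 'a \<Rightarrow> real)" for r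
    by (rule integrable_real_indicator) (use emeasure_lborel_cball_finite[of "0::'a" r] in auto)
  have shift_int: "integrable lborel (\<lambda>x. f (x + c))" "(LINT x|lborel. f (x + c)) = (LINT x|lborel. f x)" for c
  proof -
    have i: "integrable lborel f"
    proof (rule Bochner_Integration.integrable_bound)
      show "integrable lborel (\<lambda>x. B * indicator (cball (0::'a) R) x :: real)"
        by (rule integrable_mult_right) (rule cb)
      show "AE x in lborel. norm (f x) \<le> norm (B * indicator (cball 0 R) x :: real)"
      proof (rule AE_I2)
        fix x show "norm (f x) \<le> norm (B * indicator (cball 0 R) x :: real)"
          using B K(2)[of x] R[of x] by (cases "x \<in> K") (auto simp: indicator_def)
      qed
    qed simp
    have d: "distr lborel borel ((+) c) = (lborel :: 'a measure)" by (rule lborel_distr_plus)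
    have m: "(+) c \<in> measurable lborel borel" by simp
    have "integrable (distr lborel borel ((+) c)) f" unfolding d by (rule i)
    then have "integrable lborel (\<lambda>x. f (c + x))" by (rule integrable_distr[OF m])
    moreover have "(LINT x|lborel. f (c + x)) = (LINT x|distr lborel borel ((+) c). f x)"
      by (rule integral_distr[OF m, symmetric]) simp
    ultimately show "integrable lborel (\<lambda>x. f (x + c))" "(LINT x|lborel. f (x + c)) = (LINT x|lborel. f x)"
      by (simp_all add: d add.commute)
  qed
  have lim: "(\<lambda>n. LINT x|lborel. (f (x + t n *\<^sub>R v) - f x) / t n) \<longlonglongrightarrow> (LINT x|lborel. frechet_derivative f (at x) v)"
  \<comment> \<open>Steps \<open>t n\<close> are at most one, so all quotients live in the ball
    enlarged by \<open>norm v\<close>, where the Lipschitz constant bounds them.\<close>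
  proof (rule integral_dominated_convergence[where w="\<lambda>x. L * norm v * indicator (cball 0 (R + norm v)) x"])
    show "(\<lambda>x. frechet_derivative f (at x) v) \<in> borel_measurable lborel" using df by simp
    show "(\<lambda>x. (f (x + t n *\<^sub>R v) - f x) / t n) \<in> borel_measurable lborel" for n by measurable
    show "integrable lborel (\<lambda>x. L * norm v * indicator (cball (0::'a) (R + norm v)) x)"
      by (rule integrable_mult_right) (rule cb)
    show "AE x in lborel. (\<lambda>n. (f (x + t n *\<^sub>R v) - f x) / t n) \<longlonglongrightarrow> frechet_derivative f (at x) v"
    proof (rule AE_I2)
      fix x
      have "((\<lambda>s. f (x + s *\<^sub>R v)) has_derivative (\<lambda>s. frechet_derivative f (at x) (s *\<^sub>R v))) (at 0)"
      proof (rule has_derivative_compose[where g=f])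
        show "((\<lambda>s. x + s *\<^sub>R v) has_derivative (\<lambda>s. s *\<^sub>R v)) (at 0)"
          by (auto intro!: derivative_eq_intros)
        show "(f has_derivative frechet_derivative f (at x)) (at (x + 0 *\<^sub>R v))"
          using smooth_fun_has_derivative[OF test_fun_smooth[OF f], of x] by simp
      qed
      moreover have "frechet_derivative f (at x) (s *\<^sub>R v) = frechet_derivative f (at x) v * s" for s
        using linear_scale[OF has_derivative_linear[OF smooth_fun_has_derivative[OF test_fun_smooth[OF f]]]]
        by simp
      ultimately have "((\<lambda>s. f (x + s *\<^sub>R v)) has_real_derivative frechet_derivative f (at x) v) (at 0)"
        by (simp add: has_field_derivative_def)
      then have "((\<lambda>s. (f (x + (0 + s) *\<^sub>R v) - f (x + 0 *\<^sub>R v)) / s) \<longlongrightarrow> frechet_derivative f (at x) v) (at 0)"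
        unfolding DERIV_def .
      moreover have "filterlim t (at 0) sequentially"
      proof (rule filterlim_atI)
        show "t \<longlonglongrightarrow> 0" unfolding t_def by (rule LIMSEQ_inverse_real_of_nat)
        show "\<forall>\<^sub>F n in sequentially. t n \<noteq> 0" using t(1) by (simp add: less_imp_neq[symmetric])
      qed
      ultimately have "(\<lambda>n. (f (x + (0 + t n) *\<^sub>R v) - f (x + 0 *\<^sub>R v)) / t n) \<longlonglongrightarrow> frechet_derivative f (at x) v"
        by (rule filterlim_compose)
      then show "(\<lambda>n. (f (x + t n *\<^sub>R v) - f x) / t n) \<longlonglongrightarrow> frechet_derivative f (at x) v" by simp
    qed
    show "AE x in lborel. norm ((f (x + t n *\<^sub>R v) - f x) / t n) \<le> L * norm v * indicator (cball 0 (R + norm v)) x" for n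
    proof (rule AE_I2)
      fix x
      show "norm ((f (x + t n *\<^sub>R v) - f x) / t n) \<le> L * norm v * indicator (cball 0 (R + norm v)) x"
      proof (cases "x \<in> cball 0 (R + norm v)")
        case True
        have "\<bar>f (x + t n *\<^sub>R v) - f x\<bar> \<le> L * (t n * norm v)"
          using L(2)[of "x + t n *\<^sub>R v" x] t(1)[of n] by simp
        then have "\<bar>f (x + t n *\<^sub>R v) - f x\<bar> / t n \<le> L * norm v"
          using t(1)[of n] by (simp add: divide_le_eq mult_ac)
        then show ?thesis using True t(1)[of n] by simp
      next
        case False
        have n1: "norm x > R + norm v" using False by simp
        have "norm (t n *\<^sub>R v) \<le> norm v" using t[of n] by (simp add: mult_left_le_one_le)
        then have "norm (x + t n *\<^sub>R v) > R" using n1 norm_diff_ineq[of x "t n *\<^sub>R v"] by linarith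
        then have "x + t n *\<^sub>R v \<notin> K" using R[of "x + t n *\<^sub>R v"] by linarith
        moreover have "x \<notin> K" using R[of x] n1 norm_ge_zero[of v] by linarith
        ultimately show ?thesis using False by (simp add: K(2))
      qed
    qed
  qed
  have "(LINT x|lborel. (f (x + t n *\<^sub>R v) - f x) / t n) = 0" for n
    using shift_int[of "t n *\<^sub>R v"] shift_int[of 0] by simp
  from lim[unfolded this] have "(LINT x|lborel. frechet_derivative f (at x) v) = 0" by (rule LIMSEQ_unique[OF _ tendsto_const])
  moreover have "(LINT x|lebesgue_on U. frechet_derivative f (at x) v) = (LINT x|lborel. frechet_derivative f (at x) v)"
    by (rule integral_lebesgue_on_eq_lborel[OF U df test_fun_outside[OF test_frechet[OF f]]])
  ultimately show ?thesis by simp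
qed

section \<open>Square integrability under bounded factors and restriction\<close>

lemma sqi_dominated:
  fixes u :: "'a \<Rightarrow> 'b::euclidean_space" and v :: "'a \<Rightarrow> 'c::euclidean_space"
  assumes "sq_integrable M u" "v \<in> borel_measurable M" "AE x in M. norm (v x) \<le> B * norm (u x)"
  shows "sq_integrable M v"
  unfolding sq_integrable_def
proof
  show "integrable M (\<lambda>x. (norm (v x))\<^sup>2)"
  proof (rule Bochner_Integration.integrable_bound)
    show "integrable M (\<lambda>x. B\<^sup>2 * (norm (u x))\<^sup>2)" by (intro integrable_mult_right sqi_int assms)
    show "(\<lambda>x. (norm (v x))\<^sup>2) \<in> borel_measurable M" using assms(2) by measurable
    show "AE x in M. norm ((norm (v x))\<^sup>2) \<le> norm (B\<^sup>2 * (norm (u x))\<^sup>2)"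
      using assms(3)
    proof eventually_elim
      case (elim x)
      then have "(norm (v x))\<^sup>2 \<le> (B * norm (u x))\<^sup>2" by (intro power_mono) auto
      then show ?case by (simp add: power_mult_distrib)
    qed
  qed
qed (rule assms(2))

lemma sqi_inner_const:
  assumes "sq_integrable M u" shows "sq_integrable M (\<lambda>x. u x \<bullet> e)"
proof (rule sqi_dominated[OF assms, where B="norm e"])
  show "(\<lambda>x. u x \<bullet> e) \<in> borel_measurable M" by (intro borel_measurable_inner sqi_meas[OF assms] borel_measurable_const)
  show "AE x in M. norm (u x \<bullet> e) \<le> norm e * norm (u x)"
    using Cauchy_Schwarz_ineq2[of "u _" e] by (simp add: mult.commute)
qed

lemma continuous_bounded_on_closure:
  fixes c :: "'a::euclidean_space \<Rightarrow> 'b::euclidean_space"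
  assumes "bounded S" "continuous_on UNIV c"
  obtains B where "\<And>x. x \<in> S \<Longrightarrow> norm (c x) \<le> B" "B \<ge> 0"
proof -
  have "compact (c ` closure S)"
    using assms(1) by (intro compact_continuous_image) (simp_all add: continuous_on_subset[OF assms(2)])
  then have "bounded (c ` closure S)" by (rule compact_imp_bounded)
  then obtain B where B: "B > 0" "\<forall>y\<in>c ` closure S. norm y \<le> B" unfolding bounded_pos by blast
  have "norm (c x) \<le> B" if "x \<in> S" for x
    using B(2) closure_subset[of S] that by (simp add: subset_iff)
  then show thesis using that B(1) by (meson less_imp_le)
qed

lemma sqi_scaleR_continuous:
  fixes u :: "'a::euclidean_space \<Rightarrow> real" and c :: "'a \<Rightarrow> 'b::euclidean_space"
  assumes "bounded S" "continuous_on UNIV c" "sq_integrable (lebesgue_on S) u"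
  shows "sq_integrable (lebesgue_on S) (\<lambda>x. u x *\<^sub>R c x)"
proof -
  obtain B where B: "\<And>x. x \<in> S \<Longrightarrow> norm (c x) \<le> B" "B \<ge> 0"
    using continuous_bounded_on_closure[OF assms(1,2)] by metis
  show ?thesis
  proof (rule sqi_dominated[OF assms(3), where B=B])
    show "(\<lambda>x. u x *\<^sub>R c x) \<in> borel_measurable (lebesgue_on S)"
      by (intro borel_measurable_scaleR sqi_meas assms continuous_imp_lebesgue_on)
    show "AE x in lebesgue_on S. norm (u x *\<^sub>R c x) \<le> B * norm (u x)"
      by (rule AE_I2) (use B(1) in \<open>auto simp: mult.commute[of B] intro: mult_left_mono\<close>)
  qed
qed

lemma sqi_continuous_scaleR:
  fixes c :: "'a::euclidean_space \<Rightarrow> real" and u :: "'a \<Rightarrow> 'b::euclidean_space"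
  assumes "bounded S" "continuous_on UNIV c" "sq_integrable (lebesgue_on S) u"
  shows "sq_integrable (lebesgue_on S) (\<lambda>x. c x *\<^sub>R u x)"
proof -
  obtain B where B: "\<And>x. x \<in> S \<Longrightarrow> norm (c x) \<le> B" "B \<ge> 0"
    using continuous_bounded_on_closure[OF assms(1,2)] by metis
  show ?thesis
  proof (rule sqi_dominated[OF assms(3), where B=B])
    show "(\<lambda>x. c x *\<^sub>R u x) \<in> borel_measurable (lebesgue_on S)"
      by (intro borel_measurable_scaleR sqi_meas assms continuous_imp_lebesgue_on)
    show "AE x in lebesgue_on S. norm (c x *\<^sub>R u x) \<le> B * norm (u x)"
      by (rule AE_I2) (use B(1) in \<open>auto intro: mult_right_mono\<close>)
  qed
qed

lemma sqi_restrict: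
  fixes u :: "'a::euclidean_space \<Rightarrow> 'b::euclidean_space"
  assumes "U \<subseteq> D" "open U" "open D" "sq_integrable (lebesgue_on D) u"
  shows "sq_integrable (lebesgue_on U) u"
  unfolding sq_integrable_def
proof
  show "u \<in> borel_measurable (lebesgue_on U)"
    by (rule measurable_restrict_mono[OF sqi_meas[OF assms(4)] assms(1)])
  have "set_integrable lebesgue D (\<lambda>x. (norm (u x))\<^sup>2)"
    using sqi_int[OF assms(4)] assms(3) by (simp add: set_integrable_def integrable_restrict_space)
  then have "set_integrable lebesgue U (\<lambda>x. (norm (u x))\<^sup>2)"
    by (rule set_integrable_subset) (use assms in auto)
  then show "integrable (lebesgue_on U) (\<lambda>x. (norm (u x))\<^sup>2)"
    using assms(2) by (simp add: set_integrable_def integrable_restrict_space)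
qed

text \<open>Testing in each fixed direction \<open>e\<close> turns the vector identity into scalar
  products, the form required by the convergence lemma and by the fundamental lemma.\<close>

lemma is_weak_grad_iff:
  assumes D: "bounded D" "open D" and q: "sq_integrable (lebesgue_on D) q" and g: "sq_integrable (lebesgue_on D) g"
  shows "is_weak_grad D q g \<longleftrightarrow> (\<forall>\<phi> e. test_fun D \<phi> \<longrightarrow>
    (LINT p|lebesgue_on D. q p * (grad2 \<phi> p \<bullet> e)) = - (LINT p|lebesgue_on D. \<phi> p * (g p \<bullet> e)))"
proof -
  have fm: "finite_measure (lebesgue_on D)" by (rule finite_measure_lebesgue_on_bounded[OF D])
  have eq: "(LINT p|lebesgue_on D. q p * (grad2 \<phi> p \<bullet> e)) = (LINT p|lebesgue_on D. q p *\<^sub>R grad2 \<phi> p) \<bullet> e"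
    "(LINT p|lebesgue_on D. \<phi> p * (g p \<bullet> e)) = (LINT p|lebesgue_on D. \<phi> p *\<^sub>R g p) \<bullet> e"
    if "test_fun D \<phi>" for \<phi> e
  proof -
    have s: "smooth_fun \<phi>" by (rule test_fun_smooth[OF that])
    have "integrable (lebesgue_on D) (\<lambda>p. q p *\<^sub>R grad2 \<phi> p)"
      by (rule sqi_imp_integrable[OF fm sqi_scaleR_continuous[OF D(1) continuous_grad2[OF s] q]])
    then show "(LINT p|lebesgue_on D. q p * (grad2 \<phi> p \<bullet> e)) = (LINT p|lebesgue_on D. q p *\<^sub>R grad2 \<phi> p) \<bullet> e"
      by (subst integral_inner_left[symmetric]) simp_all
    have "integrable (lebesgue_on D) (\<lambda>p. \<phi> p *\<^sub>R g p)"
      by (rule sqi_imp_integrable[OF fm sqi_continuous_scaleR[OF D(1) smooth_fun_continuous[OF s] g]])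
    then show "(LINT p|lebesgue_on D. \<phi> p * (g p \<bullet> e)) = (LINT p|lebesgue_on D. \<phi> p *\<^sub>R g p) \<bullet> e"
      by (subst integral_inner_left[symmetric]) simp_all
  qed
  have inn: "a = - b \<longleftrightarrow> (\<forall>e. a \<bullet> e = - (b \<bullet> e))" for a b :: "real \<times> real"
    by (metis inner_minus_left vector_eq_rdot)
  show ?thesis unfolding is_weak_grad_def using eq inn by auto
qed

section \<open>Calculus of weak gradients\<close>

lemma test_grad2_inner:
  assumes "test_fun D \<phi>" shows "test_fun D (\<lambda>p. grad2 \<phi> p \<bullet> e)"
  using test_frechet[OF assms, of e] by (simp add: frechet_eq_grad2[OF test_fun_smooth[OF assms]])

lemma smooth_grad2_inner:
  assumes "smooth_fun \<phi>" shows "smooth_fun (\<lambda>p. grad2 \<phi> p \<bullet> e)"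
  using smooth_fun_frechet[OF assms, of e] by (simp add: frechet_eq_grad2[OF assms])

text \<open>For a fixed test function both sides are inner products with fixed square integrable
  functions, so they are continuous in the potential and in the gradient separately.\<close>

lemma weak_grad_limit:
  assumes D: "bounded D" "open D"
    and q: "\<And>n. sq_integrable (lebesgue_on D) (q n)" "sq_integrable (lebesgue_on D) q'"
    and g: "\<And>n. sq_integrable (lebesgue_on D) (g n)" "sq_integrable (lebesgue_on D) g'"
    and w: "\<And>n. is_weak_grad D (q n) (g n)"
    and ql: "(\<lambda>n. sqnorm (lebesgue_on D) (\<lambda>x. q n x - q' x)) \<longlonglongrightarrow> 0"
    and gl: "(\<lambda>n. sqnorm (lebesgue_on D) (\<lambda>x. g n x - g' x)) \<longlonglongrightarrow> 0"
  shows "is_weak_grad D q' g'"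
  unfolding is_weak_grad_iff[OF D q(2) g(2)]
proof (intro allI impI)
  fix \<phi> and e :: "real \<times> real" assume t: "test_fun D \<phi>"
  let ?M = "lebesgue_on D"
  have "(\<lambda>n. LINT p|?M. q n p \<bullet> (grad2 \<phi> p \<bullet> e)) \<longlonglongrightarrow> (LINT p|?M. q' p \<bullet> (grad2 \<phi> p \<bullet> e))"
    by (rule tendsto_inner_L2[OF q test_sqi[OF D test_grad2_inner[OF t]] ql])
  moreover have "(\<lambda>n. - (LINT p|?M. g n p \<bullet> (\<phi> p *\<^sub>R e))) \<longlonglongrightarrow> - (LINT p|?M. g' p \<bullet> (\<phi> p *\<^sub>R e))"
  proof (rule tendsto_minus[OF tendsto_inner_L2[OF g _ gl]])
    show "sq_integrable ?M (\<lambda>p. \<phi> p *\<^sub>R e)"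
      by (rule sqi_continuous_scaleR[OF D(1) smooth_fun_continuous[OF test_fun_smooth[OF t]] sqi_continuous[OF D]]) simp
  qed
  moreover have "(LINT p|?M. q n p \<bullet> (grad2 \<phi> p \<bullet> e)) = - (LINT p|?M. g n p \<bullet> (\<phi> p *\<^sub>R e))" for n
    using w[of n, unfolded is_weak_grad_iff[OF D q(1) g(1)], rule_format, OF t, of e] by simp
  ultimately have "(LINT p|?M. q' p \<bullet> (grad2 \<phi> p \<bullet> e)) = - (LINT p|?M. g' p \<bullet> (\<phi> p *\<^sub>R e))"
    using LIMSEQ_unique by simp
  then show "(LINT p|?M. q' p * (grad2 \<phi> p \<bullet> e)) = - (LINT p|?M. \<phi> p * (g' p \<bullet> e))" by simp
qed

lemma weak_grad_unique:
  assumes D: "bounded D" "open D"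
    and q: "sq_integrable (lebesgue_on D) q"
    and g: "sq_integrable (lebesgue_on D) g" "sq_integrable (lebesgue_on D) g'"
    and w: "is_weak_grad D q g" "is_weak_grad D q g'"
  shows "AE x in lebesgue_on D. g x = g' x"
proof -
  let ?M = "lebesgue_on D"
  have fm: "finite_measure ?M" by (rule finite_measure_lebesgue_on_bounded[OF D])
  have "AE x in ?M. (g x - g' x) \<bullet> e = 0" for e
  proof (rule fundamental_lemma_variations[OF D(2)])
    show "integrable ?M (\<lambda>x. (g x - g' x) \<bullet> e)"
      by (intro sqi_imp_integrable fm sqi_inner_const sqi_diff g)
    fix \<phi> assume t: "test_fun D \<phi>"
    have i: "integrable ?M (\<lambda>x. \<phi> x * (h x \<bullet> e))" if "sq_integrable ?M h" for h
      using sqi_inner[OF test_sqi[OF D t] sqi_inner_const[OF that, of e]] by simp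
    have "(LINT x|?M. \<phi> x * ((g x - g' x) \<bullet> e)) = (LINT x|?M. \<phi> x * (g x \<bullet> e) - \<phi> x * (g' x \<bullet> e))"
      by (simp add: inner_diff_left right_diff_distrib)
    also have "\<dots> = (LINT x|?M. \<phi> x * (g x \<bullet> e)) - (LINT x|?M. \<phi> x * (g' x \<bullet> e))"
      by (rule Bochner_Integration.integral_diff[OF i[OF g(1)] i[OF g(2)]])
    also have "\<dots> = 0"
      using w(1)[unfolded is_weak_grad_iff[OF D q g(1)], rule_format, OF t, of e]
        w(2)[unfolded is_weak_grad_iff[OF D q g(2)], rule_format, OF t, of e] by linarith
    finally show "(LINT x|?M. \<phi> x * ((g x - g' x) \<bullet> e)) = 0" .
  qed
  from this[of "(1,0)"] this[of "(0,1)"] show ?thesis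
    by eventually_elim (auto simp: prod_eq_iff inner_prod_def)
qed

lemma weak_grad_add:
  assumes D: "bounded D" "open D"
    and q: "sq_integrable (lebesgue_on D) q" "sq_integrable (lebesgue_on D) q'"
    and g: "sq_integrable (lebesgue_on D) g" "sq_integrable (lebesgue_on D) g'"
    and w: "is_weak_grad D q g" "is_weak_grad D q' g'"
  shows "is_weak_grad D (\<lambda>x. q x + q' x) (\<lambda>x. g x + g' x)"
  unfolding is_weak_grad_iff[OF D sqi_add[OF q] sqi_add[OF g]]
proof (intro allI impI)
  fix \<phi> and e :: "real \<times> real" assume t: "test_fun D \<phi>"
  let ?M = "lebesgue_on D"
  have i: "integrable ?M (\<lambda>x. \<phi> x * (h x \<bullet> e))" if "sq_integrable ?M h" for h
    using sqi_inner[OF test_sqi[OF D t] sqi_inner_const[OF that, of e]] by simp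
  have j: "integrable ?M (\<lambda>x. h x * (grad2 \<phi> x \<bullet> e))" if "sq_integrable ?M h" for h
    using sqi_inner[OF that test_sqi[OF D test_grad2_inner[OF t]]] by simp
  show "(LINT p|?M. (q p + q' p) * (grad2 \<phi> p \<bullet> e)) = - (LINT p|?M. \<phi> p * ((g p + g' p) \<bullet> e))"
    using w(1)[unfolded is_weak_grad_iff[OF D q(1) g(1)], rule_format, OF t, of e]
      w(2)[unfolded is_weak_grad_iff[OF D q(2) g(2)], rule_format, OF t, of e]
      i[OF g(1)] i[OF g(2)] j[OF q(1)] j[OF q(2)]
    by (simp add: distrib_right inner_add_left distrib_left)
qed

lemma weak_grad_scale:
  assumes D: "bounded D" "open D"
    and q: "sq_integrable (lebesgue_on D) q" and g: "sq_integrable (lebesgue_on D) g"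
    and w: "is_weak_grad D q g"
  shows "is_weak_grad D (\<lambda>x. c * q x) (\<lambda>x. c *\<^sub>R g x)"
  using w sqi_scaleR[OF q, of c]
  unfolding is_weak_grad_iff[OF D q g] is_weak_grad_iff[OF D sqi_scaleR[OF q, of c, simplified] sqi_scaleR[OF g, of c]]
  by (simp add: mult.assoc mult.left_commute[of _ c])

lemma weak_grad_smooth:
  assumes D: "bounded D" "open D" and f: "smooth_fun f"
  shows "is_weak_grad D f (grad2 f)"
  unfolding is_weak_grad_iff[OF D sqi_continuous[OF D smooth_fun_continuous[OF f]] sqi_continuous[OF D continuous_grad2[OF f]]]
proof (intro allI impI)
  fix \<phi> and e :: "real \<times> real" assume t: "test_fun D \<phi>"
  let ?M = "lebesgue_on D"
  have s: "smooth_fun \<phi>" by (rule test_fun_smooth[OF t])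
  have "grad2 (\<lambda>x. f x * \<phi> x) p \<bullet> e = f p * (grad2 \<phi> p \<bullet> e) + \<phi> p * (grad2 f p \<bullet> e)" for p
    by (simp add: grad2_mult[OF f s] inner_add_left)
  moreover have "(LINT p|?M. grad2 (\<lambda>x. f x * \<phi> x) p \<bullet> e) = 0"
    using test_integral_derivative[OF D(2) test_mult[OF f t], of e]
    by (simp add: frechet_eq_grad2[OF smooth_mult[OF f s]])
  moreover have "integrable ?M (\<lambda>p. f p * (grad2 \<phi> p \<bullet> e))"
    using sqi_inner[OF sqi_continuous[OF D smooth_fun_continuous[OF f]] test_sqi[OF D test_grad2_inner[OF t]]] by simp
  moreover have "integrable ?M (\<lambda>p. \<phi> p * (grad2 f p \<bullet> e))"
    using sqi_inner[OF test_sqi[OF D t] sqi_continuous[OF D smooth_fun_continuous[OF smooth_grad2_inner[OF f]]]] by simp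
  ultimately show "(LINT p|?M. f p * (grad2 \<phi> p \<bullet> e)) = - (LINT p|?M. \<phi> p * (grad2 f p \<bullet> e))"
    by (simp add: eq_neg_iff_add_eq_0)
qed

text \<open>Leibniz rule: apply the identity for \<open>q\<close> to the product of \<open>f\<close>
  with the test function, which is again a test function, and move the extra term to the other
  side.\<close>

lemma weak_grad_mult:
  assumes D: "bounded D" "open D" and f: "smooth_fun f"
    and q: "sq_integrable (lebesgue_on D) q" and g: "sq_integrable (lebesgue_on D) g"
    and w: "is_weak_grad D q g"
  shows "sq_integrable (lebesgue_on D) (\<lambda>x. f x * q x)"
    and "sq_integrable (lebesgue_on D) (\<lambda>x. f x *\<^sub>R g x + q x *\<^sub>R grad2 f x)"
    and "is_weak_grad D (\<lambda>x. f x * q x) (\<lambda>x. f x *\<^sub>R g x + q x *\<^sub>R grad2 f x)"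
proof -
  let ?M = "lebesgue_on D"
  show 1: "sq_integrable ?M (\<lambda>x. f x * q x)"
    using sqi_continuous_scaleR[OF D(1) smooth_fun_continuous[OF f] q] by simp
  show 2: "sq_integrable ?M (\<lambda>x. f x *\<^sub>R g x + q x *\<^sub>R grad2 f x)"
    by (intro sqi_add sqi_continuous_scaleR[OF D(1) smooth_fun_continuous[OF f] g]
        sqi_scaleR_continuous[OF D(1) continuous_grad2[OF f] q])
  show "is_weak_grad D (\<lambda>x. f x * q x) (\<lambda>x. f x *\<^sub>R g x + q x *\<^sub>R grad2 f x)"
    unfolding is_weak_grad_iff[OF D 1 2]
  proof (intro allI impI)
    fix \<phi> and e :: "real \<times> real" assume t: "test_fun D \<phi>"
    have s: "smooth_fun \<phi>" by (rule test_fun_smooth[OF t])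
    have tf: "test_fun D (\<lambda>x. f x * \<phi> x)" by (rule test_mult[OF f t])
    have i1: "integrable ?M (\<lambda>p. q p * (grad2 (\<lambda>x. f x * \<phi> x) p \<bullet> e))"
      using sqi_inner[OF q test_sqi[OF D test_grad2_inner[OF tf]]] by simp
    have i2: "integrable ?M (\<lambda>p. q p * (\<phi> p * (grad2 f p \<bullet> e)))"
      using sqi_inner[OF q sqi_continuous[OF D smooth_fun_continuous[OF smooth_mult[OF s smooth_grad2_inner[OF f]]]]] by simp
    have i3: "integrable ?M (\<lambda>p. (f p * \<phi> p) * (g p \<bullet> e))"
      using sqi_inner[OF test_sqi[OF D tf] sqi_inner_const[OF g, of e]] by simp
    have "(LINT p|?M. f p * q p * (grad2 \<phi> p \<bullet> e))
        = (LINT p|?M. q p * (grad2 (\<lambda>x. f x * \<phi> x) p \<bullet> e) - q p * (\<phi> p * (grad2 f p \<bullet> e)))"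
      by (subst grad2_mult[OF f s]) (simp add: inner_add_left algebra_simps)
    also have "\<dots> = (LINT p|?M. q p * (grad2 (\<lambda>x. f x * \<phi> x) p \<bullet> e)) - (LINT p|?M. q p * (\<phi> p * (grad2 f p \<bullet> e)))"
      by (rule Bochner_Integration.integral_diff[OF i1 i2])
    also have "(LINT p|?M. q p * (grad2 (\<lambda>x. f x * \<phi> x) p \<bullet> e)) = - (LINT p|?M. (f p * \<phi> p) * (g p \<bullet> e))"
      by (rule w[unfolded is_weak_grad_iff[OF D q g], rule_format, OF tf])
    also have "- (LINT p|?M. (f p * \<phi> p) * (g p \<bullet> e)) - (LINT p|?M. q p * (\<phi> p * (grad2 f p \<bullet> e)))
        = - ((LINT p|?M. (f p * \<phi> p) * (g p \<bullet> e)) + (LINT p|?M. q p * (\<phi> p * (grad2 f p \<bullet> e))))" by simp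
    also have "(LINT p|?M. (f p * \<phi> p) * (g p \<bullet> e)) + (LINT p|?M. q p * (\<phi> p * (grad2 f p \<bullet> e)))
        = (LINT p|?M. (f p * \<phi> p) * (g p \<bullet> e) + q p * (\<phi> p * (grad2 f p \<bullet> e)))"
      by (rule Bochner_Integration.integral_add[OF i3 i2, symmetric])
    also have "(LINT p|?M. (f p * \<phi> p) * (g p \<bullet> e) + q p * (\<phi> p * (grad2 f p \<bullet> e)))
        = (LINT p|?M. \<phi> p * ((f p *\<^sub>R g p + q p *\<^sub>R grad2 f p) \<bullet> e))"
      by (simp add: inner_add_left algebra_simps)
    finally show "(LINT p|?M. f p * q p * (grad2 \<phi> p \<bullet> e))
        = - (LINT p|?M. \<phi> p * ((f p *\<^sub>R g p + q p *\<^sub>R grad2 f p) \<bullet> e))" .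
  qed
qed

lemma weak_grad_restrict:
  assumes D: "open D" and U: "open U" "U \<subseteq> D" and w: "is_weak_grad D q g"
  shows "is_weak_grad U q g"
  unfolding is_weak_grad_def
proof (intro allI impI)
  fix \<phi> assume t: "test_fun U \<phi>"
  have z: "\<phi> x = 0" "grad2 \<phi> x = 0" if "x \<notin> U" for x
    using test_fun_outside[OF t that] test_fun_outside[OF test_frechet[OF t] that]
    by (simp_all add: grad2_def zero_prod_def)
  have "(LINT p|lebesgue_on U. q p *\<^sub>R grad2 \<phi> p) = (LINT p|lebesgue_on D. q p *\<^sub>R grad2 \<phi> p)"
    by (rule integral_lebesgue_on_superset[OF U(1) D U(2)]) (simp add: z)
  moreover have "(LINT p|lebesgue_on U. \<phi> p *\<^sub>R g p) = (LINT p|lebesgue_on D. \<phi> p *\<^sub>R g p)"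
    by (rule integral_lebesgue_on_superset[OF U(1) D U(2)]) (simp add: z)
  ultimately show "(LINT p|lebesgue_on U. q p *\<^sub>R grad2 \<phi> p) = - (LINT p|lebesgue_on U. \<phi> p *\<^sub>R g p)"
    using w test_fun_mono[OF t U(2)] by (simp add: is_weak_grad_def)
qed

lemma H1_wgrad:
  assumes "H1 D q"
  shows "sq_integrable (lebesgue_on D) q" "sq_integrable (lebesgue_on D) (wgrad D q)" "is_weak_grad D q (wgrad D q)"
proof -
  have "L2 D (wgrad D q) \<and> is_weak_grad D q (wgrad D q)"
    using someI_ex[of "\<lambda>g. L2 D g \<and> is_weak_grad D q g"] assms by (simp add: H1_def wgrad_def)
  with assms show "sq_integrable (lebesgue_on D) q" "sq_integrable (lebesgue_on D) (wgrad D q)" "is_weak_grad D q (wgrad D q)"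
    by (simp_all add: L2_iff H1_def)
qed

lemma H1I: "sq_integrable (lebesgue_on D) q \<Longrightarrow> sq_integrable (lebesgue_on D) g \<Longrightarrow> is_weak_grad D q g \<Longrightarrow> H1 D q"
  unfolding H1_def L2_iff by blast

text \<open>\<open>wgrad\<close> picks one representative by choice, so its algebra holds only
  almost everywhere. Each use of a concrete gradient goes through this lemma.\<close>

lemma wgrad_unique:
  assumes "bounded D" "open D" "sq_integrable (lebesgue_on D) q" "sq_integrable (lebesgue_on D) g" "is_weak_grad D q g"
  shows "AE x in lebesgue_on D. wgrad D q x = g x"
  using H1_wgrad[OF H1I[OF assms(3-5)]] by (intro weak_grad_unique[OF assms(1-3)] assms(4,5))

lemma H1_add:
  assumes D: "bounded D" "open D" and "H1 D q" "H1 D q'"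
  shows "H1 D (\<lambda>x. q x + q' x)" "AE x in lebesgue_on D. wgrad D (\<lambda>x. q x + q' x) x = wgrad D q x + wgrad D q' x"
proof -
  note a = H1_wgrad[OF assms(3)] and b = H1_wgrad[OF assms(4)]
  note c = sqi_add[OF a(1) b(1)] sqi_add[OF a(2) b(2)] weak_grad_add[OF D a(1) b(1) a(2) b(2) a(3) b(3)]
  show "H1 D (\<lambda>x. q x + q' x)" by (rule H1I[OF c])
  show "AE x in lebesgue_on D. wgrad D (\<lambda>x. q x + q' x) x = wgrad D q x + wgrad D q' x"
    by (rule wgrad_unique[OF D c])
qed

lemma H1_scale:
  assumes D: "bounded D" "open D" and "H1 D q"
  shows "H1 D (\<lambda>x. c * q x)" "AE x in lebesgue_on D. wgrad D (\<lambda>x. c * q x) x = c *\<^sub>R wgrad D q x"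
proof -
  note a = H1_wgrad[OF assms(3)]
  have s: "sq_integrable (lebesgue_on D) (\<lambda>x. c * q x)" using sqi_scaleR[OF a(1), of c] by simp
  note c = s sqi_scaleR[OF a(2)] weak_grad_scale[OF D a]
  show "H1 D (\<lambda>x. c * q x)" by (rule H1I[OF c])
  show "AE x in lebesgue_on D. wgrad D (\<lambda>x. c * q x) x = c *\<^sub>R wgrad D q x"
    by (rule wgrad_unique[OF D c])
qed

section \<open>Poincare inequalities\<close>

lemma nn_integral_lborel_affine:
  fixes g :: "'a::euclidean_space \<Rightarrow> ennreal"
  assumes c: "c \<noteq> 0" and g[measurable]: "g \<in> borel_measurable borel"
  shows "(\<integral>\<^sup>+x. g x \<partial>lborel) = ennreal (\<bar>c\<bar> ^ DIM('a)) * (\<integral>\<^sup>+x. g (c *\<^sub>R x + t) \<partial>lborel)"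
proof -
  have "(\<integral>\<^sup>+x. g x \<partial>lborel) = (\<integral>\<^sup>+x. g x \<partial>density (distr lborel borel (\<lambda>x. t + c *\<^sub>R x)) (\<lambda>_. ennreal (\<bar>c\<bar> ^ DIM('a))))"
    using lborel_affine[OF c, of t] by simp
  also have "\<dots> = (\<integral>\<^sup>+x. ennreal (\<bar>c\<bar> ^ DIM('a)) * g x \<partial>distr lborel borel (\<lambda>x. t + c *\<^sub>R x))"
    by (rule nn_integral_density) auto
  also have "\<dots> = ennreal (\<bar>c\<bar> ^ DIM('a)) * (\<integral>\<^sup>+x. g x \<partial>distr lborel borel (\<lambda>x. t + c *\<^sub>R x))"
    by (rule nn_integral_cmult) simp
  also have "(\<integral>\<^sup>+x. g x \<partial>distr lborel borel (\<lambda>x. t + c *\<^sub>R x)) = (\<integral>\<^sup>+x. g (t + c *\<^sub>R x) \<partial>lborel)"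
    by (rule nn_integral_distr) auto
  finally show ?thesis by (simp add: add.commute)
qed

lemma nn_integral_lebesgue_on:
  fixes f :: "'a::euclidean_space \<Rightarrow> real"
  assumes "open S" "integrable (lebesgue_on S) f" "\<And>x. 0 \<le> f x"
  shows "ennreal (LINT x|lebesgue_on S. f x) = (\<integral>\<^sup>+x. ennreal (f x) * indicator S x \<partial>lborel)"
proof -
  have "ennreal (LINT x|lebesgue_on S. f x) = (\<integral>\<^sup>+x. ennreal (f x) \<partial>lebesgue_on S)"
    using assms by (intro nn_integral_eq_integral[symmetric]) auto
  also have "\<dots> = (\<integral>\<^sup>+x. ennreal (f x) * indicator S x \<partial>lebesgue)"
    using assms by (intro nn_integral_restrict_space) auto
  also have "\<dots> = (\<integral>\<^sup>+x. ennreal (f x) * indicator S x \<partial>lborel)"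
    by (rule nn_integral_completion)
  finally show ?thesis .
qed

lemma integrable_lebesgue_on_continuous:
  fixes f :: "'a::euclidean_space \<Rightarrow> 'b::euclidean_space"
  assumes "bounded S" "open S" "continuous_on UNIV f"
  shows "integrable (lebesgue_on S) f"
  by (rule sqi_imp_integrable[OF finite_measure_lebesgue_on_bounded[OF assms(1,2)] sqi_continuous[OF assms]])

text \<open>Fundamental theorem of calculus along the segment, then Jensen. The result is stated
  with nonnegative integrals so that the order of integration can be exchanged freely
  afterwards.\<close>

lemma increment_sq_le_line_integral:
  fixes \<phi> :: "real \<times> real \<Rightarrow> real"
  assumes s: "smooth_fun \<phi>"
  shows "ennreal ((\<phi> x - \<phi> y)\<^sup>2) \<le> ennreal ((norm (x - y))\<^sup>2) *
    (\<integral>\<^sup>+t. ennreal ((norm (grad2 \<phi> ((1 - t) *\<^sub>R y + t *\<^sub>R x)))\<^sup>2) * indicator {0..1} t \<partial>lborel)"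
proof -
  define f where "f t = grad2 \<phi> ((1 - t) *\<^sub>R y + t *\<^sub>R x) \<bullet> (x - y)" for t
  define m where "m = \<phi> x - \<phi> y"
  have cg: "continuous_on UNIV (\<lambda>t. grad2 \<phi> ((1 - t) *\<^sub>R y + t *\<^sub>R x))"
    by (rule continuous_on_compose2[OF continuous_grad2[OF s, of UNIV]]) (auto intro!: continuous_intros)
  then have cf: "continuous_on UNIV f"
    unfolding f_def by (intro continuous_intros)
  have int: "integrable lborel (\<lambda>t. indicator {0..1} t *\<^sub>R g t)" if "continuous_on UNIV g" for g :: "real \<Rightarrow> real"
    using that by (intro borel_integrable_compact) (auto intro: continuous_on_subset)
  have "has_bochner_integral lborel (\<lambda>t. indicator {0..1} t *\<^sub>R f t)
      (\<phi> ((1 - 1) *\<^sub>R y + 1 *\<^sub>R x) - \<phi> ((1 - 0) *\<^sub>R y + 0 *\<^sub>R x))"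
  proof (rule has_bochner_integral_FTC_Icc[of 0 1 "\<lambda>t. \<phi> ((1 - t) *\<^sub>R y + t *\<^sub>R x)" f])
    fix t :: real
    have "((\<lambda>t. (1 - t) *\<^sub>R y + t *\<^sub>R x) has_vector_derivative (x - y)) (at t within {0..1})"
      by (auto intro!: derivative_eq_intros simp: algebra_simps)
    then have "((\<lambda>t. (1 - t) *\<^sub>R y + t *\<^sub>R x) has_derivative (\<lambda>h. h *\<^sub>R (x - y))) (at t within {0..1})"
      by (simp add: has_vector_derivative_def)
    from has_derivative_compose[OF this smooth_has_derivative_grad2[OF s]]
    show "((\<lambda>t. \<phi> ((1 - t) *\<^sub>R y + t *\<^sub>R x)) has_vector_derivative f t) (at t within {0..1})"
      by (simp add: has_vector_derivative_def f_def)
  next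
    show "continuous_on {0..1} f" by (rule continuous_on_subset[OF cf]) simp
  qed simp
  then have If: "(LINT t|lborel. indicator {0..1} t *\<^sub>R f t) = m"
    by (simp add: has_bochner_integral_integral_eq m_def)
  have I1: "(LINT t|lborel. indicator {0..1::real} t *\<^sub>R (1::real)) = 1" by simp
  \<comment> \<open>Jensen on the unit interval in the form that the variance of \<open>f\<close>
    about its mean \<open>m\<close> is nonnegative.\<close>
  have "0 \<le> (LINT t|lborel. indicator {0..1} t *\<^sub>R (f t - m)\<^sup>2)"
    by (rule integral_nonneg_AE) simp
  also have "\<dots> = (LINT t|lborel. indicator {0..1} t *\<^sub>R (f t)\<^sup>2 - 2 * m * (indicator {0..1} t *\<^sub>R f t) + m\<^sup>2 * (indicator {0..1} t *\<^sub>R 1))"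
    by (simp add: power2_diff algebra_simps)
  also have "\<dots> = (LINT t|lborel. indicator {0..1} t *\<^sub>R (f t)\<^sup>2) - 2 * m * m + m\<^sup>2 * 1"
  proof -
    have a: "integrable lborel (\<lambda>t. indicator {0..1} t *\<^sub>R (f t)\<^sup>2)" by (rule int) (intro continuous_intros cf)
    have b: "integrable lborel (\<lambda>t. 2 * m * (indicator {0..1} t *\<^sub>R f t))" by (rule integrable_mult_right) (rule int[OF cf])
    have c: "integrable lborel (\<lambda>t. m\<^sup>2 * (indicator {0..1::real} t *\<^sub>R (1::real)))" by (rule integrable_mult_right) (rule int, simp)
    show ?thesis
      unfolding Bochner_Integration.integral_add[OF Bochner_Integration.integrable_diff[OF a b] c]
        Bochner_Integration.integral_diff[OF a b] integral_mult_right_zero If I1 ..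
  qed
  finally have m2: "m\<^sup>2 \<le> (LINT t|lborel. indicator {0..1} t *\<^sub>R (f t)\<^sup>2)" by (simp add: power2_eq_square)
  have "ennreal ((\<phi> x - \<phi> y)\<^sup>2) \<le> ennreal (LINT t|lborel. indicator {0..1} t *\<^sub>R (f t)\<^sup>2)"
    using m2 by (intro ennreal_leI) (simp add: m_def)
  also have "\<dots> = (\<integral>\<^sup>+t. ennreal (indicator {0..1} t *\<^sub>R (f t)\<^sup>2) \<partial>lborel)"
    by (rule nn_integral_eq_integral[symmetric], rule int, intro continuous_intros cf) simp
  also have "\<dots> \<le> (\<integral>\<^sup>+t. ennreal ((norm (x - y))\<^sup>2) * (ennreal ((norm (grad2 \<phi> ((1 - t) *\<^sub>R y + t *\<^sub>R x)))\<^sup>2) * indicator {0..1} t) \<partial>lborel)"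
  proof (rule nn_integral_mono)
    fix t
    have "(f t)\<^sup>2 \<le> (norm (grad2 \<phi> ((1 - t) *\<^sub>R y + t *\<^sub>R x)) * norm (x - y))\<^sup>2"
      unfolding f_def using Cauchy_Schwarz_ineq2 by (metis power_mono abs_ge_zero power2_abs)
    then show "ennreal (indicator {0..1} t *\<^sub>R (f t)\<^sup>2) \<le> ennreal ((norm (x - y))\<^sup>2) * (ennreal ((norm (grad2 \<phi> ((1 - t) *\<^sub>R y + t *\<^sub>R x)))\<^sup>2) * indicator {0..1} t)"
      by (auto simp: indicator_def power_mult_distrib mult.commute simp flip: ennreal_mult' intro!: ennreal_leI)
  qed
  also have "\<dots> = ennreal ((norm (x - y))\<^sup>2) *
    (\<integral>\<^sup>+t. ennreal ((norm (grad2 \<phi> ((1 - t) *\<^sub>R y + t *\<^sub>R x)))\<^sup>2) * indicator {0..1} t \<partial>lborel)"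
  proof (rule nn_integral_cmult)
    have [measurable]: "(\<lambda>t. grad2 \<phi> ((1 - t) *\<^sub>R y + t *\<^sub>R x)) \<in> borel_measurable borel"
      by (rule borel_measurable_continuous_onI[OF cg])
    show "(\<lambda>t. ennreal ((norm (grad2 \<phi> ((1 - t) *\<^sub>R y + t *\<^sub>R x)))\<^sup>2) * indicator {0..1} t) \<in> borel_measurable lborel"
      by measurable
  qed
  finally show ?thesis .
qed

text \<open>The segment from \<^term>\<open>y\<close> to \<^term>\<open>x\<close> is parametrised so that for \<^term>\<open>t \<le> 1/2\<close> one integrates
  out \<^term>\<open>y\<close> and for \<^term>\<open>t \<ge> 1/2\<close> one integrates out \<^term>\<open>x\<close>; either way the Jacobian is at least a quarter.\<close>

lemma double_increment_bound:
  fixes U B :: "(real \<times> real) set" and \<phi> :: "real \<times> real \<Rightarrow> real"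
  assumes U: "open U" and B: "open B"
    and star: "\<And>x y t. x \<in> U \<Longrightarrow> y \<in> B \<Longrightarrow> 0 \<le> t \<Longrightarrow> t \<le> 1 \<Longrightarrow> (1 - t) *\<^sub>R y + t *\<^sub>R x \<in> U"
    and d: "\<And>x y. x \<in> U \<Longrightarrow> y \<in> B \<Longrightarrow> norm (x - y) \<le> d"
    and s: "smooth_fun \<phi>"
  shows "(\<integral>\<^sup>+x. (\<integral>\<^sup>+y. ennreal ((\<phi> x - \<phi> y)\<^sup>2) * indicator B y \<partial>lborel) * indicator U x \<partial>lborel)
    \<le> ennreal (d\<^sup>2) * (4 * (emeasure lborel U + emeasure lborel B) *
        (\<integral>\<^sup>+x. ennreal ((norm (grad2 \<phi> x))\<^sup>2) * indicator U x \<partial>lborel))"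
proof -
  have [measurable]: "U \<in> sets borel" "B \<in> sets borel" using U B by auto
  have [measurable]: "grad2 \<phi> \<in> borel_measurable borel" "\<phi> \<in> borel_measurable borel"
    by (intro borel_measurable_continuous_onI continuous_grad2[OF s] smooth_fun_continuous[OF s])+
  define H where "H z = ennreal ((norm (grad2 \<phi> z))\<^sup>2) * indicator U z" for z
  have H[measurable]: "H \<in> borel_measurable borel" unfolding H_def by measurable
  define I where "I = (\<integral>\<^sup>+z. H z \<partial>lborel)"
  \<comment> \<open>In the plane a dilation by c has Jacobian c^2, which is at least 1/4 for c >=
    1/2; the shift \<open>b\<close> costs nothing.\<close>
  have quarter: "(\<integral>\<^sup>+y. H (c *\<^sub>R y + b) \<partial>lborel) \<le> 4 * I" if "c \<ge> 1/2" for c b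
  proof -
    have "ennreal (1/4) * (\<integral>\<^sup>+y. H (c *\<^sub>R y + b) \<partial>lborel) \<le> ennreal (\<bar>c\<bar> ^ DIM(real \<times> real)) * (\<integral>\<^sup>+y. H (c *\<^sub>R y + b) \<partial>lborel)"
    proof (intro mult_right_mono ennreal_leI)
      have "(1/2)\<^sup>2 \<le> c\<^sup>2" using that by (intro power_mono) auto
      then show "1/4 \<le> \<bar>c\<bar> ^ DIM(real \<times> real)" by (simp add: power2_eq_square)
    qed simp
    also have "\<dots> = I"
      unfolding I_def by (rule nn_integral_lborel_affine[symmetric]) (use that in auto)
    finally have "ennreal 4 * (ennreal (1/4) * (\<integral>\<^sup>+y. H (c *\<^sub>R y + b) \<partial>lborel)) \<le> ennreal 4 * I"
      by (rule mult_left_mono) simp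
    moreover have "ennreal 4 * ennreal (1/4) = 1"
      by (subst ennreal_mult'[symmetric]) simp_all
    ultimately show ?thesis by (simp add: mult.assoc[symmetric])
  qed
  \<comment> \<open>All restrictions are carried as indicators, so that the three integrations range
    over whole spaces and can be permuted.\<close>
  define A where "A t x y = H ((1 - t) *\<^sub>R y + t *\<^sub>R x) * indicator {0..1} t * indicator B y * indicator U x" for t x y
  have slice: "(\<integral>\<^sup>+x. \<integral>\<^sup>+y. A t x y \<partial>lborel \<partial>lborel) \<le> 4 * (emeasure lborel U + emeasure lborel B) * I * indicator {0..1} t" for t
  proof (cases "t \<in> {0..1}")
    case False
    then show ?thesis by (simp add: A_def)
  next
    case True
    show ?thesis
    proof (cases "t \<le> 1/2")
      case half: True
      have "(\<integral>\<^sup>+x. \<integral>\<^sup>+y. A t x y \<partial>lborel \<partial>lborel) \<le> (\<integral>\<^sup>+x. 4 * I * indicator U x \<partial>lborel)"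
      proof (rule nn_integral_mono)
        fix x
        have "(\<integral>\<^sup>+y. A t x y \<partial>lborel) \<le> (\<integral>\<^sup>+y. H ((1 - t) *\<^sub>R y + t *\<^sub>R x) * indicator U x \<partial>lborel)"
          by (rule nn_integral_mono) (auto simp: A_def indicator_def)
        also have "\<dots> = (\<integral>\<^sup>+y. H ((1 - t) *\<^sub>R y + t *\<^sub>R x) \<partial>lborel) * indicator U x"
          by (rule nn_integral_multc) measurable
        also have "\<dots> \<le> 4 * I * indicator U x"
          by (intro mult_right_mono quarter) (use half in auto)
        finally show "(\<integral>\<^sup>+y. A t x y \<partial>lborel) \<le> 4 * I * indicator U x" .
      qed
      also have "\<dots> = 4 * I * emeasure lborel U"
        by (rule nn_integral_cmult_indicator) simp
      also have "\<dots> \<le> 4 * I * (emeasure lborel U + emeasure lborel B)"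
        by (intro mult_left_mono) auto
      finally show ?thesis using True by (simp add: mult_ac)
    next
      case False
      have "(\<integral>\<^sup>+x. \<integral>\<^sup>+y. A t x y \<partial>lborel \<partial>lborel) = (\<integral>\<^sup>+y. \<integral>\<^sup>+x. A t x y \<partial>lborel \<partial>lborel)"
        unfolding A_def by (rule lborel_pair.Fubini'[symmetric]) measurable
      also have "\<dots> \<le> (\<integral>\<^sup>+y. 4 * I * indicator B y \<partial>lborel)"
      proof (rule nn_integral_mono)
        fix y
        have "(\<integral>\<^sup>+x. A t x y \<partial>lborel) \<le> (\<integral>\<^sup>+x. H (t *\<^sub>R x + (1 - t) *\<^sub>R y) * indicator B y \<partial>lborel)"
          by (rule nn_integral_mono) (auto simp: A_def indicator_def add.commute)
        also have "\<dots> = (\<integral>\<^sup>+x. H (t *\<^sub>R x + (1 - t) *\<^sub>R y) \<partial>lborel) * indicator B y"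
          by (rule nn_integral_multc) measurable
        also have "\<dots> \<le> 4 * I * indicator B y"
          by (intro mult_right_mono quarter) (use False in auto)
        finally show "(\<integral>\<^sup>+x. A t x y \<partial>lborel) \<le> 4 * I * indicator B y" .
      qed
      also have "\<dots> = 4 * I * emeasure lborel B"
        by (rule nn_integral_cmult_indicator) simp
      also have "\<dots> \<le> 4 * I * (emeasure lborel U + emeasure lborel B)"
        by (intro mult_left_mono) auto
      finally show ?thesis using True by (simp add: mult_ac)
    qed
  qed
  have "(\<integral>\<^sup>+x. (\<integral>\<^sup>+y. ennreal ((\<phi> x - \<phi> y)\<^sup>2) * indicator B y \<partial>lborel) * indicator U x \<partial>lborel)
      \<le> (\<integral>\<^sup>+x. \<integral>\<^sup>+y. ennreal (d\<^sup>2) * (\<integral>\<^sup>+t. A t x y \<partial>lborel) \<partial>lborel \<partial>lborel)"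
  proof (rule nn_integral_mono)
    fix x
    have "(\<integral>\<^sup>+y. ennreal ((\<phi> x - \<phi> y)\<^sup>2) * indicator B y \<partial>lborel) * indicator U x
        = (\<integral>\<^sup>+y. ennreal ((\<phi> x - \<phi> y)\<^sup>2) * indicator B y * indicator U x \<partial>lborel)"
      by (rule nn_integral_multc[symmetric]) measurable
    also have "\<dots> \<le> (\<integral>\<^sup>+y. ennreal (d\<^sup>2) * (\<integral>\<^sup>+t. A t x y \<partial>lborel) \<partial>lborel)"
    proof (rule nn_integral_mono)
      fix y
      show "ennreal ((\<phi> x - \<phi> y)\<^sup>2) * indicator B y * indicator U x \<le> ennreal (d\<^sup>2) * (\<integral>\<^sup>+t. A t x y \<partial>lborel)"
      proof (cases "x \<in> U \<and> y \<in> B")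
        case True
        have "ennreal ((\<phi> x - \<phi> y)\<^sup>2) \<le> ennreal ((norm (x - y))\<^sup>2) *
            (\<integral>\<^sup>+t. ennreal ((norm (grad2 \<phi> ((1 - t) *\<^sub>R y + t *\<^sub>R x)))\<^sup>2) * indicator {0..1} t \<partial>lborel)"
          by (rule increment_sq_le_line_integral[OF s])
        also have "(\<integral>\<^sup>+t. ennreal ((norm (grad2 \<phi> ((1 - t) *\<^sub>R y + t *\<^sub>R x)))\<^sup>2) * indicator {0..1} t \<partial>lborel)
            = (\<integral>\<^sup>+t. A t x y \<partial>lborel)"
          \<comment> \<open>Star-shapedness enters only here: the segment stays in U, so the
            indicator hidden in \<open>H\<close> equals one along it.\<close>
          by (rule nn_integral_cong) (use True star[of x y] in \<open>auto simp: A_def H_def indicator_def\<close>)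
        also have "ennreal ((norm (x - y))\<^sup>2) * (\<integral>\<^sup>+t. A t x y \<partial>lborel) \<le> ennreal (d\<^sup>2) * (\<integral>\<^sup>+t. A t x y \<partial>lborel)"
          by (intro mult_right_mono ennreal_leI power_mono) (use d True in auto)
        finally show ?thesis using True by simp
      next
        case False
        then have "indicator B y * indicator U x = (0::ennreal)" by auto
        then show ?thesis by (simp only: mult.assoc mult_zero_right zero_le)
      qed
    qed
    finally show "(\<integral>\<^sup>+y. ennreal ((\<phi> x - \<phi> y)\<^sup>2) * indicator B y \<partial>lborel) * indicator U x
        \<le> (\<integral>\<^sup>+y. ennreal (d\<^sup>2) * (\<integral>\<^sup>+t. A t x y \<partial>lborel) \<partial>lborel)" .
  qed
  also have "\<dots> = (\<integral>\<^sup>+x. ennreal (d\<^sup>2) * (\<integral>\<^sup>+y. \<integral>\<^sup>+t. A t x y \<partial>lborel \<partial>lborel) \<partial>lborel)"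
    unfolding A_def by (intro nn_integral_cong nn_integral_cmult) measurable
  also have "\<dots> = ennreal (d\<^sup>2) * (\<integral>\<^sup>+x. \<integral>\<^sup>+y. \<integral>\<^sup>+t. A t x y \<partial>lborel \<partial>lborel \<partial>lborel)"
    unfolding A_def by (rule nn_integral_cmult) measurable
  also have "(\<integral>\<^sup>+x. \<integral>\<^sup>+y. \<integral>\<^sup>+t. A t x y \<partial>lborel \<partial>lborel \<partial>lborel) = (\<integral>\<^sup>+x. \<integral>\<^sup>+t. \<integral>\<^sup>+y. A t x y \<partial>lborel \<partial>lborel \<partial>lborel)"
    unfolding A_def by (intro nn_integral_cong lborel_pair.Fubini') measurable
  also have "\<dots> = (\<integral>\<^sup>+t. \<integral>\<^sup>+x. \<integral>\<^sup>+y. A t x y \<partial>lborel \<partial>lborel \<partial>lborel)"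
    unfolding A_def by (rule lborel_pair.Fubini') measurable
  also have "\<dots> \<le> (\<integral>\<^sup>+t. 4 * (emeasure lborel U + emeasure lborel B) * I * indicator {0..1} t \<partial>(lborel::real measure))"
    by (rule nn_integral_mono) (rule slice)
  also have "\<dots> = 4 * (emeasure lborel U + emeasure lborel B) * I"
    by (subst nn_integral_cmult_indicator) auto
  finally show ?thesis by (simp add: I_def H_def mult_left_mono)
qed

section \<open>The two Poincare inequalities\<close>

lemma bounded_two_sets_norm_diff:
  fixes S T :: "'a::real_normed_vector set"
  assumes "bounded S" "bounded T"
  shows "\<exists>d. \<forall>x\<in>S. \<forall>y\<in>T. norm (x - y) \<le> d"
proof -
  obtain a where a: "\<And>x. x \<in> S \<Longrightarrow> norm x \<le> a" using assms(1) unfolding bounded_iff by blast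
  obtain b where b: "\<And>x. x \<in> T \<Longrightarrow> norm x \<le> b" using assms(2) unfolding bounded_iff by blast
  have "norm (x - y) \<le> a + b" if "x \<in> S" "y \<in> T" for x y
    using norm_triangle_ineq4[of x y] a[OF that(1)] b[OF that(2)] by linarith
  then show ?thesis by blast
qed

definition mean_on :: "'a::euclidean_space set \<Rightarrow> ('a \<Rightarrow> real) \<Rightarrow> real" where
  "mean_on B f = (LINT y|lebesgue_on B. f y) / measure lebesgue B"

lemma mean_on_diff:
  assumes "bounded B" "open B" "continuous_on UNIV f" "continuous_on UNIV g"
  shows "mean_on B (\<lambda>x. f x - g x) = mean_on B f - mean_on B g"
  using integrable_lebesgue_on_continuous[OF assms(1,2,3)] integrable_lebesgue_on_continuous[OF assms(1,2,4)]
  by (simp add: mean_on_def diff_divide_distrib)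

text \<open>The mean is taken over \<open>B\<close>, since the segments used must end there. Jensen
  over \<open>B\<close> bounds the deviation from the mean by averaged increments, and integrating
  these gives the constant 4 d^2 (|U| + |B|) / |B|, where d bounds the distances between points of U
  and B.\<close>

theorem poincare_star_shaped:
  fixes U B :: "(real \<times> real) set"
  assumes U: "bounded U" "open U" and B: "bounded B" "open B" "B \<noteq> {}"
    and star: "\<And>x y t. x \<in> U \<Longrightarrow> y \<in> B \<Longrightarrow> 0 \<le> t \<Longrightarrow> t \<le> 1 \<Longrightarrow> (1 - t) *\<^sub>R y + t *\<^sub>R x \<in> U"
  shows "\<exists>C\<ge>0. \<forall>\<phi>. smooth_fun \<phi> \<longrightarrow>
    sqnorm (lebesgue_on U) (\<lambda>x. \<phi> x - mean_on B \<phi>) \<le> C * sqnorm (lebesgue_on U) (grad2 \<phi>)"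
proof -
  obtain d where d: "\<And>x y. x \<in> U \<Longrightarrow> y \<in> B \<Longrightarrow> norm (x - y) \<le> d"
    using bounded_two_sets_norm_diff[OF U(1) B(1)] by metis
  define b where "b = measure lebesgue B"
  have mu: "emeasure lborel S = ennreal (measure lebesgue S)" if "bounded S" "open S" for S :: "(real \<times> real) set"
    using that lmeasurable_open[OF that] emeasure_eq_measure2[of S lebesgue]
    by (simp add: fmeasurable_def less_top emeasure_completion borel_open)
  have b: "b > 0"
  proof -
    have "\<not> negligible B" using B open_not_negligible by blast
    then have "b \<noteq> 0" unfolding b_def using negligible_iff_measure0[OF lmeasurable_open[OF B(1,2)]] by simp
    then show ?thesis by (simp add: b_def zero_less_measure_iff)
  qed
  define C where "C = d\<^sup>2 * (4 * (measure lebesgue U + b)) / b"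
  have "sqnorm (lebesgue_on U) (\<lambda>x. \<phi> x - mean_on B \<phi>) \<le> C * sqnorm (lebesgue_on U) (grad2 \<phi>)"
    if s: "smooth_fun \<phi>" for \<phi>
  proof -
    have c\<phi>: "continuous_on UNIV \<phi>" by (rule smooth_fun_continuous[OF s])
    have iB: "integrable (lebesgue_on B) (\<lambda>y. (\<phi> x - \<phi> y)\<^sup>2)" for x
      by (intro integrable_lebesgue_on_continuous B continuous_intros c\<phi>)
    \<comment> \<open>Cauchy-Schwarz against the constant one on \<open>B\<close>.\<close>
    have jensen: "b * (\<phi> x - mean_on B \<phi>)\<^sup>2 \<le> (LINT y|lebesgue_on B. (\<phi> x - \<phi> y)\<^sup>2)" for x
    proof -
      have "(LINT y|lebesgue_on B. (\<phi> x - \<phi> y) \<bullet> 1)\<^sup>2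
          \<le> sqnorm (lebesgue_on B) (\<lambda>y. \<phi> x - \<phi> y) * sqnorm (lebesgue_on B) (\<lambda>y. 1::real)"
        by (intro L2_Cauchy_Schwarz sqi_continuous B continuous_intros c\<phi>)
      moreover have "sqnorm (lebesgue_on B) (\<lambda>y. 1::real) = b"
        using B by (simp add: sqnorm_def b_def measure_restrict_space)
      moreover have "(LINT y|lebesgue_on B. (\<phi> x - \<phi> y) \<bullet> 1) = b * (\<phi> x - mean_on B \<phi>)"
      proof -
        have "(LINT y|lebesgue_on B. (\<phi> x - \<phi> y) \<bullet> 1) = (LINT y|lebesgue_on B. \<phi> x) - (LINT y|lebesgue_on B. \<phi> y)"
          using integrable_lebesgue_on_continuous[OF B(1,2) c\<phi>]
            integrable_lebesgue_on_continuous[OF B(1,2) continuous_on_const[of UNIV "\<phi> x"]] by simp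
        also have "(LINT y|lebesgue_on B. \<phi> x) = b * \<phi> x"
          using B by (simp add: b_def measure_restrict_space)
        finally show ?thesis using b by (simp add: mean_on_def b_def[symmetric] right_diff_distrib)
      qed
      ultimately have "b * (b * (\<phi> x - mean_on B \<phi>)\<^sup>2) \<le> b * (LINT y|lebesgue_on B. (\<phi> x - \<phi> y)\<^sup>2)"
        by (simp add: sqnorm_def power_mult_distrib power2_eq_square mult_ac)
      then show ?thesis using b by simp
    qed
    define J where "J = sqnorm (lebesgue_on U) (grad2 \<phi>)"
    have eJ: "(\<integral>\<^sup>+x. ennreal ((norm (grad2 \<phi> x))\<^sup>2) * indicator U x \<partial>lborel) = ennreal J"
      unfolding J_def sqnorm_def
      by (rule nn_integral_lebesgue_on[symmetric])
         (auto intro!: U sqi_int sqi_continuous continuous_grad2[OF s])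
    have "ennreal (b * sqnorm (lebesgue_on U) (\<lambda>x. \<phi> x - mean_on B \<phi>))
        = ennreal (LINT x|lebesgue_on U. b * (\<phi> x - mean_on B \<phi>)\<^sup>2)"
      by (simp add: sqnorm_def)
    also have "\<dots> = (\<integral>\<^sup>+x. ennreal (b * (\<phi> x - mean_on B \<phi>)\<^sup>2) * indicator U x \<partial>lborel)"
      using b by (intro nn_integral_lebesgue_on integrable_lebesgue_on_continuous U continuous_intros c\<phi>) auto
    also have "\<dots> \<le> (\<integral>\<^sup>+x. (\<integral>\<^sup>+y. ennreal ((\<phi> x - \<phi> y)\<^sup>2) * indicator B y \<partial>lborel) * indicator U x \<partial>lborel)"
    proof (intro nn_integral_mono mult_right_mono)
      fix x
      show "ennreal (b * (\<phi> x - mean_on B \<phi>)\<^sup>2) \<le> (\<integral>\<^sup>+y. ennreal ((\<phi> x - \<phi> y)\<^sup>2) * indicator B y \<partial>lborel)"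
        unfolding nn_integral_lebesgue_on[OF B(2) iB zero_le_power2, symmetric]
        by (rule ennreal_leI[OF jensen])
    qed simp
    also have "\<dots> \<le> ennreal (d\<^sup>2) * (4 * (emeasure lborel U + emeasure lborel B) *
        (\<integral>\<^sup>+x. ennreal ((norm (grad2 \<phi> x))\<^sup>2) * indicator U x \<partial>lborel))"
      by (rule double_increment_bound[OF U(2) B(2) star d s])
    also have "\<dots> = ennreal (d\<^sup>2 * (4 * (measure lebesgue U + b) * J))"
      unfolding mu[OF U] mu[OF B(1,2)] eJ b_def[symmetric] using b sqnorm_nonneg[of "lebesgue_on U" "grad2 \<phi>"]
      by (simp add: ennreal_mult' ennreal_plus distrib_left J_def ennreal_numeral[symmetric] del: ennreal_numeral)
    finally have "b * sqnorm (lebesgue_on U) (\<lambda>x. \<phi> x - mean_on B \<phi>) \<le> d\<^sup>2 * (4 * (measure lebesgue U + b) * J)"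
      using b sqnorm_nonneg[of "lebesgue_on U" "grad2 \<phi>"] by (subst (asm) ennreal_le_iff) (auto simp: J_def)
    then show ?thesis using b by (simp add: C_def J_def[symmetric] field_simps)
  qed
  moreover have "C \<ge> 0" using b by (simp add: C_def)
  ultimately show ?thesis by blast
qed

text \<open>The inequality with zero boundary values follows from the one with mean values: place D
  in a large ball that also contains a ball \<open>B\<close> missing D. A test function of D has
  mean zero over \<open>B\<close>.\<close>

theorem poincare_test:
  fixes D :: "(real \<times> real) set"
  assumes D: "bounded D" "open D"
  obtains C where "C \<ge> 0" "\<And>\<phi>. test_fun D \<phi> \<Longrightarrow> sqnorm (lebesgue_on D) \<phi> \<le> C * sqnorm (lebesgue_on D) (grad2 \<phi>)"
proof -
  obtain R where R: "R > 0" "D \<subseteq> ball 0 R" using bounded_subset_ballD[OF D(1), of 0] by auto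
  \<comment> \<open>Every point of B has norm between R and 3R, which puts B inside the ball of
    radius 3R and outside the ball of radius R that contains D.\<close>
  define B where "B = ball ((2 * R, 0) :: real \<times> real) R"
  define U where "U = ball (0 :: real \<times> real) (3 * R)"
  have BU: "B \<subseteq> U"
  proof
    fix x assume "x \<in> B"
    then have "norm ((2 * R, 0) - x) < R" by (simp add: B_def dist_norm)
    moreover have "norm (2 * R, 0::real) = 2 * R" using R by (simp add: norm_Pair real_sqrt_mult)
    ultimately have "norm x < 3 * R" using norm_triangle_ineq2[of x "(2 * R, 0)"] by (simp add: norm_minus_commute)
    then show "x \<in> U" by (simp add: U_def)
  qed
  have BD: "x \<notin> D" if "x \<in> B" for x
  proof
    assume "x \<in> D"
    then have "norm x < R" using R by auto
    moreover have "norm ((2 * R, 0) - x) < R" using that by (simp add: B_def dist_norm)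
    moreover have "norm (2 * R, 0::real) = 2 * R" using R by (simp add: norm_Pair real_sqrt_mult)
    ultimately show False using norm_triangle_ineq2[of "(2 * R, 0)" x] by simp
  qed
  have UB: "bounded U" "open U" "bounded B" "open B" "B \<noteq> {}" using R by (auto simp: U_def B_def)
  have DU: "D \<subseteq> U" using R by (auto simp: U_def)
  have star: "(1 - t) *\<^sub>R y + t *\<^sub>R x \<in> U" if "x \<in> U" "y \<in> B" "0 \<le> t" "t \<le> 1" for x y t
    using convexD[of U y x "1 - t" t] that BU by (auto simp: U_def)
  have "\<exists>C\<ge>0. \<forall>\<phi>. smooth_fun \<phi> \<longrightarrow>
    sqnorm (lebesgue_on U) (\<lambda>x. \<phi> x - mean_on B \<phi>) \<le> C * sqnorm (lebesgue_on U) (grad2 \<phi>)"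
    by (rule poincare_star_shaped[OF UB star])
  then obtain C where C: "C \<ge> 0" "\<And>\<phi>. smooth_fun \<phi> \<Longrightarrow>
    sqnorm (lebesgue_on U) (\<lambda>x. \<phi> x - mean_on B \<phi>) \<le> C * sqnorm (lebesgue_on U) (grad2 \<phi>)"
    by blast
  have "sqnorm (lebesgue_on D) \<phi> \<le> C * sqnorm (lebesgue_on D) (grad2 \<phi>)" if t: "test_fun D \<phi>" for \<phi>
  proof -
    have z: "\<phi> x = 0" "grad2 \<phi> x = 0" if "x \<notin> D" for x
      using test_fun_outside[OF t that] test_fun_outside[OF test_frechet[OF t] that]
      by (simp_all add: grad2_def zero_prod_def)
    have "(LINT y|lebesgue_on B. \<phi> y) = (LINT y|lebesgue_on B. 0)"
      by (rule Bochner_Integration.integral_cong) (use BD z in auto)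
    then have m: "mean_on B \<phi> = 0" by (simp add: mean_on_def)
    have "sqnorm (lebesgue_on D) \<phi> = sqnorm (lebesgue_on U) \<phi>"
      unfolding sqnorm_def by (rule integral_lebesgue_on_superset[OF D(2) UB(2) DU]) (simp add: z)
    moreover have "sqnorm (lebesgue_on D) (grad2 \<phi>) = sqnorm (lebesgue_on U) (grad2 \<phi>)"
      unfolding sqnorm_def by (rule integral_lebesgue_on_superset[OF D(2) UB(2) DU]) (simp add: z)
    ultimately show ?thesis using C(2)[OF test_fun_smooth[OF t]] m by simp
  qed
  with C(1) show thesis by (rule that)
qed

section \<open>Local geometry of domains of class C2\<close>

definition star_region :: "'a::real_normed_vector set \<Rightarrow> bool" where
  "star_region U \<longleftrightarrow> (\<exists>c. \<exists>\<rho>>0. ball c \<rho> \<subseteq> U \<and>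
    (\<forall>x\<in>U. \<forall>y\<in>ball c \<rho>. \<forall>t. 0 \<le> t \<longrightarrow> t \<le> 1 \<longrightarrow> (1 - t) *\<^sub>R y + t *\<^sub>R x \<in> U))"

lemma star_regionI:
  assumes "\<rho> > 0" "ball c \<rho> \<subseteq> U"
    and "\<And>x y t. x \<in> U \<Longrightarrow> y \<in> ball c \<rho> \<Longrightarrow> 0 \<le> t \<Longrightarrow> t \<le> 1 \<Longrightarrow> (1 - t) *\<^sub>R y + t *\<^sub>R x \<in> U"
  shows "star_region U"
  unfolding star_region_def
  by (intro exI[of _ c] exI[of _ \<rho>] conjI ballI allI impI assms)

text \<open>After rotating so that the tangent at the boundary point is visible, the domain is locally
  the region below a graph whose deviation \<^term>\<open>e\<close> from the tangent line has Lipschitz constant at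
  most 1/12; such a region intersected with a ball is star-shaped about a ball deep inside.\<close>

lemma C2_domain_locally_star_shaped:
  assumes D: "C2_domain D" and p: "p \<in> closure D"
  shows "\<exists>r>0. star_region (D \<inter> ball p r)"
proof (cases "p \<in> D")
  case True
  have "open D" using D by (simp add: C2_domain_def)
  then obtain r where r: "r > 0" "ball p r \<subseteq> D" using True open_contains_ball by blast
  then have e: "D \<inter> ball p r = ball p r" by blast
  have "(1 - t) *\<^sub>R y + t *\<^sub>R x \<in> ball p r" if "x \<in> ball p r" "y \<in> ball p r" "0 \<le> t" "t \<le> 1" for x y t
    using convexD[OF convex_ball[of p r], of y x "1 - t" t] that by simp
  then have "star_region (ball p r)" by (intro star_regionI[OF r(1) order_refl])
  then have "star_region (D \<inter> ball p r)" by (simp only: e)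
  then show ?thesis using r(1) by blast
next
  case False
  have "open D" using D by (simp add: C2_domain_def)
  then have "p \<in> frontier D" using p False by (simp add: frontier_def interior_open)
  then obtain r0 Q g where r0: "r0 > 0" and Q: "orthogonal_transformation Q" and g: "C2_fun g"
    and Dg: "\<And>x. x \<in> ball p r0 \<Longrightarrow> x \<in> D \<longleftrightarrow> snd (Q (x - p)) < g (fst (Q (x - p)))"
    using D unfolding C2_domain_def by blast
  from g obtain g' g'' where g': "\<And>t. (g has_real_derivative g' t) (at t)"
    and g'': "\<And>t. (g' has_real_derivative g'' t) (at t)" unfolding C2_fun_def by blast
  have linQ: "linear Q" using Q by (rule orthogonal_transformation_linear)
  have nQ: "norm (Q v) = norm v" for v using Q by (rule orthogonal_transformation_norm)
  have contQ: "continuous_on UNIV Q" using linQ by (rule linear_continuous_on[OF linear_conv_bounded_linear[THEN iffD1]])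
  define a b where "a x = fst (Q (x - p))" and "b x = snd (Q (x - p))" for x
  have afst: "\<bar>fst v\<bar> \<le> norm v" for v :: "real \<times> real" using norm_fst_le[of "fst v" "snd v"] by simp
  have an: "\<bar>a x\<bar> \<le> norm (x - p)" for x unfolding a_def using afst[of "Q (x - p)"] nQ by simp
  have ap: "a p = 0" "b p = 0" by (simp_all add: a_def b_def linear_0[OF linQ])
  have isg: "isCont g t" for t by (rule DERIV_isCont[OF g'])
  \<comment> \<open>The boundary point lies on the graph: not below it because p is outside the open
    set D, not above it because p is a limit of points of D.\<close>
  have g0: "g 0 = 0"
  proof (rule antisym)
    show "g 0 \<le> 0" using Dg[of p] False r0 ap by (simp add: a_def b_def)
    obtain x where x: "\<And>n. x n \<in> D" "x \<longlonglongrightarrow> p" using p unfolding closure_sequential by blast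
    have cQ: "(\<lambda>n. Q (x n - p)) \<longlonglongrightarrow> Q (p - p)"
      by (rule continuous_on_tendsto_compose[OF contQ]) (intro tendsto_intros x, simp_all)
    have l1: "(\<lambda>n. b (x n)) \<longlonglongrightarrow> b p" unfolding b_def by (rule tendsto_snd[OF cQ])
    have "(\<lambda>n. a (x n)) \<longlonglongrightarrow> a p" unfolding a_def by (rule tendsto_fst[OF cQ])
    then have l2: "(\<lambda>n. g (a (x n))) \<longlonglongrightarrow> g (a p)" by (rule isCont_tendsto_compose[OF isg])
    have "\<forall>\<^sub>F n in sequentially. x n \<in> ball p r0"
      by (rule topological_tendstoD[OF x(2)]) (use r0 in auto)
    moreover have "b (x n) \<le> g (a (x n))" if "x n \<in> ball p r0" for n
      using Dg[OF that] x(1)[of n] by (simp add: a_def b_def)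
    ultimately have "\<forall>\<^sub>F n in sequentially. b (x n) \<le> g (a (x n))"
      by (rule eventually_mono)
    then have "b p \<le> g (a p)" by (intro tendsto_le[OF sequentially_bot l2 l1])
    then show "0 \<le> g 0" by (simp add: ap)
  qed
  define m where "m = g' 0"
  define e where "e s = g s - m * s" for s
  have "isCont g' 0" by (rule DERIV_isCont[OF g''])
  \<comment> \<open>The budget for 1/12: over horizontal distances up to 2r the deviation
    \<open>e\<close> varies by at most r/6, and it is itself at most r/12 in size. Together this is
    r/4, the depth of the central ball below the tangent.\<close>
  then obtain d where d: "d > 0" "\<And>s. \<bar>s\<bar> < d \<Longrightarrow> \<bar>g' s - m\<bar> < 1/12"
    unfolding continuous_at_eps_delta by (metis dist_real_def diff_zero m_def zero_less_divide_1_iff zero_less_numeral)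
  have elip: "\<bar>e s - e s'\<bar> \<le> 1/12 * \<bar>s - s'\<bar>" if "\<bar>s\<bar> < d" "\<bar>s'\<bar> < d" for s s'
  proof -
    have "norm (e s - e s') \<le> 1/12 * norm (s - s')"
    proof (rule field_differentiable_bound[of "ball 0 d" e "\<lambda>s. g' s - m"])
      show "(e has_field_derivative g' z - m) (at z within ball 0 d)" for z
        unfolding e_def by (auto intro!: derivative_eq_intros has_field_derivative_at_within[OF g'])
      show "norm (g' z - m) \<le> 1/12" if "z \<in> ball 0 d" for z using d(2)[of z] that by simp
    qed (use that in auto)
    then show ?thesis by simp
  qed
  have e0: "e 0 = 0" by (simp add: e_def g0)
  define r where "r = min r0 d"
  have r: "r > 0" "r \<le> r0" "r \<le> d" using r0 d by (auto simp: r_def)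
  define N where "N = sqrt (1 + m\<^sup>2)"
  have N: "N \<ge> 1" "N\<^sup>2 = 1 + m\<^sup>2" by (simp_all add: N_def)
  \<comment> \<open>\<open>l\<close> is the height above the tangent line. It is affine, so along a
    segment it interpolates exactly, and D is locally the set where \<open>l\<close> is below
    \<open>e\<close>.\<close>
  define l where "l x = b x - m * a x" for x
  \<comment> \<open>The vector (m, -1) is the downward normal of the tangent, of length
    \<open>N\<close>; the scaling places the centre \<open>c\<close> at distance r/2 from p.\<close>
  obtain v where v: "Q v = (r / (2 * N)) *\<^sub>R (m, -1)"
    using orthogonal_transformation_surj[OF Q] by (metis surjD)
  define c where "c = p + v"
  have lv: "snd (Q v) - m * fst (Q v) = - (r / 2) * N"
  proof -
    have "snd (Q v) - m * fst (Q v) = - (r / (2 * N)) * (1 + m\<^sup>2)"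
      by (simp add: v algebra_simps power2_eq_square add_divide_distrib)
    also have "\<dots> = - (r / (2 * N)) * N\<^sup>2" by (simp add: N)
    finally show ?thesis using N(1) by (simp add: power2_eq_square)
  qed
  have nv: "norm v = r / 2"
  proof -
    have "norm v = norm (Q v)" by (simp add: nQ)
    also have "\<dots> = \<bar>r / (2 * N)\<bar> * norm (m, -1::real)" unfolding v by (rule norm_scaleR)
    also have "\<bar>r / (2 * N)\<bar> = r / (2 * N)" using r N(1) by simp
    also have "norm (m, -1::real) = N" by (simp add: norm_Pair N_def add.commute)
    finally show ?thesis using N(1) by simp
  qed
  have Dl: "x \<in> D \<longleftrightarrow> l x < e (a x)" if "x \<in> ball p r" for x
    using Dg[of x] that r by (auto simp: l_def e_def a_def b_def)
  have abnd: "\<bar>a x\<bar> < r" if "x \<in> ball p r" for x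
    using an[of x] that by (simp add: dist_norm norm_minus_commute)
  have ebnd: "\<bar>e (a x)\<bar> \<le> r / 12" if "x \<in> ball p r" for x
    using elip[of "a x" 0] abnd[OF that] r e0 by simp
  have inb: "y \<in> ball p r" if "y \<in> ball c (r / 4)" for y
  proof -
    have "dist p y \<le> dist p c + dist c y" by (rule dist_triangle)
    also have "dist p c = r / 2" by (simp add: c_def dist_norm nv)
    finally show ?thesis using that r by simp
  qed
  \<comment> \<open>At the centre the height is -(r/2) N, and moving by less than r/4 raises it by
    at most (r/4) N. The final bound drops the factor N >= 1.\<close>
  have ly: "l y \<le> - (r / 4)" if "y \<in> ball c (r / 4)" for y
  proof -
    have "Q (y - p) = Q v + Q (y - c)"
      by (simp add: linear_add[OF linQ, symmetric] c_def)
    then have "l y = (snd (Q v) - m * fst (Q v)) + (Q (y - c) \<bullet> (- m, 1))"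
      by (simp add: l_def a_def b_def inner_prod_def algebra_simps)
    also have "snd (Q v) - m * fst (Q v) = - (r / 2) * N" by (rule lv)
    also have "Q (y - c) \<bullet> (- m, 1) \<le> norm (Q (y - c)) * norm (- m, 1::real)" by (rule norm_cauchy_schwarz)
    also have "norm (- m, 1::real) = N" by (simp add: norm_Pair N_def add.commute)
    also have "norm (Q (y - c)) * N \<le> r / 4 * N"
      using that N(1) by (intro mult_right_mono) (auto simp: nQ dist_norm norm_minus_commute)
    finally have "l y \<le> - (r / 4) * N" by (simp add: algebra_simps)
    also have "\<dots> \<le> - (r / 4) * 1" using r N(1) by (intro mult_left_mono_neg) auto
    finally show ?thesis by simp
  qed
  have sub: "y \<in> D" if "y \<in> ball c (r / 4)" for y
    using Dl[OF inb[OF that]] ly[OF that] ebnd[OF inb[OF that]] r by auto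
  have "(1 - t) *\<^sub>R y + t *\<^sub>R x \<in> D \<inter> ball p r"
    if x: "x \<in> D \<inter> ball p r" and y: "y \<in> ball c (r / 4)" and t: "0 \<le> t" "t \<le> 1" for x y t
  \<comment> \<open>The strict inequality at x is scaled by t and would be lost at t = 0, where the
    point is y itself.\<close>
  proof (cases "t = 0")
    case True
    then show ?thesis using sub[OF y] inb[OF y] by simp
  next
    case False
    define z where "z = (1 - t) *\<^sub>R y + t *\<^sub>R x"
    have xb: "x \<in> ball p r" and yb: "y \<in> ball p r" using x inb[OF y] by auto
    have zb: "z \<in> ball p r"
      unfolding z_def using convexD[OF convex_ball[of p r], of y x "1 - t" t] xb yb t by simp
    have "z - p = (1 - t) *\<^sub>R (y - p) + t *\<^sub>R (x - p)" by (simp add: z_def algebra_simps)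
    then have Qz: "Q (z - p) = (1 - t) *\<^sub>R Q (y - p) + t *\<^sub>R Q (x - p)"
      by (simp add: linear_add[OF linQ] linear_scale[OF linQ])
    have az: "a z = (1 - t) * a y + t * a x" by (simp add: a_def Qz)
    have lz: "l z = (1 - t) * l y + t * l x" by (simp add: l_def a_def b_def Qz algebra_simps)
    have "l x < e (a x)" using x Dl by blast
    then have "t * l x < t * e (a x)" using t False by simp
    moreover have "(1 - t) * l y \<le> (1 - t) * (- (r / 4))" using ly[OF y] t by (intro mult_left_mono) auto
    ultimately have 1: "l z < (1 - t) * (- (r / 4)) + t * e (a x)" unfolding lz by linarith
    have "\<bar>e (a z) - e (a x)\<bar> \<le> 1/12 * \<bar>a z - a x\<bar>"
      using abnd[OF zb] abnd[OF xb] r by (intro elip) auto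
    also have "a z - a x = (1 - t) * (a y - a x)" by (simp add: az algebra_simps)
    also have "1/12 * \<bar>(1 - t) * (a y - a x)\<bar> \<le> 1/12 * ((1 - t) * (2 * r))"
    proof -
      have "\<bar>a y - a x\<bar> \<le> 2 * r" using abnd[OF xb] abnd[OF yb] by linarith
      then have "(1 - t) * \<bar>a y - a x\<bar> \<le> (1 - t) * (2 * r)" using t by (intro mult_left_mono) auto
      moreover have "\<bar>(1 - t) * (a y - a x)\<bar> = (1 - t) * \<bar>a y - a x\<bar>" using t by (simp add: abs_mult)
      ultimately show ?thesis by linarith
    qed
    finally have "- (e (a z) - e (a x)) \<le> 1/12 * ((1 - t) * (2 * r))" by (rule abs_le_D2)
    moreover have "1/12 * ((1 - t) * (2 * r)) = (1 - t) * (r / 6)" by simp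
    ultimately have 2: "e (a x) - (1 - t) * (r / 6) \<le> e (a z)" by linarith
    \<comment> \<open>The balance announced by the constants: 1/4 = 1/6 + 1/12.\<close>
    have "(1 - t) * (- (r / 12)) \<le> (1 - t) * e (a x)"
      using ebnd[OF xb] t by (intro mult_left_mono) (auto simp: abs_le_iff)
    then have "(1 - t) * (- (r / 4)) + t * e (a x) \<le> e (a x) - (1 - t) * (r / 6)"
      by (simp add: algebra_simps)
    with 1 2 have "l z < e (a z)" by linarith
    then show ?thesis using Dl[OF zb] zb by (simp add: z_def)
  qed
  moreover have "ball c (r / 4) \<subseteq> D \<inter> ball p r" using sub inb by blast
  moreover have "r / 4 > 0" using r by simp
  ultimately have "star_region (D \<inter> ball p r)" by (intro star_regionI)
  then show ?thesis using r(1) by blast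
qed

section \<open>Poincare inequalities on unions of pieces\<close>

lemma sqnorm_lebesgue_on:
  fixes f :: "'a::euclidean_space \<Rightarrow> 'b::euclidean_space"
  assumes "open S"
  shows "sqnorm (lebesgue_on S) f = (LINT x|lebesgue. indicator S x * (norm (f x))\<^sup>2)"
    and "sq_integrable (lebesgue_on S) f \<Longrightarrow> integrable lebesgue (\<lambda>x. indicator S x * (norm (f x))\<^sup>2)"
  using assms sqi_int[of "lebesgue_on S" f]
  by (simp_all add: sqnorm_def integral_restrict_space integrable_restrict_space)

lemma sqnorm_mono_set:
  fixes f :: "'a::euclidean_space \<Rightarrow> 'b::euclidean_space"
  assumes "open V" "open W" "V \<subseteq> W" "sq_integrable (lebesgue_on W) f"
  shows "sqnorm (lebesgue_on V) f \<le> sqnorm (lebesgue_on W) f"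
  unfolding sqnorm_lebesgue_on(1)[OF assms(1)] sqnorm_lebesgue_on(1)[OF assms(2)]
proof (rule integral_mono)
  show "integrable lebesgue (\<lambda>x. indicator V x * (norm (f x))\<^sup>2)"
    by (rule sqnorm_lebesgue_on(2)[OF assms(1) sqi_restrict[OF assms(3,1,2,4)]])
  show "integrable lebesgue (\<lambda>x. indicator W x * (norm (f x))\<^sup>2)"
    by (rule sqnorm_lebesgue_on(2)[OF assms(2,4)])
  show "indicator V x * (norm (f x))\<^sup>2 \<le> indicator W x * (norm (f x))\<^sup>2" for x
    using assms(3) by (auto simp: indicator_def)
qed

lemma sqnorm_Un_le:
  fixes f :: "'a::euclidean_space \<Rightarrow> 'b::euclidean_space"
  assumes "open V" "open W" "sq_integrable (lebesgue_on (V \<union> W)) f"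
  shows "sqnorm (lebesgue_on (V \<union> W)) f \<le> sqnorm (lebesgue_on V) f + sqnorm (lebesgue_on W) f"
proof -
  have VW: "open (V \<union> W)" using assms by blast
  have iV: "integrable lebesgue (\<lambda>x. indicator V x * (norm (f x))\<^sup>2)"
    by (rule sqnorm_lebesgue_on(2)[OF assms(1) sqi_restrict[OF _ assms(1) VW assms(3)]]) simp
  have iW: "integrable lebesgue (\<lambda>x. indicator W x * (norm (f x))\<^sup>2)"
    by (rule sqnorm_lebesgue_on(2)[OF assms(2) sqi_restrict[OF _ assms(2) VW assms(3)]]) simp
  have "sqnorm (lebesgue_on (V \<union> W)) f \<le> (LINT x|lebesgue. indicator V x * (norm (f x))\<^sup>2 + indicator W x * (norm (f x))\<^sup>2)"
    unfolding sqnorm_lebesgue_on(1)[OF VW]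
    by (rule integral_mono[OF sqnorm_lebesgue_on(2)[OF VW assms(3)] Bochner_Integration.integrable_add[OF iV iW]])
       (auto simp: indicator_def)
  also have "\<dots> = sqnorm (lebesgue_on V) f + sqnorm (lebesgue_on W) f"
    unfolding sqnorm_lebesgue_on(1)[OF assms(1)] sqnorm_lebesgue_on(1)[OF assms(2)]
    by (rule Bochner_Integration.integral_add[OF iV iW])
  finally show ?thesis .
qed

text \<open>The constant subtracted is an arbitrary functional \<open>m\<close> rather than the mean
  over W. This makes the property stable under unions, which simply keep the functional of one
  piece. Compatibility with differences is what later makes normalised sequences Cauchy.\<close>

definition poincare_on :: "(real \<times> real) set \<Rightarrow> bool" where
  "poincare_on W \<longleftrightarrow> open W \<and> bounded W \<and> W \<noteq> {} \<and> (\<exists>C\<ge>0. \<exists>m.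
    (\<forall>\<phi> \<psi>. smooth_fun \<phi> \<longrightarrow> smooth_fun \<psi> \<longrightarrow> m (\<lambda>x. \<phi> x - \<psi> x) = m \<phi> - m \<psi>) \<and>
    (\<forall>\<phi>. smooth_fun \<phi> \<longrightarrow> sqnorm (lebesgue_on W) (\<lambda>x. \<phi> x - m \<phi>) \<le> C * sqnorm (lebesgue_on W) (grad2 \<phi>)))"

lemma sqnorm_const:
  assumes "bounded W" "open (W :: 'a::euclidean_space set)"
  shows "sqnorm (lebesgue_on W) (\<lambda>x. c :: real) = c\<^sup>2 * measure lebesgue W"
  using assms by (simp add: sqnorm_def measure_restrict_space)

lemma measure_open_pos:
  assumes "bounded W" "open (W :: 'a::euclidean_space set)" "W \<noteq> {}"
  shows "measure lebesgue W > 0"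
  using assms open_not_negligible[of W] negligible_iff_measure0[OF lmeasurable_open[OF assms(1,2)]]
  by (simp add: zero_less_measure_iff)

text \<open>The two pieces have different normalising constants, but on the overlap, which is open
  and nonempty and so of positive measure, the function is close to both. Hence the constants are
  close to each other and the one from \<open>V\<close> also works on \<open>W\<close>.\<close>

lemma poincare_on_Un:
  assumes V: "poincare_on V" and W: "poincare_on W" and ne: "V \<inter> W \<noteq> {}"
  shows "poincare_on (V \<union> W)"
proof -
  from V obtain C m where oV: "open V" "bounded V" and C: "C \<ge> 0"
    and mlin: "\<And>\<phi> \<psi>. smooth_fun \<phi> \<Longrightarrow> smooth_fun \<psi> \<Longrightarrow> m (\<lambda>x. \<phi> x - \<psi> x) = m \<phi> - m \<psi>"
    and mV: "\<And>\<phi>. smooth_fun \<phi> \<Longrightarrow> sqnorm (lebesgue_on V) (\<lambda>x. \<phi> x - m \<phi>) \<le> C * sqnorm (lebesgue_on V) (grad2 \<phi>)"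
    unfolding poincare_on_def by blast
  from W obtain C' m' where oW: "open W" "bounded W" and C': "C' \<ge> 0"
    and mW: "\<And>\<phi>. smooth_fun \<phi> \<Longrightarrow> sqnorm (lebesgue_on W) (\<lambda>x. \<phi> x - m' \<phi>) \<le> C' * sqnorm (lebesgue_on W) (grad2 \<phi>)"
    unfolding poincare_on_def by blast
  have o: "open (V \<union> W)" "bounded (V \<union> W)" "open (V \<inter> W)" "bounded (V \<inter> W)"
    using oV oW by auto
  define k where "k = measure lebesgue (V \<inter> W)"
  define w where "w = measure lebesgue W"
  have k: "k > 0" unfolding k_def by (rule measure_open_pos[OF o(4,3) ne])
  \<comment> \<open>Three contributions: \<open>V\<close> with its own constant, \<open>W\<close>
    with its own constant, and \<open>W\<close> times the squared gap between the constants, the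
    last divided by the measure \<open>k\<close> of the overlap.\<close>
  define K where "K = C + 2 * C' + 2 * w * ((2 * C + 2 * C') / k)"
  have K: "K \<ge> 0" using C C' k by (simp add: K_def w_def)
  have "sqnorm (lebesgue_on (V \<union> W)) (\<lambda>x. \<phi> x - m \<phi>) \<le> K * sqnorm (lebesgue_on (V \<union> W)) (grad2 \<phi>)"
    if s: "smooth_fun \<phi>" for \<phi>
  proof -
    have ct: "continuous_on UNIV (\<lambda>x. \<phi> x - c)" "continuous_on UNIV (\<lambda>x. c - \<phi> x)" "continuous_on UNIV (\<lambda>x::real\<times>real. c)" for c
      by (intro continuous_intros smooth_fun_continuous[OF s])+
    note sq = sqi_continuous[OF _ _ ct(1)] sqi_continuous[OF _ _ ct(2)] sqi_continuous[OF _ _ ct(3)]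
    define J where "J = sqnorm (lebesgue_on (V \<union> W)) (grad2 \<phi>)"
    have sg: "sq_integrable (lebesgue_on (V \<union> W)) (grad2 \<phi>)"
      by (rule sqi_continuous[OF o(2,1) continuous_grad2[OF s]])
    have JV: "sqnorm (lebesgue_on V) (grad2 \<phi>) \<le> J" "sqnorm (lebesgue_on W) (grad2 \<phi>) \<le> J"
      unfolding J_def by (rule sqnorm_mono_set[OF _ o(1) _ sg]; use oV oW in simp)+
    have 1: "sqnorm (lebesgue_on V) (\<lambda>x. \<phi> x - m \<phi>) \<le> C * J"
      using mV[OF s] mult_left_mono[OF JV(1) C] by linarith
    have 2: "sqnorm (lebesgue_on W) (\<lambda>x. \<phi> x - m' \<phi>) \<le> C' * J"
      using mW[OF s] mult_left_mono[OF JV(2) C'] by linarith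
    have "k * (m' \<phi> - m \<phi>)\<^sup>2 = sqnorm (lebesgue_on (V \<inter> W)) (\<lambda>x. m' \<phi> - m \<phi>)"
      by (simp add: sqnorm_const[OF o(4,3)] k_def)
    also have "\<dots> \<le> 2 * sqnorm (lebesgue_on (V \<inter> W)) (\<lambda>x. m' \<phi> - \<phi> x) + 2 * sqnorm (lebesgue_on (V \<inter> W)) (\<lambda>x. \<phi> x - m \<phi>)"
      by (rule sqnorm_triangle; intro sqi_continuous o smooth_fun_continuous[OF s] continuous_on_const)
    also have "sqnorm (lebesgue_on (V \<inter> W)) (\<lambda>x. m' \<phi> - \<phi> x) = sqnorm (lebesgue_on (V \<inter> W)) (\<lambda>x. \<phi> x - m' \<phi>)"
      by (rule sqnorm_minus_commute)
    also have "2 * sqnorm (lebesgue_on (V \<inter> W)) (\<lambda>x. \<phi> x - m' \<phi>) + 2 * sqnorm (lebesgue_on (V \<inter> W)) (\<lambda>x. \<phi> x - m \<phi>)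
        \<le> 2 * sqnorm (lebesgue_on W) (\<lambda>x. \<phi> x - m' \<phi>) + 2 * sqnorm (lebesgue_on V) (\<lambda>x. \<phi> x - m \<phi>)"
      by (intro add_mono mult_left_mono sqnorm_mono_set o oV oW sq) auto
    also have "\<dots> \<le> (2 * C + 2 * C') * J" using 1 2 by (simp add: algebra_simps)
    finally have 3: "(m' \<phi> - m \<phi>)\<^sup>2 \<le> (2 * C + 2 * C') / k * J" using k by (simp add: field_simps)
    have "sqnorm (lebesgue_on (V \<union> W)) (\<lambda>x. \<phi> x - m \<phi>)
        \<le> sqnorm (lebesgue_on V) (\<lambda>x. \<phi> x - m \<phi>) + sqnorm (lebesgue_on W) (\<lambda>x. \<phi> x - m \<phi>)"
      by (rule sqnorm_Un_le[OF oV(1) oW(1) sq(1)[OF o(2,1)]])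
    also have "sqnorm (lebesgue_on W) (\<lambda>x. \<phi> x - m \<phi>)
        \<le> 2 * sqnorm (lebesgue_on W) (\<lambda>x. \<phi> x - m' \<phi>) + 2 * sqnorm (lebesgue_on W) (\<lambda>x. m' \<phi> - m \<phi>)"
      by (rule sqnorm_triangle; intro sqi_continuous oW smooth_fun_continuous[OF s] continuous_on_const)
    also have "sqnorm (lebesgue_on W) (\<lambda>x. m' \<phi> - m \<phi>) = w * (m' \<phi> - m \<phi>)\<^sup>2"
      by (simp add: sqnorm_const[OF oW(2,1)] w_def)
    also have "w * (m' \<phi> - m \<phi>)\<^sup>2 \<le> w * ((2 * C + 2 * C') / k * J)"
      by (rule mult_left_mono[OF 3]) (simp add: w_def)
    finally have "sqnorm (lebesgue_on (V \<union> W)) (\<lambda>x. \<phi> x - m \<phi>)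
        \<le> C * J + (2 * (C' * J) + 2 * (w * ((2 * C + 2 * C') / k * J)))" using 1 2 by linarith
    also have "\<dots> = K * J" by (simp add: K_def algebra_simps)
    finally show ?thesis by (simp add: J_def)
  qed
  moreover have "V \<union> W \<noteq> {}" using ne by blast
  ultimately show ?thesis unfolding poincare_on_def using o(1,2) K mlin
    by (intro conjI exI[of _ K] exI[of _ m]) auto
qed

lemma poincare_on_Union:
  assumes "finite F" "poincare_on V" "\<And>W. W \<in> F \<Longrightarrow> poincare_on W \<and> W \<inter> V \<noteq> {}"
  shows "poincare_on (V \<union> \<Union>F)"
  using assms
proof (induction F rule: finite_induct)
  case (insert W F)
  have "poincare_on ((V \<union> \<Union>F) \<union> W)"
    by (rule poincare_on_Un) (use insert in blast)+
  moreover have "(V \<union> \<Union>F) \<union> W = V \<union> \<Union>(insert W F)" by blast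
  ultimately show ?case by simp
qed simp

text \<open>A new piece absorbs all members that meet it, and the others stay untouched.
  Disjointness is wanted because the constants chosen on different members bear no relation to each
  other.\<close>

lemma poincare_on_disjoint_family:
  assumes "finite F" "\<And>W. W \<in> F \<Longrightarrow> poincare_on W"
  shows "\<exists>G. finite G \<and> \<Union>G = \<Union>F \<and> pairwise disjnt G \<and> (\<forall>W\<in>G. poincare_on W)"
  using assms
proof (induction F rule: finite_induct)
  case empty
  show ?case by (rule exI[of _ "{}"]) simp
next
  case (insert V F)
  then obtain G where G: "finite G" "\<Union>G = \<Union>F" "pairwise disjnt G" "\<And>W. W \<in> G \<Longrightarrow> poincare_on W" by auto
  define H where "H = {W \<in> G. W \<inter> V \<noteq> {}}"
  have HG: "H \<subseteq> G" by (auto simp: H_def)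
  have P: "poincare_on (V \<union> \<Union>H)"
    by (rule poincare_on_Union) (use G insert.prems finite_subset[OF HG] in \<open>auto simp: H_def\<close>)
  have dis: "disjnt W (V \<union> \<Union>H)" if "W \<in> G - H" for W
  proof -
    have "W \<inter> V = {}" using that by (auto simp: H_def)
    moreover have "W \<inter> W' = {}" if "W' \<in> H" for W'
    proof -
      have "W \<in> G" "W' \<in> G" "W \<noteq> W'" using that \<open>W \<in> G - H\<close> HG by auto
      then have "disjnt W W'" by (rule pairwiseD[OF G(3)])
      then show ?thesis by (simp add: disjnt_def)
    qed
    ultimately show ?thesis unfolding disjnt_def by blast
  qed
  show ?case
  proof (rule exI[of _ "insert (V \<union> \<Union>H) (G - H)"], intro conjI ballI)
    show "finite (insert (V \<union> \<Union>H) (G - H))" using G by simp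
    show "\<Union>(insert (V \<union> \<Union>H) (G - H)) = \<Union>(insert V F)" using G(2) HG by auto
    show "pairwise disjnt (insert (V \<union> \<Union>H) (G - H))"
      using dis pairwise_subset[OF G(3), of "G - H"] by (auto simp: pairwise_insert disjnt_sym)
    show "poincare_on W" if "W \<in> insert (V \<union> \<Union>H) (G - H)" for W using that P G(4) by auto
  qed
qed

text \<open>The covering balls have half the radius of the star-shaped neighbourhoods; the margin is
  later filled by cut-offs supported in the smaller ball and by the spread of the mollifier.\<close>

lemma C2_domain_finite_star_cover:
  assumes D: "C2_domain D"
  shows "\<exists>I r. finite I \<and> (\<forall>p. r p > 0) \<and> closure D \<subseteq> (\<Union>p\<in>I. ball p (r p)) \<and>
    (\<forall>p\<in>I. star_region (D \<inter> ball p (2 * r p)))"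
proof -
  have "\<exists>r>0. p \<in> closure D \<longrightarrow> star_region (D \<inter> ball p (2 * r))" for p
  proof (cases "p \<in> closure D")
    case True
    obtain r where "r > 0" "star_region (D \<inter> ball p r)"
      using C2_domain_locally_star_shaped[OF D True] by blast
    then show ?thesis by (intro exI[of _ "r / 2"]) simp
  qed (use zero_less_one in blast)
  then obtain r where r: "\<And>p. r p > 0" "\<And>p. p \<in> closure D \<Longrightarrow> star_region (D \<inter> ball p (2 * r p))"
    by metis
  have cpt: "compact (closure D)" using D by (simp add: C2_domain_def)
  have cov: "closure D \<subseteq> (\<Union>p\<in>closure D. ball p (r p))" using r(1) by force
  have "\<exists>I\<subseteq>closure D. finite I \<and> closure D \<subseteq> (\<Union>p\<in>I. ball p (r p))"
    by (rule compactE_image[OF cpt _ cov]) auto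
  then obtain I where "I \<subseteq> closure D" "finite I" "closure D \<subseteq> (\<Union>p\<in>I. ball p (r p))" by blast
  with r show ?thesis by (intro exI[of _ I] exI[of _ r]) auto
qed

lemma star_region_poincare:
  assumes "bounded U" "open U" "star_region U"
  shows "poincare_on U"
proof -
  obtain c \<rho> where c: "\<rho> > 0" "ball c \<rho> \<subseteq> U"
    "\<And>x y t. x \<in> U \<Longrightarrow> y \<in> ball c \<rho> \<Longrightarrow> 0 \<le> t \<Longrightarrow> t \<le> 1 \<Longrightarrow> (1 - t) *\<^sub>R y + t *\<^sub>R x \<in> U"
    using assms(3) unfolding star_region_def by blast
  have B: "bounded (ball c \<rho>)" "open (ball c \<rho>)" "ball c \<rho> \<noteq> {}" using c(1) by auto
  have "U \<noteq> {}" using c(2) B(3) by blast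
  moreover have "\<exists>C\<ge>0. \<forall>\<phi>. smooth_fun \<phi> \<longrightarrow>
    sqnorm (lebesgue_on U) (\<lambda>x. \<phi> x - mean_on (ball c \<rho>) \<phi>) \<le> C * sqnorm (lebesgue_on U) (grad2 \<phi>)"
    by (rule poincare_star_shaped[OF assms(1,2) B c(3)])
  ultimately show ?thesis unfolding poincare_on_def
    using assms mean_on_diff[OF B(1,2) smooth_fun_continuous smooth_fun_continuous] by blast
qed

lemma C2_domain_poincare_decomposition:
  assumes D: "C2_domain D"
  shows "\<exists>G. finite G \<and> \<Union>G = D \<and> pairwise disjnt G \<and> (\<forall>W\<in>G. poincare_on W)"
proof -
  have oD: "open D" "bounded D" using D by (simp_all add: C2_domain_def)
  obtain I r where I: "finite I" "\<And>p. r p > 0" "closure D \<subseteq> (\<Union>p\<in>I. ball p (r p))"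
    "\<And>p. p \<in> I \<Longrightarrow> star_region (D \<inter> ball p (2 * r p))"
    using C2_domain_finite_star_cover[OF D] by blast
  define F where "F = (\<lambda>p. D \<inter> ball p (2 * r p)) ` I"
  have "poincare_on (D \<inter> ball p (2 * r p))" if p: "p \<in> I" for p
    by (rule star_region_poincare[OF _ _ I(4)[OF p]]) (use oD in auto)
  then have "\<And>W. W \<in> F \<Longrightarrow> poincare_on W" by (auto simp: F_def)
  moreover have "finite F" using I(1) by (simp add: F_def)
  ultimately obtain G where G: "finite G" "\<Union>G = \<Union>F" "pairwise disjnt G" "\<forall>W\<in>G. poincare_on W"
    using poincare_on_disjoint_family[of F] by auto
  have "\<Union>F = D"
  proof
    show "D \<subseteq> \<Union>F"
    proof
      fix x assume x: "x \<in> D"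
      then obtain p where p: "p \<in> I" "x \<in> ball p (r p)" using I(3) closure_subset by blast
      then have "x \<in> ball p (2 * r p)" using I(2)[of p] by simp
      with p x show "x \<in> \<Union>F" by (auto simp: F_def)
    qed
  qed (auto simp: F_def)
  with G show ?thesis by blast
qed

section \<open>Limits of gradients of smooth functions\<close>

text \<open>The derivatives of the local models agree on overlaps by uniqueness, so reading each
  model at its own base point defines a global derivative that is again locally C^k.\<close>

lemma Ck_local:
  assumes "\<And>x. \<exists>V h. open V \<and> x \<in> V \<and> Ck k h \<and> (\<forall>y\<in>V. f y = h y)"
  shows "Ck k f"
  using assms
proof (induction k arbitrary: f)
  case 0
  have "isCont f x" for x
  proof -
    obtain V h where V: "open V" "x \<in> V" "Ck 0 h" "\<forall>y\<in>V. f y = h y" using 0[of x] by blast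
    have "isCont h x" using V(3) by (simp add: continuous_on_eq_continuous_at)
    moreover have "\<forall>\<^sub>F y in nhds x. f y = h y"
      using eventually_nhds_in_open[OF V(1,2)] by (rule eventually_mono) (use V(4) in blast)
    ultimately show ?thesis by (simp add: isCont_cong)
  qed
  then show ?case by (simp add: continuous_at_imp_continuous_on)
next
  case (Suc k)
  have "\<forall>x. \<exists>V h h'. open V \<and> x \<in> V \<and> (\<forall>y\<in>V. f y = h y) \<and> (\<forall>y. (h has_derivative h' y) (at y)) \<and> (\<forall>v. Ck k (\<lambda>y. h' y v))"
    using Suc.prems unfolding Ck_Suc_iff by meson
  then obtain V h h' where V: "\<And>x. open (V x)" "\<And>x. x \<in> V x" "\<And>x y. y \<in> V x \<Longrightarrow> f y = h x y"
    and h': "\<And>x y. (h x has_derivative h' x y) (at y)" "\<And>x v. Ck k (\<lambda>y. h' x y v)" by metis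
  have der: "(f has_derivative h' x y) (at y)" if "y \<in> V x" for x y
    by (rule has_derivative_transform_within_open[OF h'(1) V(1) that]) (simp add: V(3))
  have eq: "h' y y = h' x y" if "y \<in> V x" for x y
    by (rule has_derivative_unique[OF der[OF V(2)] der[OF that]])
  show ?case
  proof (rule Ck_SucI)
    show "(f has_derivative h' x x) (at x)" for x by (rule der[OF V(2)])
    show "Ck k (\<lambda>x. h' x x v)" for v
    proof (rule Suc.IH)
      fix x
      show "\<exists>W g. open W \<and> x \<in> W \<and> Ck k g \<and> (\<forall>y\<in>W. h' y y v = g y)"
        by (intro exI[of _ "V x"] exI[of _ "\<lambda>y. h' x y v"]) (use V h'(2) eq in auto)
    qed
  qed
qed

lemma grad2_cong_open:
  assumes "open V" "p \<in> V" "\<And>x. x \<in> V \<Longrightarrow> f x = g x" and g: "smooth_fun g"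
  shows "grad2 f p = grad2 g p"
proof (rule grad2_eqI)
  show "(f has_derivative (\<lambda>v. grad2 g p \<bullet> v)) (at p)"
    by (rule has_derivative_transform_within_open[OF smooth_has_derivative_grad2[OF g] assms(1,2)])
       (simp add: assms(3))
qed

text \<open>Removing the open set \<open>W'\<close> from the carrier leaves a compact set inside
  \<open>W\<close>, so cutting off at the component boundary creates no singularity.\<close>

lemma test_fun_cut_component:
  assumes W: "open W" "open W'" "W \<inter> W' = {}" and t: "test_fun (W \<union> W') \<phi>"
  shows "test_fun W (\<lambda>x. if x \<in> W then \<phi> x else 0)"
proof -
  obtain K where K: "compact K" "K \<subseteq> W \<union> W'" "\<And>x. x \<notin> K \<Longrightarrow> \<phi> x = 0" using test_funE[OF t] by metis
  show ?thesis
  proof (rule test_funI[where K="K - W'"])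
    show "compact (K - W')" using K(1) W(2) by (rule compact_diff)
    show "K - W' \<subseteq> W" using K(2) by blast
    show "(if x \<in> W then \<phi> x else 0) = 0" if "x \<notin> K - W'" for x
      using that K(3)[of x] W(3) by auto
    show "smooth_fun (\<lambda>x. if x \<in> W then \<phi> x else 0)"
      unfolding smooth_fun_def
    proof (intro allI Ck_local)
      fix k x
      consider "x \<in> W" | "x \<in> W'" | "x \<in> - K" using K(2) by blast
      then show "\<exists>V h. open V \<and> x \<in> V \<and> Ck k h \<and> (\<forall>y\<in>V. (if y \<in> W then \<phi> y else 0) = h y)"
      proof cases
        case 1
        then show ?thesis using W(1) smooth_fun_Ck[OF test_fun_smooth[OF t]]
          by (intro exI[of _ W] exI[of _ \<phi>]) auto
      next
        case 2
        then show ?thesis using W by (intro exI[of _ W'] exI[of _ "\<lambda>_. 0"]) (auto intro: Ck_const)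
      next
        case 3
        then show ?thesis using K by (intro exI[of _ "- K"] exI[of _ "\<lambda>_. 0"])
            (auto intro: Ck_const compact_imp_closed)
      qed
    qed
  qed
qed

section \<open>Gluing over disjoint open pieces\<close>

lemma integral_disjoint_Union:
  fixes f :: "'a::euclidean_space \<Rightarrow> 'b::euclidean_space"
  assumes G: "finite G" "pairwise disjnt G" "\<And>W. W \<in> G \<Longrightarrow> open W"
    and f: "\<And>W. W \<in> G \<Longrightarrow> integrable (lebesgue_on W) f"
  shows "integrable (lebesgue_on (\<Union>G)) f"
    and "(LINT x|lebesgue_on (\<Union>G). f x) = (\<Sum>W\<in>G. (LINT x|lebesgue_on W. f x))"
proof -
  have oG: "open (\<Union>G)" using G(3) by blast
  have i: "integrable lebesgue (\<lambda>x. indicator W x *\<^sub>R f x)" if "W \<in> G" for W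
    using f[OF that] G(3)[OF that] by (simp add: integrable_restrict_space)
  have eq: "indicator (\<Union>G) x *\<^sub>R f x = (\<Sum>W\<in>G. indicator W x *\<^sub>R f x)" for x
  proof (cases "x \<in> \<Union>G")
    case True
    then obtain W where W: "W \<in> G" "x \<in> W" by blast
    have "x \<notin> W'" if "W' \<in> G - {W}" for W'
      using G(2) W that unfolding pairwise_def disjnt_def by blast
    then have "(\<Sum>W'\<in>G - {W}. indicator W' x *\<^sub>R f x) = 0" by (intro sum.neutral) auto
    then have "(\<Sum>W'\<in>G. indicator W' x *\<^sub>R f x) = indicator W x *\<^sub>R f x"
      using sum.remove[OF G(1) W(1), of "\<lambda>W'. indicator W' x *\<^sub>R f x"] by simp
    with True W show ?thesis by simp
  next
    case False
    then show ?thesis by (simp add: sum.neutral indicator_def)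
  qed
  have "integrable lebesgue (\<lambda>x. \<Sum>W\<in>G. indicator W x *\<^sub>R f x)"
    by (rule Bochner_Integration.integrable_sum[OF i])
  then show "integrable (lebesgue_on (\<Union>G)) f"
    using oG by (simp add: integrable_restrict_space eq)
  have "(LINT x|lebesgue_on (\<Union>G). f x) = (LINT x|lebesgue. (\<Sum>W\<in>G. indicator W x *\<^sub>R f x))"
    using oG by (simp add: integral_restrict_space eq)
  also have "\<dots> = (\<Sum>W\<in>G. (LINT x|lebesgue. indicator W x *\<^sub>R f x))"
    by (rule Bochner_Integration.integral_sum[OF i])
  also have "\<dots> = (\<Sum>W\<in>G. (LINT x|lebesgue_on W. f x))"
    by (rule sum.cong[OF refl]) (use G(3) in \<open>simp add: integral_restrict_space\<close>)
  finally show "(LINT x|lebesgue_on (\<Union>G). f x) = (\<Sum>W\<in>G. (LINT x|lebesgue_on W. f x))" .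
qed

lemma measurable_disjoint_Union:
  fixes f :: "'a::euclidean_space \<Rightarrow> 'b::euclidean_space"
  assumes G: "finite G" "pairwise disjnt G" "\<And>W. W \<in> G \<Longrightarrow> open W"
    and f: "\<And>W. W \<in> G \<Longrightarrow> f \<in> borel_measurable (lebesgue_on W)"
  shows "f \<in> borel_measurable (lebesgue_on (\<Union>G))"
proof -
  have "(\<lambda>x. if x \<in> W then f x else 0) \<in> borel_measurable lebesgue" if "W \<in> G" for W
    using f[OF that] G(3)[OF that] by (simp add: borel_measurable_if)
  then have m: "(\<lambda>x. \<Sum>W\<in>G. if x \<in> W then f x else 0) \<in> borel_measurable lebesgue"
    by (rule borel_measurable_sum)
  have eq: "(\<Sum>W\<in>G. if x \<in> W then f x else 0) = (if x \<in> \<Union>G then f x else 0)" for x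
  proof (cases "x \<in> \<Union>G")
    case True
    then obtain W where W: "W \<in> G" "x \<in> W" by blast
    have "x \<notin> W'" if "W' \<in> G - {W}" for W'
      using G(2) W that unfolding pairwise_def disjnt_def by blast
    then have "(\<Sum>W'\<in>G - {W}. if x \<in> W' then f x else 0) = 0" by (intro sum.neutral) auto
    then have "(\<Sum>W'\<in>G. if x \<in> W' then f x else 0) = (if x \<in> W then f x else 0)"
      using sum.remove[OF G(1) W(1), of "\<lambda>W'. if x \<in> W' then f x else 0"] by simp
    with True W show ?thesis by simp
  next
    case False
    then have "(if x \<in> W then f x else 0) = 0" if "W \<in> G" for W using that by auto
    with False show ?thesis by (simp add: sum.neutral)
  qed
  have "open (\<Union>G)" using G(3) by blast
  then have L: "\<Union>G \<in> sets lebesgue" by simp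
  from m show ?thesis unfolding eq borel_measurable_if[OF L] .
qed

text \<open>The functions themselves need not converge, only their gradients do. Subtracting a
  constant on each piece makes them Cauchy there by the Poincare inequality; the limits are glued,
  which is harmless because a test function splits along disjoint open pieces.\<close>

lemma smooth_gradients_closed:
  assumes D: "bounded D" "open D"
    and G: "finite G" "\<Union>G = D" "pairwise disjnt G" "\<And>W. W \<in> G \<Longrightarrow> poincare_on W"
    and \<phi>: "\<And>n. smooth_fun (\<phi> n)" and g: "sq_integrable (lebesgue_on D) g"
    and lim: "(\<lambda>n. sqnorm (lebesgue_on D) (\<lambda>x. grad2 (\<phi> n) x - g x)) \<longlonglongrightarrow> 0"
  obtains q where "sq_integrable (lebesgue_on D) q" "is_weak_grad D q g"
proof -
  have sg: "sq_integrable (lebesgue_on D) (grad2 (\<phi> n))" for n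
    by (rule sqi_continuous[OF D continuous_grad2[OF \<phi>]])
  have cauchy: "L2_Cauchy (lebesgue_on D) (\<lambda>n. grad2 (\<phi> n))"
    by (rule L2_convergent_imp_Cauchy[OF sg g lim])
  have "\<exists>q. sq_integrable (lebesgue_on W) q \<and> is_weak_grad W q g" if W: "W \<in> G" for W
  proof -
    from G(4)[OF W] obtain C m where oW: "open W" "bounded W" and C: "C \<ge> 0"
      and mlin: "\<And>\<phi> \<psi>. smooth_fun \<phi> \<Longrightarrow> smooth_fun \<psi> \<Longrightarrow> m (\<lambda>x. \<phi> x - \<psi> x) = m \<phi> - m \<psi>"
      and mW: "\<And>\<phi>. smooth_fun \<phi> \<Longrightarrow> sqnorm (lebesgue_on W) (\<lambda>x. \<phi> x - m \<phi>) \<le> C * sqnorm (lebesgue_on W) (grad2 \<phi>)"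
      unfolding poincare_on_def by blast
    have WD: "W \<subseteq> D" using W G(2) by blast
    \<comment> \<open>Normalising by \<open>m\<close> leaves the gradients unchanged and, since
      \<open>m\<close> respects differences, lets the Poincare inequality control
      \<open>\<psi> k - \<psi> n\<close>.\<close>
    define \<psi> where "\<psi> n x = \<phi> n x - m (\<phi> n)" for n x
    have s\<psi>: "smooth_fun (\<psi> n)" for n unfolding \<psi>_def by (rule smooth_diff[OF \<phi> smooth_const])
    have g\<psi>: "grad2 (\<psi> n) = grad2 (\<phi> n)" for n
      by (rule ext) (simp add: \<psi>_def[abs_def] grad2_diff[OF \<phi> smooth_const] grad2_const)
    have bound: "sqnorm (lebesgue_on W) (\<lambda>x. \<psi> k x - \<psi> n x) \<le> C * sqnorm (lebesgue_on D) (\<lambda>x. grad2 (\<phi> k) x - grad2 (\<phi> n) x)" for k n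
    proof -
      have s: "smooth_fun (\<lambda>x. \<phi> k x - \<phi> n x)" by (rule smooth_diff[OF \<phi> \<phi>])
      have "sqnorm (lebesgue_on W) (\<lambda>x. \<psi> k x - \<psi> n x)
          = sqnorm (lebesgue_on W) (\<lambda>x. (\<phi> k x - \<phi> n x) - m (\<lambda>x. \<phi> k x - \<phi> n x))"
        by (simp add: \<psi>_def mlin[OF \<phi> \<phi>] algebra_simps)
      also have "\<dots> \<le> C * sqnorm (lebesgue_on W) (grad2 (\<lambda>x. \<phi> k x - \<phi> n x))" by (rule mW[OF s])
      also have "grad2 (\<lambda>x. \<phi> k x - \<phi> n x) = (\<lambda>x. grad2 (\<phi> k) x - grad2 (\<phi> n) x)"
        by (rule ext) (rule grad2_diff[OF \<phi> \<phi>])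
      also have "C * sqnorm (lebesgue_on W) (\<lambda>x. grad2 (\<phi> k) x - grad2 (\<phi> n) x)
          \<le> C * sqnorm (lebesgue_on D) (\<lambda>x. grad2 (\<phi> k) x - grad2 (\<phi> n) x)"
        by (rule mult_left_mono[OF sqnorm_mono_set[OF oW(1) D(2) WD sqi_diff[OF sg sg]] C])
      finally show ?thesis .
    qed
    have "L2_Cauchy (lebesgue_on W) \<psi>"
      by (rule L2_Cauchy_dominated[OF cauchy C bound])
    moreover have sqi\<psi>: "sq_integrable (lebesgue_on W) (\<psi> n)" for n
      by (rule sqi_continuous[OF oW(2,1) smooth_fun_continuous[OF s\<psi>]])
    ultimately obtain q where q: "sq_integrable (lebesgue_on W) q" "(\<lambda>n. sqnorm (lebesgue_on W) (\<lambda>x. \<psi> n x - q x)) \<longlonglongrightarrow> 0"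
      using L2_complete[of "lebesgue_on W" \<psi>] by blast
    have gW: "sq_integrable (lebesgue_on W) g" by (rule sqi_restrict[OF WD oW(1) D(2) g])
    have "is_weak_grad W q g"
    proof (rule weak_grad_limit[OF oW(2,1) sqi\<psi> q(1) _ gW _ q(2)])
      show "sq_integrable (lebesgue_on W) (grad2 (\<phi> n))" for n by (rule sqi_restrict[OF WD oW(1) D(2) sg])
      show "is_weak_grad W (\<psi> n) (grad2 (\<phi> n))" for n
        using weak_grad_smooth[OF oW(2,1) s\<psi>[of n]] by (simp add: g\<psi>)
      show "(\<lambda>n. sqnorm (lebesgue_on W) (\<lambda>x. grad2 (\<phi> n) x - g x)) \<longlonglongrightarrow> 0"
      proof (rule tendsto_sandwich[OF _ _ tendsto_const lim])
        show "\<forall>\<^sub>F n in sequentially. 0 \<le> sqnorm (lebesgue_on W) (\<lambda>x. grad2 (\<phi> n) x - g x)"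
          by (simp add: sqnorm_nonneg)
        show "\<forall>\<^sub>F n in sequentially. sqnorm (lebesgue_on W) (\<lambda>x. grad2 (\<phi> n) x - g x) \<le> sqnorm (lebesgue_on D) (\<lambda>x. grad2 (\<phi> n) x - g x)"
          by (intro always_eventually allI sqnorm_mono_set[OF oW(1) D(2) WD sqi_diff[OF sg g]])
      qed
    qed
    with q(1) show ?thesis by blast
  qed
  then obtain Q where Q: "\<And>W. W \<in> G \<Longrightarrow> sq_integrable (lebesgue_on W) (Q W)" "\<And>W. W \<in> G \<Longrightarrow> is_weak_grad W (Q W) g"
    by metis
  have oG: "open W" "bounded W" if "W \<in> G" for W using G(4)[OF that] by (simp_all add: poincare_on_def)
  \<comment> \<open>Disjointness makes the piece containing x unique, so the description is well
    defined on D; off D its value does not matter.\<close>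
  define q where "q x = Q (THE W. W \<in> G \<and> x \<in> W) x" for x
  have qeq: "q x = Q W x" if "W \<in> G" "x \<in> W" for W x
  proof -
    have "(THE W. W \<in> G \<and> x \<in> W) = W"
      by (rule the_equality) (use that G(3) in \<open>auto simp: pairwise_def disjnt_def\<close>)
    then show ?thesis by (simp add: q_def)
  qed
  have qW: "sq_integrable (lebesgue_on W) q" if W: "W \<in> G" for W
  proof -
    have "q \<in> borel_measurable (lebesgue_on W)"
      using sqi_meas[OF Q(1)[OF W]] qeq[OF W] measurable_cong[of "lebesgue_on W" q "Q W" borel] by simp
    then show ?thesis by (rule sqi_AE_cong[OF Q(1)[OF W]]) (rule AE_I2, simp add: qeq[OF W])
  qed
  have wW: "is_weak_grad W q g" if W: "W \<in> G" for W
  proof -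
    have "(LINT p|lebesgue_on W. q p *\<^sub>R grad2 \<phi> p) = (LINT p|lebesgue_on W. Q W p *\<^sub>R grad2 \<phi> p)" for \<phi>
      by (rule Bochner_Integration.integral_cong) (use qeq[OF W] in auto)
    then show ?thesis using Q(2)[OF W] by (simp add: is_weak_grad_def)
  qed
  have sq: "sq_integrable (lebesgue_on D) q"
    unfolding sq_integrable_def G(2)[symmetric]
    using measurable_disjoint_Union[OF G(1,3) oG(1) sqi_meas[OF qW]]
      integral_disjoint_Union(1)[OF G(1,3) oG(1) sqi_int[OF qW]] by simp
  have "is_weak_grad D q g"
    unfolding is_weak_grad_def
  proof (intro allI impI)
    fix \<phi> assume t: "test_fun D \<phi>"
    have s: "smooth_fun \<phi>" by (rule test_fun_smooth[OF t])
    have WD: "W \<subseteq> D" if "W \<in> G" for W using that G(2) by blast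
    have gW: "sq_integrable (lebesgue_on W) g" if "W \<in> G" for W
      by (rule sqi_restrict[OF WD[OF that] oG(1)[OF that] D(2) g])
    have i1: "integrable (lebesgue_on W) (\<lambda>p. q p *\<^sub>R grad2 \<phi> p)" if "W \<in> G" for W
      by (rule sqi_imp_integrable[OF finite_measure_lebesgue_on_bounded[OF oG(2,1)[OF that]]
            sqi_scaleR_continuous[OF oG(2)[OF that] continuous_grad2[OF s] qW[OF that]]])
    have i2: "integrable (lebesgue_on W) (\<lambda>p. \<phi> p *\<^sub>R g p)" if "W \<in> G" for W
      by (rule sqi_imp_integrable[OF finite_measure_lebesgue_on_bounded[OF oG(2,1)[OF that]]
            sqi_continuous_scaleR[OF oG(2)[OF that] smooth_fun_continuous[OF s] gW[OF that]]])
    \<comment> \<open>The weak identity on W needs a test function supported in W: the part of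
      \<phi> living on W, extended by zero.\<close>
    have local: "(LINT p|lebesgue_on W. q p *\<^sub>R grad2 \<phi> p) = - (LINT p|lebesgue_on W. \<phi> p *\<^sub>R g p)" if W: "W \<in> G" for W
    proof -
      define \<psi> where "\<psi> x = (if x \<in> W then \<phi> x else 0)" for x
      have "W \<union> \<Union>(G - {W}) = D" using G(2) W by blast
      then have "test_fun (W \<union> \<Union>(G - {W})) \<phi>" using t by simp
      moreover have "W \<inter> \<Union>(G - {W}) = {}" using G(3) W unfolding pairwise_def disjnt_def by blast
      moreover have "open (\<Union>(G - {W}))" using oG(1) by blast
      ultimately have t\<psi>: "test_fun W \<psi>"
        unfolding \<psi>_def[abs_def] using test_fun_cut_component[OF oG(1)[OF W]] by blast
      have "(LINT p|lebesgue_on W. q p *\<^sub>R grad2 \<phi> p) = (LINT p|lebesgue_on W. q p *\<^sub>R grad2 \<psi> p)"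
      proof (rule Bochner_Integration.integral_cong[OF refl])
        fix p assume "p \<in> space (lebesgue_on W)"
        then have "grad2 \<psi> p = grad2 \<phi> p"
          by (intro grad2_cong_open[OF oG(1)[OF W] _ _ s]) (auto simp: \<psi>_def)
        then show "q p *\<^sub>R grad2 \<phi> p = q p *\<^sub>R grad2 \<psi> p" by simp
      qed
      also have "\<dots> = - (LINT p|lebesgue_on W. \<psi> p *\<^sub>R g p)" using wW[OF W] t\<psi> by (simp add: is_weak_grad_def)
      also have "(LINT p|lebesgue_on W. \<psi> p *\<^sub>R g p) = (LINT p|lebesgue_on W. \<phi> p *\<^sub>R g p)"
        by (rule Bochner_Integration.integral_cong) (auto simp: \<psi>_def)
      finally show ?thesis .
    qed
    have "(LINT p|lebesgue_on D. q p *\<^sub>R grad2 \<phi> p) = (\<Sum>W\<in>G. (LINT p|lebesgue_on W. q p *\<^sub>R grad2 \<phi> p))"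
      using integral_disjoint_Union(2)[OF G(1,3) oG(1) i1] by (simp add: G(2))
    also have "\<dots> = - (\<Sum>W\<in>G. (LINT p|lebesgue_on W. \<phi> p *\<^sub>R g p))"
      unfolding sum_negf[symmetric] by (rule sum.cong[OF refl local])
    also have "(\<Sum>W\<in>G. (LINT p|lebesgue_on W. \<phi> p *\<^sub>R g p)) = (LINT p|lebesgue_on D. \<phi> p *\<^sub>R g p)"
      using integral_disjoint_Union(2)[OF G(1,3) oG(1) i2] by (simp add: G(2))
    finally show "(LINT p|lebesgue_on D. q p *\<^sub>R grad2 \<phi> p) = - (LINT p|lebesgue_on D. \<phi> p *\<^sub>R g p)" .
  qed
  with sq show thesis by (rule that)
qed

section \<open>Smoothness of kernel integrals\<close>

lemma test_fun_derivative_lipschitz: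
  fixes f :: "'a::euclidean_space \<Rightarrow> real"
  assumes "test_fun U f"
  obtains L where "L \<ge> 0" "\<And>x y v. \<bar>frechet_derivative f (at x) v - frechet_derivative f (at y) v\<bar> \<le> L * norm (x - y) * norm v"
proof -
  have s: "smooth_fun f" by (rule test_fun_smooth[OF assms])
  have "\<exists>L\<ge>0. \<forall>x y. \<bar>frechet_derivative f (at x) b - frechet_derivative f (at y) b\<bar> \<le> L * norm (x - y)" for b
    using test_fun_lipschitz[OF test_frechet[OF assms, of b]] by metis
  then obtain L where L: "\<And>b. L b \<ge> 0"
    "\<And>b x y. \<bar>frechet_derivative f (at x) b - frechet_derivative f (at y) b\<bar> \<le> L b * norm (x - y)" by metis
  have "\<bar>frechet_derivative f (at x) v - frechet_derivative f (at y) v\<bar> \<le> (\<Sum>b\<in>Basis. L b) * norm (x - y) * norm v" for x y v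
  proof -
    have "\<bar>frechet_derivative f (at x) v - frechet_derivative f (at y) v\<bar>
        = \<bar>\<Sum>b\<in>Basis. (v \<bullet> b) * (frechet_derivative f (at x) b - frechet_derivative f (at y) b)\<bar>"
      unfolding smooth_frechet_expand[OF s, of x v] smooth_frechet_expand[OF s, of y v]
      by (simp add: sum_subtractf right_diff_distrib)
    also have "\<dots> \<le> (\<Sum>b\<in>Basis. \<bar>(v \<bullet> b) * (frechet_derivative f (at x) b - frechet_derivative f (at y) b)\<bar>)"
      by (rule sum_abs)
    also have "\<dots> \<le> (\<Sum>b\<in>Basis. norm v * (L b * norm (x - y)))"
      unfolding abs_mult by (intro sum_mono mult_mono L Basis_le_norm) auto
    also have "\<dots> = (\<Sum>b\<in>Basis. L b) * norm (x - y) * norm v"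
      by (simp add: sum_distrib_left sum_distrib_right mult_ac)
    finally show ?thesis .
  qed
  moreover have "(\<Sum>b\<in>Basis. L b) \<ge> 0" by (intro sum_nonneg L)
  ultimately show thesis using that by blast
qed

text \<open>The mean value inequality for f minus its linear part at \<open>a\<close>, whose
  derivative is small because the derivative of a test function is Lipschitz. The bound is uniform
  in \<open>a\<close>, as needed under an integral sign.\<close>

lemma test_fun_second_order:
  fixes f :: "'a::euclidean_space \<Rightarrow> real"
  assumes "test_fun U f"
  obtains M where "M \<ge> 0" "\<And>a h. \<bar>f (a + h) - f a - frechet_derivative f (at a) h\<bar> \<le> M * (norm h)\<^sup>2"
proof -
  have s: "smooth_fun f" by (rule test_fun_smooth[OF assms])
  obtain L where L: "L \<ge> 0" "\<And>x y v. \<bar>frechet_derivative f (at x) v - frechet_derivative f (at y) v\<bar> \<le> L * norm (x - y) * norm v"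
    using test_fun_derivative_lipschitz[OF assms] by metis
  have "\<bar>f (a + h) - f a - frechet_derivative f (at a) h\<bar> \<le> L * (norm h)\<^sup>2" for a h
  proof -
    let ?A = "frechet_derivative f (at a)"
    have lin: "bounded_linear ?A" by (rule has_derivative_bounded_linear[OF smooth_fun_has_derivative[OF s]])
    have "norm ((f (a + h) - ?A (a + h)) - (f a - ?A a)) \<le> (L * norm h) * norm ((a + h) - a)"
    proof (rule differentiable_bound[of "cball a (norm h)" "\<lambda>y. f y - ?A y" "\<lambda>y v. frechet_derivative f (at y) v - ?A v"])
      fix y assume y: "y \<in> cball a (norm h)"
      show "((\<lambda>y. f y - ?A y) has_derivative (\<lambda>v. frechet_derivative f (at y) v - ?A v)) (at y within cball a (norm h))"
        by (intro has_derivative_diff has_derivative_at_withinI[OF smooth_fun_has_derivative[OF s]]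
            bounded_linear_imp_has_derivative lin)
      show "onorm (\<lambda>v. frechet_derivative f (at y) v - ?A v) \<le> L * norm h"
      proof (rule onorm_le)
        fix v :: 'a
        have "norm (y - a) \<le> norm h" using y by (simp add: dist_norm norm_minus_commute)
        then have "L * norm (y - a) * norm v \<le> L * norm h * norm v"
          using L(1) by (intro mult_right_mono mult_left_mono) auto
        then show "norm (frechet_derivative f (at y) v - ?A v) \<le> L * norm h * norm v"
          using L(2)[of y v a] by simp
      qed
    qed (simp_all add: dist_norm)
    moreover have "?A (a + h) = ?A a + ?A h" using lin by (rule linear_simps(1))
    ultimately show ?thesis by (simp add: power2_eq_square mult.assoc algebra_simps)
  qed
  with L(1) show thesis using that by blast
qed

lemma integrable_test_times:
  fixes K :: "'a::euclidean_space \<Rightarrow> real"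
  assumes K: "test_fun V K" and f: "integrable (lebesgue_on U) f"
  shows "integrable (lebesgue_on U) (\<lambda>w. K (\<alpha> *\<^sub>R x + \<beta> *\<^sub>R w) * f w)"
proof -
  obtain B where B: "\<And>x. \<bar>K x\<bar> \<le> B" "B \<ge> 0" using test_fun_bounded[OF K] by metis
  have c: "continuous_on UNIV (\<lambda>w. K (\<alpha> *\<^sub>R x + \<beta> *\<^sub>R w))"
    by (rule continuous_on_compose2[OF smooth_fun_continuous[OF test_fun_smooth[OF K], of UNIV]])
       (auto intro!: continuous_intros)
  show ?thesis
  proof (rule Bochner_Integration.integrable_bound)
    show "integrable (lebesgue_on U) (\<lambda>w. B * norm (f w))" using f by simp
    show "(\<lambda>w. K (\<alpha> *\<^sub>R x + \<beta> *\<^sub>R w) * f w) \<in> borel_measurable (lebesgue_on U)"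
      by (intro borel_measurable_times continuous_imp_lebesgue_on c borel_measurable_integrable f)
    show "AE w in lebesgue_on U. norm (K (\<alpha> *\<^sub>R x + \<beta> *\<^sub>R w) * f w) \<le> norm (B * norm (f w))"
      using B by (intro AE_I2) (simp add: abs_mult mult_right_mono)
  qed
qed

text \<open>The two scalars cover dilations and translations together: x and w enter through one
  affine combination, so differentiating in x or in w differs only by the ratio \<alpha> /
  \<beta>.\<close>

definition kernel_int :: "'a::euclidean_space set \<Rightarrow> ('a \<Rightarrow> real) \<Rightarrow> real \<Rightarrow> real \<Rightarrow> ('a \<Rightarrow> real) \<Rightarrow> 'a \<Rightarrow> real" where
  "kernel_int U K \<alpha> \<beta> f x = (LINT w|lebesgue_on U. K (\<alpha> *\<^sub>R x + \<beta> *\<^sub>R w) * f w)"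

text \<open>Differentiation under the integral sign, by integrating the uniform quadratic Taylor
  remainder of \<open>K\<close> against |f|. The derivative is again a combination of kernel
  integrals, which is what the induction to all orders feeds on.\<close>

lemma kernel_int_has_derivative:
  fixes K :: "'a::euclidean_space \<Rightarrow> real"
  assumes K: "test_fun V K" and f: "integrable (lebesgue_on U) f"
  shows "(kernel_int U K \<alpha> \<beta> f has_derivative
    (\<lambda>v. \<Sum>b\<in>Basis. (v \<bullet> b) * (\<alpha> * kernel_int U (\<lambda>y. frechet_derivative K (at y) b) \<alpha> \<beta> f x))) (at x)"
proof -
  let ?D = "\<lambda>y b. frechet_derivative K (at y) b"
  let ?L = "\<lambda>v. \<Sum>b\<in>Basis. (v \<bullet> b) * (\<alpha> * kernel_int U (\<lambda>y. ?D y b) \<alpha> \<beta> f x)"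
  have s: "smooth_fun K" by (rule test_fun_smooth[OF K])
  obtain M where M: "M \<ge> 0" "\<And>a h. \<bar>K (a + h) - K a - ?D a h\<bar> \<le> M * (norm h)\<^sup>2"
    using test_fun_second_order[OF K] by metis
  define C where "C = M * \<alpha>\<^sup>2 * (LINT w|lebesgue_on U. norm (f w))"
  have iK: "integrable (lebesgue_on U) (\<lambda>w. K (\<alpha> *\<^sub>R y + \<beta> *\<^sub>R w) * f w)" for y
    by (rule integrable_test_times[OF K f])
  have iD: "integrable (lebesgue_on U) (\<lambda>w. ?D (\<alpha> *\<^sub>R y + \<beta> *\<^sub>R w) b * f w)" for y b
    by (rule integrable_test_times[OF test_frechet[OF K] f])
  have Leq: "?L v = (LINT w|lebesgue_on U. ?D (\<alpha> *\<^sub>R x + \<beta> *\<^sub>R w) (\<alpha> *\<^sub>R v) * f w)" for v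
  proof -
    have "?L v = (\<Sum>b\<in>Basis. (LINT w|lebesgue_on U. ((\<alpha> *\<^sub>R v) \<bullet> b) * (?D (\<alpha> *\<^sub>R x + \<beta> *\<^sub>R w) b * f w)))"
      unfolding kernel_int_def integral_mult_right_zero inner_scaleR_left by (simp only: mult_ac)
    also have "\<dots> = (LINT w|lebesgue_on U. (\<Sum>b\<in>Basis. ((\<alpha> *\<^sub>R v) \<bullet> b) * (?D (\<alpha> *\<^sub>R x + \<beta> *\<^sub>R w) b * f w)))"
      by (rule Bochner_Integration.integral_sum[symmetric]) (intro integrable_mult_right iD)
    also have "\<dots> = (LINT w|lebesgue_on U. ?D (\<alpha> *\<^sub>R x + \<beta> *\<^sub>R w) (\<alpha> *\<^sub>R v) * f w)"
      by (rule Bochner_Integration.integral_cong[OF refl])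
         (subst (2) smooth_frechet_expand[OF s], simp add: sum_distrib_right mult.assoc)
    finally show ?thesis .
  qed
  have iDv: "integrable (lebesgue_on U) (\<lambda>w. ?D (\<alpha> *\<^sub>R x + \<beta> *\<^sub>R w) (\<alpha> *\<^sub>R v) * f w)" for v by (rule iD)
  have rem: "\<bar>kernel_int U K \<alpha> \<beta> f y - kernel_int U K \<alpha> \<beta> f x - ?L (y - x)\<bar> \<le> C * (norm (y - x))\<^sup>2" for y
  proof -
    define r where "r w = K (\<alpha> *\<^sub>R y + \<beta> *\<^sub>R w) * f w - K (\<alpha> *\<^sub>R x + \<beta> *\<^sub>R w) * f w
      - ?D (\<alpha> *\<^sub>R x + \<beta> *\<^sub>R w) (\<alpha> *\<^sub>R (y - x)) * f w" for w
    have ir: "integrable (lebesgue_on U) r"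
      unfolding r_def by (intro Bochner_Integration.integrable_diff iK iDv)
    have rle: "\<bar>r w\<bar> \<le> M * \<alpha>\<^sup>2 * (norm (y - x))\<^sup>2 * norm (f w)" for w
    proof -
      have e: "\<alpha> *\<^sub>R y + \<beta> *\<^sub>R w = (\<alpha> *\<^sub>R x + \<beta> *\<^sub>R w) + \<alpha> *\<^sub>R (y - x)" by (simp add: algebra_simps)
      have "\<bar>K (\<alpha> *\<^sub>R y + \<beta> *\<^sub>R w) - K (\<alpha> *\<^sub>R x + \<beta> *\<^sub>R w) - ?D (\<alpha> *\<^sub>R x + \<beta> *\<^sub>R w) (\<alpha> *\<^sub>R (y - x))\<bar> \<le> M * (norm (\<alpha> *\<^sub>R (y - x)))\<^sup>2"
        unfolding e by (rule M(2))
      then have "\<bar>K (\<alpha> *\<^sub>R y + \<beta> *\<^sub>R w) - K (\<alpha> *\<^sub>R x + \<beta> *\<^sub>R w) - ?D (\<alpha> *\<^sub>R x + \<beta> *\<^sub>R w) (\<alpha> *\<^sub>R (y - x))\<bar> * \<bar>f w\<bar>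
          \<le> M * (norm (\<alpha> *\<^sub>R (y - x)))\<^sup>2 * \<bar>f w\<bar>" by (rule mult_right_mono) simp
      then show ?thesis
        unfolding r_def left_diff_distrib[symmetric] abs_mult norm_scaleR power_mult_distrib power2_abs
        by (simp only: mult.assoc real_norm_def)
    qed
    have "kernel_int U K \<alpha> \<beta> f y - kernel_int U K \<alpha> \<beta> f x - ?L (y - x) = (LINT w|lebesgue_on U. r w)"
      unfolding Leq unfolding kernel_int_def r_def
      by (simp only: Bochner_Integration.integral_diff Bochner_Integration.integrable_diff iK iDv)
    also have "\<bar>LINT w|lebesgue_on U. r w\<bar> \<le> (LINT w|lebesgue_on U. \<bar>r w\<bar>)" by (rule integral_abs_bound)
    also have "\<dots> \<le> (LINT w|lebesgue_on U. M * \<alpha>\<^sup>2 * (norm (y - x))\<^sup>2 * norm (f w))"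
      by (rule integral_mono[OF integrable_abs[OF ir] integrable_mult_right[OF integrable_norm[OF f]] rle])
    also have "\<dots> = C * (norm (y - x))\<^sup>2" by (simp add: C_def)
    finally show ?thesis .
  qed
  show ?thesis
  proof (rule has_derivativeI_sandwich[of 1 _ _ _ _ "\<lambda>y. C * norm (y - x)"])
    show "bounded_linear ?L"
      by (intro bounded_linear_sum bounded_linear_mult_left bounded_linear_compose[OF bounded_linear_mult_left bounded_linear_inner_left])
    show "norm (kernel_int U K \<alpha> \<beta> f y - kernel_int U K \<alpha> \<beta> f x - ?L (y - x)) / norm (y - x) \<le> C * norm (y - x)"
      if "y \<noteq> x" for y
      using rem[of y] that by (simp add: divide_le_eq power2_eq_square mult.assoc)
    have "((\<lambda>y. C * norm (y - x)) \<longlongrightarrow> C * norm (x - x)) (at x)" by (intro tendsto_intros)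
    then show "((\<lambda>y. C * norm (y - x)) \<longlongrightarrow> 0) (at x)" by simp
  qed simp
qed

lemma smooth_kernel_int:
  fixes K :: "'a::euclidean_space \<Rightarrow> real"
  assumes K: "test_fun V K" and f: "integrable (lebesgue_on U) f"
  shows "smooth_fun (kernel_int U K \<alpha> \<beta> f)"
proof -
  have "Ck k (kernel_int U K \<alpha> \<beta> f)" for k
    using K
  proof (induction k arbitrary: K)
    case 0
    then show ?case
      using has_derivative_continuous[OF kernel_int_has_derivative[OF 0 f]]
      by (simp add: continuous_at_imp_continuous_on)
  next
    case (Suc k)
    show ?case
      by (rule Ck_SucI[OF kernel_int_has_derivative[OF Suc.prems f]])
         (intro Ck_sum Ck_cmult Suc.IH test_frechet Suc.prems)
  qed
  then show ?thesis by (simp add: smooth_fun_def)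
qed

lemma frechet_kernel_int:
  fixes K :: "'a::euclidean_space \<Rightarrow> real"
  assumes K: "test_fun V K" and f: "integrable (lebesgue_on U) f" and b: "b \<in> Basis"
  shows "frechet_derivative (kernel_int U K \<alpha> \<beta> f) (at x) b = \<alpha> * kernel_int U (\<lambda>y. frechet_derivative K (at y) b) \<alpha> \<beta> f x"
proof -
  have "frechet_derivative (kernel_int U K \<alpha> \<beta> f) (at x) b
      = (\<Sum>b'\<in>Basis. (b \<bullet> b') * (\<alpha> * kernel_int U (\<lambda>y. frechet_derivative K (at y) b') \<alpha> \<beta> f x))"
    unfolding frechet_derivative_eqI[OF kernel_int_has_derivative[OF K f]] ..
  also have "\<dots> = (\<Sum>b'\<in>Basis. if b' = b then \<alpha> * kernel_int U (\<lambda>y. frechet_derivative K (at y) b') \<alpha> \<beta> f x else 0)"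
    by (rule sum.cong[OF refl]) (use b in \<open>auto simp: inner_Basis\<close>)
  also have "\<dots> = \<alpha> * kernel_int U (\<lambda>y. frechet_derivative K (at y) b) \<alpha> \<beta> f x"
    using b by simp
  finally show ?thesis .
qed

section \<open>Kernel integrals of functions with a weak gradient\<close>

lemma grad2_affine:
  assumes "smooth_fun K"
  shows "grad2 (\<lambda>w. K (\<beta> *\<^sub>R w + b)) w = \<beta> *\<^sub>R grad2 K (\<beta> *\<^sub>R w + b)"
proof (rule grad2_eqI)
  have "((\<lambda>w. K (\<beta> *\<^sub>R w + b)) has_derivative (\<lambda>v. grad2 K (\<beta> *\<^sub>R w + b) \<bullet> (\<beta> *\<^sub>R v))) (at w)"
    by (rule has_derivative_compose[OF _ smooth_has_derivative_grad2[OF assms]])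
       (auto intro!: derivative_eq_intros)
  then show "((\<lambda>w. K (\<beta> *\<^sub>R w + b)) has_derivative (\<lambda>v. (\<beta> *\<^sub>R grad2 K (\<beta> *\<^sub>R w + b)) \<bullet> v)) (at w)"
    by simp
qed

text \<open>The derivative in x is traded for one in w and then moved onto \<open>q\<close> by the
  weak gradient, which gives the sign. The support hypothesis says that, for this x, the kernel as a
  function of w is a test function of U.\<close>

lemma grad2_kernel_int:
  fixes K :: "real \<times> real \<Rightarrow> real"
  assumes U: "bounded U" "open U" and K: "test_fun V K" and \<beta>: "\<beta> \<noteq> 0"
    and q: "sq_integrable (lebesgue_on U) q" and g: "sq_integrable (lebesgue_on U) g" and w: "is_weak_grad U q g"
    and supp: "\<And>w. \<alpha> *\<^sub>R x + \<beta> *\<^sub>R w \<in> V \<Longrightarrow> w \<in> U"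
    and e: "e \<in> Basis"
  shows "grad2 (kernel_int U K \<alpha> \<beta> q) x \<bullet> e = - (\<alpha> / \<beta>) * kernel_int U K \<alpha> \<beta> (\<lambda>w. g w \<bullet> e) x"
proof -
  have iq: "integrable (lebesgue_on U) q"
    by (rule sqi_imp_integrable[OF finite_measure_lebesgue_on_bounded[OF U] q])
  have s: "smooth_fun K" by (rule test_fun_smooth[OF K])
  define \<psi> where "\<psi> w = K (\<beta> *\<^sub>R w + \<alpha> *\<^sub>R x)" for w
  have t: "test_fun U \<psi>" unfolding \<psi>_def
    by (rule test_fun_affine[OF K \<beta>]) (use supp in \<open>simp add: add.commute\<close>)
  have g\<psi>: "grad2 \<psi> w \<bullet> e = \<beta> * frechet_derivative K (at (\<alpha> *\<^sub>R x + \<beta> *\<^sub>R w)) e" for w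
    unfolding \<psi>_def[abs_def] grad2_affine[OF s] by (simp add: frechet_eq_grad2[OF s] add.commute)
  have "\<beta> * kernel_int U (\<lambda>y. frechet_derivative K (at y) e) \<alpha> \<beta> q x = (LINT w|lebesgue_on U. q w * (grad2 \<psi> w \<bullet> e))"
    unfolding kernel_int_def g\<psi> integral_mult_right_zero[symmetric] by (simp add: mult_ac)
  also have "\<dots> = - (LINT w|lebesgue_on U. \<psi> w * (g w \<bullet> e))"
    by (rule w[unfolded is_weak_grad_iff[OF U q g], rule_format, OF t])
  also have "(LINT w|lebesgue_on U. \<psi> w * (g w \<bullet> e)) = kernel_int U K \<alpha> \<beta> (\<lambda>w. g w \<bullet> e) x"
    by (simp add: kernel_int_def \<psi>_def add.commute)
  finally have "\<beta> * kernel_int U (\<lambda>y. frechet_derivative K (at y) e) \<alpha> \<beta> q x = - kernel_int U K \<alpha> \<beta> (\<lambda>w. g w \<bullet> e) x" .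
  then have *: "kernel_int U (\<lambda>y. frechet_derivative K (at y) e) \<alpha> \<beta> q x = - kernel_int U K \<alpha> \<beta> (\<lambda>w. g w \<bullet> e) x / \<beta>"
    using \<beta> by (simp add: field_simps)
  have "grad2 (kernel_int U K \<alpha> \<beta> q) x \<bullet> e = frechet_derivative (kernel_int U K \<alpha> \<beta> q) (at x) e"
    by (rule frechet_eq_grad2[OF smooth_kernel_int[OF K iq], symmetric])
  also have "\<dots> = \<alpha> * kernel_int U (\<lambda>y. frechet_derivative K (at y) e) \<alpha> \<beta> q x"
    by (rule frechet_kernel_int[OF K iq e])
  finally show ?thesis unfolding * by simp
qed

section \<open>Mollification on star-shaped sets\<close>

lemma test_fun_integrable_lborel:
  fixes f :: "'a::euclidean_space \<Rightarrow> real"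
  assumes V: "bounded V" "open V" and f: "test_fun V f"
  shows "integrable lborel f"
proof -
  have "integrable (lebesgue_on V) f"
    by (rule integrable_lebesgue_on_continuous[OF V smooth_fun_continuous[OF test_fun_smooth[OF f]]])
  then have "integrable lebesgue (\<lambda>x. indicator V x *\<^sub>R f x)"
    using V(2) by (simp add: integrable_restrict_space)
  moreover have "(\<lambda>x. indicator V x *\<^sub>R f x) = f"
  proof (rule ext)
    show "indicator V x *\<^sub>R f x = f x" for x
      using test_fun_outside[OF f, of x] by (cases "x \<in> V") simp_all
  qed
  ultimately show ?thesis using integrable_completion[of f lborel] test_fun_borel[OF f] by simp
qed

text \<open>A zero integral would make the bump vanish almost everywhere, and the open ball where it
  is positive would be negligible.\<close>

lemma ball_bump_integral_pos:
  fixes c :: "'a::euclidean_space"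
  assumes "r > 0" shows "(LINT y|lborel. ball_bump c r y) > 0"
proof -
  have i: "integrable lborel (ball_bump c r)"
    by (rule test_fun_integrable_lborel[OF _ _ test_ball_bump[OF assms, of c "ball c (2 * r)"]])
       (use assms in auto)
  have "(LINT y|lborel. ball_bump c r y) \<noteq> 0"
  proof
    assume "(LINT y|lborel. ball_bump c r y) = 0"
    then have "AE y in lborel. ball_bump c r y = 0"
      using integral_nonneg_eq_0_iff_AE[OF i] by (simp add: ball_bump_nonneg)
    then have "AE y in lborel. y \<notin> ball c r"
      by eventually_elim (metis ball_bump_pos(2)[OF assms])
    then have "AE y in lebesgue. y \<notin> ball c r" by (rule AE_completion)
    then have "{y \<in> space lebesgue. \<not> (y \<notin> ball c r)} \<in> null_sets lebesgue"
      unfolding completion.AE_iff_null_sets .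
    moreover have "{y \<in> space lebesgue. \<not> (y \<notin> ball c r)} = ball c r" by auto
    ultimately have "negligible (ball c r)" by (simp only: negligible_iff_null_sets)
    then show False using open_not_negligible[of "ball c r"] assms by simp
  qed
  moreover have "0 \<le> (LINT y|lborel. ball_bump c r y)" by (rule integral_nonneg_AE) (simp add: ball_bump_nonneg)
  ultimately show ?thesis by simp
qed

text \<open>Averaging over the dilations of \<^term>\<open>U\<close> towards points of the central ball mollifies and at the
  same time only uses values inside \<^term>\<open>U\<close>, so no extension operator is needed.\<close>

locale star_shaped_about =
  fixes U :: "(real \<times> real) set" and c :: "real \<times> real" and \<rho> :: real
  assumes bounded_U: "bounded U" and open_U: "open U" and rho_pos: "\<rho> > 0" and ball_U: "ball c \<rho> \<subseteq> U"
    and star: "\<And>x y t. x \<in> U \<Longrightarrow> y \<in> ball c \<rho> \<Longrightarrow> 0 \<le> t \<Longrightarrow> t \<le> 1 \<Longrightarrow> (1 - t) *\<^sub>R y + t *\<^sub>R x \<in> U"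
begin

text \<open>Unit mass, and supported in half the radius so that its compact carrier lies inside the
  open central ball.\<close>

definition eta :: "real \<times> real \<Rightarrow> real" where
  "eta y = inverse (LINT y|lborel. ball_bump c (\<rho> / 2) y) * ball_bump c (\<rho> / 2) y"

text \<open>The substitution w = (1 - \<delta>) x + \<delta> y in the average over y:
  \<open>eta\<close> is evaluated at the y belonging to w, and \<delta>^-2 is the Jacobian in the
  plane.\<close>

definition ker :: "real \<Rightarrow> real \<times> real \<Rightarrow> real \<times> real \<Rightarrow> real" where
  "ker \<delta> x w = (1 / \<delta>\<^sup>2) * eta ((- (1 - \<delta>) / \<delta>) *\<^sub>R x + (1 / \<delta>) *\<^sub>R w)"

text \<open>For x in U this is the \<open>eta\<close>-average over y of f((1 - \<delta>) x +
  \<delta> y). Written as a kernel integral it makes sense, and is smooth, on the whole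
  plane.\<close>

definition mollify :: "real \<Rightarrow> (real \<times> real \<Rightarrow> real) \<Rightarrow> real \<times> real \<Rightarrow> real" where
  "mollify \<delta> f x = (1 / \<delta>\<^sup>2) * kernel_int U eta (- (1 - \<delta>) / \<delta>) (1 / \<delta>) f x"

lemma mollify_eq: "mollify \<delta> f x = (LINT w|lebesgue_on U. ker \<delta> x w * f w)"
  unfolding mollify_def kernel_int_def ker_def integral_mult_right_zero[symmetric] by (simp add: mult.assoc)

lemma eta_test: "test_fun (ball c \<rho>) eta"
proof -
  have "test_fun (ball c \<rho>) (ball_bump c (\<rho> / 2))"
    by (rule test_ball_bump) (use rho_pos in auto)
  then show ?thesis unfolding eta_def[abs_def] by (rule test_cmult)
qed

lemma eta_nonneg: "0 \<le> eta y"
  unfolding eta_def using ball_bump_integral_pos[of "\<rho> / 2" c] rho_pos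
  by (intro mult_nonneg_nonneg ball_bump_nonneg) simp

lemma eta_continuous: "continuous_on A eta"
  by (rule smooth_fun_continuous[OF test_fun_smooth[OF eta_test]])

lemma eta_borel[measurable]: "eta \<in> borel_measurable borel"
  by (rule borel_measurable_continuous_onI[OF eta_continuous])

lemma eta_nn_integral: "(\<integral>\<^sup>+y. ennreal (eta y) \<partial>lborel) = 1"
proof -
  have i: "integrable lborel eta" by (rule test_fun_integrable_lborel[OF _ _ eta_test]) auto
  have "(LINT y|lborel. eta y) = 1"
    unfolding eta_def using ball_bump_integral_pos[of "\<rho> / 2" c] rho_pos by simp
  then show ?thesis using nn_integral_eq_integral[OF i] eta_nonneg by simp
qed

lemma ker_nonneg: "0 \<le> ker \<delta> x w"
  by (simp add: ker_def eta_nonneg)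

lemma ker_continuous: "continuous_on UNIV (ker \<delta> x)"
  unfolding ker_def
  by (intro continuous_intros continuous_on_compose2[OF eta_continuous[of UNIV]]) auto

lemma ker_nn_integral:
  assumes "\<delta> > 0" shows "(\<integral>\<^sup>+w. ennreal (ker \<delta> x w) \<partial>lborel) = 1"
proof -
  have "1 = (\<integral>\<^sup>+y. ennreal (eta y) \<partial>lborel)" by (rule eta_nn_integral[symmetric])
  also have "\<dots> = ennreal (\<bar>1 / \<delta>\<bar> ^ DIM(real \<times> real)) * (\<integral>\<^sup>+w. ennreal (eta ((1 / \<delta>) *\<^sub>R w + (- (1 - \<delta>) / \<delta>) *\<^sub>R x)) \<partial>lborel)"
    by (rule nn_integral_lborel_affine) (use assms in auto)
  also have "\<dots> = (\<integral>\<^sup>+w. ennreal (\<bar>1 / \<delta>\<bar> ^ DIM(real \<times> real)) * ennreal (eta ((1 / \<delta>) *\<^sub>R w + (- (1 - \<delta>) / \<delta>) *\<^sub>R x)) \<partial>lborel)"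
    by (rule nn_integral_cmult[symmetric]) measurable
  also have "\<dots> = (\<integral>\<^sup>+w. ennreal (ker \<delta> x w) \<partial>lborel)"
    by (rule nn_integral_cong)
       (simp add: ker_def ennreal_mult'[symmetric] power_divide add.commute eta_nonneg power2_eq_square)
  finally show ?thesis ..
qed

text \<open>As a function of x the kernel has mass (1 - \<delta>)^-2, because x is contracted by the
  factor 1 - \<delta>; the restriction on \<delta> turns this into 4.\<close>

lemma ker_nn_integral_adjoint:
  assumes "\<delta> > 0" "\<delta> \<le> 1/2" shows "(\<integral>\<^sup>+x. ennreal (ker \<delta> x w) \<partial>lborel) \<le> 4"
proof -
  define X where "X = (\<integral>\<^sup>+x. ennreal (eta ((- (1 - \<delta>) / \<delta>) *\<^sub>R x + (1 / \<delta>) *\<^sub>R w)) \<partial>lborel)"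
  have "1 = (\<integral>\<^sup>+y. ennreal (eta y) \<partial>lborel)" by (rule eta_nn_integral[symmetric])
  also have "\<dots> = ennreal (\<bar>- (1 - \<delta>) / \<delta>\<bar> ^ DIM(real \<times> real)) * X"
    unfolding X_def by (rule nn_integral_lborel_affine) (use assms in auto)
  also have "\<bar>- (1 - \<delta>) / \<delta>\<bar> ^ DIM(real \<times> real) = (1 - \<delta>)\<^sup>2 / \<delta>\<^sup>2"
    by (simp add: power_divide power2_eq_square algebra_simps)
  finally have X1: "ennreal ((1 - \<delta>)\<^sup>2 / \<delta>\<^sup>2) * X = 1" by simp
  have "(\<integral>\<^sup>+x. ennreal (ker \<delta> x w) \<partial>lborel) = (\<integral>\<^sup>+x. ennreal (1 / \<delta>\<^sup>2) * ennreal (eta ((- (1 - \<delta>) / \<delta>) *\<^sub>R x + (1 / \<delta>) *\<^sub>R w)) \<partial>lborel)"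
    by (rule nn_integral_cong) (simp add: ker_def ennreal_mult'[symmetric] eta_nonneg)
  also have "\<dots> = ennreal (1 / \<delta>\<^sup>2) * X"
    unfolding X_def by (rule nn_integral_cmult) measurable
  also have "\<dots> \<le> ennreal (4 * ((1 - \<delta>)\<^sup>2 / \<delta>\<^sup>2)) * X"
  proof (intro mult_right_mono ennreal_leI)
    have "(1/2)\<^sup>2 \<le> (1 - \<delta>)\<^sup>2" using assms by (intro power_mono) auto
    then have "1 \<le> 4 * (1 - \<delta>)\<^sup>2" by (simp add: power2_eq_square)
    then show "1 / \<delta>\<^sup>2 \<le> 4 * ((1 - \<delta>)\<^sup>2 / \<delta>\<^sup>2)" by (simp add: divide_right_mono)
  qed simp
  also have "\<dots> = 4 * (ennreal ((1 - \<delta>)\<^sup>2 / \<delta>\<^sup>2) * X)"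
    by (subst ennreal_mult) (simp_all add: mult.assoc)
  finally show ?thesis by (simp add: X1)
qed

lemma ker_support:
  assumes "\<delta> > 0" "ker \<delta> x w \<noteq> 0"
  obtains y where "y \<in> ball c \<rho>" "w = (1 - \<delta>) *\<^sub>R x + \<delta> *\<^sub>R y"
proof
  define y where "y = (- (1 - \<delta>) / \<delta>) *\<^sub>R x + (1 / \<delta>) *\<^sub>R w"
  have "eta y \<noteq> 0" using assms by (simp add: ker_def y_def)
  then show "y \<in> ball c \<rho>" using test_fun_outside[OF eta_test] by blast
  have "\<delta> *\<^sub>R y = (- (1 - \<delta>)) *\<^sub>R x + w"
    using assms(1) by (simp add: y_def scaleR_add_right)
  then show "w = (1 - \<delta>) *\<^sub>R x + \<delta> *\<^sub>R y" by (simp add: algebra_simps)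
qed

lemma dilate_in_U:
  assumes "x \<in> U" "0 < \<delta>" "\<delta> < 1" "(- (1 - \<delta>) / \<delta>) *\<^sub>R x + (1 / \<delta>) *\<^sub>R w \<in> ball c \<rho>"
  shows "w \<in> U"
proof -
  define y where "y = (- (1 - \<delta>) / \<delta>) *\<^sub>R x + (1 / \<delta>) *\<^sub>R w"
  have "\<delta> *\<^sub>R y = (- (1 - \<delta>)) *\<^sub>R x + w"
    using assms(2) by (simp add: y_def scaleR_add_right)
  then have "w = (1 - (1 - \<delta>)) *\<^sub>R y + (1 - \<delta>) *\<^sub>R x" by (simp add: algebra_simps)
  also have "\<dots> \<in> U" by (rule star) (use assms in \<open>auto simp: y_def\<close>)
  finally show ?thesis .
qed

text \<open>For x in U the kernel is supported inside U, so integrating over U loses no mass. For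
  other x only the upper bound one survives.\<close>

lemma ker_integral:
  assumes x: "x \<in> U" and d: "0 < \<delta>" "\<delta> < 1"
  shows "(LINT w|lebesgue_on U. ker \<delta> x w) = 1"
proof -
  have m: "ker \<delta> x \<in> borel_measurable borel" by (rule borel_measurable_continuous_onI[OF ker_continuous])
  have "(LINT w|lebesgue_on U. ker \<delta> x w) = (LINT w|lborel. ker \<delta> x w)"
  proof (rule integral_lebesgue_on_eq_lborel[OF open_U m])
    fix w assume "w \<notin> U"
    then have "(- (1 - \<delta>) / \<delta>) *\<^sub>R x + (1 / \<delta>) *\<^sub>R w \<notin> ball c \<rho>"
      using dilate_in_U[OF x d] by blast
    then show "ker \<delta> x w = 0" by (simp add: ker_def test_fun_outside[OF eta_test])
  qed
  also have "\<dots> = 1"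
    using integral_eq_nn_integral[of "ker \<delta> x" lborel] m ker_nonneg ker_nn_integral[OF d(1)] by simp
  finally show ?thesis .
qed

lemma ker_integral_le:
  assumes "0 < \<delta>" shows "(LINT w|lebesgue_on U. ker \<delta> x w) \<le> 1"
proof -
  have "ennreal (LINT w|lebesgue_on U. ker \<delta> x w) = (\<integral>\<^sup>+w. ennreal (ker \<delta> x w) * indicator U w \<partial>lborel)"
    by (rule nn_integral_lebesgue_on[OF open_U integrable_lebesgue_on_continuous[OF bounded_U open_U ker_continuous] ker_nonneg])
  also have "\<dots> \<le> (\<integral>\<^sup>+w. ennreal (ker \<delta> x w) \<partial>lborel)"
    by (rule nn_integral_mono) (simp add: indicator_def)
  also have "\<dots> = ennreal 1" using ker_nn_integral[OF assms] by simp
  finally show ?thesis by (subst (asm) ennreal_le_iff) auto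
qed

lemma sqi_ker_mult:
  fixes f :: "real \<times> real \<Rightarrow> real"
  assumes "sq_integrable (lebesgue_on U) f"
  shows "sq_integrable (lebesgue_on U) (\<lambda>w. sqrt (ker \<delta> x w) * f w)"
    and "integrable (lebesgue_on U) (\<lambda>w. ker \<delta> x w * (f w)\<^sup>2)"
proof -
  have "continuous_on UNIV (\<lambda>w. sqrt (ker \<delta> x w))" by (intro continuous_on_real_sqrt ker_continuous)
  from sqi_continuous_scaleR[OF bounded_U this assms]
  show 1: "sq_integrable (lebesgue_on U) (\<lambda>w. sqrt (ker \<delta> x w) * f w)" by simp
  show "integrable (lebesgue_on U) (\<lambda>w. ker \<delta> x w * (f w)\<^sup>2)"
    using sqi_int[OF 1] by (simp add: power_mult_distrib ker_nonneg)
qed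

text \<open>Jensen for a kernel of mass at most one: split it into two square roots and apply
  Cauchy-Schwarz.\<close>

lemma mollify_sq_le:
  assumes f: "sq_integrable (lebesgue_on U) f" and d: "0 < \<delta>"
  shows "(mollify \<delta> f x)\<^sup>2 \<le> (LINT w|lebesgue_on U. ker \<delta> x w * (f w)\<^sup>2)"
proof -
  have sk: "sq_integrable (lebesgue_on U) (\<lambda>w. sqrt (ker \<delta> x w))"
    by (intro sqi_continuous bounded_U open_U continuous_on_real_sqrt ker_continuous)
  have "(mollify \<delta> f x)\<^sup>2 = (LINT w|lebesgue_on U. sqrt (ker \<delta> x w) \<bullet> (sqrt (ker \<delta> x w) * f w))\<^sup>2"
    by (simp add: mollify_eq mult.assoc[symmetric] ker_nonneg)
  also have "\<dots> \<le> sqnorm (lebesgue_on U) (\<lambda>w. sqrt (ker \<delta> x w)) * sqnorm (lebesgue_on U) (\<lambda>w. sqrt (ker \<delta> x w) * f w)"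
    by (rule L2_Cauchy_Schwarz[OF sk sqi_ker_mult(1)[OF f]])
  also have "\<dots> \<le> 1 * sqnorm (lebesgue_on U) (\<lambda>w. sqrt (ker \<delta> x w) * f w)"
    by (rule mult_right_mono) (use ker_integral_le[OF d] in \<open>simp_all add: sqnorm_def ker_nonneg\<close>)
  also have "\<dots> = (LINT w|lebesgue_on U. ker \<delta> x w * (f w)\<^sup>2)"
    by (simp add: sqnorm_def power_mult_distrib ker_nonneg)
  finally show ?thesis .
qed

lemma sqi_integrable_U: "sq_integrable (lebesgue_on U) f \<Longrightarrow> integrable (lebesgue_on U) f"
  by (rule sqi_imp_integrable[OF finite_measure_lebesgue_on_bounded[OF bounded_U open_U]])

lemma mollify_smooth:
  assumes "integrable (lebesgue_on U) f" shows "smooth_fun (mollify \<delta> f)"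
  unfolding mollify_def[abs_def] by (rule smooth_cmult[OF smooth_kernel_int[OF eta_test assms]])

lemma mollify_sqi:
  assumes "sq_integrable (lebesgue_on U) f" shows "sq_integrable (lebesgue_on U) (mollify \<delta> f)"
  by (rule sqi_continuous[OF bounded_U open_U smooth_fun_continuous[OF mollify_smooth[OF sqi_integrable_U[OF assms]]]])

text \<open>Schur's test with mass at most one in w and at most 4 in x. The Borel hypothesis is
  there for the exchange of integrals.\<close>

lemma mollify_bound_borel:
  assumes f: "sq_integrable (lebesgue_on U) f" and fb[measurable]: "f \<in> borel_measurable borel"
    and d: "0 < \<delta>" "\<delta> \<le> 1/2"
  shows "sqnorm (lebesgue_on U) (mollify \<delta> f) \<le> 4 * sqnorm (lebesgue_on U) f"
proof -
  have [measurable]: "U \<in> sets borel" using open_U by simp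
  have "ennreal (sqnorm (lebesgue_on U) (mollify \<delta> f)) = (\<integral>\<^sup>+x. ennreal ((mollify \<delta> f x)\<^sup>2) * indicator U x \<partial>lborel)"
    unfolding sqnorm_def real_norm_def power2_abs
    by (rule nn_integral_lebesgue_on[OF open_U]) (use sqi_int[OF mollify_sqi[OF f]] in simp_all)
  also have "\<dots> \<le> (\<integral>\<^sup>+x. \<integral>\<^sup>+w. ennreal (ker \<delta> x w) * (ennreal ((f w)\<^sup>2) * indicator U w) \<partial>lborel \<partial>lborel)"
  proof (rule nn_integral_mono)
    fix x
    have "ennreal ((mollify \<delta> f x)\<^sup>2) * indicator U x \<le> ennreal ((mollify \<delta> f x)\<^sup>2)"
      by (simp add: indicator_def)
    also have "\<dots> \<le> ennreal (LINT w|lebesgue_on U. ker \<delta> x w * (f w)\<^sup>2)"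
      by (rule ennreal_leI[OF mollify_sq_le[OF f d(1)]])
    also have "\<dots> = (\<integral>\<^sup>+w. ennreal (ker \<delta> x w * (f w)\<^sup>2) * indicator U w \<partial>lborel)"
      by (rule nn_integral_lebesgue_on[OF open_U sqi_ker_mult(2)[OF f]]) (simp add: ker_nonneg)
    also have "\<dots> = (\<integral>\<^sup>+w. ennreal (ker \<delta> x w) * (ennreal ((f w)\<^sup>2) * indicator U w) \<partial>lborel)"
      by (rule nn_integral_cong) (simp add: ennreal_mult' ker_nonneg mult.assoc)
    finally show "ennreal ((mollify \<delta> f x)\<^sup>2) * indicator U x \<le> (\<integral>\<^sup>+w. ennreal (ker \<delta> x w) * (ennreal ((f w)\<^sup>2) * indicator U w) \<partial>lborel)" .
  qed
  also have "\<dots> = (\<integral>\<^sup>+w. \<integral>\<^sup>+x. ennreal (ker \<delta> x w) * (ennreal ((f w)\<^sup>2) * indicator U w) \<partial>lborel \<partial>lborel)"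
    unfolding ker_def by (rule lborel_pair.Fubini'[symmetric]) measurable
  also have "\<dots> = (\<integral>\<^sup>+w. (\<integral>\<^sup>+x. ennreal (ker \<delta> x w) \<partial>lborel) * (ennreal ((f w)\<^sup>2) * indicator U w) \<partial>lborel)"
    unfolding ker_def by (intro nn_integral_cong nn_integral_multc) measurable
  also have "\<dots> \<le> (\<integral>\<^sup>+w. 4 * (ennreal ((f w)\<^sup>2) * indicator U w) \<partial>lborel)"
    by (intro nn_integral_mono mult_right_mono ker_nn_integral_adjoint d) simp
  also have "\<dots> = 4 * (\<integral>\<^sup>+w. ennreal ((f w)\<^sup>2) * indicator U w \<partial>lborel)"
    by (rule nn_integral_cmult) measurable
  also have "(\<integral>\<^sup>+w. ennreal ((f w)\<^sup>2) * indicator U w \<partial>lborel) = ennreal (sqnorm (lebesgue_on U) f)"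
    unfolding sqnorm_def real_norm_def power2_abs
    by (rule nn_integral_lebesgue_on[OF open_U, symmetric]) (use sqi_int[OF f] in simp_all)
  also have "4 * ennreal (sqnorm (lebesgue_on U) f) = ennreal (4 * sqnorm (lebesgue_on U) f)"
    by (simp add: ennreal_mult')
  finally show ?thesis using sqnorm_nonneg[of "lebesgue_on U" f] by (subst (asm) ennreal_le_iff) auto
qed

lemma mollify_bound:
  assumes f: "sq_integrable (lebesgue_on U) f" and d: "0 < \<delta>" "\<delta> \<le> 1/2"
  shows "sqnorm (lebesgue_on U) (mollify \<delta> f) \<le> 4 * sqnorm (lebesgue_on U) f"
proof -
  obtain g where g: "g \<in> borel_measurable borel" "AE x in lebesgue_on U. f x = g x"
    using lebesgue_on_borel_version[OF sqi_meas[OF f]] open_U by auto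
  have gm: "g \<in> borel_measurable (lebesgue_on U)" by (rule borel_imp_lebesgue_on[OF g(1)])
  have gs: "sq_integrable (lebesgue_on U) g" by (rule sqi_AE_cong[OF f gm g(2)])
  have "mollify \<delta> f = mollify \<delta> g"
  proof (rule ext)
    fix x
    have km: "ker \<delta> x \<in> borel_measurable (lebesgue_on U)" by (rule continuous_imp_lebesgue_on[OF ker_continuous])
    show "mollify \<delta> f x = mollify \<delta> g x"
      unfolding mollify_eq
    proof (rule integral_cong_AE)
      show "(\<lambda>w. ker \<delta> x w * f w) \<in> borel_measurable (lebesgue_on U)"
        by (rule borel_measurable_times[OF km sqi_meas[OF f]])
      show "(\<lambda>w. ker \<delta> x w * g w) \<in> borel_measurable (lebesgue_on U)"
        by (rule borel_measurable_times[OF km gm])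
      show "AE w in lebesgue_on U. ker \<delta> x w * f w = ker \<delta> x w * g w" using g(2) by eventually_elim simp
    qed
  qed
  moreover have "sqnorm (lebesgue_on U) f = sqnorm (lebesgue_on U) g"
    by (rule sqnorm_cong_AE[OF f gs g(2)])
  ultimately show ?thesis using mollify_bound_borel[OF gs g(1) d] by simp
qed

lemma integrable_ker_mult:
  assumes "sq_integrable (lebesgue_on U) f"
  shows "integrable (lebesgue_on U) (\<lambda>w. ker \<delta> x w * f w)"
  using sqi_inner[OF sqi_continuous[OF bounded_U open_U ker_continuous] assms, of \<delta> x] by simp

lemma mollify_diff:
  assumes "sq_integrable (lebesgue_on U) f" "sq_integrable (lebesgue_on U) g"
  shows "mollify \<delta> (\<lambda>x. f x - g x) x = mollify \<delta> f x - mollify \<delta> g x"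
  using integrable_ker_mult[OF assms(1)] integrable_ker_mult[OF assms(2)]
  by (simp add: mollify_eq right_diff_distrib)

text \<open>Points seen by the kernel satisfy w - x = \<delta> (y - x) with y in the central ball,
  so a Lipschitz function changes by O(\<delta>).\<close>

lemma mollify_test_error:
  assumes t: "test_fun V \<psi>"
  obtains C where "C \<ge> 0" "\<And>\<delta> x. 0 < \<delta> \<Longrightarrow> \<delta> < 1 \<Longrightarrow> x \<in> U \<Longrightarrow> \<bar>mollify \<delta> \<psi> x - \<psi> x\<bar> \<le> C * \<delta>"
proof -
  obtain L where L: "L \<ge> 0" "\<And>x y. \<bar>\<psi> x - \<psi> y\<bar> \<le> L * norm (x - y)" using test_fun_lipschitz[OF t] by metis
  obtain d where d: "\<And>x y. x \<in> U \<Longrightarrow> y \<in> ball c \<rho> \<Longrightarrow> norm (x - y) \<le> d"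
    using bounded_two_sets_norm_diff[OF bounded_U bounded_ball[of c \<rho>]] by blast
  have c\<psi>: "continuous_on UNIV \<psi>" by (rule smooth_fun_continuous[OF test_fun_smooth[OF t]])
  have ik: "integrable (lebesgue_on U) (\<lambda>w. ker \<delta> x w * g w)" if "continuous_on UNIV g" for g \<delta> x
    by (rule integrable_ker_mult[OF sqi_continuous[OF bounded_U open_U that]])
  have "\<bar>mollify \<delta> \<psi> x - \<psi> x\<bar> \<le> L * \<bar>d\<bar> * \<delta>" if \<delta>: "0 < \<delta>" "\<delta> < 1" and x: "x \<in> U" for \<delta> x
  proof -
    have "\<psi> x = (LINT w|lebesgue_on U. ker \<delta> x w * \<psi> x)" by (simp add: ker_integral[OF x \<delta>])
    then have "mollify \<delta> \<psi> x - \<psi> x = (LINT w|lebesgue_on U. ker \<delta> x w * \<psi> w) - (LINT w|lebesgue_on U. ker \<delta> x w * \<psi> x)"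
      by (simp add: mollify_eq)
    also have "\<dots> = (LINT w|lebesgue_on U. ker \<delta> x w * \<psi> w - ker \<delta> x w * \<psi> x)"
      by (rule Bochner_Integration.integral_diff[symmetric]; rule ik) (simp_all add: c\<psi>)
    also have "\<bar>\<dots>\<bar> \<le> (LINT w|lebesgue_on U. \<bar>ker \<delta> x w * \<psi> w - ker \<delta> x w * \<psi> x\<bar>)" by (rule integral_abs_bound)
    also have "\<dots> \<le> (LINT w|lebesgue_on U. ker \<delta> x w * (L * \<bar>d\<bar> * \<delta>))"
    proof (rule integral_mono)
      show "integrable (lebesgue_on U) (\<lambda>w. \<bar>ker \<delta> x w * \<psi> w - ker \<delta> x w * \<psi> x\<bar>)"
        by (intro integrable_abs Bochner_Integration.integrable_diff ik c\<psi> continuous_on_const)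
      show "integrable (lebesgue_on U) (\<lambda>w. ker \<delta> x w * (L * \<bar>d\<bar> * \<delta>))" by (rule ik) simp
      fix w
      show "\<bar>ker \<delta> x w * \<psi> w - ker \<delta> x w * \<psi> x\<bar> \<le> ker \<delta> x w * (L * \<bar>d\<bar> * \<delta>)"
      proof (cases "ker \<delta> x w = 0")
        case False
        obtain y where y: "y \<in> ball c \<rho>" "w = (1 - \<delta>) *\<^sub>R x + \<delta> *\<^sub>R y" by (rule ker_support[OF \<delta>(1) False])
        have "w - x = \<delta> *\<^sub>R (y - x)" by (simp add: y(2) algebra_simps)
        then have "norm (w - x) = \<delta> * norm (x - y)" using \<delta> by (simp add: norm_minus_commute)
        also have "\<dots> \<le> \<delta> * \<bar>d\<bar>" using d[OF x y(1)] \<delta> by (intro mult_left_mono) auto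
        finally have "L * norm (w - x) \<le> L * (\<delta> * \<bar>d\<bar>)" using L(1) by (rule mult_left_mono)
        then have "\<bar>\<psi> w - \<psi> x\<bar> \<le> L * \<bar>d\<bar> * \<delta>" using L(2)[of w x] by (simp add: mult_ac)
        then have "ker \<delta> x w * \<bar>\<psi> w - \<psi> x\<bar> \<le> ker \<delta> x w * (L * \<bar>d\<bar> * \<delta>)" using ker_nonneg by (rule mult_left_mono)
        then show ?thesis by (simp add: right_diff_distrib[symmetric] abs_mult ker_nonneg)
      qed simp
    qed
    also have "\<dots> = L * \<bar>d\<bar> * \<delta>" by (simp add: ker_integral[OF x \<delta>])
    finally show ?thesis .
  qed
  then show thesis using L(1) that[of "L * \<bar>d\<bar>"] by simp
qed

lemma mollify_test_tendsto:
  assumes t: "test_fun V \<psi>" and \<delta>: "\<And>n. 0 < \<delta> n" "\<And>n. \<delta> n < 1" "\<delta> \<longlonglongrightarrow> 0"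
  shows "(\<lambda>n. sqnorm (lebesgue_on U) (\<lambda>x. mollify (\<delta> n) \<psi> x - \<psi> x)) \<longlonglongrightarrow> 0"
proof -
  obtain C where C: "C \<ge> 0" "\<And>\<delta> x. 0 < \<delta> \<Longrightarrow> \<delta> < 1 \<Longrightarrow> x \<in> U \<Longrightarrow> \<bar>mollify \<delta> \<psi> x - \<psi> x\<bar> \<le> C * \<delta>"
    by (rule mollify_test_error[OF t]; rule that; assumption)
  have c\<psi>: "continuous_on UNIV \<psi>" by (rule smooth_fun_continuous[OF test_fun_smooth[OF t]])
  have s\<psi>: "sq_integrable (lebesgue_on U) \<psi>" by (rule sqi_continuous[OF bounded_U open_U c\<psi>])
  have le: "sqnorm (lebesgue_on U) (\<lambda>x. mollify (\<delta> n) \<psi> x - \<psi> x) \<le> (C * \<delta> n)\<^sup>2 * measure lebesgue U" for n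
  proof -
    have "sqnorm (lebesgue_on U) (\<lambda>x. mollify (\<delta> n) \<psi> x - \<psi> x) \<le> sqnorm (lebesgue_on U) (\<lambda>x. C * \<delta> n)"
      unfolding sqnorm_def
    proof (rule integral_mono)
      show "integrable (lebesgue_on U) (\<lambda>x. (norm (mollify (\<delta> n) \<psi> x - \<psi> x))\<^sup>2)"
        by (rule sqi_int[OF sqi_diff[OF mollify_sqi[OF s\<psi>] s\<psi>]])
      show "integrable (lebesgue_on U) (\<lambda>x. (norm (C * \<delta> n))\<^sup>2)"
        by (rule integrable_lebesgue_on_continuous[OF bounded_U open_U]) simp
      fix x assume "x \<in> space (lebesgue_on U)"
      then have "\<bar>mollify (\<delta> n) \<psi> x - \<psi> x\<bar> \<le> C * \<delta> n" using C(2)[OF \<delta>(1,2)] by simp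
      then show "(norm (mollify (\<delta> n) \<psi> x - \<psi> x))\<^sup>2 \<le> (norm (C * \<delta> n))\<^sup>2"
        by (intro power_mono) auto
    qed
    also have "\<dots> = (C * \<delta> n)\<^sup>2 * measure lebesgue U" by (rule sqnorm_const[OF bounded_U open_U])
    finally show ?thesis .
  qed
  have "(\<lambda>n. (C * \<delta> n)\<^sup>2 * measure lebesgue U) \<longlonglongrightarrow> (C * 0)\<^sup>2 * measure lebesgue U"
    by (intro tendsto_intros \<delta>(3))
  then have lim: "(\<lambda>n. (C * \<delta> n)\<^sup>2 * measure lebesgue U) \<longlonglongrightarrow> 0" by simp
  show ?thesis
    by (rule tendsto_sandwich[OF _ _ tendsto_const lim]) (simp_all add: sqnorm_nonneg le)
qed

text \<open>Uniform boundedness of the mollifiers together with convergence on the dense set of test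
  functions.\<close>

lemma mollify_tendsto:
  assumes f: "sq_integrable (lebesgue_on U) f" and \<delta>: "\<And>n. 0 < \<delta> n" "\<And>n. \<delta> n \<le> 1/2" "\<delta> \<longlonglongrightarrow> 0"
  shows "(\<lambda>n. sqnorm (lebesgue_on U) (\<lambda>x. mollify (\<delta> n) f x - f x)) \<longlonglongrightarrow> 0"
proof (rule LIMSEQ_I)
  fix e :: real assume e: "e > 0"
  let ?M = "lebesgue_on U"
  obtain \<psi> where \<psi>: "\<And>n. test_fun U (\<psi> n)" "(\<lambda>n. sqnorm ?M (\<lambda>x. \<psi> n x - f x)) \<longlonglongrightarrow> 0"
    by (rule test_functions_dense[OF bounded_U open_U f]; rule that; assumption)
  \<comment> \<open>Two triangle inequalities and the bound 4 give 2 * 4 * e/40 + 4 * e/8 + 4 *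
    e/40, which is 4e/5.\<close>
  have "\<forall>\<^sub>F n in sequentially. sqnorm ?M (\<lambda>x. \<psi> n x - f x) < e / 40"
    using order_tendstoD(2)[OF \<psi>(2), of "e / 40"] e by simp
  then obtain m where m: "sqnorm ?M (\<lambda>x. \<psi> m x - f x) < e / 40"
    using eventually_happens[of _ sequentially] by auto
  have s\<psi>: "sq_integrable ?M (\<psi> m)" by (rule test_sqi[OF bounded_U open_U \<psi>(1)])
  have \<delta>1: "\<delta> n < 1" for n using \<delta>(2)[of n] by simp
  have "\<forall>\<^sub>F n in sequentially. sqnorm ?M (\<lambda>x. mollify (\<delta> n) (\<psi> m) x - \<psi> m x) < e / 8"
    using order_tendstoD(2)[OF mollify_test_tendsto[OF \<psi>(1) \<delta>(1) \<delta>1 \<delta>(3)], of "e / 8"] e by simp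
  then obtain N where N: "\<And>n. n \<ge> N \<Longrightarrow> sqnorm ?M (\<lambda>x. mollify (\<delta> n) (\<psi> m) x - \<psi> m x) < e / 8"
    unfolding eventually_sequentially by blast
  have "norm (sqnorm ?M (\<lambda>x. mollify (\<delta> n) f x - f x) - 0) < e" if "n \<ge> N" for n
  proof -
    have sm: "sq_integrable ?M (mollify (\<delta> n) f)" "sq_integrable ?M (mollify (\<delta> n) (\<psi> m))"
      by (rule mollify_sqi[OF f] mollify_sqi[OF s\<psi>])+
    have 1: "sqnorm ?M (\<lambda>x. mollify (\<delta> n) f x - f x)
        \<le> 2 * sqnorm ?M (\<lambda>x. mollify (\<delta> n) f x - mollify (\<delta> n) (\<psi> m) x) + 2 * sqnorm ?M (\<lambda>x. mollify (\<delta> n) (\<psi> m) x - f x)"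
      by (rule sqnorm_triangle[OF sm(1) sm(2) f])
    have 2: "sqnorm ?M (\<lambda>x. mollify (\<delta> n) (\<psi> m) x - f x)
        \<le> 2 * sqnorm ?M (\<lambda>x. mollify (\<delta> n) (\<psi> m) x - \<psi> m x) + 2 * sqnorm ?M (\<lambda>x. \<psi> m x - f x)"
      by (rule sqnorm_triangle[OF sm(2) s\<psi> f])
    have "sqnorm ?M (\<lambda>x. mollify (\<delta> n) f x - mollify (\<delta> n) (\<psi> m) x) = sqnorm ?M (mollify (\<delta> n) (\<lambda>x. f x - \<psi> m x))"
      by (simp add: sqnorm_def mollify_diff[OF f s\<psi>])
    also have "\<dots> \<le> 4 * sqnorm ?M (\<lambda>x. f x - \<psi> m x)"
      by (rule mollify_bound[OF sqi_diff[OF f s\<psi>] \<delta>(1,2)])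
    also have "sqnorm ?M (\<lambda>x. f x - \<psi> m x) = sqnorm ?M (\<lambda>x. \<psi> m x - f x)" by (rule sqnorm_minus_commute)
    finally show ?thesis using 1 2 m N[OF that] sqnorm_nonneg[of ?M "\<lambda>x. mollify (\<delta> n) f x - f x"] by simp
  qed
  then show "\<exists>N. \<forall>n\<ge>N. norm (sqnorm ?M (\<lambda>x. mollify (\<delta> n) f x - f x) - 0) < e" by blast
qed

text \<open>Averaging f((1 - \<delta>) x + \<delta> y) and differentiating in x produces the inner
  factor 1 - \<delta>; otherwise the weak gradient is just averaged.\<close>

lemma grad2_mollify:
  assumes q: "sq_integrable (lebesgue_on U) q" and g: "sq_integrable (lebesgue_on U) g" and w: "is_weak_grad U q g"
    and x: "x \<in> U" and \<delta>: "0 < \<delta>" "\<delta> < 1" and e: "e \<in> Basis"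
  shows "grad2 (mollify \<delta> q) x \<bullet> e = (1 - \<delta>) * mollify \<delta> (\<lambda>w. g w \<bullet> e) x"
proof -
  have b: "1 / \<delta> \<noteq> 0" using \<delta> by simp
  have "grad2 (mollify \<delta> q) x \<bullet> e = (1 / \<delta>\<^sup>2) * (grad2 (kernel_int U eta (- (1 - \<delta>) / \<delta>) (1 / \<delta>) q) x \<bullet> e)"
    unfolding mollify_def[abs_def] grad2_cmult[OF smooth_kernel_int[OF eta_test sqi_integrable_U[OF q]]] by simp
  also have "grad2 (kernel_int U eta (- (1 - \<delta>) / \<delta>) (1 / \<delta>) q) x \<bullet> e
      = - ((- (1 - \<delta>) / \<delta>) / (1 / \<delta>)) * kernel_int U eta (- (1 - \<delta>) / \<delta>) (1 / \<delta>) (\<lambda>w. g w \<bullet> e) x"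
    by (rule grad2_kernel_int[OF bounded_U open_U eta_test b q g w dilate_in_U[OF x \<delta>] e])
  also have "- ((- (1 - \<delta>) / \<delta>) / (1 / \<delta>)) = 1 - \<delta>" using \<delta> by simp
  finally show ?thesis unfolding mollify_def[of \<delta> "\<lambda>w. g w \<bullet> e" x] by (simp only: mult.left_commute)
qed

end

section \<open>Gradients are orthogonal to weakly solenoidal fields\<close>

text \<open>The mollified cut-off potential is smooth on the whole plane and vanishes near the part
  of D outside the star-shaped piece, so the hypothesis on \<open>a\<close> applies and reduces to
  an integral over the piece. There its gradient is (1 - \<delta>) times the mollified gradient, and
  \<delta> tends to zero.\<close>

lemma cut_off_gradient_orthogonal:
  fixes D :: "(real \<times> real) set"
  assumes D: "bounded D" "open D" and r: "r > 0" and st: "star_region (D \<inter> ball p (2 * r))"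
    and \<zeta>: "smooth_fun \<zeta>" "\<And>x. x \<notin> cball p r \<Longrightarrow> \<zeta> x = 0"
    and a: "sq_integrable (lebesgue_on D) a"
    and a0: "\<And>\<phi>. smooth_fun \<phi> \<Longrightarrow> (LINT x|lebesgue_on D. a x \<bullet> grad2 \<phi> x) = 0"
    and q: "sq_integrable (lebesgue_on D) q" and g: "sq_integrable (lebesgue_on D) g" and w: "is_weak_grad D q g"
  shows "(LINT x|lebesgue_on D. a x \<bullet> (\<zeta> x *\<^sub>R g x + q x *\<^sub>R grad2 \<zeta> x)) = 0"
proof -
  define U where "U = D \<inter> ball p (2 * r)"
  have UD: "U \<subseteq> D" and oU: "open U" using D by (auto simp: U_def)
  obtain c \<rho> where c: "\<rho> > 0" "ball c \<rho> \<subseteq> U"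
    "\<And>x y t. x \<in> U \<Longrightarrow> y \<in> ball c \<rho> \<Longrightarrow> 0 \<le> t \<Longrightarrow> t \<le> 1 \<Longrightarrow> (1 - t) *\<^sub>R y + t *\<^sub>R x \<in> U"
    using st unfolding star_region_def U_def[symmetric] by blast
  interpret star_shaped_about U c \<rho>
    by unfold_locales (use D c oU in \<open>auto simp: U_def\<close>)
  define Q where "Q x = \<zeta> x * q x" for x
  define G where "G x = \<zeta> x *\<^sub>R g x + q x *\<^sub>R grad2 \<zeta> x" for x
  note m = weak_grad_mult[OF D \<zeta>(1) q g w, folded Q_def G_def]
  have QU: "sq_integrable (lebesgue_on U) Q" "sq_integrable (lebesgue_on U) G" "is_weak_grad U Q G"
    by (rule sqi_restrict[OF UD oU D(2) m(1)] sqi_restrict[OF UD oU D(2) m(2)] weak_grad_restrict[OF D(2) oU UD m(3)])+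
  have aU: "sq_integrable (lebesgue_on U) a" by (rule sqi_restrict[OF UD oU D(2) a])
  let ?e1 = "(1, 0) :: real \<times> real" and ?e2 = "(0, 1) :: real \<times> real"
  have basis: "?e1 \<in> Basis" "?e2 \<in> Basis" by (auto simp: Basis_prod_def)
  have inner2: "x \<bullet> y = (y \<bullet> ?e1) \<bullet> (x \<bullet> ?e1) + (y \<bullet> ?e2) \<bullet> (x \<bullet> ?e2)" for x y :: "real \<times> real"
    by (simp add: inner_prod_def)
  \<comment> \<open>The shift by 12 keeps every parameter below 1/12, as the support estimate for
    the mollified function requires.\<close>
  define \<delta> where "\<delta> n = inverse (real (Suc (n + 12)))" for n
  have "(\<lambda>n. inverse (real (Suc (n + 12)))) \<longlonglongrightarrow> 0"
    using LIMSEQ_ignore_initial_segment[OF LIMSEQ_inverse_real_of_nat, of 12] by simp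
  then have \<delta>lim: "\<delta> \<longlonglongrightarrow> 0" by (simp add: \<delta>_def[abs_def])
  have \<delta>: "0 < \<delta> n" "\<delta> n < 1/12" for n
    by (simp_all add: \<delta>_def field_simps)
  have \<delta>': "\<delta> n < 1" "\<delta> n \<le> 1/2" for n using \<delta>(2)[of n] by linarith+
  \<comment> \<open>A point w seen from z satisfies |w - p| >= (1 - \<delta>) 3r/2 - 2r \<delta> =
    3r/2 - (7/2) \<delta> r. With \<delta> < 1/12 this exceeds r, where \<zeta> is zero.\<close>
  have vanish: "mollify (\<delta> n) Q z = 0" if z: "z \<in> - cball p (3 * r / 2)" for n z
  proof -
    have kz: "ker (\<delta> n) z w * Q w = 0" for w
    proof (cases "ker (\<delta> n) z w = 0")
      case False
      obtain y where y: "y \<in> ball c \<rho>" "w = (1 - \<delta> n) *\<^sub>R z + \<delta> n *\<^sub>R y" by (rule ker_support[OF \<delta>(1) False])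
      have "y \<in> ball p (2 * r)" using y(1) c(2) by (auto simp: U_def)
      then have ny: "norm (y - p) < 2 * r" by (simp add: dist_norm norm_minus_commute)
      have nz: "norm (z - p) > 3 * r / 2" using z by (simp add: dist_norm norm_minus_commute)
      have "w - p = (1 - \<delta> n) *\<^sub>R (z - p) + \<delta> n *\<^sub>R (y - p)" by (simp add: y(2) algebra_simps)
      then have "norm (w - p) \<ge> norm ((1 - \<delta> n) *\<^sub>R (z - p)) - norm (\<delta> n *\<^sub>R (y - p))"
        by (metis norm_diff_ineq)
      then have 1: "norm (w - p) \<ge> (1 - \<delta> n) * norm (z - p) - \<delta> n * norm (y - p)"
        using \<delta>(1)[of n] \<delta>'(1)[of n] by simp
      have 2: "(1 - \<delta> n) * norm (z - p) \<ge> (1 - \<delta> n) * (3 * r / 2)"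
        using nz \<delta>'(1)[of n] by (intro mult_left_mono) auto
      have 3: "\<delta> n * norm (y - p) \<le> \<delta> n * (2 * r)" using ny \<delta>(1)[of n] by (intro mult_left_mono) auto
      have 4: "\<delta> n * r < 1/12 * r" using \<delta>(2)[of n] r by (rule mult_strict_right_mono)
      have "(1 - \<delta> n) * (3 * r / 2) - \<delta> n * (2 * r) = 3 * r / 2 - 7/2 * (\<delta> n * r)" by (simp add: field_simps)
      then have "norm (w - p) > r" using 1 2 3 4 r by linarith
      then have "w \<notin> cball p r" by (simp add: dist_norm norm_minus_commute)
      then show ?thesis by (simp add: Q_def \<zeta>(2))
    qed simp
    show ?thesis unfolding mollify_eq kz by simp
  qed
  have zero: "(LINT x|lebesgue_on U. mollify (\<delta> n) (\<lambda>w. G w \<bullet> ?e1) x \<bullet> (a x \<bullet> ?e1)) +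
      (LINT x|lebesgue_on U. mollify (\<delta> n) (\<lambda>w. G w \<bullet> ?e2) x \<bullet> (a x \<bullet> ?e2)) = 0" for n
  proof -
    let ?m1 = "mollify (\<delta> n) (\<lambda>w. G w \<bullet> ?e1)" and ?m2 = "mollify (\<delta> n) (\<lambda>w. G w \<bullet> ?e2)"
    have sF: "smooth_fun (mollify (\<delta> n) Q)" by (rule mollify_smooth[OF sqi_integrable_U[OF QU(1)]])
    have i1: "integrable (lebesgue_on U) (\<lambda>x. ?m1 x \<bullet> (a x \<bullet> ?e1))"
      by (intro sqi_inner mollify_sqi sqi_inner_const QU aU)
    have i2: "integrable (lebesgue_on U) (\<lambda>x. ?m2 x \<bullet> (a x \<bullet> ?e2))"
      by (intro sqi_inner mollify_sqi sqi_inner_const QU aU)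
    have "0 = (LINT x|lebesgue_on D. a x \<bullet> grad2 (mollify (\<delta> n) Q) x)" by (rule a0[OF sF, symmetric])
    also have "\<dots> = (LINT x|lebesgue_on U. a x \<bullet> grad2 (mollify (\<delta> n) Q) x)"
    proof (rule integral_lebesgue_on_superset[OF oU D(2) UD, symmetric])
      fix x assume "x \<in> D" "x \<notin> U"
      then have "dist p x \<ge> 2 * r" by (simp add: U_def)
      then have "x \<in> - cball p (3 * r / 2)" using r by simp
      then have "grad2 (mollify (\<delta> n) Q) x = 0"
        by (intro grad2_local_zero[of "- cball p (3 * r / 2)"] vanish) auto
      then show "a x \<bullet> grad2 (mollify (\<delta> n) Q) x = 0" by simp
    qed
    also have "\<dots> = (LINT x|lebesgue_on U. (1 - \<delta> n) * (?m1 x \<bullet> (a x \<bullet> ?e1) + ?m2 x \<bullet> (a x \<bullet> ?e2)))"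
    proof (rule Bochner_Integration.integral_cong[OF refl])
      fix x assume "x \<in> space (lebesgue_on U)"
      then have x: "x \<in> U" by simp
      have "a x \<bullet> grad2 (mollify (\<delta> n) Q) x = (grad2 (mollify (\<delta> n) Q) x \<bullet> ?e1) \<bullet> (a x \<bullet> ?e1)
          + (grad2 (mollify (\<delta> n) Q) x \<bullet> ?e2) \<bullet> (a x \<bullet> ?e2)" by (rule inner2)
      then show "a x \<bullet> grad2 (mollify (\<delta> n) Q) x = (1 - \<delta> n) * (?m1 x \<bullet> (a x \<bullet> ?e1) + ?m2 x \<bullet> (a x \<bullet> ?e2))"
        unfolding grad2_mollify[OF QU x \<delta>(1) \<delta>'(1) basis(1)] grad2_mollify[OF QU x \<delta>(1) \<delta>'(1) basis(2)]
        by (simp only: inner_real_def distrib_left mult.assoc)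
    qed
    also have "\<dots> = (1 - \<delta> n) * ((LINT x|lebesgue_on U. ?m1 x \<bullet> (a x \<bullet> ?e1)) + (LINT x|lebesgue_on U. ?m2 x \<bullet> (a x \<bullet> ?e2)))"
      unfolding integral_mult_right_zero Bochner_Integration.integral_add[OF i1 i2] ..
    finally show ?thesis using \<delta>'(1)[of n] by simp
  qed
  have sG: "sq_integrable (lebesgue_on U) (\<lambda>w. G w \<bullet> e)" for e by (rule sqi_inner_const[OF QU(2)])
  have sa: "sq_integrable (lebesgue_on U) (\<lambda>w. a w \<bullet> e)" for e by (rule sqi_inner_const[OF aU])
  have lim: "(\<lambda>n. LINT x|lebesgue_on U. mollify (\<delta> n) (\<lambda>w. G w \<bullet> e) x \<bullet> (a x \<bullet> e)) \<longlonglongrightarrow>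
      (LINT x|lebesgue_on U. (G x \<bullet> e) \<bullet> (a x \<bullet> e))" for e
    by (rule tendsto_inner_L2[OF mollify_sqi[OF sG] sG sa mollify_tendsto[OF sG \<delta>(1) \<delta>'(2) \<delta>lim]])
  from tendsto_add[OF lim[of ?e1] lim[of ?e2]]
  have "(\<lambda>n. 0) \<longlonglongrightarrow> (LINT x|lebesgue_on U. (G x \<bullet> ?e1) \<bullet> (a x \<bullet> ?e1)) + (LINT x|lebesgue_on U. (G x \<bullet> ?e2) \<bullet> (a x \<bullet> ?e2))"
    unfolding zero .
  then have "0 = (LINT x|lebesgue_on U. (G x \<bullet> ?e1) \<bullet> (a x \<bullet> ?e1)) + (LINT x|lebesgue_on U. (G x \<bullet> ?e2) \<bullet> (a x \<bullet> ?e2))"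
    by (rule LIMSEQ_unique[OF tendsto_const])
  also have "\<dots> = (LINT x|lebesgue_on U. (G x \<bullet> ?e1) \<bullet> (a x \<bullet> ?e1) + (G x \<bullet> ?e2) \<bullet> (a x \<bullet> ?e2))"
    by (rule Bochner_Integration.integral_add[OF sqi_inner[OF sG sa] sqi_inner[OF sG sa], symmetric])
  also have "\<dots> = (LINT x|lebesgue_on U. a x \<bullet> G x)"
    by (rule Bochner_Integration.integral_cong[OF refl]) (rule inner2[symmetric])
  also have "\<dots> = (LINT x|lebesgue_on D. a x \<bullet> G x)"
  proof (rule integral_lebesgue_on_superset[OF oU D(2) UD])
    fix x assume "x \<in> D" "x \<notin> U"
    then have "dist p x \<ge> 2 * r" by (simp add: U_def)
    then have x: "x \<in> - cball p r" using r by simp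
    then have "grad2 \<zeta> x = 0" by (intro grad2_local_zero[of "- cball p r"] \<zeta>(2)) auto
    moreover have "\<zeta> x = 0" using x \<zeta>(2) by simp
    ultimately show "a x \<bullet> G x = 0" by (simp add: G_def)
  qed
  finally show ?thesis by (simp add: G_def)
qed

text \<open>A smooth partition of unity on D splits \<open>g\<close> into weak gradients of cut-off
  potentials: the functions sum to one and their gradients to zero, so the terms containing
  \<open>q\<close> cancel.\<close>

theorem gradient_orthogonal_to_solenoidal:
  fixes D :: "(real \<times> real) set"
  assumes D: "C2_domain D"
    and a: "sq_integrable (lebesgue_on D) a"
    and a0: "\<And>\<phi>. smooth_fun \<phi> \<Longrightarrow> (LINT x|lebesgue_on D. a x \<bullet> grad2 \<phi> x) = 0"
    and q: "sq_integrable (lebesgue_on D) q" and g: "sq_integrable (lebesgue_on D) g" and w: "is_weak_grad D q g"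
  shows "(LINT x|lebesgue_on D. a x \<bullet> g x) = 0"
proof -
  have oD: "bounded D" "open D" using D by (simp_all add: C2_domain_def)
  obtain I r where I: "finite I" "\<And>p. r p > 0" "closure D \<subseteq> (\<Union>p\<in>I. ball p (r p))"
    "\<And>p. p \<in> I \<Longrightarrow> star_region (D \<inter> ball p (2 * r p))"
    using C2_domain_finite_star_cover[OF D] by blast
  define b where "b x = (\<Sum>p\<in>I. ball_bump p (r p) x)" for x
  have sb: "smooth_fun b"
    unfolding smooth_fun_def b_def by (intro allI Ck_sum smooth_fun_Ck[OF smooth_ball_bump])
  have bn: "0 \<le> b x" for x unfolding b_def by (intro sum_nonneg ball_bump_nonneg)
  have bpos: "b x > 0" if x: "x \<in> closure D" for x
  proof -
    obtain p where p: "p \<in> I" "x \<in> ball p (r p)" using I(3) x by blast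
    have "0 < ball_bump p (r p) x" using p(2) ball_bump_pos(1)[OF I(2)[of p], of p x] by simp
    also have "\<dots> \<le> b x" unfolding b_def by (rule member_le_sum) (use p I(1) in \<open>auto simp: ball_bump_nonneg\<close>)
    finally show ?thesis .
  qed
  have "\<exists>c>0. \<forall>x\<in>closure D. c \<le> b x"
  proof (cases "closure D = {}")
    case True
    then show ?thesis by (intro exI[of _ 1]) simp
  next
    case False
    have cpt: "compact (closure D)" using oD by simp
    obtain x where "x \<in> closure D" "\<forall>y\<in>closure D. b x \<le> b y"
      using continuous_attains_inf[OF cpt False smooth_fun_continuous[OF sb]] by blast
    then show ?thesis using bpos by blast
  qed
  then obtain c where c: "c > 0" "\<And>x. x \<in> closure D \<Longrightarrow> c \<le> b x" by blast
  \<comment> \<open>The sum \<open>b\<close> of bumps can vanish away from D. The added step is zero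
    wherever b >= c, in particular on D, and positive where \<open>b\<close> vanishes, so the
    quotient is smooth on the whole plane.\<close>
  define den where "den x = b x + sstep (c - b x)" for x
  have den: "den x \<noteq> 0" for x
  proof -
    have "den x > 0"
    proof (cases "b x > 0")
      case True
      then show ?thesis using sstep_bounds(1)[of "c - b x"] by (simp add: den_def)
    next
      case False
      then have "b x = 0" using bn[of x] by simp
      then show ?thesis using c(1) sstep_bounds(3)[of c] by (simp add: den_def)
    qed
    then show ?thesis by simp
  qed
  have sden: "Ck k den" for k
    unfolding den_def
    by (intro Ck_add Ck_compose_real[OF Ck_sstep] Ck_diff Ck_const smooth_fun_Ck[OF sb])
  define \<zeta> where "\<zeta> p x = ball_bump p (r p) x * inverse (den x)" for p x
  have s\<zeta>: "smooth_fun (\<zeta> p)" for p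
    unfolding smooth_fun_def \<zeta>_def
    by (intro allI Ck_mult Ck_inverse[OF den sden] smooth_fun_Ck[OF smooth_ball_bump])
  have \<zeta>0: "\<zeta> p x = 0" if "x \<notin> cball p (r p)" for p x
    using ball_bump_pos(2)[OF I(2)[of p], of p x] that by (simp add: \<zeta>_def)
  have part: "(\<Sum>p\<in>I. \<zeta> p x) = 1" if "x \<in> D" for x
  proof -
    have "c \<le> b x" using c(2) that closure_subset by blast
    then have d: "den x = b x" by (simp add: den_def sstep_eq)
    have "(\<Sum>p\<in>I. \<zeta> p x) = b x * inverse (den x)" by (simp add: \<zeta>_def b_def sum_distrib_right)
    then show ?thesis using den[of x] d by simp
  qed
  have gpart: "(\<Sum>p\<in>I. grad2 (\<zeta> p) x) = 0" if "x \<in> D" for x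
  proof -
    have "(\<Sum>p\<in>I. grad2 (\<zeta> p) x) = grad2 (\<lambda>x. \<Sum>p\<in>I. \<zeta> p x) x" by (rule grad2_sum[OF s\<zeta>, symmetric])
    also have "\<dots> = grad2 (\<lambda>x. 1) x" by (rule grad2_cong_open[OF oD(2) that part smooth_const])
    finally show ?thesis by (simp add: grad2_const)
  qed
  have "(LINT x|lebesgue_on D. a x \<bullet> g x) = (LINT x|lebesgue_on D. (\<Sum>p\<in>I. a x \<bullet> (\<zeta> p x *\<^sub>R g x + q x *\<^sub>R grad2 (\<zeta> p) x)))"
  proof (rule Bochner_Integration.integral_cong[OF refl])
    fix x assume "x \<in> space (lebesgue_on D)"
    then have x: "x \<in> D" by simp
    have "(\<Sum>p\<in>I. \<zeta> p x *\<^sub>R g x + q x *\<^sub>R grad2 (\<zeta> p) x) = (\<Sum>p\<in>I. \<zeta> p x) *\<^sub>R g x + q x *\<^sub>R (\<Sum>p\<in>I. grad2 (\<zeta> p) x)"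
      by (simp add: sum.distrib scaleR_left.sum scaleR_right.sum)
    also have "\<dots> = g x" by (simp add: part[OF x] gpart[OF x])
    finally show "a x \<bullet> g x = (\<Sum>p\<in>I. a x \<bullet> (\<zeta> p x *\<^sub>R g x + q x *\<^sub>R grad2 (\<zeta> p) x))"
      by (simp add: inner_sum_right[symmetric])
  qed
  also have "\<dots> = (\<Sum>p\<in>I. (LINT x|lebesgue_on D. a x \<bullet> (\<zeta> p x *\<^sub>R g x + q x *\<^sub>R grad2 (\<zeta> p) x)))"
    by (rule Bochner_Integration.integral_sum) (rule sqi_inner[OF a weak_grad_mult(2)[OF oD s\<zeta> q g w]])
  also have "\<dots> = (\<Sum>p\<in>I. 0)"
    by (rule sum.cong[OF refl], rule cut_off_gradient_orthogonal[OF oD I(2) I(4) s\<zeta> \<zeta>0 a a0 q g w])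
  finally show ?thesis by simp
qed

section \<open>The vertical average\<close>

lemma AE_lborel_fst:
  assumes "AE x in (lborel :: 'a::euclidean_space measure). P x"
  shows "AE z in (lborel :: ('a \<times> 'b::euclidean_space) measure). P (fst z)"
proof -
  obtain N where N: "N \<in> null_sets (lborel :: 'a measure)" "{x. \<not> P x} \<subseteq> N"
    using assms unfolding eventually_ae_filter by auto
  have "emeasure (lborel \<Otimes>\<^sub>M lborel) (N \<times> (UNIV :: 'b set)) = emeasure lborel N * emeasure lborel (UNIV :: 'b set)"
    using N(1) by (intro lborel.emeasure_pair_measure_Times) auto
  also have "\<dots> = 0" using N(1) by auto
  finally have "N \<times> (UNIV :: 'b set) \<in> null_sets (lborel \<Otimes>\<^sub>M lborel)"
    using N(1) by (intro null_setsI) auto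
  then have n: "N \<times> (UNIV :: 'b set) \<in> null_sets lborel" by (simp add: lborel_prod)
  show ?thesis by (rule AE_I'[OF n]) (use N(2) in auto)
qed

lemma borel_measurable_lift:
  fixes g :: "'a::euclidean_space \<Rightarrow> 'b::euclidean_space"
  assumes "g \<in> borel_measurable borel"
  shows "(\<lambda>x :: 'a \<times> 'c::euclidean_space. g (fst x)) \<in> borel_measurable borel"
proof -
  have "(fst :: 'a \<times> 'c \<Rightarrow> 'a) \<in> borel_measurable borel"
    by (rule borel_measurable_continuous_onI) (intro continuous_intros)
  from measurable_compose[OF this assms] show ?thesis .
qed

lemma AE_lebesgue_on_iff:
  assumes "open (S :: 'a::euclidean_space set)"
  shows "(AE x in lebesgue_on S. P x) \<longleftrightarrow> (AE x in lborel. x \<in> S \<longrightarrow> P x)"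
  using assms by (simp add: AE_restrict_space_iff AE_completion_iff)

lemma lebesgue_on_borel_extension:
  fixes f :: "'a::euclidean_space \<Rightarrow> 'b::euclidean_space"
  assumes S: "open S" and f: "f \<in> borel_measurable (lebesgue_on S)"
  obtains g where "g \<in> borel_measurable borel" "AE x in lborel. x \<in> S \<longrightarrow> f x = g x" "\<And>x. x \<notin> S \<Longrightarrow> g x = 0"
proof -
  obtain g where g: "g \<in> borel_measurable borel" "AE x in lebesgue_on S. f x = g x"
    using lebesgue_on_borel_version[OF f] S by auto
  have [measurable]: "g \<in> borel_measurable borel" "S \<in> sets borel" using g S by auto
  show thesis
  proof (rule that[of "\<lambda>x. indicator S x *\<^sub>R g x"])
    show "(\<lambda>x. indicator S x *\<^sub>R g x) \<in> borel_measurable borel" by measurable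
    show "AE x in lborel. x \<in> S \<longrightarrow> f x = indicator S x *\<^sub>R g x"
      using g(2)[unfolded AE_lebesgue_on_iff[OF S]] by eventually_elim simp
  qed simp
qed

lemma sqi_lborel_extension:
  fixes f g :: "'a::euclidean_space \<Rightarrow> 'b::euclidean_space"
  assumes S: "open S" and f: "sq_integrable (lebesgue_on S) f"
    and g: "g \<in> borel_measurable borel" "AE x in lborel. x \<in> S \<longrightarrow> f x = g x" "\<And>x. x \<notin> S \<Longrightarrow> g x = 0"
  shows "sq_integrable lborel g"
proof -
  have "sq_integrable (lebesgue_on S) g"
    by (rule sqi_AE_cong[OF f borel_imp_lebesgue_on[OF g(1)]]) (use g(2) in \<open>simp add: AE_lebesgue_on_iff[OF S]\<close>)
  then have "integrable lebesgue (\<lambda>x. indicator S x * (norm (g x))\<^sup>2)"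
    by (rule sqnorm_lebesgue_on(2)[OF S])
  moreover have "(\<lambda>x. indicator S x * (norm (g x))\<^sup>2) = (\<lambda>x. (norm (g x))\<^sup>2)"
  proof (rule ext)
    show "indicator S x * (norm (g x))\<^sup>2 = (norm (g x))\<^sup>2" for x
      using g(3)[of x] by (cases "x \<in> S") simp_all
  qed
  ultimately have "integrable lebesgue (\<lambda>x. (norm (g x))\<^sup>2)" by simp
  moreover have "(\<lambda>x. (norm (g x))\<^sup>2) \<in> borel_measurable lborel" using g(1) by measurable
  ultimately show ?thesis using g(1) by (simp add: sq_integrable_def integrable_completion)
qed

lemma measurable_lebesgue_on_AE:
  fixes f g :: "'a::euclidean_space \<Rightarrow> 'b::euclidean_space"
  assumes S: "open S" and g: "g \<in> borel_measurable borel" and ae: "AE x in lborel. x \<in> S \<longrightarrow> f x = g x"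
  shows "f \<in> borel_measurable (lebesgue_on S)"
proof -
  have L: "S \<in> sets lebesgue" using S by simp
  have "(\<lambda>x. if x \<in> S then g x else 0) \<in> borel_measurable lebesgue"
    unfolding borel_measurable_if[OF L] by (rule borel_imp_lebesgue_on[OF g])
  moreover have "AE x in lebesgue. (if x \<in> S then g x else 0) = (if x \<in> S then f x else 0)"
    by (rule AE_completion) (use ae in \<open>eventually_elim, simp\<close>)
  ultimately have "(\<lambda>x. if x \<in> S then f x else 0) \<in> borel_measurable lebesgue" by (rule borel_measurable_AE)
  then show ?thesis unfolding borel_measurable_if[OF L] .
qed

lemma integral_lebesgue_on_AE_lborel:
  fixes f g :: "'a::euclidean_space \<Rightarrow> 'b::euclidean_space"
  assumes S: "open S" and g: "g \<in> borel_measurable borel" and ae: "AE x in lborel. x \<in> S \<longrightarrow> f x = g x"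
    and z: "\<And>x. x \<notin> S \<Longrightarrow> g x = 0"
  shows "(LINT x|lebesgue_on S. f x) = (LINT x|lborel. g x)"
proof -
  have "(LINT x|lebesgue_on S. f x) = (LINT x|lebesgue_on S. g x)"
    by (rule integral_cong_AE[OF measurable_lebesgue_on_AE[OF S g ae] borel_imp_lebesgue_on[OF g]])
       (use ae in \<open>simp add: AE_lebesgue_on_iff[OF S]\<close>)
  also have "\<dots> = (LINT x|lborel. g x)" by (rule integral_lebesgue_on_eq_lborel[OF S g z])
  finally show ?thesis .
qed

section \<open>Lifting to the cylinder and averaging over the vertical variable\<close>

lemma open_Omega: "open D \<Longrightarrow> open (Omega D h)" and bounded_Omega: "bounded D \<Longrightarrow> bounded (Omega D h)"
  by (auto simp: Omega_def open_Times bounded_Times)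

lemma AE_Omega_fst:
  assumes D: "open D" and ae: "AE p in lebesgue_on D. P p"
  shows "AE x in lebesgue_on (Omega D h). P (fst x)"
proof -
  have "AE x in (lborel :: ((real \<times> real) \<times> real) measure). fst x \<in> D \<longrightarrow> P (fst x)"
    by (rule AE_lborel_fst) (use ae in \<open>simp add: AE_lebesgue_on_iff[OF D]\<close>)
  then show ?thesis unfolding AE_lebesgue_on_iff[OF open_Omega[OF D]]
    by eventually_elim (auto simp: Omega_def)
qed

text \<open>\<open>vavg\<close> integrates slices of a Lebesgue measurable representative, which may
  be bad on a null set of base points. By Fubini for null sets almost every slice agrees with that
  of a Borel version.\<close>

lemma vavg_AE:
  assumes D: "open D" and h: "h > 0"
    and u0: "u0 \<in> borel_measurable borel" "AE x in lborel. x \<in> Omega D h \<longrightarrow> u x = u0 x" "\<And>x. x \<notin> Omega D h \<Longrightarrow> u0 x = 0"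
  shows "AE p in lborel. p \<in> D \<longrightarrow> vavg h u p = (1 / h) *\<^sub>R (LINT z|lborel. u0 (p, z))"
proof -
  have "AE x in (lborel \<Otimes>\<^sub>M lborel). x \<in> Omega D h \<longrightarrow> u x = u0 x"
    unfolding lborel_prod by (rule u0(2))
  then have "AE p in lborel. AE z in lborel. (p, z) \<in> Omega D h \<longrightarrow> u (p, z) = u0 (p, z)"
    by (rule lborel_pair.AE_pair)
  then show ?thesis
  proof eventually_elim
    case (elim p)
    show ?case
    proof
      assume p: "p \<in> D"
      have m: "(\<lambda>z. u0 (p, z)) \<in> borel_measurable borel" using u0(1) by measurable
      have "(LINT z|lebesgue_on {-h<..<0}. u (p, z)) = (LINT z|lborel. u0 (p, z))"
      proof (rule integral_lebesgue_on_AE_lborel[OF _ m])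
        show "AE z in lborel. z \<in> {-h<..<0} \<longrightarrow> u (p, z) = u0 (p, z)"
          using elim by eventually_elim (use p in \<open>simp add: Omega_def\<close>)
        show "u0 (p, z) = 0" if "z \<notin> {-h<..<0}" for z using that by (intro u0(3)) (auto simp: Omega_def)
      qed simp
      then show "vavg h u p = (1 / h) *\<^sub>R (LINT z|lborel. u0 (p, z))" by (simp add: vavg_def)
    qed
  qed
qed

lemma Omega_borel_version:
  assumes D: "bounded D" "open D" and u: "sq_integrable (lebesgue_on (Omega D h)) u"
  obtains u0 where "u0 \<in> borel_measurable borel" "AE x in lborel. x \<in> Omega D h \<longrightarrow> u x = u0 x"
    "\<And>x. x \<notin> Omega D h \<Longrightarrow> u0 x = (0 :: real \<times> real)" "sq_integrable lborel u0" "integrable lborel u0"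
proof -
  note O = open_Omega[OF D(2), of h] bounded_Omega[OF D(1), of h]
  obtain u0 where u0: "u0 \<in> borel_measurable borel" "AE x in lborel. x \<in> Omega D h \<longrightarrow> u x = u0 x"
    "\<And>x. x \<notin> Omega D h \<Longrightarrow> u0 x = 0"
    by (rule lebesgue_on_borel_extension[OF O(1) sqi_meas[OF u]]; rule that; assumption)
  have s: "sq_integrable lborel u0" by (rule sqi_lborel_extension[OF O(1) u u0])
  have "sq_integrable (lebesgue_on (Omega D h)) u0"
    by (rule sqi_AE_cong[OF u borel_imp_lebesgue_on[OF u0(1)]]) (use u0(2) in \<open>simp add: AE_lebesgue_on_iff[OF O(1)]\<close>)
  then have "integrable (lebesgue_on (Omega D h)) u0"
    by (rule sqi_imp_integrable[OF finite_measure_lebesgue_on_bounded[OF O(2,1)]])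
  then have "integrable lebesgue (\<lambda>x. indicator (Omega D h) x *\<^sub>R u0 x)"
    using O(1) by (simp add: integrable_restrict_space)
  moreover have "(\<lambda>x. indicator (Omega D h) x *\<^sub>R u0 x) = u0"
  proof (rule ext)
    show "indicator (Omega D h) x *\<^sub>R u0 x = u0 x" for x
      using u0(3)[of x] by (cases "x \<in> Omega D h") simp_all
  qed
  ultimately have "integrable lborel u0" using integrable_completion[of u0 lborel] u0(1) by simp
  with u0 s show thesis by (rule that)
qed

lemma sqi_lift:
  fixes g :: "real \<times> real \<Rightarrow> real \<times> real"
  assumes D: "bounded D" "open D" and h: "h > 0" and g: "sq_integrable (lebesgue_on D) g"
  shows "sq_integrable (lebesgue_on (Omega D h)) (\<lambda>x. g (fst x))"
proof -
  note O = open_Omega[OF D(2), of h] bounded_Omega[OF D(1), of h]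
  obtain g0 where g0: "g0 \<in> borel_measurable borel" "AE x in lborel. x \<in> D \<longrightarrow> g x = g0 x" "\<And>x. x \<notin> D \<Longrightarrow> g0 x = 0"
    by (rule lebesgue_on_borel_extension[OF D(2) sqi_meas[OF g]]; rule that; assumption)
  have s: "sq_integrable lborel g0" by (rule sqi_lborel_extension[OF D(2) g g0])
  have [measurable]: "g0 \<in> borel_measurable borel" "Omega D h \<in> sets borel" "D \<in> sets borel" using g0(1) O(1) D(2) by auto
  have gf[measurable]: "(\<lambda>x. g0 (fst x)) \<in> borel_measurable (borel :: ((real \<times> real) \<times> real) measure)"
    by (rule borel_measurable_lift[OF g0(1)])
  have "(\<integral>\<^sup>+x. ennreal ((norm (g0 (fst x)))\<^sup>2) * indicator (Omega D h) x \<partial>(lborel \<Otimes>\<^sub>M lborel))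
      = (\<integral>\<^sup>+p. \<integral>\<^sup>+z. ennreal ((norm (g0 p))\<^sup>2) * indicator {-h<..<0} z \<partial>lborel \<partial>lborel)"
  proof -
    have "(\<integral>\<^sup>+x. ennreal ((norm (g0 (fst x)))\<^sup>2) * indicator (Omega D h) x \<partial>(lborel \<Otimes>\<^sub>M lborel))
      = (\<integral>\<^sup>+p. \<integral>\<^sup>+z. ennreal ((norm (g0 (fst (p, z))))\<^sup>2) * indicator (Omega D h) (p, z) \<partial>lborel \<partial>lborel)"
    proof (rule lborel.nn_integral_fst[symmetric])
      show "(\<lambda>x. ennreal ((norm (g0 (fst x)))\<^sup>2) * indicator (Omega D h) x) \<in> borel_measurable (lborel \<Otimes>\<^sub>M lborel)"
        unfolding lborel_prod by measurable
    qed
    also have "\<dots> = (\<integral>\<^sup>+p. \<integral>\<^sup>+z. ennreal ((norm (g0 p))\<^sup>2) * indicator {-h<..<0} z \<partial>lborel \<partial>lborel)"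
      by (intro nn_integral_cong) (use g0(3) in \<open>auto simp: Omega_def indicator_def\<close>)
    finally show ?thesis .
  qed
  also have "\<dots> = (\<integral>\<^sup>+p. ennreal ((norm (g0 p))\<^sup>2) * ennreal h \<partial>lborel)"
    using h by (simp add: nn_integral_cmult_indicator)
  also have "\<dots> = (\<integral>\<^sup>+p. ennreal ((norm (g0 p))\<^sup>2) \<partial>lborel) * ennreal h"
    by (rule nn_integral_multc) measurable
  also have "\<dots> < \<infinity>"
    using sqi_int[OF s] unfolding integrable_iff_bounded by (simp add: ennreal_mult_less_top)
  finally have fin: "(\<integral>\<^sup>+x. ennreal ((norm (g0 (fst x)))\<^sup>2) * indicator (Omega D h) x \<partial>lborel) < \<infinity>"
    by (simp add: lborel_prod)
  have m: "(\<lambda>x. g0 (fst x)) \<in> borel_measurable (lebesgue_on (Omega D h))"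
    by (rule borel_imp_lebesgue_on[OF gf])
  have s0: "sq_integrable (lebesgue_on (Omega D h)) (\<lambda>x. g0 (fst x))"
    unfolding sq_integrable_def
  proof
    have "(\<integral>\<^sup>+x. ennreal (norm ((norm (g0 (fst x)))\<^sup>2)) \<partial>lebesgue_on (Omega D h))
        = (\<integral>\<^sup>+x. ennreal ((norm (g0 (fst x)))\<^sup>2) * indicator (Omega D h) x \<partial>lebesgue)"
      using O(1) by (subst nn_integral_restrict_space) simp_all
    also have "\<dots> = (\<integral>\<^sup>+x. ennreal ((norm (g0 (fst x)))\<^sup>2) * indicator (Omega D h) x \<partial>lborel)"
      by (rule nn_integral_completion)
    finally have "(\<integral>\<^sup>+x. ennreal (norm ((norm (g0 (fst x)))\<^sup>2)) \<partial>lebesgue_on (Omega D h)) < \<infinity>" using fin by simp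
    moreover have "(\<lambda>x. (norm (g0 (fst x)))\<^sup>2) \<in> borel_measurable (lebesgue_on (Omega D h))" using m by measurable
    ultimately show "integrable (lebesgue_on (Omega D h)) (\<lambda>x. (norm (g0 (fst x)))\<^sup>2)" by (simp only: integrable_iff_bounded)
  qed (rule m)
  have "AE p in lebesgue_on D. g0 p = g p" using g0(2) unfolding AE_lebesgue_on_iff[OF D(2)] by eventually_elim auto
  then have ae: "AE x in lebesgue_on (Omega D h). g0 (fst x) = g (fst x)" by (rule AE_Omega_fst[OF D(2)])
  have "(\<lambda>x. g (fst x)) \<in> borel_measurable (lebesgue_on (Omega D h))"
  proof (rule measurable_lebesgue_on_AE[OF O(1), of "\<lambda>x. g0 (fst x)"])
    show "(\<lambda>x. g0 (fst x)) \<in> borel_measurable (borel :: ((real \<times> real) \<times> real) measure)" by (rule gf)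
    show "AE x in lborel. x \<in> Omega D h \<longrightarrow> g (fst x) = g0 (fst x)"
      using ae unfolding AE_lebesgue_on_iff[OF O(1)] by eventually_elim auto
  qed
  then show ?thesis by (rule sqi_AE_cong[OF s0 _ ae])
qed

text \<open>Cauchy-Schwarz against the indicator of the vertical interval bounds the squared average
  by 1/h times the integral of the squared slice; Fubini integrates this over the base.\<close>

lemma vavg_sqi:
  assumes D: "bounded D" "open D" and h: "h > 0" and u: "sq_integrable (lebesgue_on (Omega D h)) u"
  shows "sq_integrable (lebesgue_on D) (vavg h u)"
proof -
  obtain u0 where u0: "u0 \<in> borel_measurable borel" "AE x in lborel. x \<in> Omega D h \<longrightarrow> u x = u0 x"
    "\<And>x. x \<notin> Omega D h \<Longrightarrow> u0 x = (0 :: real \<times> real)" "sq_integrable lborel u0" "integrable lborel u0"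
    by (rule Omega_borel_version[OF D u]; rule that; assumption)
  have [measurable]: "u0 \<in> borel_measurable borel" by (rule u0(1))
  define v where "v p = (1 / h) *\<^sub>R (LINT z|lborel. u0 (p, z))" for p
  have vm: "v \<in> borel_measurable borel"
  proof -
    have "(\<lambda>p. (LINT z|lborel. u0 (p, z))) \<in> borel_measurable lborel"
      by (rule lborel.borel_measurable_lebesgue_integral) measurable
    then have "v \<in> borel_measurable lborel" unfolding v_def by measurable
    then show ?thesis by simp
  qed
  have ae: "AE p in lborel. p \<in> D \<longrightarrow> vavg h u p = v p"
    unfolding v_def by (rule vavg_AE[OF D(2) h u0(1-3)])
  have i2: "integrable (lborel \<Otimes>\<^sub>M lborel) (\<lambda>x. (norm (u0 x))\<^sup>2)" using sqi_int[OF u0(4)] by (simp add: lborel_prod)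
  have bnd: "AE p in lborel. (norm (v p))\<^sup>2 \<le> (1 / h) * (LINT z|lborel. (norm (u0 (p, z)))\<^sup>2)"
    using lborel_pair.AE_integrable_fst'[OF i2]
  proof eventually_elim
    case (elim p)
    let ?J = "{-h<..<0} :: real set"
    have s1: "sq_integrable lborel (\<lambda>z. norm (u0 (p, z)))"
      unfolding sq_integrable_def using elim by simp
    have s2: "sq_integrable lborel (indicator ?J :: real \<Rightarrow> real)"
    proof -
      have "(\<lambda>z. (norm (indicator ?J z :: real))\<^sup>2) = indicator ?J"
        by (rule ext) (simp add: indicator_def)
      moreover have "integrable lborel (indicator ?J :: real \<Rightarrow> real)"
        by (rule integrable_real_indicator) (use h in auto)
      ultimately show ?thesis unfolding sq_integrable_def by simp
    qed
    have "sqnorm lborel (indicator ?J :: real \<Rightarrow> real) = h"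
    proof -
      have "sqnorm lborel (indicator ?J :: real \<Rightarrow> real) = (LINT z|lborel. indicator ?J z)"
        unfolding sqnorm_def by (rule Bochner_Integration.integral_cong) (auto simp: indicator_def)
      also have "\<dots> = h" using h by simp
      finally show ?thesis .
    qed
    moreover have "(LINT z|lborel. norm (u0 (p, z)) \<bullet> indicator ?J z) = (LINT z|lborel. norm (u0 (p, z)))"
    proof (rule Bochner_Integration.integral_cong[OF refl])
      fix z
      have "u0 (p, z) = 0" if "z \<notin> ?J" by (rule u0(3)) (use that in \<open>simp add: Omega_def\<close>)
      then show "norm (u0 (p, z)) \<bullet> indicator ?J z = norm (u0 (p, z))" by (cases "z \<in> ?J") simp_all
    qed
    ultimately have "(LINT z|lborel. norm (u0 (p, z)))\<^sup>2 \<le> (LINT z|lborel. (norm (u0 (p, z)))\<^sup>2) * h"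
      using L2_Cauchy_Schwarz[OF s1 s2] by (simp add: sqnorm_def)
    moreover have "norm (v p) \<le> (1 / h) * (LINT z|lborel. norm (u0 (p, z)))"
      using integral_norm_bound[of lborel "\<lambda>z. u0 (p, z)"] h by (simp add: v_def divide_right_mono)
    then have "(norm (v p))\<^sup>2 \<le> ((1 / h) * (LINT z|lborel. norm (u0 (p, z))))\<^sup>2" by (rule power_mono) simp
    then have "(norm (v p))\<^sup>2 \<le> (1 / h\<^sup>2) * (LINT z|lborel. norm (u0 (p, z)))\<^sup>2" by (simp add: power_divide)
    moreover have "(1 / h\<^sup>2) * (LINT z|lborel. norm (u0 (p, z)))\<^sup>2 \<le> (1 / h\<^sup>2) * ((LINT z|lborel. (norm (u0 (p, z)))\<^sup>2) * h)"
      using calculation(1) by (rule mult_left_mono) simp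
    ultimately show ?case using h by (simp add: power2_eq_square)
  qed
  have "sq_integrable lborel v"
    unfolding sq_integrable_def
  proof
    show "integrable lborel (\<lambda>p. (norm (v p))\<^sup>2)"
    proof (rule Bochner_Integration.integrable_bound)
      show "integrable lborel (\<lambda>p. (1 / h) * (LINT z|lborel. (norm (u0 (p, z)))\<^sup>2))"
        by (rule integrable_mult_right) (rule lborel_pair.integrable_fst'[OF i2])
      show "(\<lambda>p. (norm (v p))\<^sup>2) \<in> borel_measurable lborel" using vm by measurable
      show "AE p in lborel. norm ((norm (v p))\<^sup>2) \<le> norm ((1 / h) * (LINT z|lborel. (norm (u0 (p, z)))\<^sup>2))"
        using bnd by eventually_elim (use h in simp)
    qed
  qed (use vm in simp)
  then have "integrable lborel (\<lambda>p. (norm (v p))\<^sup>2)" by (rule sqi_int)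
  moreover have "(\<lambda>p. (norm (v p))\<^sup>2) \<in> borel_measurable lborel" using vm by measurable
  ultimately have "integrable lebesgue (\<lambda>p. (norm (v p))\<^sup>2)" by (simp only: integrable_completion)
  then have "set_integrable lebesgue UNIV (\<lambda>p. (norm (v p))\<^sup>2)" by (simp add: set_integrable_def)
  then have "set_integrable lebesgue D (\<lambda>p. (norm (v p))\<^sup>2)"
    by (rule set_integrable_subset) (use D in auto)
  then have "integrable (lebesgue_on D) (\<lambda>p. (norm (v p))\<^sup>2)"
    using D(2) by (simp add: set_integrable_def integrable_restrict_space)
  then have sv: "sq_integrable (lebesgue_on D) v" using borel_imp_lebesgue_on[OF vm] by (simp add: sq_integrable_def)
  have "AE p in lebesgue_on D. v p = vavg h u p"
    using ae unfolding AE_lebesgue_on_iff[OF D(2)] by eventually_elim auto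
  then show ?thesis by (rule sqi_AE_cong[OF sv measurable_lebesgue_on_AE[OF D(2) vm ae]])
qed

text \<open>Fubini, carried out for Borel versions extended by zero, so that neither the cylinder
  nor the base has to be tracked during the exchange.\<close>

theorem integral_Omega_vavg:
  assumes D: "bounded D" "open D" and h: "h > 0" and u: "sq_integrable (lebesgue_on (Omega D h)) u"
    and g: "sq_integrable (lebesgue_on D) g"
  shows "(LINT x|lebesgue_on (Omega D h). u x \<bullet> g (fst x)) = h * (LINT p|lebesgue_on D. vavg h u p \<bullet> g p)"
proof -
  note O = open_Omega[OF D(2), of h] bounded_Omega[OF D(1), of h]
  obtain u0 where u0: "u0 \<in> borel_measurable borel" "AE x in lborel. x \<in> Omega D h \<longrightarrow> u x = u0 x"
    "\<And>x. x \<notin> Omega D h \<Longrightarrow> u0 x = (0 :: real \<times> real)" "sq_integrable lborel u0" "integrable lborel u0"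
    by (rule Omega_borel_version[OF D u]; rule that; assumption)
  obtain g0 where g0: "g0 \<in> borel_measurable borel" "AE x in lborel. x \<in> D \<longrightarrow> g x = g0 x" "\<And>x. x \<notin> D \<Longrightarrow> g0 x = 0"
    by (rule lebesgue_on_borel_extension[OF D(2) sqi_meas[OF g]]; rule that; assumption)
  have [measurable]: "u0 \<in> borel_measurable borel" "g0 \<in> borel_measurable borel" by (rule u0(1) g0(1))+
  define W where "W x = u0 x \<bullet> g0 (fst x)" for x
  have [measurable]: "(\<lambda>x. g0 (fst x)) \<in> borel_measurable (borel :: ((real \<times> real) \<times> real) measure)"
    by (rule borel_measurable_lift[OF g0(1)])
  have Wm: "W \<in> borel_measurable borel" unfolding W_def by measurable
  have Wz: "W x = 0" if "x \<notin> Omega D h" for x using u0(3)[OF that] by (simp add: W_def)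
  have "AE x in lborel. fst x \<in> D \<longrightarrow> g (fst x) = g0 (fst x)" by (rule AE_lborel_fst[OF g0(2)])
  with u0(2) have Wae: "AE x in lborel. x \<in> Omega D h \<longrightarrow> u x \<bullet> g (fst x) = W x"
    by eventually_elim (auto simp: W_def Omega_def)
  have Wi: "integrable lborel W"
  proof -
    have i: "integrable (lebesgue_on (Omega D h)) (\<lambda>x. u x \<bullet> g (fst x))"
      by (rule sqi_inner[OF u sqi_lift[OF D h g]])
    have "integrable (lebesgue_on (Omega D h)) W"
      by (rule integrable_cong_AE_imp[OF i borel_imp_lebesgue_on[OF Wm]])
         (use Wae in \<open>simp add: AE_lebesgue_on_iff[OF O(1)] eq_commute\<close>)
    then have "integrable lebesgue (\<lambda>x. indicator (Omega D h) x *\<^sub>R W x)"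
      using O(1) by (simp add: integrable_restrict_space)
    moreover have "(\<lambda>x. indicator (Omega D h) x *\<^sub>R W x) = W"
    proof (rule ext)
      show "indicator (Omega D h) x *\<^sub>R W x = W x" for x
        using Wz[of x] by (cases "x \<in> Omega D h") simp_all
    qed
    ultimately show ?thesis using integrable_completion[of W lborel] Wm by simp
  qed
  have "(LINT x|lebesgue_on (Omega D h). u x \<bullet> g (fst x)) = (LINT x|lborel. W x)"
    by (rule integral_lebesgue_on_AE_lborel[OF O(1) Wm Wae Wz])
  also have "\<dots> = (LINT p|lborel. (LINT z|lborel. W (p, z)))"
    using lborel_pair.integral_fst'[of W] Wi by (simp add: lborel_prod)
  also have "\<dots> = (LINT p|lborel. h * (((1 / h) *\<^sub>R (LINT z|lborel. u0 (p, z))) \<bullet> g0 p))"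
  proof (rule integral_cong_AE)
    have "(\<lambda>p. (LINT z|lborel. W (p, z))) \<in> borel_measurable lborel"
      by (rule lborel.borel_measurable_lebesgue_integral) (use Wm in measurable)
    then show "(\<lambda>p. (LINT z|lborel. W (p, z))) \<in> borel_measurable lborel" .
    have "(\<lambda>p. (LINT z|lborel. u0 (p, z))) \<in> borel_measurable lborel"
      by (rule lborel.borel_measurable_lebesgue_integral) measurable
    then show "(\<lambda>p. h * (((1 / h) *\<^sub>R (LINT z|lborel. u0 (p, z))) \<bullet> g0 p)) \<in> borel_measurable lborel"
      by measurable
    have "integrable (lborel \<Otimes>\<^sub>M lborel) u0" using u0(5) by (simp add: lborel_prod)
    then have "AE p in lborel. integrable lborel (\<lambda>z. u0 (p, z))" by (rule lborel_pair.AE_integrable_fst')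
    then show "AE p in lborel. (LINT z|lborel. W (p, z)) = h * (((1 / h) *\<^sub>R (LINT z|lborel. u0 (p, z))) \<bullet> g0 p)"
      by eventually_elim (use h in \<open>simp add: W_def\<close>)
  qed
  also have "\<dots> = h * (LINT p|lborel. ((1 / h) *\<^sub>R (LINT z|lborel. u0 (p, z))) \<bullet> g0 p)"
    by (rule integral_mult_right_zero)
  also have "(LINT p|lborel. ((1 / h) *\<^sub>R (LINT z|lborel. u0 (p, z))) \<bullet> g0 p) = (LINT p|lebesgue_on D. vavg h u p \<bullet> g p)"
  proof (rule integral_lebesgue_on_AE_lborel[OF D(2), symmetric])
    have "(\<lambda>p. (LINT z|lborel. u0 (p, z))) \<in> borel_measurable lborel"
      by (rule lborel.borel_measurable_lebesgue_integral) measurable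
    then have "(\<lambda>p. ((1 / h) *\<^sub>R (LINT z|lborel. u0 (p, z))) \<bullet> g0 p) \<in> borel_measurable lborel" by measurable
    then show "(\<lambda>p. ((1 / h) *\<^sub>R (LINT z|lborel. u0 (p, z))) \<bullet> g0 p) \<in> borel_measurable borel" by simp
    have "AE p in lborel. p \<in> D \<longrightarrow> vavg h u p = (1 / h) *\<^sub>R (LINT z|lborel. u0 (p, z))"
      by (rule vavg_AE[OF D(2) h u0(1-3)])
    with g0(2) show "AE p in lborel. p \<in> D \<longrightarrow> vavg h u p \<bullet> g p = ((1 / h) *\<^sub>R (LINT z|lborel. u0 (p, z))) \<bullet> g0 p"
      by eventually_elim simp
    show "((1 / h) *\<^sub>R (LINT z|lborel. u0 (p, z))) \<bullet> g0 p = 0" if "p \<notin> D" for p using g0(3)[OF that] by simp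
  qed
  finally show ?thesis .
qed

lemma vavg_lift:
  assumes "h > 0" shows "vavg h (\<lambda>x. g (fst x)) = g"
proof (rule ext)
  fix p
  have "measure (lebesgue_on {-h<..<0}) {-h<..<0} = measure lebesgue {-h<..<0}"
    by (rule measure_restrict_space) auto
  then have m: "measure (lebesgue_on {-h<..<0}) {-h<..<0} = h" using assms by simp
  show "vavg h (\<lambda>x. g (fst x)) p = g p" using assms by (simp add: vavg_def m)
qed

section \<open>The decomposition\<close>

text \<open>Fundamental theorem of calculus on the vertical segment: the end points z = 0 and z = -h
  lie outside the open cylinder, so the test function is zero there.\<close>

lemma dz_test_integral_zero:
  assumes h: "h > 0" and t: "test_fun (Omega D h) \<phi>"
  shows "(LINT z|lebesgue_on {-h<..<0}. dz \<phi> (p, z)) = 0"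
proof -
  have s: "smooth_fun \<phi>" by (rule test_fun_smooth[OF t])
  have c: "continuous_on UNIV (\<lambda>z. dz \<phi> (p, z))"
    unfolding dz_def
    by (rule continuous_on_compose2[OF smooth_fun_continuous[OF smooth_fun_frechet[OF s], of UNIV]])
       (auto intro!: continuous_intros)
  have out: "dz \<phi> (p, z) = 0" "\<phi> (p, z) = 0" if "z \<notin> {-h<..<0}" for z
    using test_fun_outside[OF test_frechet[OF t], of "(p, z)"] test_fun_outside[OF t, of "(p, z)"] that
    by (auto simp: dz_def Omega_def)
  have "has_bochner_integral lborel (\<lambda>z. indicator {-h..0} z *\<^sub>R dz \<phi> (p, z)) (\<phi> (p, 0) - \<phi> (p, -h))"
  proof (rule has_bochner_integral_FTC_Icc)
    fix z
    have lin: "linear (frechet_derivative \<phi> (at (p, z)))"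
      by (rule has_derivative_linear[OF smooth_fun_has_derivative[OF s]])
    have "((\<lambda>z. (p, z)) has_derivative (\<lambda>k. (0, k))) (at z within {-h..0})"
      by (auto intro!: derivative_eq_intros)
    from has_derivative_compose[OF this smooth_fun_has_derivative[OF s]]
    have "((\<lambda>z. \<phi> (p, z)) has_derivative (\<lambda>k. frechet_derivative \<phi> (at (p, z)) (0, k))) (at z within {-h..0})" .
    moreover have "frechet_derivative \<phi> (at (p, z)) (0, k) = k *\<^sub>R dz \<phi> (p, z)" for k
    proof -
      have "(0, k) = k *\<^sub>R ((0, 0), 1 :: real)" by (simp add: zero_prod_def)
      then show ?thesis unfolding dz_def by (metis linear_scale[OF lin])
    qed
    ultimately show "((\<lambda>z. \<phi> (p, z)) has_vector_derivative dz \<phi> (p, z)) (at z within {-h..0})"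
      by (simp add: has_vector_derivative_def)
  next
    show "continuous_on {-h..0} (\<lambda>z. dz \<phi> (p, z))" by (rule continuous_on_subset[OF c]) simp
  qed (use h in simp)
  then have "(LINT z|lborel. indicator {-h..0} z *\<^sub>R dz \<phi> (p, z)) = 0"
    using out(2)[of 0] out(2)[of "-h"] by (simp add: has_bochner_integral_integral_eq)
  moreover have "(\<lambda>z. indicator {-h..0} z *\<^sub>R dz \<phi> (p, z)) = (\<lambda>z. dz \<phi> (p, z))"
  proof (rule ext)
    show "indicator {-h..0} z *\<^sub>R dz \<phi> (p, z) = dz \<phi> (p, z)" for z
      using out(1)[of z] by (cases "z \<in> {-h..0}") auto
  qed
  moreover have "(LINT z|lebesgue_on {-h<..<0}. dz \<phi> (p, z)) = (LINT z|lborel. dz \<phi> (p, z))"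
    by (rule integral_lebesgue_on_eq_lborel[OF _ borel_measurable_continuous_onI[OF c] out(1)]) simp_all
  ultimately show ?thesis by simp
qed

lemma continuous_dz:
  assumes "smooth_fun \<phi>" shows "continuous_on A (dz \<phi>)"
  unfolding dz_def by (rule smooth_fun_continuous[OF smooth_fun_frechet[OF assms]])

lemma dz_scaleR_integrable:
  fixes u :: "(real \<times> real) \<times> real \<Rightarrow> real \<times> real"
  assumes D: "bounded D" "open D" and u: "sq_integrable (lebesgue_on (Omega D h)) u" and s: "smooth_fun \<phi>"
  shows "integrable (lebesgue_on (Omega D h)) (\<lambda>x. dz \<phi> x *\<^sub>R u x)"
  by (rule sqi_imp_integrable[OF finite_measure_lebesgue_on_bounded[OF bounded_Omega[OF D(1)] open_Omega[OF D(2)]]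
        sqi_continuous_scaleR[OF bounded_Omega[OF D(1)] continuous_dz[OF s] u]])

text \<open>Paired with a constant vector, the claim is the adjoint identity for the field
  \<open>dz \<phi>\<close> times that vector, whose vertical average vanishes.\<close>

lemma dz_zero_lift:
  assumes D: "bounded D" "open D" and h: "h > 0" and g: "sq_integrable (lebesgue_on D) g"
  shows "dz_zero (Omega D h) (\<lambda>x. g (fst x))"
  unfolding dz_zero_def
proof (intro allI impI)
  fix \<phi> assume t: "test_fun (Omega D h) \<phi>"
  let ?O = "lebesgue_on (Omega D h)"
  have s: "smooth_fun \<phi>" by (rule test_fun_smooth[OF t])
  have i: "integrable ?O (\<lambda>x. dz \<phi> x *\<^sub>R g (fst x))"
    by (rule dz_scaleR_integrable[OF D sqi_lift[OF D h g] s])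
  have "(LINT x|?O. dz \<phi> x *\<^sub>R g (fst x)) \<bullet> e = 0" for e
  proof -
    have ue: "sq_integrable ?O (\<lambda>x. dz \<phi> x *\<^sub>R e)"
      by (intro sqi_continuous bounded_Omega open_Omega D continuous_on_scaleR continuous_dz[OF s] continuous_on_const)
    have "vavg h (\<lambda>x. dz \<phi> x *\<^sub>R e) p = 0" for p
    proof -
      have "(LINT z|lebesgue_on {-h<..<0}. dz \<phi> (p, z) *\<^sub>R e) = (LINT z|lebesgue_on {-h<..<0}. dz \<phi> (p, z)) *\<^sub>R e"
        by (rule integral_scaleR_left)
           (intro integrable_lebesgue_on_continuous continuous_on_compose2[OF continuous_dz[OF s, of UNIV]], auto intro!: continuous_intros)
      then show ?thesis by (simp add: vavg_def dz_test_integral_zero[OF h t])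
    qed
    then have "(LINT x|?O. (dz \<phi> x *\<^sub>R e) \<bullet> g (fst x)) = 0"
      using integral_Omega_vavg[OF D h ue g] by simp
    moreover have "(LINT x|?O. dz \<phi> x *\<^sub>R g (fst x)) \<bullet> e = (LINT x|?O. (dz \<phi> x *\<^sub>R g (fst x)) \<bullet> e)"
      by (rule integral_inner_left[symmetric]) (rule i)
    ultimately show ?thesis by (simp add: inner_commute)
  qed
  then show "(LINT x|?O. dz \<phi> x *\<^sub>R g (fst x)) = 0" using inner_eq_zero_iff by blast
qed

text \<open>Splits the single limit in the definition into one for the functions and one for the
  gradients, both terms being nonnegative.\<close>

lemma H10_iff:
  assumes D: "bounded D" "open D"
  shows "H10 D q \<longleftrightarrow> H1 D q \<and> (\<exists>\<phi>. (\<forall>k. test_fun D (\<phi> k)) \<and>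
    (\<lambda>k. sqnorm (lebesgue_on D) (\<lambda>p. \<phi> k p - q p)) \<longlonglongrightarrow> 0 \<and>
    (\<lambda>k. sqnorm (lebesgue_on D) (\<lambda>p. grad2 (\<phi> k) p - wgrad D q p)) \<longlonglongrightarrow> 0)"
proof -
  have "(\<lambda>k. LINT p|lebesgue_on D. (\<phi> k p - q p)\<^sup>2 + (norm (grad2 (\<phi> k) p - wgrad D q p))\<^sup>2) \<longlonglongrightarrow> 0 \<longleftrightarrow>
    (\<lambda>k. sqnorm (lebesgue_on D) (\<lambda>p. \<phi> k p - q p)) \<longlonglongrightarrow> 0 \<and>
    (\<lambda>k. sqnorm (lebesgue_on D) (\<lambda>p. grad2 (\<phi> k) p - wgrad D q p)) \<longlonglongrightarrow> 0"
    if q: "H1 D q" and t: "\<forall>k. test_fun D (\<phi> k)" for \<phi> :: "nat \<Rightarrow> real \<times> real \<Rightarrow> real"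
  proof -
    define S where "S k = sqnorm (lebesgue_on D) (\<lambda>p. \<phi> k p - q p)" for k
    define T where "T k = sqnorm (lebesgue_on D) (\<lambda>p. grad2 (\<phi> k) p - wgrad D q p)" for k
    have "(LINT p|lebesgue_on D. (\<phi> k p - q p)\<^sup>2 + (norm (grad2 (\<phi> k) p - wgrad D q p))\<^sup>2) = S k + T k" for k
    proof -
      have tk: "test_fun D (\<phi> k)" using t by blast
      have "integrable (lebesgue_on D) (\<lambda>p. (norm (\<phi> k p - q p))\<^sup>2)"
        by (rule sqi_int[OF sqi_diff[OF test_sqi[OF D tk] H1_wgrad(1)[OF q]]])
      moreover have "integrable (lebesgue_on D) (\<lambda>p. (norm (grad2 (\<phi> k) p - wgrad D q p))\<^sup>2)"
        by (rule sqi_int[OF sqi_diff[OF sqi_continuous[OF D continuous_grad2[OF test_fun_smooth[OF tk]]] H1_wgrad(2)[OF q]]])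
      ultimately show ?thesis by (simp add: S_def T_def sqnorm_def)
    qed
    moreover have "(\<lambda>k. S k + T k) \<longlonglongrightarrow> 0 \<longleftrightarrow> S \<longlonglongrightarrow> 0 \<and> T \<longlonglongrightarrow> 0"
    proof
      assume l: "(\<lambda>k. S k + T k) \<longlonglongrightarrow> 0"
      have n: "0 \<le> S k" "0 \<le> T k" for k by (simp_all add: S_def T_def sqnorm_nonneg)
      have "S \<longlonglongrightarrow> 0" by (rule tendsto_sandwich[OF _ _ tendsto_const l]) (simp_all add: n)
      moreover have "T \<longlonglongrightarrow> 0" by (rule tendsto_sandwich[OF _ _ tendsto_const l]) (simp_all add: n)
      ultimately show "S \<longlonglongrightarrow> 0 \<and> T \<longlonglongrightarrow> 0" by blast
    next
      assume "S \<longlonglongrightarrow> 0 \<and> T \<longlonglongrightarrow> 0"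
      then show "(\<lambda>k. S k + T k) \<longlonglongrightarrow> 0" using tendsto_add[of S 0 sequentially T 0] by simp
    qed
    ultimately show ?thesis by (simp add: S_def[symmetric] T_def[symmetric])
  qed
  then show ?thesis unfolding H10_def by blast
qed

text \<open>Membership without mentioning \<open>wgrad\<close>: the approximating test functions
  themselves prove that \<open>g\<close> is a weak gradient, so it may replace the chosen one in the
  limit.\<close>

lemma H10_I:
  assumes D: "bounded D" "open D"
    and q: "sq_integrable (lebesgue_on D) q" and g: "sq_integrable (lebesgue_on D) g"
    and t: "\<And>k. test_fun D (\<phi> k)"
    and ql: "(\<lambda>k. sqnorm (lebesgue_on D) (\<lambda>p. \<phi> k p - q p)) \<longlonglongrightarrow> 0"
    and gl: "(\<lambda>k. sqnorm (lebesgue_on D) (\<lambda>p. grad2 (\<phi> k) p - g p)) \<longlonglongrightarrow> 0"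
  shows "H10 D q" "AE p in lebesgue_on D. wgrad D q p = g p"
proof -
  have s: "smooth_fun (\<phi> k)" for k by (rule test_fun_smooth[OF t])
  have sg: "sq_integrable (lebesgue_on D) (grad2 (\<phi> k))" for k by (rule sqi_continuous[OF D continuous_grad2[OF s]])
  have w: "is_weak_grad D q g"
    by (rule weak_grad_limit[OF D test_sqi[OF D t] q sg g weak_grad_smooth[OF D s] ql gl])
  have H: "H1 D q" by (rule H1I[OF q g w])
  show ae: "AE p in lebesgue_on D. wgrad D q p = g p" by (rule wgrad_unique[OF D q g w])
  have "sqnorm (lebesgue_on D) (\<lambda>p. grad2 (\<phi> k) p - wgrad D q p) = sqnorm (lebesgue_on D) (\<lambda>p. grad2 (\<phi> k) p - g p)" for k
    by (rule sqnorm_cong_AE[OF sqi_diff[OF sg H1_wgrad(2)[OF H]] sqi_diff[OF sg g]]) (use ae in \<open>eventually_elim, simp\<close>)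
  then show "H10 D q" unfolding H10_iff[OF D] using H t ql gl by (intro conjI exI[of _ \<phi>]) auto
qed

lemma H10_E:
  assumes D: "bounded D" "open D" and q: "H10 D q"
  obtains \<phi> where "H1 D q" "\<And>k. test_fun D (\<phi> k)"
    "(\<lambda>k. sqnorm (lebesgue_on D) (\<lambda>p. \<phi> k p - q p)) \<longlonglongrightarrow> 0"
    "(\<lambda>k. sqnorm (lebesgue_on D) (\<lambda>p. grad2 (\<phi> k) p - wgrad D q p)) \<longlonglongrightarrow> 0"
  using q unfolding H10_iff[OF D] by blast

section \<open>Linear structure of the potentials and of the three field spaces\<close>

lemma H10_add:
  assumes D: "bounded D" "open D" and "H10 D q" "H10 D r"
  shows "H10 D (\<lambda>x. q x + r x)"
proof -
  obtain \<phi> where \<phi>: "H1 D q" "\<And>k. test_fun D (\<phi> k)"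
    "(\<lambda>k. sqnorm (lebesgue_on D) (\<lambda>p. \<phi> k p - q p)) \<longlonglongrightarrow> 0"
    "(\<lambda>k. sqnorm (lebesgue_on D) (\<lambda>p. grad2 (\<phi> k) p - wgrad D q p)) \<longlonglongrightarrow> 0"
    by (rule H10_E[OF D assms(3)]; rule that; assumption)
  obtain \<psi> where \<psi>: "H1 D r" "\<And>k. test_fun D (\<psi> k)"
    "(\<lambda>k. sqnorm (lebesgue_on D) (\<lambda>p. \<psi> k p - r p)) \<longlonglongrightarrow> 0"
    "(\<lambda>k. sqnorm (lebesgue_on D) (\<lambda>p. grad2 (\<psi> k) p - wgrad D r p)) \<longlonglongrightarrow> 0"
    by (rule H10_E[OF D assms(4)]; rule that; assumption)
  have add: "(\<lambda>k. sqnorm M (\<lambda>p. (f k p + g k p) - (f' p + g' p))) \<longlonglongrightarrow> 0"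
    if "\<And>k. sq_integrable M (\<lambda>p. f k p - f' p)" "\<And>k. sq_integrable M (\<lambda>p. g k p - g' p)"
      and l: "(\<lambda>k. sqnorm M (\<lambda>p. f k p - f' p)) \<longlonglongrightarrow> 0" "(\<lambda>k. sqnorm M (\<lambda>p. g k p - g' p)) \<longlonglongrightarrow> 0"
    for M :: "(real \<times> real) measure" and f g :: "nat \<Rightarrow> real \<times> real \<Rightarrow> 'b::euclidean_space" and f' g'
  proof -
    have "(\<lambda>k. 2 * sqnorm M (\<lambda>p. f k p - f' p) + 2 * sqnorm M (\<lambda>p. g k p - g' p)) \<longlonglongrightarrow> 2 * 0 + 2 * 0"
      by (intro tendsto_intros l)
    then have lim: "(\<lambda>k. 2 * sqnorm M (\<lambda>p. f k p - f' p) + 2 * sqnorm M (\<lambda>p. g k p - g' p)) \<longlonglongrightarrow> 0" by simp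
    have le: "sqnorm M (\<lambda>p. (f k p + g k p) - (f' p + g' p)) \<le> 2 * sqnorm M (\<lambda>p. f k p - f' p) + 2 * sqnorm M (\<lambda>p. g k p - g' p)" for k
      using sqnorm_add_le[OF that(1)[of k] that(2)[of k]] by (simp add: algebra_simps)
    show ?thesis by (rule tendsto_sandwich[OF _ _ tendsto_const lim]) (simp_all add: sqnorm_nonneg le)
  qed
  note q = H1_wgrad[OF \<phi>(1)] and r = H1_wgrad[OF \<psi>(1)]
  show ?thesis
  proof (rule H10_I(1)[OF D, of _ "\<lambda>x. wgrad D q x + wgrad D r x" "\<lambda>k x. \<phi> k x + \<psi> k x"])
    show "sq_integrable (lebesgue_on D) (\<lambda>x. q x + r x)" by (rule sqi_add[OF q(1) r(1)])
    show "sq_integrable (lebesgue_on D) (\<lambda>x. wgrad D q x + wgrad D r x)" by (rule sqi_add[OF q(2) r(2)])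
    show "test_fun D (\<lambda>x. \<phi> k x + \<psi> k x)" for k by (rule test_add[OF \<phi>(2) \<psi>(2)])
    show "(\<lambda>k. sqnorm (lebesgue_on D) (\<lambda>p. \<phi> k p + \<psi> k p - (q p + r p))) \<longlonglongrightarrow> 0"
      by (rule add[OF sqi_diff[OF test_sqi[OF D \<phi>(2)] q(1)] sqi_diff[OF test_sqi[OF D \<psi>(2)] r(1)] \<phi>(3) \<psi>(3)])
    have "(\<lambda>k. sqnorm (lebesgue_on D) (\<lambda>p. (grad2 (\<phi> k) p + grad2 (\<psi> k) p) - (wgrad D q p + wgrad D r p))) \<longlonglongrightarrow> 0"
      by (rule add[OF sqi_diff[OF sqi_continuous[OF D continuous_grad2[OF test_fun_smooth[OF \<phi>(2)]]] q(2)]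
            sqi_diff[OF sqi_continuous[OF D continuous_grad2[OF test_fun_smooth[OF \<psi>(2)]]] r(2)] \<phi>(4) \<psi>(4)])
    then show "(\<lambda>k. sqnorm (lebesgue_on D) (\<lambda>p. grad2 (\<lambda>x. \<phi> k x + \<psi> k x) p - (wgrad D q p + wgrad D r p))) \<longlonglongrightarrow> 0"
      by (simp add: grad2_add[OF test_fun_smooth[OF \<phi>(2)] test_fun_smooth[OF \<psi>(2)]])
  qed
qed

lemma H10_scale:
  assumes D: "bounded D" "open D" and "H10 D q"
  shows "H10 D (\<lambda>x. c * q x)"
proof -
  obtain \<phi> where \<phi>: "H1 D q" "\<And>k. test_fun D (\<phi> k)"
    "(\<lambda>k. sqnorm (lebesgue_on D) (\<lambda>p. \<phi> k p - q p)) \<longlonglongrightarrow> 0"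
    "(\<lambda>k. sqnorm (lebesgue_on D) (\<lambda>p. grad2 (\<phi> k) p - wgrad D q p)) \<longlonglongrightarrow> 0"
    by (rule H10_E[OF D assms(3)]; rule that; assumption)
  note q = H1_wgrad[OF \<phi>(1)]
  have sc: "sqnorm M (\<lambda>p. c *\<^sub>R f p - c *\<^sub>R g p) = c\<^sup>2 * sqnorm M (\<lambda>p. f p - g p)"
    for M :: "(real \<times> real) measure" and f g :: "real \<times> real \<Rightarrow> 'b::euclidean_space"
    by (simp add: sqnorm_def scaleR_diff_right[symmetric] power_mult_distrib)
  have l: "(\<lambda>k. c\<^sup>2 * f k) \<longlonglongrightarrow> 0" if "f \<longlonglongrightarrow> 0" for f
    using tendsto_mult[OF tendsto_const that, of "c\<^sup>2"] by simp
  show ?thesis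
  proof (rule H10_I(1)[OF D, of _ "\<lambda>x. c *\<^sub>R wgrad D q x" "\<lambda>k x. c * \<phi> k x"])
    show "sq_integrable (lebesgue_on D) (\<lambda>x. c * q x)" using sqi_scaleR[OF q(1), of c] by simp
    show "sq_integrable (lebesgue_on D) (\<lambda>x. c *\<^sub>R wgrad D q x)" by (rule sqi_scaleR[OF q(2)])
    show "test_fun D (\<lambda>x. c * \<phi> k x)" for k by (rule test_cmult[OF \<phi>(2)])
    show "(\<lambda>k. sqnorm (lebesgue_on D) (\<lambda>p. c * \<phi> k p - c * q p)) \<longlonglongrightarrow> 0"
      using l[OF \<phi>(3)] unfolding sc[symmetric] by simp
    show "(\<lambda>k. sqnorm (lebesgue_on D) (\<lambda>p. grad2 (\<lambda>x. c * \<phi> k x) p - c *\<^sub>R wgrad D q p)) \<longlonglongrightarrow> 0"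
      using l[OF \<phi>(4)] unfolding sc[symmetric] grad2_cmult[OF test_fun_smooth[OF \<phi>(2)]] .
  qed
qed

lemma H10_zero:
  assumes D: "bounded D" "open D" shows "H10 D (\<lambda>x. 0)"
  by (rule H10_I(1)[OF D sqi_zero sqi_zero, of "\<lambda>k x. 0"]) (simp_all add: test_zero sqnorm_def grad2_const)

lemma wgrad_zero:
  assumes D: "bounded D" "open D" shows "AE x in lebesgue_on D. wgrad D (\<lambda>x. 0) x = 0"
  by (rule wgrad_unique[OF D sqi_zero sqi_zero]) (simp add: is_weak_grad_def)

lemma weakly_harmonic_closed:
  assumes D: "bounded D" "open D"
  shows "weakly_harmonic D (\<lambda>x. 0)"
    and "H1 D q \<Longrightarrow> H1 D r \<Longrightarrow> weakly_harmonic D q \<Longrightarrow> weakly_harmonic D r \<Longrightarrow> weakly_harmonic D (\<lambda>x. q x + r x)"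
    and "H1 D q \<Longrightarrow> weakly_harmonic D q \<Longrightarrow> weakly_harmonic D (\<lambda>x. c * q x)"
proof -
  let ?M = "lebesgue_on D"
  have sg: "sq_integrable ?M (grad2 \<phi>)" if "test_fun D \<phi>" for \<phi>
    by (rule sqi_continuous[OF D continuous_grad2[OF test_fun_smooth[OF that]]])
  have H0: "H1 D (\<lambda>x. 0)" using H10_zero[OF D] by (simp add: H10_def)
  show "weakly_harmonic D (\<lambda>x. 0)"
    unfolding weakly_harmonic_def
    using integral_inner_cong_AE[OF H1_wgrad(2)[OF H0] sqi_zero sg wgrad_zero[OF D]] by simp
  show "weakly_harmonic D (\<lambda>x. q x + r x)" if "H1 D q" "H1 D r" "weakly_harmonic D q" "weakly_harmonic D r"
    unfolding weakly_harmonic_def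
  proof (intro allI impI)
    fix \<phi> assume t: "test_fun D \<phi>"
    note q = H1_wgrad(2)[OF that(1)] and r = H1_wgrad(2)[OF that(2)]
    have "(LINT p|?M. wgrad D (\<lambda>x. q x + r x) p \<bullet> grad2 \<phi> p) = (LINT p|?M. (wgrad D q p + wgrad D r p) \<bullet> grad2 \<phi> p)"
      by (rule integral_inner_cong_AE[OF H1_wgrad(2)[OF H1_add(1)[OF D that(1,2)]] sqi_add[OF q r] sg[OF t] H1_add(2)[OF D that(1,2)]])
    also have "\<dots> = (LINT p|?M. wgrad D q p \<bullet> grad2 \<phi> p) + (LINT p|?M. wgrad D r p \<bullet> grad2 \<phi> p)"
      unfolding inner_add_left by (rule Bochner_Integration.integral_add[OF sqi_inner[OF q sg[OF t]] sqi_inner[OF r sg[OF t]]])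
    also have "\<dots> = 0" using that(3,4) t by (simp add: weakly_harmonic_def)
    finally show "(LINT p|?M. wgrad D (\<lambda>x. q x + r x) p \<bullet> grad2 \<phi> p) = 0" .
  qed
  show "weakly_harmonic D (\<lambda>x. c * q x)" if "H1 D q" "weakly_harmonic D q"
    unfolding weakly_harmonic_def
  proof (intro allI impI)
    fix \<phi> assume t: "test_fun D \<phi>"
    note q = H1_wgrad(2)[OF that(1)]
    have "(LINT p|?M. wgrad D (\<lambda>x. c * q x) p \<bullet> grad2 \<phi> p) = (LINT p|?M. (c *\<^sub>R wgrad D q p) \<bullet> grad2 \<phi> p)"
      by (rule integral_inner_cong_AE[OF H1_wgrad(2)[OF H1_scale(1)[OF D that(1)]] sqi_scaleR[OF q] sg[OF t] H1_scale(2)[OF D that(1)]])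
    also have "\<dots> = 0" using that(2) t by (simp add: weakly_harmonic_def)
    finally show "(LINT p|?M. wgrad D (\<lambda>x. c * q x) p \<bullet> grad2 \<phi> p) = 0" .
  qed
qed

text \<open>One argument for both gradient spaces; \<open>P\<close> is the condition on the
  potential. It must be closed under sums of potentials since \<open>wgrad\<close> is linear only
  almost everywhere.\<close>

lemma gradient_fields_subspace:
  assumes D: "bounded D" "open D" and h: "h > 0"
    and H: "\<And>q. P q \<Longrightarrow> H1 D q" and P0: "P (\<lambda>x. 0)"
    and Padd: "\<And>q r. P q \<Longrightarrow> P r \<Longrightarrow> P (\<lambda>x. q x + r x)" and Psc: "\<And>q c. P q \<Longrightarrow> P (\<lambda>x. c * q x)"
  shows "fun_subspace {u. L2 (Omega D h) u \<and> dz_zero (Omega D h) u \<and>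
    (\<exists>q. P q \<and> (AE x in lebesgue_on (Omega D h). u x = wgrad D q (fst x)))}" (is "fun_subspace ?G")
proof -
  let ?O = "lebesgue_on (Omega D h)"
  have dz_add: "dz_zero (Omega D h) (\<lambda>x. u x + v x)"
    if "dz_zero (Omega D h) u" "dz_zero (Omega D h) v" "sq_integrable ?O u" "sq_integrable ?O v" for u v
    using that dz_scaleR_integrable[OF D that(3) test_fun_smooth] dz_scaleR_integrable[OF D that(4) test_fun_smooth]
    by (simp add: dz_zero_def scaleR_add_right)
  have dz_sc: "dz_zero (Omega D h) (\<lambda>x. c *\<^sub>R u x)"
    if "dz_zero (Omega D h) u" for u c
    unfolding dz_zero_def
  proof (intro allI impI)
    fix \<phi> assume t: "test_fun (Omega D h) \<phi>"
    have "(LINT x|?O. dz \<phi> x *\<^sub>R c *\<^sub>R u x) = (LINT x|?O. c *\<^sub>R (dz \<phi> x *\<^sub>R u x))"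
      by (simp add: mult.commute)
    also have "\<dots> = c *\<^sub>R (LINT x|?O. dz \<phi> x *\<^sub>R u x)"
      by (rule integral_scaleR_right)
    also have "\<dots> = 0" using that t by (simp add: dz_zero_def)
    finally show "(LINT x|?O. dz \<phi> x *\<^sub>R c *\<^sub>R u x) = 0" .
  qed
  have "(\<lambda>x. 0) \<in> ?G"
  proof -
    have "AE x in ?O. (0 :: real \<times> real) = wgrad D (\<lambda>x. 0) (fst x)"
      using AE_Omega_fst[OF D(2) wgrad_zero[OF D], of h] by eventually_elim simp
    then show ?thesis using P0 sqi_zero by (auto simp: L2_iff dz_zero_def)
  qed
  moreover have "(\<lambda>x. u x + v x) \<in> ?G" if "u \<in> ?G" "v \<in> ?G" for u v
  proof -
    obtain q r where q: "P q" "AE x in ?O. u x = wgrad D q (fst x)" and r: "P r" "AE x in ?O. v x = wgrad D r (fst x)"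
      using \<open>u \<in> ?G\<close> \<open>v \<in> ?G\<close> by blast
    have "AE x in ?O. wgrad D (\<lambda>x. q x + r x) (fst x) = wgrad D q (fst x) + wgrad D r (fst x)"
      by (rule AE_Omega_fst[OF D(2) H1_add(2)[OF D H[OF q(1)] H[OF r(1)]]])
    with q(2) r(2) have "AE x in ?O. u x + v x = wgrad D (\<lambda>x. q x + r x) (fst x)" by eventually_elim simp
    then show ?thesis using that Padd[OF q(1) r(1)] by (auto simp: L2_iff intro!: sqi_add dz_add)
  qed
  moreover have "(\<lambda>x. c *\<^sub>R u x) \<in> ?G" if u: "u \<in> ?G" for u c
  proof -
    obtain q where q: "P q" "AE x in ?O. u x = wgrad D q (fst x)" using u by blast
    have "AE x in ?O. wgrad D (\<lambda>x. c * q x) (fst x) = c *\<^sub>R wgrad D q (fst x)"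
      by (rule AE_Omega_fst[OF D(2) H1_scale(2)[OF D H[OF q(1)]]])
    with q(2) have "AE x in ?O. c *\<^sub>R u x = wgrad D (\<lambda>x. c * q x) (fst x)" by eventually_elim simp
    then show ?thesis using that Psc[OF q(1)] by (auto simp: L2_iff intro!: sqi_scaleR dz_sc)
  qed
  ultimately show ?thesis unfolding fun_subspace_def by blast
qed

lemma Gspace_subspaces:
  assumes D: "bounded D" "open D" and h: "h > 0"
  shows "fun_subspace (Gspace1 D h)" "fun_subspace (Gspace2 D h)"
proof -
  have "fun_subspace {u. L2 (Omega D h) u \<and> dz_zero (Omega D h) u \<and>
    (\<exists>q. (H1 D q \<and> weakly_harmonic D q) \<and> (AE x in lebesgue_on (Omega D h). u x = wgrad D q (fst x)))}"
    by (rule gradient_fields_subspace[OF D h])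
       (use H10_zero[OF D] weakly_harmonic_closed[OF D] H1_add(1)[OF D] H1_scale(1)[OF D] in \<open>auto simp: H10_def\<close>)
  then show "fun_subspace (Gspace1 D h)" by (simp add: Gspace1_def conj_assoc)
  show "fun_subspace (Gspace2 D h)" unfolding Gspace2_def
    by (rule gradient_fields_subspace[OF D h])
       (use H10_zero[OF D] H10_add[OF D] H10_scale[OF D] in \<open>auto simp: H10_def\<close>)
qed

text \<open>The adjoint identity moves the test from D to the cylinder, where linearity in the field
  is immediate and no algebra of \<open>vavg\<close> is required.\<close>

lemma Hspace1_iff:
  assumes D: "bounded D" "open D" and h: "h > 0"
  shows "v \<in> Hspace1 D h \<longleftrightarrow> sq_integrable (lebesgue_on (Omega D h)) v \<and>
    (\<forall>\<phi>. smooth_fun \<phi> \<longrightarrow> (LINT x|lebesgue_on (Omega D h). v x \<bullet> grad2 \<phi> (fst x)) = 0)"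
  using integral_Omega_vavg[OF D h _ sqi_continuous[OF D continuous_grad2], of v] h
  by (auto simp: Hspace1_def L2_iff)

lemma Hspace1_subspace:
  assumes D: "bounded D" "open D" and h: "h > 0"
  shows "fun_subspace (Hspace1 D h)"
proof -
  have i: "integrable (lebesgue_on (Omega D h)) (\<lambda>x. v x \<bullet> grad2 \<phi> (fst x))"
    if "sq_integrable (lebesgue_on (Omega D h)) v" "smooth_fun \<phi>" for v \<phi>
    by (rule sqi_inner[OF that(1) sqi_lift[OF D h sqi_continuous[OF D continuous_grad2[OF that(2)]]]])
  show ?thesis
    unfolding fun_subspace_def Ball_def Hspace1_iff[OF D h]
    by (auto simp: inner_add_left i intro: sqi_zero sqi_add sqi_scaleR)
qed

section \<open>Orthogonality and existence of the potentials\<close>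

lemma Hspace1_orthogonal_gradient:
  assumes D: "C2_domain D" and h: "h > 0" and a: "a \<in> Hspace1 D h" and q: "H1 D q"
  shows "(LINT x|lebesgue_on (Omega D h). a x \<bullet> wgrad D q (fst x)) = 0"
proof -
  have oD: "bounded D" "open D" using D by (simp_all add: C2_domain_def)
  have sa: "sq_integrable (lebesgue_on (Omega D h)) a" using a by (simp add: Hspace1_def L2_iff)
  note w = H1_wgrad[OF q]
  have "(LINT p|lebesgue_on D. vavg h a p \<bullet> wgrad D q p) = 0"
    by (rule gradient_orthogonal_to_solenoidal[OF D vavg_sqi[OF oD h sa] _ w]) (use a in \<open>simp add: Hspace1_def\<close>)
  then show ?thesis using integral_Omega_vavg[OF oD h sa w(2)] by simp
qed

text \<open>Weak harmonicity is orthogonality to gradients of test functions, and those approximate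
  the gradient of an H^1_0 function.\<close>

lemma harmonic_orthogonal_H10:
  assumes D: "bounded D" "open D" and q: "H1 D q" "weakly_harmonic D q" and r: "H10 D r"
  shows "(LINT p|lebesgue_on D. wgrad D q p \<bullet> wgrad D r p) = 0"
proof -
  obtain \<phi> where \<phi>: "H1 D r" "\<And>k. test_fun D (\<phi> k)"
    "(\<lambda>k. sqnorm (lebesgue_on D) (\<lambda>p. \<phi> k p - r p)) \<longlonglongrightarrow> 0"
    "(\<lambda>k. sqnorm (lebesgue_on D) (\<lambda>p. grad2 (\<phi> k) p - wgrad D r p)) \<longlonglongrightarrow> 0"
    by (rule H10_E[OF D r]; rule that; assumption)
  have "(\<lambda>k. LINT p|lebesgue_on D. grad2 (\<phi> k) p \<bullet> wgrad D q p) \<longlonglongrightarrow> (LINT p|lebesgue_on D. wgrad D r p \<bullet> wgrad D q p)"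
    by (rule tendsto_inner_L2[OF sqi_continuous[OF D continuous_grad2[OF test_fun_smooth[OF \<phi>(2)]]]
          H1_wgrad(2)[OF \<phi>(1)] H1_wgrad(2)[OF q(1)] \<phi>(4)])
  moreover have "(LINT p|lebesgue_on D. grad2 (\<phi> k) p \<bullet> wgrad D q p) = 0" for k
    using q(2) \<phi>(2) by (simp add: weakly_harmonic_def inner_commute)
  ultimately have "(\<lambda>k. 0) \<longlonglongrightarrow> (LINT p|lebesgue_on D. wgrad D r p \<bullet> wgrad D q p)" by simp
  then have "(LINT p|lebesgue_on D. wgrad D r p \<bullet> wgrad D q p) = 0" by (rule LIMSEQ_unique[OF _ tendsto_const])
  then show ?thesis by (simp add: inner_commute)
qed

text \<open>Orthogonal projection takes the place of Lax-Milgram. The approximating gradients come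
  from test functions, and the Poincare inequality for these makes the potentials converge along
  with the gradients.\<close>

lemma exists_q2:
  assumes D: "bounded D" "open D" and h: "h > 0" and u: "sq_integrable (lebesgue_on (Omega D h)) u"
  shows "\<exists>q2. solves_q2 D h u q2"
proof -
  let ?M = "lebesgue_on D"
  let ?V = "{grad2 \<phi> |\<phi>. test_fun D \<phi>}"
  have sg: "sq_integrable ?M (grad2 \<phi>)" if "test_fun D \<phi>" for \<phi>
    by (rule sqi_continuous[OF D continuous_grad2[OF test_fun_smooth[OF that]]])
  have su: "sq_integrable ?M (vavg h u)" by (rule vavg_sqi[OF D h u])
  have V: "\<And>v. v \<in> ?V \<Longrightarrow> sq_integrable ?M v" using sg by blast
  have V0: "(\<lambda>x. 0) \<in> ?V"
    using test_zero[of D] grad2_const[of 0] by (auto intro!: exI[of _ "\<lambda>_. 0"])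
  have Va: "(\<lambda>x. v x + w x) \<in> ?V" if "v \<in> ?V" "w \<in> ?V" for v w
  proof -
    obtain \<phi> \<psi> where p: "test_fun D \<phi>" "v = grad2 \<phi>" "test_fun D \<psi>" "w = grad2 \<psi>" using \<open>v \<in> ?V\<close> \<open>w \<in> ?V\<close> by blast
    have "(\<lambda>x. v x + w x) = grad2 (\<lambda>x. \<phi> x + \<psi> x)"
      by (rule ext) (simp add: p grad2_add[OF test_fun_smooth[OF p(1)] test_fun_smooth[OF p(3)]])
    then show ?thesis using test_add[OF p(1,3)] by blast
  qed
  have Vs: "(\<lambda>x. c *\<^sub>R v x) \<in> ?V" if vV: "v \<in> ?V" for v c
  proof -
    obtain \<phi> where p: "test_fun D \<phi>" "v = grad2 \<phi>" using vV by blast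
    have "(\<lambda>x. c *\<^sub>R v x) = grad2 (\<lambda>x. c * \<phi> x)"
      by (rule ext) (simp add: p grad2_cmult[OF test_fun_smooth[OF p(1)]])
    then show ?thesis using test_cmult[OF p(1)] by blast
  qed
  obtain v g where v: "\<And>n. v n \<in> ?V" "sq_integrable ?M g" "(\<lambda>n. sqnorm ?M (\<lambda>x. v n x - g x)) \<longlonglongrightarrow> 0"
    "\<And>w. w \<in> ?V \<Longrightarrow> (LINT x|?M. (vavg h u x - g x) \<bullet> w x) = 0"
    by (rule L2_projection[of ?V ?M "vavg h u"]; (rule V V0 Va Vs su that; assumption?)+)
  from v(1) have "\<forall>n. \<exists>\<phi>. test_fun D \<phi> \<and> v n = grad2 \<phi>" by blast
  then obtain \<phi> where \<phi>: "\<And>n. test_fun D (\<phi> n)" "\<And>n. v n = grad2 (\<phi> n)" by metis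
  have lim: "(\<lambda>n. sqnorm ?M (\<lambda>x. grad2 (\<phi> n) x - g x)) \<longlonglongrightarrow> 0" using v(3) by (simp add: \<phi>(2))
  obtain C where C: "C \<ge> 0" "\<And>\<phi>. test_fun D \<phi> \<Longrightarrow> sqnorm ?M \<phi> \<le> C * sqnorm ?M (grad2 \<phi>)"
    by (rule poincare_test[OF D]; rule that; assumption)
  have cau: "L2_Cauchy ?M \<phi>"
  proof (rule L2_Cauchy_dominated[OF L2_convergent_imp_Cauchy[OF sg[OF \<phi>(1)] v(2) lim] C(1)])
    fix k n
    have "test_fun D (\<lambda>x. \<phi> k x + (-1) * \<phi> n x)" by (rule test_add[OF \<phi>(1) test_cmult[OF \<phi>(1)]])
    then have "test_fun D (\<lambda>x. \<phi> k x - \<phi> n x)" by simp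
    from C(2)[OF this] show "sqnorm ?M (\<lambda>x. \<phi> k x - \<phi> n x) \<le> C * sqnorm ?M (\<lambda>x. grad2 (\<phi> k) x - grad2 (\<phi> n) x)"
      by (simp add: grad2_diff[OF test_fun_smooth[OF \<phi>(1)] test_fun_smooth[OF \<phi>(1)], abs_def])
  qed
  obtain q where q: "sq_integrable ?M q" "(\<lambda>n. sqnorm ?M (\<lambda>x. \<phi> n x - q x)) \<longlonglongrightarrow> 0"
    by (rule L2_complete[OF test_sqi[OF D \<phi>(1)] cau]; rule that; assumption)
  note H = H10_I[OF D q(1) v(2) \<phi>(1) q(2) lim]
  have "H1 D q" using H(1) by (simp add: H10_def)
  note w = H1_wgrad(2)[OF this]
  have "(LINT p|?M. wgrad D q p \<bullet> grad2 \<psi> p) = (LINT p|?M. vavg h u p \<bullet> grad2 \<psi> p)" if t: "test_fun D \<psi>" for \<psi>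
  proof -
    have "(LINT p|?M. vavg h u p \<bullet> grad2 \<psi> p) - (LINT p|?M. g p \<bullet> grad2 \<psi> p) = (LINT p|?M. (vavg h u p - g p) \<bullet> grad2 \<psi> p)"
      using sqi_inner[OF su sg[OF t]] sqi_inner[OF v(2) sg[OF t]] by (simp add: inner_diff_left)
    also have "\<dots> = 0" by (rule v(4)) (use t in blast)
    finally show ?thesis using integral_inner_cong_AE[OF w v(2) sg[OF t] H(2)] by simp
  qed
  then show ?thesis using H(1) by (auto simp: solves_q2_def)
qed

text \<open>Same scheme with all smooth functions in place of test functions. Their constants are
  not controlled, hence the closedness of smooth gradients through the disjoint Poincare
  pieces.\<close>

lemma exists_q1:
  assumes CD: "C2_domain D" and h: "h > 0" and u: "sq_integrable (lebesgue_on (Omega D h)) u"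
    and q2: "solves_q2 D h u q2"
  shows "\<exists>q1. solves_q1 D h u q2 q1"
proof -
  have D: "bounded D" "open D" using CD by (simp_all add: C2_domain_def)
  let ?M = "lebesgue_on D"
  let ?V = "{grad2 \<phi> |\<phi>. smooth_fun \<phi>}"
  have sg: "sq_integrable ?M (grad2 \<phi>)" if "smooth_fun \<phi>" for \<phi>
    by (rule sqi_continuous[OF D continuous_grad2[OF that]])
  have su: "sq_integrable ?M (vavg h u)" by (rule vavg_sqi[OF D h u])
  have H2: "H1 D q2" using q2 by (simp add: solves_q2_def H10_def)
  note w2 = H1_wgrad(2)[OF H2]
  have sr: "sq_integrable ?M (\<lambda>p. vavg h u p - wgrad D q2 p)" by (rule sqi_diff[OF su w2])
  have V: "\<And>v. v \<in> ?V \<Longrightarrow> sq_integrable ?M v" using sg by blast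
  have V0: "(\<lambda>x. 0) \<in> ?V"
    using smooth_const[of 0] grad2_const[of 0] by (auto intro!: exI[of _ "\<lambda>_. 0"])
  have Va: "(\<lambda>x. v x + w x) \<in> ?V" if "v \<in> ?V" "w \<in> ?V" for v w
  proof -
    obtain \<phi> \<psi> where p: "smooth_fun \<phi>" "v = grad2 \<phi>" "smooth_fun \<psi>" "w = grad2 \<psi>" using \<open>v \<in> ?V\<close> \<open>w \<in> ?V\<close> by blast
    have "(\<lambda>x. v x + w x) = grad2 (\<lambda>x. \<phi> x + \<psi> x)"
      by (rule ext) (simp add: p grad2_add[OF p(1,3)])
    then show ?thesis using smooth_add[OF p(1,3)] by blast
  qed
  have Vs: "(\<lambda>x. c *\<^sub>R v x) \<in> ?V" if vV: "v \<in> ?V" for v c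
  proof -
    obtain \<phi> where p: "smooth_fun \<phi>" "v = grad2 \<phi>" using vV by blast
    have "(\<lambda>x. c *\<^sub>R v x) = grad2 (\<lambda>x. c * \<phi> x)"
      by (rule ext) (simp add: p grad2_cmult[OF p(1)])
    then show ?thesis using smooth_cmult[OF p(1)] by blast
  qed
  obtain v g where v: "\<And>n. v n \<in> ?V" "sq_integrable ?M g" "(\<lambda>n. sqnorm ?M (\<lambda>x. v n x - g x)) \<longlonglongrightarrow> 0"
    "\<And>w. w \<in> ?V \<Longrightarrow> (LINT x|?M. ((vavg h u x - wgrad D q2 x) - g x) \<bullet> w x) = 0"
    by (rule L2_projection[of ?V ?M "\<lambda>p. vavg h u p - wgrad D q2 p"]; (rule V V0 Va Vs sr that; assumption?)+)
  from v(1) have "\<forall>n. \<exists>\<phi>. smooth_fun \<phi> \<and> v n = grad2 \<phi>" by blast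
  then obtain \<phi> where \<phi>: "\<And>n. smooth_fun (\<phi> n)" "\<And>n. v n = grad2 (\<phi> n)" by metis
  have lim: "(\<lambda>n. sqnorm ?M (\<lambda>x. grad2 (\<phi> n) x - g x)) \<longlonglongrightarrow> 0" using v(3) by (simp add: \<phi>(2))
  obtain G where G: "finite G" "\<Union>G = D" "pairwise disjnt G" "\<And>W. W \<in> G \<Longrightarrow> poincare_on W"
    using C2_domain_poincare_decomposition[OF CD] by blast
  obtain q where q: "sq_integrable ?M q" "is_weak_grad D q g"
    by (rule smooth_gradients_closed[OF D G \<phi>(1) v(2) lim]; (rule that; assumption)?)
  have H: "H1 D q" by (rule H1I[OF q(1) v(2) q(2)])
  have ae: "AE x in ?M. wgrad D q x = g x" by (rule wgrad_unique[OF D q(1) v(2) q(2)])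
  have eq: "(LINT p|?M. wgrad D q p \<bullet> grad2 \<psi> p) = (LINT p|?M. (vavg h u p - wgrad D q2 p) \<bullet> grad2 \<psi> p)" if t: "smooth_fun \<psi>" for \<psi>
  proof -
    have "(LINT p|?M. (vavg h u p - wgrad D q2 p) \<bullet> grad2 \<psi> p) - (LINT p|?M. g p \<bullet> grad2 \<psi> p)
        = (LINT p|?M. (vavg h u p - wgrad D q2 p) \<bullet> grad2 \<psi> p - g p \<bullet> grad2 \<psi> p)"
      by (rule Bochner_Integration.integral_diff[OF sqi_inner[OF sr sg[OF t]] sqi_inner[OF v(2) sg[OF t]], symmetric])
    also have "\<dots> = (LINT p|?M. ((vavg h u p - wgrad D q2 p) - g p) \<bullet> grad2 \<psi> p)"
      by (simp only: inner_diff_left)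
    also have "\<dots> = 0" by (rule v(4)) (use t in blast)
    finally show ?thesis using integral_inner_cong_AE[OF H1_wgrad(2)[OF H] v(2) sg[OF t] ae] by simp
  qed
  \<comment> \<open>The equation for q2 says that the projected field is orthogonal to gradients of
    test functions; the Neumann identity transfers this to the projection.\<close>
  have "weakly_harmonic D q"
    unfolding weakly_harmonic_def
  proof (intro allI impI)
    fix \<psi> assume t: "test_fun D \<psi>"
    have s: "smooth_fun \<psi>" by (rule test_fun_smooth[OF t])
    have "(LINT p|?M. (vavg h u p - wgrad D q2 p) \<bullet> grad2 \<psi> p)
        = (LINT p|?M. vavg h u p \<bullet> grad2 \<psi> p) - (LINT p|?M. wgrad D q2 p \<bullet> grad2 \<psi> p)"
      unfolding inner_diff_left by (rule Bochner_Integration.integral_diff[OF sqi_inner[OF su sg[OF s]] sqi_inner[OF w2 sg[OF s]]])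
    also have "\<dots> = 0" using q2 t by (simp add: solves_q2_def)
    finally show "(LINT p|?M. wgrad D q p \<bullet> grad2 \<psi> p) = 0" using eq[OF s] by simp
  qed
  then show ?thesis using H eq by (auto simp: solves_q1_def)
qed

section \<open>The projector and the decomposition\<close>

lemma residual_in_Hspace1:
  assumes D: "bounded D" "open D" and h: "h > 0" and u: "sq_integrable (lebesgue_on (Omega D h)) u"
    and q2: "solves_q2 D h u q2" and q1: "solves_q1 D h u q2 q1"
  shows "(\<lambda>x. u x - (wgrad D q1 (fst x) + wgrad D q2 (fst x))) \<in> Hspace1 D h"
proof -
  let ?M = "lebesgue_on D" and ?O = "lebesgue_on (Omega D h)"
  have H: "H1 D q1" "H1 D q2" using q1 q2 by (simp_all add: solves_q1_def solves_q2_def H10_def)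
  note w1 = H1_wgrad(2)[OF H(1)] and w2 = H1_wgrad(2)[OF H(2)]
  have w: "sq_integrable ?M (\<lambda>p. wgrad D q1 p + wgrad D q2 p)" by (rule sqi_add[OF w1 w2])
  note lw = sqi_lift[OF D h w]
  show ?thesis unfolding Hspace1_iff[OF D h]
  proof (intro conjI allI impI)
    show "sq_integrable ?O (\<lambda>x. u x - (wgrad D q1 (fst x) + wgrad D q2 (fst x)))" by (rule sqi_diff[OF u lw])
    fix \<phi> :: "real \<times> real \<Rightarrow> real" assume s: "smooth_fun \<phi>"
    have g: "sq_integrable ?M (grad2 \<phi>)" by (rule sqi_continuous[OF D continuous_grad2[OF s]])
    note lg = sqi_lift[OF D h g]
    have "(LINT x|?O. (u x - (wgrad D q1 (fst x) + wgrad D q2 (fst x))) \<bullet> grad2 \<phi> (fst x))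
        = (LINT x|?O. u x \<bullet> grad2 \<phi> (fst x)) - (LINT x|?O. (wgrad D q1 (fst x) + wgrad D q2 (fst x)) \<bullet> grad2 \<phi> (fst x))"
      unfolding inner_diff_left by (rule Bochner_Integration.integral_diff[OF sqi_inner[OF u lg] sqi_inner[OF lw lg]])
    also have "(LINT x|?O. u x \<bullet> grad2 \<phi> (fst x)) = h * (LINT p|?M. vavg h u p \<bullet> grad2 \<phi> p)"
      by (rule integral_Omega_vavg[OF D h u g])
    also have "(LINT x|?O. (wgrad D q1 (fst x) + wgrad D q2 (fst x)) \<bullet> grad2 \<phi> (fst x))
        = h * (LINT p|?M. (wgrad D q1 p + wgrad D q2 p) \<bullet> grad2 \<phi> p)"
      using integral_Omega_vavg[OF D h lw g] vavg_lift[OF h, of "\<lambda>p. wgrad D q1 p + wgrad D q2 p"] by simp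
    also have "(LINT p|?M. (wgrad D q1 p + wgrad D q2 p) \<bullet> grad2 \<phi> p) = (LINT p|?M. vavg h u p \<bullet> grad2 \<phi> p)"
    proof -
      note su = vavg_sqi[OF D h u]
      have "(LINT p|?M. wgrad D q1 p \<bullet> grad2 \<phi> p) = (LINT p|?M. (vavg h u p - wgrad D q2 p) \<bullet> grad2 \<phi> p)"
        using q1 s by (simp add: solves_q1_def)
      also have "\<dots> = (LINT p|?M. vavg h u p \<bullet> grad2 \<phi> p) - (LINT p|?M. wgrad D q2 p \<bullet> grad2 \<phi> p)"
        unfolding inner_diff_left by (rule Bochner_Integration.integral_diff[OF sqi_inner[OF su g] sqi_inner[OF w2 g]])
      moreover have "(LINT p|?M. (wgrad D q1 p + wgrad D q2 p) \<bullet> grad2 \<phi> p)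
          = (LINT p|?M. wgrad D q1 p \<bullet> grad2 \<phi> p) + (LINT p|?M. wgrad D q2 p \<bullet> grad2 \<phi> p)"
        unfolding inner_add_left by (rule Bochner_Integration.integral_add[OF sqi_inner[OF w1 g] sqi_inner[OF w2 g]])
      ultimately show ?thesis by simp
    qed
    finally show "(LINT x|?O. (u x - (wgrad D q1 (fst x) + wgrad D q2 (fst x))) \<bullet> grad2 \<phi> (fst x)) = 0" by simp
  qed
qed

text \<open>\<open>leray\<close> is a choice, so its value is known only through its defining
  property. The residual satisfies the same property, and two such fields differ by an element of
  \<open>Hspace1\<close> orthogonal to itself.\<close>

lemma leray_AE:
  assumes CD: "C2_domain D" and h: "h > 0" and u: "sq_integrable (lebesgue_on (Omega D h)) u"
    and q2: "solves_q2 D h u q2" and q1: "solves_q1 D h u q2 q1"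
  shows "AE x in lebesgue_on (Omega D h). leray D h u x = u x - (wgrad D q1 (fst x) + wgrad D q2 (fst x))"
proof -
  have D: "bounded D" "open D" using CD by (simp_all add: C2_domain_def)
  let ?M = "lebesgue_on D" and ?O = "lebesgue_on (Omega D h)"
  have H: "H1 D q1" "H1 D q2" using q1 q2 by (simp_all add: solves_q1_def solves_q2_def H10_def)
  note w1 = sqi_lift[OF D h H1_wgrad(2)[OF H(1)]] and w2 = sqi_lift[OF D h H1_wgrad(2)[OF H(2)]]
  define v0 where "v0 = (\<lambda>x. u x - (wgrad D q1 (fst x) + wgrad D q2 (fst x)))"
  have v0H: "v0 \<in> Hspace1 D h" unfolding v0_def by (rule residual_in_Hspace1[OF D h u q2 q1])
  have Hs: "sq_integrable ?O w" if "w \<in> Hspace1 D h" for w using that by (simp add: Hspace1_def L2_iff)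
  have v0o: "L2_inner (Omega D h) (\<lambda>x. u x - v0 x) w = 0" if w: "w \<in> Hspace1 D h" for w
  proof -
    have "L2_inner (Omega D h) (\<lambda>x. u x - v0 x) w = (LINT x|?O. w x \<bullet> wgrad D q1 (fst x) + w x \<bullet> wgrad D q2 (fst x))"
      by (simp add: L2_inner_def v0_def inner_commute inner_add_left inner_add_right add.commute)
    also have "\<dots> = (LINT x|?O. w x \<bullet> wgrad D q1 (fst x)) + (LINT x|?O. w x \<bullet> wgrad D q2 (fst x))"
      by (rule Bochner_Integration.integral_add[OF sqi_inner[OF Hs[OF w] w1] sqi_inner[OF Hs[OF w] w2]])
    also have "\<dots> = 0"
      using Hspace1_orthogonal_gradient[OF CD h w H(1)] Hspace1_orthogonal_gradient[OF CD h w H(2)] by simp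
    finally show ?thesis .
  qed
  define v where "v = leray D h u"
  have "v \<in> Hspace1 D h \<and> (\<forall>w\<in>Hspace1 D h. L2_inner (Omega D h) (\<lambda>x. u x - v x) w = 0)"
    unfolding v_def leray_def by (rule someI[of _ v0]) (use v0H v0o in blast)
  then have vH: "v \<in> Hspace1 D h" and vo: "\<And>w. w \<in> Hspace1 D h \<Longrightarrow> L2_inner (Omega D h) (\<lambda>x. u x - v x) w = 0" by blast+
  define d where "d = (\<lambda>x. v x + (-1) *\<^sub>R v0 x)"
  note sub = Hspace1_subspace[OF D h, unfolded fun_subspace_def]
  have "(\<lambda>x. (-1) *\<^sub>R v0 x) \<in> Hspace1 D h"
    by (rule bspec[OF spec[OF conjunct2[OF conjunct2[OF sub]], of "-1"] v0H])
  then have dH: "d \<in> Hspace1 D h"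
    unfolding d_def by (rule bspec[OF bspec[OF conjunct1[OF conjunct2[OF sub]] vH]])
  have i: "integrable ?O (\<lambda>x. (u x - v0 x) \<bullet> d x)" "integrable ?O (\<lambda>x. (u x - v x) \<bullet> d x)"
    by (intro sqi_inner sqi_diff u Hs vH v0H dH)+
  \<comment> \<open>\<open>d\<close> is the difference of the two residuals u - v0 and u - v, both
    orthogonal to every element of \<open>Hspace1\<close> and so to \<open>d\<close>.\<close>
  have "sqnorm ?O d = (LINT x|?O. (u x - v0 x) \<bullet> d x - (u x - v x) \<bullet> d x)"
    unfolding sqnorm_def by (simp add: power2_norm_eq_inner inner_diff_left[symmetric] d_def)
  also have "\<dots> = L2_inner (Omega D h) (\<lambda>x. u x - v0 x) d - L2_inner (Omega D h) (\<lambda>x. u x - v x) d"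
    unfolding L2_inner_def by (rule Bochner_Integration.integral_diff[OF i])
  also have "\<dots> = 0" using v0o[OF dH] vo[OF dH] by simp
  finally have "AE x in ?O. d x = 0" by (rule sqnorm_eq_0_AE[OF Hs[OF dH]])
  then have "AE x in ?O. v x = v0 x" by eventually_elim (simp add: d_def)
  then show ?thesis by (simp only: v_def v0_def)
qed

theorem theorem3p2:
  fixes D :: "(real \<times> real) set" and h :: real
  assumes "C2_domain D" and "h > 0"
  shows "fun_subspace (Hspace1 D h) \<and> fun_subspace (Gspace1 D h) \<and> fun_subspace (Gspace2 D h)
    \<and> (\<forall>a\<in>Hspace1 D h. \<forall>b\<in>Gspace1 D h. L2_inner (Omega D h) a b = 0)
    \<and> (\<forall>a\<in>Hspace1 D h. \<forall>c\<in>Gspace2 D h. L2_inner (Omega D h) a c = 0)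
    \<and> (\<forall>b\<in>Gspace1 D h. \<forall>c\<in>Gspace2 D h. L2_inner (Omega D h) b c = 0)
    \<and> (\<forall>u. L2 (Omega D h) u \<longrightarrow>
         (\<exists>a\<in>Hspace1 D h. \<exists>b\<in>Gspace1 D h. \<exists>c\<in>Gspace2 D h.
            AE x in lebesgue_on (Omega D h). u x = a x + b x + c x))
    \<and> (\<forall>u. L2 (Omega D h) u \<longrightarrow>
         (\<exists>q1 q2. solves_q2 D h u q2 \<and> solves_q1 D h u q2 q1) \<and>
         (\<forall>q1 q2. solves_q2 D h u q2 \<and> solves_q1 D h u q2 q1 \<longrightarrow>
            (AE x in lebesgue_on (Omega D h).
               u x = leray D h u x + wgrad D (\<lambda>p. q1 p + q2 p) (fst x))))"
proof -
  note CD = assms(1) and h = assms(2)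
  have D: "bounded D" "open D" using CD by (simp_all add: C2_domain_def)
  let ?O = "lebesgue_on (Omega D h)"
  \<comment> \<open>Replaces the second field by the lift of its gradient, so that only one
    representative of each gradient field has to be considered.\<close>
  have orth: "L2_inner (Omega D h) a b = (LINT x|?O. wgrad D q (fst x) \<bullet> a x)"
    if "sq_integrable ?O a" "sq_integrable ?O b" "H1 D q" "AE x in ?O. b x = wgrad D q (fst x)" for a b q
    using integral_inner_cong_AE[OF that(2) sqi_lift[OF D h H1_wgrad(2)[OF that(3)]] that(1,4)]
    by (simp add: L2_inner_def inner_commute)
  have HG1: "L2_inner (Omega D h) a b = 0" if "a \<in> Hspace1 D h" "b \<in> Gspace1 D h" for a b
    using orth[of a b] Hspace1_orthogonal_gradient[OF CD h that(1)] that
    by (auto simp: Hspace1_def Gspace1_def L2_iff inner_commute)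
  have HG2: "L2_inner (Omega D h) a c = 0" if "a \<in> Hspace1 D h" "c \<in> Gspace2 D h" for a c
    using orth[of a c] Hspace1_orthogonal_gradient[OF CD h that(1)] that
    by (auto simp: Hspace1_def Gspace2_def H10_def L2_iff inner_commute)
  have GG: "L2_inner (Omega D h) b c = 0" if bG: "b \<in> Gspace1 D h" and cG: "c \<in> Gspace2 D h" for b c
  proof -
    obtain q where q: "H1 D q" "weakly_harmonic D q" "AE x in ?O. b x = wgrad D q (fst x)" and b: "sq_integrable ?O b"
      using bG unfolding Gspace1_def L2_iff by blast
    obtain r where r: "H10 D r" "AE x in ?O. c x = wgrad D r (fst x)" and c: "sq_integrable ?O c"
      using cG unfolding Gspace2_def L2_iff by blast
    have H: "H1 D r" using r(1) by (simp add: H10_def)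
    note wr = H1_wgrad(2)[OF H] and wq = H1_wgrad(2)[OF q(1)]
    have "L2_inner (Omega D h) b c = (LINT x|?O. wgrad D r (fst x) \<bullet> b x)" by (rule orth[OF b c H r(2)])
    also have "\<dots> = (LINT x|?O. b x \<bullet> wgrad D r (fst x))" by (simp add: inner_commute)
    also have "\<dots> = (LINT x|?O. wgrad D q (fst x) \<bullet> wgrad D r (fst x))"
      by (rule integral_inner_cong_AE[OF b sqi_lift[OF D h wq] sqi_lift[OF D h wr] q(3)])
    also have "\<dots> = h * (LINT p|lebesgue_on D. wgrad D q p \<bullet> wgrad D r p)"
      using integral_Omega_vavg[OF D h sqi_lift[OF D h wq] wr] by (simp add: vavg_lift[OF h])
    also have "\<dots> = 0" by (simp add: harmonic_orthogonal_H10[OF D q(1,2) r(1)])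
    finally show ?thesis .
  qed
  have ex: "\<exists>q1 q2. solves_q2 D h u q2 \<and> solves_q1 D h u q2 q1" if "sq_integrable ?O u" for u
    using exists_q2[OF D h that] exists_q1[OF CD h that] by blast
  have dec: "\<exists>a\<in>Hspace1 D h. \<exists>b\<in>Gspace1 D h. \<exists>c\<in>Gspace2 D h. AE x in ?O. u x = a x + b x + c x"
    if u: "sq_integrable ?O u" for u
  proof -
    obtain q1 q2 where q: "solves_q2 D h u q2" "solves_q1 D h u q2 q1" using ex[OF u] by blast
    have H: "H1 D q1" "weakly_harmonic D q1" "H10 D q2" "H1 D q2" using q by (simp_all add: solves_q1_def solves_q2_def H10_def)
    note w1 = H1_wgrad(2)[OF H(1)] and w2 = H1_wgrad(2)[OF H(4)]
    \<comment> \<open>The summands are lifts of planar gradients, so the vanishing z-derivative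
      holds by construction.\<close>
    have 1: "(\<lambda>x. wgrad D q1 (fst x)) \<in> Gspace1 D h"
      using H sqi_lift[OF D h w1] dz_zero_lift[OF D h w1] by (auto simp: Gspace1_def L2_iff)
    have 2: "(\<lambda>x. wgrad D q2 (fst x)) \<in> Gspace2 D h"
      using H sqi_lift[OF D h w2] dz_zero_lift[OF D h w2] by (auto simp: Gspace2_def L2_iff)
    show ?thesis
      by (rule bexI[OF _ residual_in_Hspace1[OF D h u q]], rule bexI[OF _ 1], rule bexI[OF _ 2]) simp
  qed
  have ler: "AE x in ?O. u x = leray D h u x + wgrad D (\<lambda>p. q1 p + q2 p) (fst x)"
    if u: "sq_integrable ?O u" and q: "solves_q2 D h u q2" "solves_q1 D h u q2 q1" for u q1 q2
  proof -
    have H: "H1 D q1" "H1 D q2" using q by (simp_all add: solves_q1_def solves_q2_def H10_def)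
    \<comment> \<open>The gradient chosen for the sum and the sum of the chosen gradients agree only
      off a null set of D, which lifts to a null set of the cylinder.\<close>
    have "AE x in ?O. wgrad D (\<lambda>p. q1 p + q2 p) (fst x) = wgrad D q1 (fst x) + wgrad D q2 (fst x)"
      by (rule AE_Omega_fst[OF D(2) H1_add(2)[OF D H]])
    with leray_AE[OF CD h u q] show ?thesis by eventually_elim simp
  qed
  show ?thesis
    unfolding L2_iff
    using Hspace1_subspace[OF D h] Gspace_subspaces[OF D h] HG1 HG2 GG ex dec ler by blast
qed

end
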